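(* Let $n \geq 2$, let $\Omega \subset \mathbb{R}^n$ be a bounded open set, let $0 < s < 1$, and let $q_1, q_2 \in L^{\infty}(\Omega)$ be such that, for $j=1,2$, the only $u \in H^s(\mathbb{R}^n)$ with $((-\Delta)^s + q_j)u = 0$ in $\Omega$ and $u|_{\Omega_e} = 0$ is $u \equiv 0$. Let $W_1, W_2 \subset \Omega_e$ be nonempty open sets. If the Dirichlet-to-Neumann maps $\Lambda_{q_1}, \Lambda_{q_2}$ for the equations $((-\Delta)^s + q_j)u = 0$ in $\Omega$ satisfy $$\Lambda_{q_1} f|_{W_2} = \Lambda_{q_2} f|_{W_2} \quad \text{for all } f \in C^{\infty}_c(W_1),$$ then $q_1 = q_2$ (almost everywhere) in $\Omega$.
   Context: Functions are real valued. $\Omega_e = \mathbb{R}^n \setminus \overline{\Omega}$ is the exterior domain. $H^s(\mathbb{R}^n)$ is the $L^2$-based Sobolev space and $\widetilde{H}^s(\Omega)$ is the closure of $C^\infty_c(\Omega)$ in $H^s(\mathbb{R}^n)$. The fractional Laplacian is the Fourier multiplier $(-\Delta)^a u = \mathcal{F}^{-1}\{|\xi|^{2a}\hat u(\xi)\}$. For $u \in H^s(\mathbb{R}^n)$ the equation $((-\Delta)^s+q)u=0$ in $\Omega$ is understood in the sense of distributions in $\Omega$. For $q \in L^\infty(\Omega)$ let $$B_q(v,w) = \int_{\mathbb{R}^n} (-\Delta)^{s/2} v \, (-\Delta)^{s/2} w \,dx + \int_\Omega q v w\,dx, \qquad v,w \in H^s(\mathbb{R}^n).$$ If $q$ satisfies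 the uniqueness condition in the claim, then for each $f \in H^s(\mathbb{R}^n)$ there is a unique $u_f \in H^s(\mathbb{R}^n)$ with $((-\Delta)^s+q)u_f = 0$ in $\Omega$ and $u_f - f \in \widetilde{H}^s(\Omega)$. Put $X = H^s(\mathbb{R}^n)/\widetilde{H}^s(\Omega)$ with the quotient norm. The Dirichlet-to-Neumann (DN) map is the bounded linear map $\Lambda_q : X \to X^*$ defined by $(\Lambda_q [f],[g]) = B_q(u_f,g)$ for $f,g \in H^s(\mathbb{R}^n)$ (this is well defined on classes). One writes $f$ for $[f]$. For $F \in X^*$ and an open set $W \subset \Omega_e$, $F|_{W}$ denotes the distribution on $W$ given by $F|_W(\varphi) = F([\varphi])$, $\varphi \in C^\infty_c(W)$. *)

theory Defs
  imports "HOL-Analysis.Analysis"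
begin

text \<open>
  Elements of the function spaces are honest functions on \<open>\<real>\<^sup>n\<close>, with \<open>n = CARD('n)\<close>; every notion
  below depends on them only up to equality almost everywhere.
\<close>

section \<open>Test functions\<close>

primrec C_k :: "nat \<Rightarrow> ('a::real_normed_vector \<Rightarrow> 'b::real_normed_vector) \<Rightarrow> bool" where
  "C_k 0 f \<longleftrightarrow> continuous_on UNIV f"
| "C_k (Suc k) f \<longleftrightarrow>
    (\<forall>x. f differentiable (at x)) \<and> (\<forall>v. C_k k (\<lambda>x. frechet_derivative f (at x) v))"

definition smooth :: "('a::real_normed_vector \<Rightarrow> 'b::real_normed_vector) \<Rightarrow> bool" where
  "smooth f \<longleftrightarrow> (\<forall>k. C_k k f)"

definition Cc_infty :: "(real^'n) set \<Rightarrow> (real^'n \<Rightarrow> real) set" where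
  "Cc_infty U = {\<phi>. smooth \<phi> \<and> compact (closure {x. \<phi> x \<noteq> 0}) \<and> closure {x. \<phi> x \<noteq> 0} \<subseteq> U}"


section \<open>Lebesgue spaces and the Fourier transform\<close>

definition L2 :: "(real^'n \<Rightarrow> 'b::real_normed_vector) set" where
  "L2 = {u \<in> borel_measurable lebesgue. integrable lebesgue (\<lambda>x. (norm (u x))\<^sup>2)}"

definition L_infty :: "(real^'n) set \<Rightarrow> (real^'n \<Rightarrow> real) set" where
  "L_infty U = {q. set_borel_measurable lebesgue U q \<and>
                   (\<exists>C. AE x in lebesgue. x \<in> U \<longrightarrow> \<bar>q x\<bar> \<le> C)}"

definition fourier_integral :: "(real^'n \<Rightarrow> complex) \<Rightarrow> real^'n \<Rightarrow> complex" where
  "fourier_integral u \<xi> = (LINT x|lebesgue. cis (- (x \<bullet> \<xi>)) * u x)"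

definition inverse_fourier_integral :: "(real^'n \<Rightarrow> complex) \<Rightarrow> real^'n \<Rightarrow> complex" where
  "inverse_fourier_integral u x =
     (LINT \<xi>|lebesgue. cis (x \<bullet> \<xi>) * u \<xi>) / of_real ((2 * pi) ^ CARD('n))"

text \<open>
  The Fourier transform on \<open>L\<^sup>2\<close>: the limit in \<open>L\<^sup>2\<close> of the Fourier integrals of the truncations of
  \<open>u\<close> to large balls. By Plancherel's theorem it exists; it is unique up to a null set, and the
  choice operator picks a representative. The nonnegative integral is used so that the limit
  is meaningful without presupposing integrability.
\<close>

definition is_fourier_transform :: "(real^'n \<Rightarrow> complex) \<Rightarrow> (real^'n \<Rightarrow> complex) \<Rightarrow> bool" where
  "is_fourier_transform u v \<longleftrightarrow> v \<in> L2 \<and>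
     (\<lambda>k::nat. \<integral>\<^sup>+\<xi>. ennreal ((cmod (v \<xi> -
         fourier_integral (\<lambda>x. indicator (cball 0 (real k)) x * u x) \<xi>))\<^sup>2) \<partial>lebesgue)
       \<longlonglongrightarrow> 0"

definition fourier :: "(real^'n \<Rightarrow> real) \<Rightarrow> real^'n \<Rightarrow> complex" where
  "fourier u = (SOME v. is_fourier_transform (\<lambda>x. of_real (u x)) v)"


section \<open>Sobolev spaces\<close>

text \<open>
  Only orders \<open>s \<ge> 0\<close> are covered, for which the elements of \<open>H\<^sup>s\<close> are square integrable functions.
\<close>

definition Hs :: "real \<Rightarrow> (real^'n \<Rightarrow> real) set" where
  "Hs s = {u \<in> L2. integrable lebesgue (\<lambda>\<xi>. (1 + (norm \<xi>)\<^sup>2) powr s * (cmod (fourier u \<xi>))\<^sup>2)}"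

definition Hs_norm :: "real \<Rightarrow> (real^'n \<Rightarrow> real) \<Rightarrow> real" where
  "Hs_norm s u = sqrt (LINT \<xi>|lebesgue. (1 + (norm \<xi>)\<^sup>2) powr s * (cmod (fourier u \<xi>))\<^sup>2)"

definition Hs_tilde :: "real \<Rightarrow> (real^'n) set \<Rightarrow> (real^'n \<Rightarrow> real) set" where
  "Hs_tilde s \<Omega> =
     {u \<in> Hs s. \<forall>\<epsilon>>0. \<exists>\<phi>\<in>Cc_infty \<Omega>. Hs_norm s (\<lambda>x. u x - \<phi> x) < \<epsilon>}"


section \<open>The fractional Laplacian\<close>

text \<open>
  The multiplier \<open>\<F>\<^sup>-\<^sup>1{\<bar>\<xi>\<bar>\<^sup>2\<^sup>a \<F> u}\<close> is needed in two situations. For \<open>u \<in> H\<^sup>2\<^sup>a\<close> it is a real valued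
  function in \<open>L\<^sup>2\<close>, unique up to a null set. In general it is a tempered distribution, where
  \<open>(\<F>\<^sup>-\<^sup>1 T)(\<phi>) = T(\<F>\<^sup>-\<^sup>1 \<phi>)\<close>.
\<close>

definition frac_laplacian :: "real \<Rightarrow> (real^'n \<Rightarrow> real) \<Rightarrow> real^'n \<Rightarrow> real" where
  "frac_laplacian a u = (SOME v. v \<in> L2 \<and>
     (AE \<xi> in lebesgue. fourier v \<xi> = of_real (norm \<xi> powr (2 * a)) * fourier u \<xi>))"

definition frac_laplacian_distr ::
    "real \<Rightarrow> (real^'n \<Rightarrow> real) \<Rightarrow> (real^'n \<Rightarrow> real) \<Rightarrow> complex" where
  "frac_laplacian_distr a u \<phi> =
     (LINT \<xi>|lebesgue. of_real (norm \<xi> powr (2 * a)) * fourier u \<xi> *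
                        inverse_fourier_integral (\<lambda>x. of_real (\<phi> x)) \<xi>)"


section \<open>The Dirichlet problem and the Dirichlet-to-Neumann map\<close>

definition schroedinger_eq ::
    "real \<Rightarrow> (real^'n) set \<Rightarrow> (real^'n \<Rightarrow> real) \<Rightarrow> (real^'n \<Rightarrow> real) \<Rightarrow> bool" where
  "schroedinger_eq s \<Omega> q u \<longleftrightarrow>
     (\<forall>\<phi>\<in>Cc_infty \<Omega>. frac_laplacian_distr s u \<phi> +
                      of_real (LINT x:\<Omega>|lebesgue. q x * u x * \<phi> x) = 0)"

definition exterior :: "(real^'n) set \<Rightarrow> (real^'n) set" where
  "exterior \<Omega> = - closure \<Omega>"

definition uniqueness_condition :: "real \<Rightarrow> (real^'n) set \<Rightarrow> (real^'n \<Rightarrow> real) \<Rightarrow> bool" where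
  "uniqueness_condition s \<Omega> q \<longleftrightarrow>
     (\<forall>u\<in>Hs s. schroedinger_eq s \<Omega> q u \<longrightarrow>
        (AE x in lebesgue. x \<in> exterior \<Omega> \<longrightarrow> u x = 0) \<longrightarrow> (AE x in lebesgue. u x = 0))"

definition bilinear_form ::
    "real \<Rightarrow> (real^'n) set \<Rightarrow> (real^'n \<Rightarrow> real) \<Rightarrow> (real^'n \<Rightarrow> real) \<Rightarrow> (real^'n \<Rightarrow> real) \<Rightarrow> real" where
  "bilinear_form s \<Omega> q v w =
     (LINT x|lebesgue. frac_laplacian (s / 2) v x * frac_laplacian (s / 2) w x) +
     (LINT x:\<Omega>|lebesgue. q x * v x * w x)"

definition dirichlet_solution ::
    "real \<Rightarrow> (real^'n) set \<Rightarrow> (real^'n \<Rightarrow> real) \<Rightarrow> (real^'n \<Rightarrow> real) \<Rightarrow> (real^'n \<Rightarrow> real) \<Rightarrow> bool" where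
  "dirichlet_solution s \<Omega> q f u \<longleftrightarrow>
     u \<in> Hs s \<and> schroedinger_eq s \<Omega> q u \<and> (\<lambda>x. u x - f x) \<in> Hs_tilde s \<Omega>"

definition trace_rel :: "real \<Rightarrow> (real^'n) set \<Rightarrow> (real^'n \<Rightarrow> real) rel" where
  "trace_rel s \<Omega> = {(f, g). f \<in> Hs s \<and> g \<in> Hs s \<and> (\<lambda>x. f x - g x) \<in> Hs_tilde s \<Omega>}"

definition trace_space :: "real \<Rightarrow> (real^'n) set \<Rightarrow> (real^'n \<Rightarrow> real) set set" where
  "trace_space s \<Omega> = Hs s // trace_rel s \<Omega>"

definition trace_class :: "real \<Rightarrow> (real^'n) set \<Rightarrow> (real^'n \<Rightarrow> real) \<Rightarrow> (real^'n \<Rightarrow> real) set" where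
  "trace_class s \<Omega> f = trace_rel s \<Omega> `` {f}"

text \<open>
  The value of the functional \<open>\<Lambda>\<^sub>q F\<close> at \<open>G\<close> is \<open>B\<^sub>q(u\<^sub>f, g)\<close> for any representatives \<open>f \<in> F\<close> and
  \<open>g \<in> G\<close>. Under the uniqueness condition, \<open>u\<^sub>f\<close> exists and the value does not depend on the choices.
\<close>

definition DN_map ::
    "real \<Rightarrow> (real^'n) set \<Rightarrow> (real^'n \<Rightarrow> real) \<Rightarrow>
     (real^'n \<Rightarrow> real) set \<Rightarrow> (real^'n \<Rightarrow> real) set \<Rightarrow> real" where
  "DN_map s \<Omega> q = (\<lambda>F\<in>trace_space s \<Omega>. \<lambda>G\<in>trace_space s \<Omega>.
     (THE b. \<exists>f\<in>F. \<exists>g\<in>G. \<exists>u. dirichlet_solution s \<Omega> q f u \<and> b = bilinear_form s \<Omega> q u g))"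

definition restrict_distr ::
    "real \<Rightarrow> (real^'n) set \<Rightarrow> ((real^'n \<Rightarrow> real) set \<Rightarrow> real) \<Rightarrow> (real^'n) set \<Rightarrow>
     (real^'n \<Rightarrow> real) \<Rightarrow> real" where
  "restrict_distr s \<Omega> F W = (\<lambda>\<phi>\<in>Cc_infty W. F (trace_class s \<Omega> \<phi>))"

end

theory Submission
  imports Defs "HOL-Probability.Characteristic_Functions"
begin

text \<open>
  The Dirichlet-to-Neumann maps enter through an integral identity. If \<open>u\<^sub>1\<close> solves the equation with
  \<open>q\<^sub>1\<close> and data in \<open>C\<^sub>c\<^sup>\<infinity>(W\<^sub>1)\<close>, and \<open>u\<^sub>2\<close> solves the one with \<open>q\<^sub>2\<close> and data in \<open>C\<^sub>c\<^sup>\<infinity>(W\<^sub>2)\<close>, then the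
  symmetry of the bilinear forms and the equality of the measurements give
  \<open>\<integral>\<^bsub>\<Omega>\<^esub> (q\<^sub>1 - q\<^sub>2) u\<^sub>1 u\<^sub>2 = 0\<close> (\<open>DN_integral_identity\<close>). It remains to see that there are enough
  solutions. This is Runge approximation: the restrictions to \<open>\<Omega>\<close> of the solutions with data in
  \<open>C\<^sub>c\<^sup>\<infinity>(W)\<close> are dense in \<open>L\<^sup>2(\<Omega>)\<close>, for every nonempty open set \<open>W\<close> in the exterior. In the dual form
  \<open>runge_dual\<close>, a function orthogonal to all of them is zero. Applied with \<open>q\<^sub>1\<close> and \<open>W\<^sub>1\<close> this turns
  the identity into \<open>(q\<^sub>1 - q\<^sub>2) u\<^sub>2 = 0\<close>; applied with \<open>q\<^sub>2\<close> and \<open>W\<^sub>2\<close> to the function \<open>q\<^sub>1 - q\<^sub>2\<close> it gives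
  \<open>q\<^sub>1 = q\<^sub>2\<close>.

  For Runge approximation, let \<open>v\<close> be orthogonal to all these solutions, and solve
  \<open>((-\<Delta>)\<^sup>s + q) \<phi> = v\<close> in \<open>\<Omega>\<close> with \<open>\<phi>\<close> in the energy space of \<open>\<Omega>\<close>. Pairing the equation with solutions
  shows that \<open>(-\<Delta>)\<^sup>s \<phi>\<close> vanishes on \<open>W\<close>, where also \<open>\<phi> = 0\<close>. Unique continuation yields \<open>\<phi> = 0\<close>, hence
  \<open>v = 0\<close>. So two facts are needed.

  Solvability of the Dirichlet problem (\<open>dirichlet_problem_solvable\<close>). The form is coercive up to low
  frequencies, and the low frequencies of a function supported in a bounded set are controlled by
  finitely many values of its Fourier transform (\<open>low_frequency_finite_rank\<close>). Thus the form becomes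
  coercive after adding a form of finite rank, the coercive form is invertible
  (\<open>coercive_solvable\<close>), and the finite rank part is removed again by linear algebra
  (\<open>solvable_on_remove_finite_rank\<close>); the uniqueness condition says that the kernel is trivial.

  Unique continuation (\<open>frac_laplacian_unique_continuation\<close>). Away from the support of \<open>\<phi>\<close> the
  function \<open>(-\<Delta>)\<^sup>s \<phi>\<close> is a multiple of the Riesz potential \<open>\<integral> \<phi>(y) \<bar>x - y\<bar>\<^sup>-\<^sup>n\<^sup>-\<^sup>2\<^sup>s dy\<close>
  (\<open>energy_zero_imp_riesz_zero\<close>), which is seen by writing both the symbol and the kernel as
  superpositions of heat semigroups. If the potential vanishes on an open set, then so do its
  Laplacians, that is, the potentials with all exponents \<open>n + 2 s + 2 k\<close>. Polynomials in
  \<open>\<bar>x - y\<bar>\<^sup>-\<^sup>2\<close> approximate a Gaussian, whose derivatives in \<open>x\<close> produce all moments of the product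
  of \<open>\<phi>\<close> and a positive function; these vanish, and \<open>\<phi> = 0\<close> follows
  (\<open>riesz_potential_unique_continuation\<close>).

  The Fourier transform on \<open>L\<^sup>2\<close> with Plancherel's theorem, inversion and reality is built first, from
  the Gaussian regularization \<open>fourier_gauss_identity\<close>, which also supplies the heat kernel in the
  kernel representation of the fractional Laplacian.
\<close>

section \<open>The Hilbert space of square integrable functions\<close>

lemma one_over_Suc_tendsto_0: "(\<lambda>k. 1 / real (Suc k)) \<longlonglongrightarrow> 0"
  using lim_1_over_n[where 'a=real, THEN filterlim_compose[OF _ filterlim_Suc]] by simp

text \<open>
  A quadratic function of a real parameter is tested at its minimum. This yields both the
  Cauchy--Schwarz inequality and, with \<open>A = 0\<close>, the Euler--Lagrange equation of a minimizer.
\<close>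

lemma quadratic_nonneg_discriminant:
  fixes A B C :: real
  assumes nn: "\<And>t. 0 \<le> A + 2 * t * B + t\<^sup>2 * C"
  shows "B\<^sup>2 \<le> A * C"
proof (cases "C = 0")
  case True
  have "B = 0"
  proof (rule ccontr)
    assume "B \<noteq> 0"
    then have "A + 2 * (- (A + 1) / (2 * B)) * B + (- (A + 1) / (2 * B))\<^sup>2 * C = -1"
      using True by (simp add: field_simps)
    then show False using nn[of "- (A + 1) / (2 * B)"] by linarith
  qed
  then show ?thesis using True by simp
next
  case False
  have Cpos: "C > 0"
  proof (rule ccontr)
    assume "\<not> C > 0"
    then have "C < 0" using False by simp
    define t where "t = 1 + \<bar>A\<bar> / (- C)"
    have t1: "t \<ge> 1" using \<open>C < 0\<close> by (simp add: t_def divide_nonneg_neg)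
    have "A < - C + \<bar>A\<bar>" using \<open>C < 0\<close> by simp
    also have "\<dots> = t * (- C)" using \<open>C < 0\<close> by (simp add: t_def field_simps)
    also have "\<dots> \<le> t\<^sup>2 * (- C)"
      using t1 \<open>C < 0\<close> by (intro mult_right_mono) (auto simp: power2_eq_square)
    finally have "A + t\<^sup>2 * C < 0" by simp
    then show False using nn[of t] nn[of "- t"] by simp
  qed
  have "0 \<le> A + 2 * (- B / C) * B + (- B / C)\<^sup>2 * C" by (rule nn)
  also have "\<dots> = (A * C - B\<^sup>2) / C" using Cpos by (simp add: field_simps power2_eq_square)
  finally show ?thesis using Cpos by (simp add: zero_le_divide_iff)
qed

definition l2norm :: "(real^'n \<Rightarrow> 'b::real_normed_vector) \<Rightarrow> real" where
  "l2norm u = sqrt (LINT x|lebesgue. (norm (u x))\<^sup>2)"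

lemma l2norm_nonneg [simp]: "0 \<le> l2norm u"
  by (simp add: l2norm_def)

lemma l2norm_sq: "(l2norm u)\<^sup>2 = (LINT x|lebesgue. (norm (u x))\<^sup>2)"
  by (simp add: l2norm_def)

lemma L2_measurable [measurable_dest]: "u \<in> L2 \<Longrightarrow> u \<in> borel_measurable lebesgue"
  by (simp add: L2_def)

lemma L2_integrable_sq: "u \<in> L2 \<Longrightarrow> integrable lebesgue (\<lambda>x. (norm (u x))\<^sup>2)"
  by (simp add: L2_def)

lemma L2I: "u \<in> borel_measurable lebesgue \<Longrightarrow> integrable lebesgue (\<lambda>x. (norm (u x))\<^sup>2) \<Longrightarrow> u \<in> L2"
  by (simp add: L2_def)

lemma L2_AE_bounded:
  fixes u :: "real^'n \<Rightarrow> 'b::real_normed_vector" and v :: "real^'n \<Rightarrow> 'c::real_normed_vector"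
  assumes "u \<in> L2" and "v \<in> borel_measurable lebesgue" and "AE x in lebesgue. norm (v x) \<le> C * norm (u x)"
  shows "v \<in> L2"
proof (rule L2I)
  have [measurable]: "v \<in> borel_measurable lebesgue" by fact
  show "integrable lebesgue (\<lambda>x. (norm (v x))\<^sup>2)"
  proof (rule Bochner_Integration.integrable_bound)
    show "integrable lebesgue (\<lambda>x. C\<^sup>2 * (norm (u x))\<^sup>2)"
      using L2_integrable_sq[OF assms(1)] by simp
    show "AE x in lebesgue. norm ((norm (v x))\<^sup>2) \<le> norm (C\<^sup>2 * (norm (u x))\<^sup>2)"
      using assms(3)
    proof eventually_elim
      fix x assume "norm (v x) \<le> C * norm (u x)"
      then have "(norm (v x))\<^sup>2 \<le> (C * norm (u x))\<^sup>2" by (intro power_mono) auto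
      then show "norm ((norm (v x))\<^sup>2) \<le> norm (C\<^sup>2 * (norm (u x))\<^sup>2)"
        by (simp add: power_mult_distrib)
    qed
  qed simp
qed fact

lemma L2_bounded:
  fixes u :: "real^'n \<Rightarrow> 'b::real_normed_vector" and v :: "real^'n \<Rightarrow> 'c::real_normed_vector"
  assumes "u \<in> L2" and "v \<in> borel_measurable lebesgue" and "\<And>x. norm (v x) \<le> C * norm (u x)"
  shows "v \<in> L2"
  using L2_AE_bounded[OF assms(1,2), of C] assms(3) by simp

lemma L2_norm: "u \<in> L2 \<Longrightarrow> (\<lambda>x. norm (u x)) \<in> L2"
  by (rule L2_bounded[of u _ 1]) (auto dest: L2_measurable)

lemma L2_zero [simp]: "(\<lambda>x. 0) \<in> L2"
  by (simp add: L2_def)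

lemma norm_add_sq_le: "(norm (a + b))\<^sup>2 \<le> 2 * (norm a)\<^sup>2 + 2 * (norm b)\<^sup>2" for a b :: "'b::real_normed_vector"
proof -
  have "(norm (a + b))\<^sup>2 \<le> (norm a + norm b)\<^sup>2" by (intro power_mono norm_triangle_ineq) auto
  also have "\<dots> \<le> 2 * (norm a)\<^sup>2 + 2 * (norm b)\<^sup>2"
    using sum_squares_bound[of "norm a" "norm b"] by (simp add: power2_sum)
  finally show ?thesis .
qed

lemma L2_add:
  fixes u v :: "real^'n \<Rightarrow> 'b::{real_normed_field,banach,second_countable_topology}"
  assumes "u \<in> L2" "v \<in> L2" shows "(\<lambda>x. u x + v x) \<in> L2"
proof (rule L2I)
  have [measurable]: "u \<in> borel_measurable lebesgue" "v \<in> borel_measurable lebesgue"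
    using assms by (auto dest: L2_measurable)
  show "(\<lambda>x. u x + v x) \<in> borel_measurable lebesgue" by measurable
  show "integrable lebesgue (\<lambda>x. (norm (u x + v x))\<^sup>2)"
  proof (rule Bochner_Integration.integrable_bound)
    show "integrable lebesgue (\<lambda>x. 2 * (norm (u x))\<^sup>2 + 2 * (norm (v x))\<^sup>2)"
      using assms by (intro Bochner_Integration.integrable_add integrable_mult_right L2_integrable_sq) auto
    show "AE x in lebesgue. norm ((norm (u x + v x))\<^sup>2) \<le> norm (2 * (norm (u x))\<^sup>2 + 2 * (norm (v x))\<^sup>2)"
      using norm_add_sq_le by auto
  qed simp
qed

lemma L2_cmult:
  fixes u :: "real^'n \<Rightarrow> 'b::{real_normed_field,banach,second_countable_topology}"
  assumes "u \<in> L2" shows "(\<lambda>x. c * u x) \<in> L2"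
proof -
  have [measurable]: "u \<in> borel_measurable lebesgue" using assms by (rule L2_measurable)
  show ?thesis by (rule L2_bounded[OF assms, of _ "norm c"]) (auto simp: norm_mult)
qed

lemma L2_lin:
  fixes u v :: "real^'n \<Rightarrow> 'b::{real_normed_field,banach,second_countable_topology}"
  assumes "u \<in> L2" "v \<in> L2" shows "(\<lambda>x. u x + c * v x) \<in> L2"
  using assms by (intro L2_add L2_cmult)

lemma L2_diff:
  fixes u v :: "real^'n \<Rightarrow> 'b::{real_normed_field,banach,second_countable_topology}"
  assumes "u \<in> L2" "v \<in> L2" shows "(\<lambda>x. u x - v x) \<in> L2"
  using L2_lin[OF assms, of "-1"] by simp

lemma L2_of_real: "u \<in> L2 \<Longrightarrow> (\<lambda>x. complex_of_real (u x)) \<in> L2"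
  by (rule L2_bounded[of u _ 1]) (auto dest: L2_measurable)

lemma L2_cnj: "u \<in> L2 \<Longrightarrow> (\<lambda>x. cnj (u x)) \<in> L2"
  by (rule L2_bounded[of u _ 1])
     (auto dest!: L2_measurable intro!: borel_measurable_continuous_on[of cnj] continuous_intros)

lemma L2_Re: "u \<in> L2 \<Longrightarrow> (\<lambda>x. Re (u x)) \<in> L2"
  by (rule L2_bounded[of u _ 1]) (auto dest: L2_measurable simp: abs_Re_le_cmod)

lemma L2_indicator:
  fixes u :: "real^'n \<Rightarrow> 'b::{real_normed_field,banach,second_countable_topology}"
  assumes "u \<in> L2" "A \<in> sets lebesgue" shows "(\<lambda>x. indicator A x * u x) \<in> L2"
proof -
  have [measurable]: "u \<in> borel_measurable lebesgue" "A \<in> sets lebesgue" using assms by (auto dest: L2_measurable)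
  show ?thesis by (rule L2_bounded[OF assms(1), of _ 1]) (auto simp: indicator_def)
qed

lemma L2_mult_integrable:
  fixes u v :: "real^'n \<Rightarrow> 'b::{real_normed_field,banach,second_countable_topology}"
  assumes "u \<in> L2" "v \<in> L2" shows "integrable lebesgue (\<lambda>x. u x * v x)"
proof (rule Bochner_Integration.integrable_bound)
  have [measurable]: "u \<in> borel_measurable lebesgue" "v \<in> borel_measurable lebesgue"
    using assms by (auto dest: L2_measurable)
  show "integrable lebesgue (\<lambda>x. (norm (u x))\<^sup>2 + (norm (v x))\<^sup>2)"
    using assms by (intro Bochner_Integration.integrable_add L2_integrable_sq)
  show "(\<lambda>x. u x * v x) \<in> borel_measurable lebesgue" by measurable
  have "norm (a * b) \<le> (norm a)\<^sup>2 + (norm b)\<^sup>2" for a b :: 'b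
  proof -
    have "0 \<le> norm a * norm b" by simp
    then show ?thesis
      using sum_squares_bound[of "norm a" "norm b"] by (simp only: norm_mult mult.assoc)
  qed
  then show "AE x in lebesgue. norm (u x * v x) \<le> norm ((norm (u x))\<^sup>2 + (norm (v x))\<^sup>2)"
    by auto
qed

lemma l2norm_Cauchy_Schwarz:
  fixes u v :: "real^'n \<Rightarrow> 'b::{real_normed_field,banach,second_countable_topology}"
  assumes "u \<in> L2" "v \<in> L2"
  shows "(LINT x|lebesgue. norm (u x) * norm (v x)) \<le> l2norm u * l2norm v"
proof -
  let ?B = "LINT x|lebesgue. norm (u x) * norm (v x)"
  note i = L2_integrable_sq[OF assms(1)] L2_integrable_sq[OF assms(2)]
    L2_mult_integrable[OF L2_norm[OF assms(1)] L2_norm[OF assms(2)]]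
  have "?B\<^sup>2 \<le> (l2norm u)\<^sup>2 * (l2norm v)\<^sup>2"
  proof (rule quadratic_nonneg_discriminant)
    fix t :: real
    have "0 \<le> (LINT x|lebesgue. (norm (u x) + t * norm (v x))\<^sup>2)" by simp
    also have "(\<lambda>x. (norm (u x) + t * norm (v x))\<^sup>2) =
      (\<lambda>x. (norm (u x))\<^sup>2 + 2 * t * (norm (u x) * norm (v x)) + t\<^sup>2 * (norm (v x))\<^sup>2)"
      by (auto simp: power2_eq_square algebra_simps)
    also have "(LINT x|lebesgue. \<dots> x) = (l2norm u)\<^sup>2 + 2 * t * ?B + t\<^sup>2 * (l2norm v)\<^sup>2"
      using i by (simp add: l2norm_sq)
    finally show "0 \<le> (l2norm u)\<^sup>2 + 2 * t * ?B + t\<^sup>2 * (l2norm v)\<^sup>2" .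
  qed
  then have "?B\<^sup>2 \<le> (l2norm u * l2norm v)\<^sup>2" by (simp add: power_mult_distrib)
  then show ?thesis by (rule power2_le_imp_le) simp
qed

lemma l2norm_integral_mult:
  fixes u v :: "real^'n \<Rightarrow> 'b::{real_normed_field,banach,second_countable_topology}"
  assumes "u \<in> L2" "v \<in> L2"
  shows "norm (LINT x|lebesgue. u x * v x) \<le> l2norm u * l2norm v"
proof -
  have "norm (LINT x|lebesgue. u x * v x) \<le> (LINT x|lebesgue. norm (u x * v x))"
    by (rule integral_norm_bound)
  also have "\<dots> = (LINT x|lebesgue. norm (u x) * norm (v x))" by (simp add: norm_mult)
  also have "\<dots> \<le> l2norm u * l2norm v" by (rule l2norm_Cauchy_Schwarz[OF assms])
  finally show ?thesis .
qed

lemma l2norm_cmult: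
  fixes u :: "real^'n \<Rightarrow> 'b::{real_normed_field,banach,second_countable_topology}"
  shows "l2norm (\<lambda>x. c * u x) = norm c * l2norm u"
  by (simp add: l2norm_def norm_mult power_mult_distrib real_sqrt_mult)

lemma l2norm_triangle:
  fixes u v :: "real^'n \<Rightarrow> 'b::{real_normed_field,banach,second_countable_topology}"
  assumes "u \<in> L2" "v \<in> L2"
  shows "l2norm (\<lambda>x. u x + v x) \<le> l2norm u + l2norm v"
proof (rule power2_le_imp_le)
  note i = L2_integrable_sq[OF assms(1)] L2_integrable_sq[OF assms(2)]
    L2_mult_integrable[OF L2_norm[OF assms(1)] L2_norm[OF assms(2)]]
  have "(l2norm (\<lambda>x. u x + v x))\<^sup>2 = (LINT x|lebesgue. (norm (u x + v x))\<^sup>2)" by (rule l2norm_sq)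
  also have "\<dots> \<le> (LINT x|lebesgue. (norm (u x))\<^sup>2 + 2 * (norm (u x) * norm (v x)) + (norm (v x))\<^sup>2)"
  proof (rule integral_mono)
    show "integrable lebesgue (\<lambda>x. (norm (u x + v x))\<^sup>2)"
      by (rule L2_integrable_sq[OF L2_add[OF assms]])
    fix x
    have "(norm (u x + v x))\<^sup>2 \<le> (norm (u x) + norm (v x))\<^sup>2" by (intro power_mono norm_triangle_ineq) auto
    then show "(norm (u x + v x))\<^sup>2 \<le> (norm (u x))\<^sup>2 + 2 * (norm (u x) * norm (v x)) + (norm (v x))\<^sup>2"
      by (simp add: power2_sum)
  qed (use i in simp)
  also have "\<dots> = (l2norm u)\<^sup>2 + 2 * (LINT x|lebesgue. norm (u x) * norm (v x)) + (l2norm v)\<^sup>2"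
    using i by (simp add: l2norm_sq)
  also have "\<dots> \<le> (l2norm u + l2norm v)\<^sup>2"
    using l2norm_Cauchy_Schwarz[OF assms] by (simp add: power2_sum)
  finally show "(l2norm (\<lambda>x. u x + v x))\<^sup>2 \<le> (l2norm u + l2norm v)\<^sup>2" .
qed simp

lemma l2norm_minus_commute: "l2norm (\<lambda>x. u x - v x) = l2norm (\<lambda>x. v x - u x)"
  by (simp add: l2norm_def norm_minus_commute)

lemma l2norm_triangle_diff:
  fixes u v w :: "real^'n \<Rightarrow> 'b::{real_normed_field,banach,second_countable_topology}"
  assumes "u \<in> L2" "v \<in> L2" "w \<in> L2"
  shows "l2norm (\<lambda>x. u x - w x) \<le> l2norm (\<lambda>x. u x - v x) + l2norm (\<lambda>x. v x - w x)"
  using l2norm_triangle[OF L2_diff[OF assms(1,2)] L2_diff[OF assms(2,3)]] by simp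

lemma l2norm_cong_AE:
  assumes "u \<in> L2" "v \<in> L2" "AE x in lebesgue. u x = v x" shows "l2norm u = l2norm v"
proof -
  have "(LINT x|lebesgue. (norm (u x))\<^sup>2) = (LINT x|lebesgue. (norm (v x))\<^sup>2)"
    using assms by (intro integral_cong_AE) (auto dest: L2_measurable)
  then show ?thesis by (simp add: l2norm_def)
qed

lemma l2norm_eq_0:
  assumes "u \<in> L2" "l2norm u = 0" shows "AE x in lebesgue. u x = 0"
  using integral_nonneg_eq_0_iff_AE[OF L2_integrable_sq[OF assms(1)]] assms(2)
  by (simp add: l2norm_def)

lemma l2norm_tendsto:
  fixes u :: "real^'n \<Rightarrow> 'b::{real_normed_field,banach,second_countable_topology}"
  assumes "\<And>k. f k \<in> L2" "u \<in> L2" "(\<lambda>k::nat. l2norm (\<lambda>x. f k x - u x)) \<longlonglongrightarrow> 0"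
  shows "(\<lambda>k. l2norm (f k)) \<longlonglongrightarrow> l2norm u"
proof (rule LIM_zero_cancel, rule Lim_null_comparison)
  have "\<bar>l2norm (f k) - l2norm u\<bar> \<le> l2norm (\<lambda>x. f k x - u x)" for k
    using l2norm_triangle[OF L2_diff[OF assms(1)[of k] assms(2)] assms(2)]
      l2norm_triangle[OF L2_diff[OF assms(2) assms(1)[of k]] assms(1)[of k]]
      l2norm_minus_commute[of u "f k"] by simp
  then show "\<forall>\<^sub>F k in sequentially. norm (l2norm (f k) - l2norm u) \<le> l2norm (\<lambda>x. f k x - u x)"
    by simp
qed fact

lemma L2_mult_tendsto:
  fixes u v :: "real^'n \<Rightarrow> 'b::{real_normed_field,banach,second_countable_topology}"
  assumes f: "\<And>k. f k \<in> L2" "u \<in> L2" "(\<lambda>k::nat. l2norm (\<lambda>x. f k x - u x)) \<longlonglongrightarrow> 0"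
    and g: "\<And>k. g k \<in> L2" "v \<in> L2" "(\<lambda>k::nat. l2norm (\<lambda>x. g k x - v x)) \<longlonglongrightarrow> 0"
  shows "(\<lambda>k. LINT x|lebesgue. f k x * g k x) \<longlonglongrightarrow> (LINT x|lebesgue. u x * v x)"
proof (rule LIM_zero_cancel, rule Lim_null_comparison)
  let ?e = "\<lambda>k. l2norm (f k) * l2norm (\<lambda>x. g k x - v x) + l2norm (\<lambda>x. f k x - u x) * l2norm v"
  have "norm ((LINT x|lebesgue. f k x * g k x) - (LINT x|lebesgue. u x * v x)) \<le> ?e k" for k
  proof -
    have "(LINT x|lebesgue. f k x * g k x) - (LINT x|lebesgue. u x * v x)
        = (LINT x|lebesgue. f k x * g k x - u x * v x)"
      by (rule Bochner_Integration.integral_diff[symmetric]; rule L2_mult_integrable; fact)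
    also have "\<dots> = (LINT x|lebesgue. f k x * (g k x - v x) + (f k x - u x) * v x)"
      by (simp add: algebra_simps)
    also have "\<dots> = (LINT x|lebesgue. f k x * (g k x - v x)) + (LINT x|lebesgue. (f k x - u x) * v x)"
      by (rule Bochner_Integration.integral_add; intro L2_mult_integrable L2_diff; fact)
    also have "norm \<dots> \<le> ?e k"
      by (intro norm_triangle_mono l2norm_integral_mult L2_diff; fact)
    finally show ?thesis .
  qed
  then show "\<forall>\<^sub>F k in sequentially. norm ((LINT x|lebesgue. f k x * g k x) - (LINT x|lebesgue. u x * v x)) \<le> ?e k"
    by simp
  have "?e \<longlonglongrightarrow> l2norm u * 0 + 0 * l2norm v"
    by (intro tendsto_intros l2norm_tendsto; fact)
  then show "?e \<longlonglongrightarrow> 0" by simp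
qed

lemma L2_tendsto_subseq_AE:
  fixes u :: "real^'n \<Rightarrow> 'b::{real_normed_field,banach,second_countable_topology}"
  assumes "\<And>k. f k \<in> L2" "u \<in> L2" "(\<lambda>k::nat. l2norm (\<lambda>x. f k x - u x)) \<longlonglongrightarrow> 0"
  obtains r :: "nat \<Rightarrow> nat" where "strict_mono r" "AE x in lebesgue. (\<lambda>k. f (r k) x) \<longlonglongrightarrow> u x"
proof -
  have "(\<lambda>k. (l2norm (\<lambda>x. f k x - u x))\<^sup>2) \<longlonglongrightarrow> 0\<^sup>2" by (intro tendsto_intros assms)
  then have "(\<lambda>k. LINT x|lebesgue. norm ((norm (f k x - u x))\<^sup>2)) \<longlonglongrightarrow> 0"
    by (simp add: l2norm_sq)
  from tendsto_L1_AE_subseq[OF _ this] obtain r where r: "strict_mono r"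
     "AE x in lebesgue. (\<lambda>k. (norm (f (r k) x - u x))\<^sup>2) \<longlonglongrightarrow> 0"
    using L2_integrable_sq[OF L2_diff[OF assms(1,2)]] by auto
  have "AE x in lebesgue. (\<lambda>k. f (r k) x) \<longlonglongrightarrow> u x"
    using r(2)
  proof eventually_elim
    fix x assume "(\<lambda>k. (norm (f (r k) x - u x))\<^sup>2) \<longlonglongrightarrow> 0"
    then have "(\<lambda>k. sqrt ((norm (f (r k) x - u x))\<^sup>2)) \<longlonglongrightarrow> sqrt 0" by (intro tendsto_intros)
    then have "(\<lambda>k. norm (f (r k) x - u x)) \<longlonglongrightarrow> 0" by simp
    then show "(\<lambda>k. f (r k) x) \<longlonglongrightarrow> u x" by (simp add: LIM_zero_iff tendsto_norm_zero_iff)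
  qed
  with r(1) show ?thesis by (rule that)
qed

lemma L2_tendsto_unique:
  fixes u v :: "real^'n \<Rightarrow> 'b::{real_normed_field,banach,second_countable_topology}"
  assumes f: "\<And>k. f k \<in> L2" "u \<in> L2" "v \<in> L2" "(\<lambda>k::nat. l2norm (\<lambda>x. f k x - u x)) \<longlonglongrightarrow> 0"
    "(\<lambda>k::nat. l2norm (\<lambda>x. f k x - v x)) \<longlonglongrightarrow> 0"
  shows "AE x in lebesgue. u x = v x"
proof -
  have "l2norm (\<lambda>x. u x - v x) \<le> l2norm (\<lambda>x. f k x - u x) + l2norm (\<lambda>x. f k x - v x)" for k
    using l2norm_triangle_diff[OF f(2) f(1)[of k] f(3)] l2norm_minus_commute[of u "f k"] by simp
  moreover have "(\<lambda>k. l2norm (\<lambda>x. f k x - u x) + l2norm (\<lambda>x. f k x - v x)) \<longlonglongrightarrow> 0 + 0"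
    by (intro tendsto_intros f)
  ultimately have "l2norm (\<lambda>x. u x - v x) \<le> 0"
    by (intro LIMSEQ_le_const[of "\<lambda>k. l2norm (\<lambda>x. f k x - u x) + l2norm (\<lambda>x. f k x - v x)"]) auto
  then have "l2norm (\<lambda>x. u x - v x) = 0" using l2norm_nonneg[of "\<lambda>x. u x - v x"] by linarith
  then show ?thesis using l2norm_eq_0[OF L2_diff[OF f(2,3)]] by simp
qed

text \<open>
  Fatou's lemma for square norms. It serves where only pointwise convergence is at hand, as for the
  Fourier integrals of an approximating sequence or for difference quotients.
\<close>

lemma L2_Fatou:
  fixes u :: "real^'n \<Rightarrow> 'b::{real_normed_field,banach,second_countable_topology}"
  assumes f: "\<And>k. f k \<in> L2" and u[measurable]: "u \<in> borel_measurable lebesgue"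
    and lim: "AE x in lebesgue. (\<lambda>k. f k x) \<longlonglongrightarrow> u x"
    and le: "eventually (\<lambda>k::nat. l2norm (f k) \<le> e) sequentially"
  shows "u \<in> L2" "l2norm u \<le> e"
proof -
  obtain k0 where "l2norm (f k0) \<le> e" using eventually_happens'[OF sequentially_bot le] by blast
  then have e: "0 \<le> e" using l2norm_nonneg[of "f k0"] by linarith
  have [measurable]: "f k \<in> borel_measurable lebesgue" for k using f by (rule L2_measurable)
  have "(\<integral>\<^sup>+x. ennreal ((norm (u x))\<^sup>2) \<partial>lebesgue) = (\<integral>\<^sup>+x. liminf (\<lambda>k. ennreal ((norm (f k x))\<^sup>2)) \<partial>lebesgue)"
    using lim
  proof (intro nn_integral_cong_AE, eventually_elim)
    fix x assume "(\<lambda>k. f k x) \<longlonglongrightarrow> u x"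
    then have "(\<lambda>k. ennreal ((norm (f k x))\<^sup>2)) \<longlonglongrightarrow> ennreal ((norm (u x))\<^sup>2)"
      by (intro tendsto_intros)
    then show "ennreal ((norm (u x))\<^sup>2) = liminf (\<lambda>k. ennreal ((norm (f k x))\<^sup>2))"
      by (intro lim_imp_Liminf[symmetric]) auto
  qed
  also have "\<dots> \<le> liminf (\<lambda>k. \<integral>\<^sup>+x. ennreal ((norm (f k x))\<^sup>2) \<partial>lebesgue)"
    by (rule nn_integral_liminf) simp
  also have "\<dots> \<le> ennreal (e\<^sup>2)"
  proof (rule Liminf_le)
    show "\<forall>\<^sub>F k in sequentially. (\<integral>\<^sup>+x. ennreal ((norm (f k x))\<^sup>2) \<partial>lebesgue) \<le> ennreal (e\<^sup>2)"
      using le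
    proof eventually_elim
      fix k assume "l2norm (f k) \<le> e"
      then have "(l2norm (f k))\<^sup>2 \<le> e\<^sup>2" by (intro power_mono) auto
      then show "(\<integral>\<^sup>+x. ennreal ((norm (f k x))\<^sup>2) \<partial>lebesgue) \<le> ennreal (e\<^sup>2)"
        using L2_integrable_sq[OF f[of k]] by (simp add: nn_integral_eq_integral l2norm_sq ennreal_leI)
    qed
  qed simp
  finally have le: "(\<integral>\<^sup>+x. ennreal ((norm (u x))\<^sup>2) \<partial>lebesgue) \<le> ennreal (e\<^sup>2)" .
  have i: "integrable lebesgue (\<lambda>x. (norm (u x))\<^sup>2)"
    by (rule integrableI_bounded) (use le in \<open>auto simp: order_le_less_trans\<close>)
  then show "u \<in> L2" by (auto intro: L2I)
  have "(l2norm u)\<^sup>2 \<le> e\<^sup>2"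
    using le i by (simp add: nn_integral_eq_integral l2norm_sq)
  then show "l2norm u \<le> e" using e by (rule power2_le_imp_le)
qed

text \<open>
  Riesz--Fischer. Let \<open>D\<^sub>k\<close> be the squared distance of consecutive members of a subsequence that is
  chosen with \<open>\<integral> D\<^sub>k \<le> 4\<^sup>-\<^sup>k\<close>. Then \<open>\<Sum>\<^sub>k 2\<^sup>k D\<^sub>k\<close> has finite integral, so at almost every point it has
  a finite value \<open>C\<close>, the distances are at most \<open>C\<^sup>1\<^sup>/\<^sup>2 2\<^sup>-\<^sup>k\<^sup>/\<^sup>2\<close>, and the subsequence converges. Fatou's
  lemma upgrades this to mean square convergence of the whole sequence.
\<close>

lemma L2_complete:
  fixes f :: "nat \<Rightarrow> real^'n \<Rightarrow> 'b::{real_normed_field,banach,second_countable_topology}"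
  assumes f: "\<And>k. f k \<in> L2"
    and Cauchy: "\<And>e. e > 0 \<Longrightarrow> \<exists>N. \<forall>i\<ge>N. \<forall>j\<ge>N. l2norm (\<lambda>x. f i x - f j x) < e"
  obtains u where "u \<in> L2" "(\<lambda>k. l2norm (\<lambda>x. f k x - u x)) \<longlonglongrightarrow> 0"
proof -
  have [measurable]: "f k \<in> borel_measurable lebesgue" for k using f by (rule L2_measurable)
  have "\<exists>N. \<forall>i\<ge>N. \<forall>j\<ge>N. l2norm (\<lambda>x. f i x - f j x) < (1/2)^k" for k :: nat
    by (rule Cauchy) simp
  then obtain N where N: "\<And>k i j. i \<ge> N k \<Longrightarrow> j \<ge> N k \<Longrightarrow> l2norm (\<lambda>x. f i x - f j x) < (1/2)^k"
    by metis
  define r where "r k = Max (N ` {..k}) + k" for k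
  have rN: "N j \<le> r k" if "j \<le> k" for j k
    unfolding r_def using that by (intro trans_le_add1 Max_ge) auto
  have r_ge: "k \<le> r k" for k by (simp add: r_def)
  define D where "D k x = (norm (f (r (Suc k)) x - f (r k) x))\<^sup>2" for k x
  have Dnn: "0 \<le> D k x" for k x by (simp add: D_def)
  have [measurable]: "D k \<in> borel_measurable lebesgue" for k unfolding D_def by measurable
  have Dint: "integrable lebesgue (D k)" for k
    unfolding D_def by (rule L2_integrable_sq[OF L2_diff[OF f f]])
  have D: "(\<integral>\<^sup>+x. ennreal (2^k * D k x) \<partial>lebesgue) \<le> ennreal ((1/2)^k)" for k
  proof -
    have "l2norm (\<lambda>x. f (r (Suc k)) x - f (r k) x) \<le> (1/2)^k"
      using N[of k "r (Suc k)" "r k"] rN[of k k] rN[of k "Suc k"] by simp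
    then have "(l2norm (\<lambda>x. f (r (Suc k)) x - f (r k) x))\<^sup>2 \<le> ((1/2)^k)\<^sup>2" by (intro power_mono) auto
    then have "(LINT x|lebesgue. D k x) \<le> ((1/2)^k)\<^sup>2" by (simp add: l2norm_sq D_def)
    then have "2^k * (LINT x|lebesgue. D k x) \<le> 2^k * ((1/2)^k)\<^sup>2" by (intro mult_left_mono) auto
    also have "\<dots> = (1/2)^k" by (simp add: power2_eq_square power_divide)
    finally have "2^k * (LINT x|lebesgue. D k x) \<le> (1/2)^k" .
    moreover have "(\<integral>\<^sup>+x. ennreal (2^k * D k x) \<partial>lebesgue) = ennreal (2^k * (LINT x|lebesgue. D k x))"
      using Dint[of k] Dnn by (subst nn_integral_eq_integral) auto
    ultimately show ?thesis by (simp add: ennreal_leI)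
  qed
  have "(\<integral>\<^sup>+x. (\<Sum>k. ennreal (2^k * D k x)) \<partial>lebesgue) = (\<Sum>k. \<integral>\<^sup>+x. ennreal (2^k * D k x) \<partial>lebesgue)"
    by (rule nn_integral_suminf) simp
  also have "\<dots> \<le> (\<Sum>k. ennreal ((1/2)^k))" by (intro suminf_le D) auto
  also have "\<dots> = ennreal (\<Sum>k. (1/2)^k)" by (rule suminf_ennreal2) auto
  also have "\<dots> < \<infinity>" by simp
  finally have "AE x in lebesgue. (\<Sum>k. ennreal (2^k * D k x)) \<noteq> \<infinity>"
    by (intro nn_integral_PInf_AE) auto
  then have conv: "AE x in lebesgue. convergent (\<lambda>k. f (r k) x)"
  proof eventually_elim
    fix x assume fin: "(\<Sum>k. ennreal (2^k * D k x)) \<noteq> \<infinity>"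
    define C where "C = enn2real (\<Sum>k. ennreal (2^k * D k x))"
    have bound: "norm (f (r (Suc k)) x - f (r k) x) \<le> sqrt C * (sqrt (1/2))^k" for k
    proof -
      have "ennreal (2^k * D k x) \<le> (\<Sum>k. ennreal (2^k * D k x))"
        using sum_le_suminf[OF summableI, of "{k}" "\<lambda>k. ennreal (2^k * D k x)"] by simp
      also have "\<dots> = ennreal C" using fin by (simp add: C_def top.not_eq_extremum)
      finally have "2^k * D k x \<le> C" using Dnn[of k x] C_def enn2real_nonneg
        by (subst (asm) ennreal_le_iff) auto
      then have "D k x \<le> C * (1/2)^k" by (simp add: field_simps power_divide)
      then have "sqrt (D k x) \<le> sqrt (C * (1/2)^k)" by simp
      then show ?thesis by (simp add: D_def real_sqrt_mult real_sqrt_power)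
    qed
    have "summable (\<lambda>k. sqrt C * (sqrt (1/2))^k)"
      by (intro summable_mult summable_geometric) (simp add: real_sqrt_lt_1_iff)
    then have "summable (\<lambda>k. f (r (Suc k)) x - f (r k) x)"
      by (rule summable_comparison_test') (use bound in auto)
    then have "convergent (\<lambda>n. (\<Sum>k<n. f (r (Suc k)) x - f (r k) x) + f (r 0) x)"
      by (simp add: summable_iff_convergent convergent_add_const_right_iff)
    then show "convergent (\<lambda>k. f (r k) x)"
      by (simp add: sum_lessThan_telescope[of "\<lambda>k. f (r k) x"])
  qed
  define u where "u x = lim (\<lambda>k. f (r k) x)" for x
  have [measurable]: "u \<in> borel_measurable lebesgue" unfolding u_def by measurable
  have lim: "AE x in lebesgue. (\<lambda>k. f (r k) x) \<longlonglongrightarrow> u x"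
    using conv by eventually_elim (simp add: u_def convergent_LIMSEQ_iff)
  have est: "(\<lambda>x. f i x - u x) \<in> L2 \<and> l2norm (\<lambda>x. f i x - u x) \<le> (1/2)^k" if "i \<ge> N k" for i k
  proof -
    have "AE x in lebesgue. (\<lambda>j. f i x - f (r j) x) \<longlonglongrightarrow> f i x - u x"
      using lim by eventually_elim (intro tendsto_intros)
    moreover have "eventually (\<lambda>j. l2norm (\<lambda>x. f i x - f (r j) x) \<le> (1/2)^k) sequentially"
      using eventually_ge_at_top[of k]
      by eventually_elim (use N rN that in \<open>auto intro: less_imp_le\<close>)
    ultimately show ?thesis
      using L2_Fatou[of "\<lambda>j x. f i x - f (r j) x" "\<lambda>x. f i x - u x" "(1/2)^k"] L2_diff[OF f f] by simp
  qed
  have "(\<lambda>x. f (N 0) x - (f (N 0) x - u x)) \<in> L2"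
    by (rule L2_diff[OF f]) (use est[of 0 "N 0"] in auto)
  then have "u \<in> L2" by simp
  moreover have "(\<lambda>k. l2norm (\<lambda>x. f k x - u x)) \<longlonglongrightarrow> 0"
  proof (rule LIMSEQ_I)
    fix e :: real assume "0 < e"
    then obtain k where k: "(1/2)^k < e" using real_arch_pow_inv[of e "1/2"] by auto
    have "norm (l2norm (\<lambda>x. f i x - u x) - 0) < e" if "i \<ge> N k" for i
      using est[OF that] k by simp
    then show "\<exists>no. \<forall>n\<ge>no. norm (l2norm (\<lambda>x. f n x - u x) - 0) < e" by blast
  qed
  ultimately show ?thesis by (rule that)
qed

section \<open>Gaussians and their Fourier transforms\<close>

lemma sigma_finite_lebesgue: "sigma_finite_measure (lebesgue :: 'a::euclidean_space measure)"
proof -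
  obtain A where A: "countable A" "A \<subseteq> sets (lborel :: 'a measure)" "\<Union> A = space (lborel :: 'a measure)"
      "\<forall>a\<in>A. emeasure (lborel :: 'a measure) a \<noteq> \<infinity>"
    using lborel.sigma_finite_countable by blast
  show ?thesis
  proof
    show "\<exists>A::'a set set. countable A \<and> A \<subseteq> sets lebesgue \<and> \<Union> A = space lebesgue \<and> (\<forall>a\<in>A. emeasure lebesgue a \<noteq> \<infinity>)"
      using A by (intro exI[of _ A]) (auto simp: subset_iff emeasure_completion)
  qed
qed

interpretation leb: sigma_finite_measure "lebesgue :: 'a::euclidean_space measure"
  by (rule sigma_finite_lebesgue)

interpretation lebp: pair_sigma_finite "lebesgue :: 'a::euclidean_space measure" "lebesgue :: 'b::euclidean_space measure" ..

lemma measurable_lebesgue_borel: "(\<lambda>x. x) \<in> borel_measurable lebesgue"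
  by (rule measurable_completion) simp

lemma measurable_cis [measurable]: "cis \<in> borel_measurable borel"
  by (intro borel_measurable_continuous_onI continuous_intros)

lemma measurable_cnj [measurable]: "cnj \<in> borel_measurable borel"
  by (intro borel_measurable_continuous_onI continuous_intros)

text \<open>
  The pattern of Fubini's theorem for Fourier and Gauss kernels: two integrable factors in separate
  variables, coupled by a bounded kernel.
\<close>

lemma (in pair_sigma_finite) integrable_bounded_kernel:
  fixes f g :: "_ \<Rightarrow> 'c::{real_normed_field,banach,second_countable_topology}"
  assumes f: "integrable M1 f" and g: "integrable M2 g"
    and k[measurable]: "k \<in> borel_measurable (M1 \<Otimes>\<^sub>M M2)" and C: "\<And>p. norm (k p) \<le> C"
  shows "integrable (M1 \<Otimes>\<^sub>M M2) (\<lambda>(x, y). f x * (k (x, y) * g y))"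
proof (rule Bochner_Integration.integrable_bound)
  have [measurable]: "f \<in> borel_measurable M1" "g \<in> borel_measurable M2" using f g by auto
  show "integrable (M1 \<Otimes>\<^sub>M M2) (\<lambda>(x, y). of_real C * (f x * g y))"
  proof (rule Fubini_integrable)
    have "integrable M1 (\<lambda>x. (\<bar>C\<bar> * (\<integral>y. norm (g y) \<partial>M2)) * norm (f x))"
      using f by simp
    then show "integrable M1 (\<lambda>x. \<integral>y. norm (case (x, y) of (x, y) \<Rightarrow> of_real C * (f x * g y)) \<partial>M2)"
      by (simp add: norm_mult mult_ac)
  qed (use f g in auto)
  show "(\<lambda>(x, y). f x * (k (x, y) * g y)) \<in> borel_measurable (M1 \<Otimes>\<^sub>M M2)"
    by measurable
  have "norm (f x * (k (x, y) * g y)) \<le> norm (of_real C * (f x * g y))" for x y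
  proof -
    have "norm (k (x, y)) * (norm (f x) * norm (g y)) \<le> \<bar>C\<bar> * (norm (f x) * norm (g y))"
      using C[of "(x, y)"] by (intro mult_right_mono) auto
    then show ?thesis by (simp add: norm_mult mult_ac)
  qed
  then show "AE p in M1 \<Otimes>\<^sub>M M2. norm (case p of (x, y) \<Rightarrow> f x * (k (x, y) * g y)) \<le>
      norm (case p of (x, y) \<Rightarrow> of_real C * (f x * g y))"
    by auto
qed

lemma (in pair_sigma_finite) integral_swap_kernel:
  fixes f g :: "_ \<Rightarrow> 'c::{real_normed_field,banach,second_countable_topology}"
  assumes f: "integrable M1 f" and g: "integrable M2 g"
    and k: "k \<in> borel_measurable (M1 \<Otimes>\<^sub>M M2)" and C: "\<And>p. norm (k p) \<le> C"
  shows "(\<integral>x. f x * (\<integral>y. k (x, y) * g y \<partial>M2) \<partial>M1) = (\<integral>y. g y * (\<integral>x. k (x, y) * f x \<partial>M1) \<partial>M2)"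
proof -
  have "(\<integral>y. (\<integral>x. f x * (k (x, y) * g y) \<partial>M1) \<partial>M2) = (\<integral>x. (\<integral>y. f x * (k (x, y) * g y) \<partial>M2) \<partial>M1)"
    by (rule Fubini_integral) (use integrable_bounded_kernel[OF assms] in simp)
  moreover have "(\<integral>y. f x * (k (x, y) * g y) \<partial>M2) = f x * (\<integral>y. k (x, y) * g y \<partial>M2)" for x
    by simp
  moreover have "(\<integral>x. f x * (k (x, y) * g y) \<partial>M1) = g y * (\<integral>x. k (x, y) * f x \<partial>M1)" for y
  proof -
    have "(\<lambda>x. f x * (k (x, y) * g y)) = (\<lambda>x. g y * (k (x, y) * f x))" by (auto simp: mult_ac)
    then show ?thesis by simp
  qed
  ultimately show ?thesis by simp
qed

lemma lborel_integral_prod_Basis: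
  fixes f :: "'a::euclidean_space \<Rightarrow> real \<Rightarrow> complex"
  assumes f: "\<And>b. b \<in> Basis \<Longrightarrow> integrable lborel (f b)"
  shows "integrable lborel (\<lambda>x::'a. \<Prod>b\<in>Basis. f b (x \<bullet> b))"
    and "(LINT x|lborel. (\<Prod>b\<in>Basis. f b ((x::'a) \<bullet> b))) = (\<Prod>b\<in>Basis. LINT x|lborel. f b x)"
proof -
  interpret product_sigma_finite "\<lambda>_::'a. lborel :: real measure" ..
  have [measurable]: "f b \<in> borel_measurable borel" if "b \<in> Basis" for b
    using borel_measurable_integrable[OF f[OF that]] by simp
  have m: "(\<lambda>x::'a. \<Prod>b\<in>Basis. f b (x \<bullet> b)) \<in> borel_measurable borel" by measurable
  have m': "(\<lambda>f. \<Sum>b\<in>Basis. f b *\<^sub>R b) \<in> (\<Pi>\<^sub>M b\<in>(Basis::'a set). (lborel :: real measure)) \<rightarrow>\<^sub>M borel" by measurable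
  have eq: "(\<Prod>b\<in>Basis. f b ((\<Sum>b\<in>Basis. x b *\<^sub>R b) \<bullet> b)) = (\<Prod>b\<in>Basis. f b (x b))" for x :: "'a \<Rightarrow> real"
    by (intro prod.cong) (simp_all add: inner_sum_left inner_Basis if_distrib[of "\<lambda>z. x _ * z"] sum.delta cong: if_cong)
  show "integrable lborel (\<lambda>x::'a. \<Prod>b\<in>Basis. f b (x \<bullet> b))"
    by (subst lborel_eq, subst integrable_distr_eq[OF m' m]) (simp only: eq, rule product_integrable_prod, auto intro: f)
  show "(LINT x|lborel. (\<Prod>b\<in>Basis. f b ((x::'a) \<bullet> b))) = (\<Prod>b\<in>Basis. LINT x|lborel. f b x)"
    by (subst lborel_eq, subst integral_distr[OF m' m]) (simp only: eq, rule product_integral_prod, auto intro: f)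
qed

lemma gauss_fourier_1D:
  fixes a t :: real
  assumes t: "t > 0"
  shows "integrable lborel (\<lambda>x. cis (a * x) * of_real (exp (- t * x\<^sup>2)))" (is "integrable _ ?f")
    and "(LINT x|lborel. cis (a * x) * of_real (exp (- t * x\<^sup>2))) = of_real (sqrt (pi / t) * exp (- a\<^sup>2 / (4 * t)))"
proof -
  define c where "c = sqrt (2 * t)"
  define b where "b = a / c"
  have c: "c > 0" "c\<^sup>2 = 2 * t" using t by (auto simp: c_def)
  have b2: "b\<^sup>2 / 2 = a\<^sup>2 / (4 * t)" using c by (simp add: b_def power_divide)
  let ?g = "\<lambda>x. std_normal_density x *\<^sub>R cis (b * x)"
  have dens: "std_normal_density (c * x) = exp (- t * x\<^sup>2) / sqrt (2 * pi)" for x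
    by (simp add: std_normal_density_def power_mult_distrib c)
  have f_eq: "?f x = sqrt (2 * pi) *\<^sub>R ?g (0 + c * x)" for x
    using c by (simp add: dens b_def scaleR_conv_of_real)
  have ig: "integrable lborel ?g"
    by (rule Bochner_Integration.integrable_bound[OF integrable_normal_density[of 1 0]]) auto
  have "char std_normal_distribution b = (LINT x|lborel. ?g x)"
    unfolding char_def by (subst integral_density) (auto simp: cis_conv_exp)
  then have vg: "(LINT x|lborel. ?g x) = of_real (exp (- b\<^sup>2 / 2))"
    by (simp add: char_std_normal_distribution)
  have "integrable lborel (\<lambda>x. ?g (0 + c * x))"
    using lborel_integrable_real_affine[OF ig, of c 0] c by simp
  then show "integrable lborel ?f" unfolding f_eq by (rule integrable_scaleR_right)
  have "(LINT x|lborel. ?g x) = \<bar>c\<bar> *\<^sub>R (LINT x|lborel. ?g (0 + c * x))"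
    by (rule lborel_integral_real_affine) (use c in simp)
  then have "(LINT x|lborel. ?g (0 + c * x)) = (1 / c) *\<^sub>R of_real (exp (- b\<^sup>2 / 2))"
    using vg c by (simp add: divide_simps scaleR_conv_of_real mult.commute)
  then have "(LINT x|lborel. ?f x) = (sqrt (2 * pi) / c) *\<^sub>R of_real (exp (- b\<^sup>2 / 2))"
    unfolding f_eq by (subst integral_scaleR_right) simp
  also have "sqrt (2 * pi) / c = sqrt (pi / t)" using t by (simp add: c_def real_sqrt_divide real_sqrt_mult)
  finally show "(LINT x|lborel. ?f x) = of_real (sqrt (pi / t) * exp (- a\<^sup>2 / (4 * t)))"
    using b2 by (simp add: scaleR_conv_of_real)
qed

lemma cis_sum: "cis (\<Sum>i\<in>I. f i) = (\<Prod>i\<in>I. cis (f i))" if "finite I"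
  using that by (induction I) (auto simp: cis_mult[symmetric])

lemma gauss_fourier:
  fixes x :: "real^'n" and t :: real
  assumes t: "t > 0"
  shows "integrable lebesgue (\<lambda>\<xi>. cis (x \<bullet> \<xi>) * of_real (exp (- t * (norm \<xi>)\<^sup>2)))" (is "integrable _ ?f")
    and "(LINT \<xi>|lebesgue. cis (x \<bullet> \<xi>) * of_real (exp (- t * (norm \<xi>)\<^sup>2))) =
      of_real (sqrt (pi / t) ^ CARD('n) * exp (- (norm x)\<^sup>2 / (4 * t)))"
proof -
  have nsq: "(norm y)\<^sup>2 = (\<Sum>b\<in>Basis. (y \<bullet> b)\<^sup>2)" for y :: "real^'n"
    by (subst power2_norm_eq_inner, subst euclidean_inner) (simp add: power2_eq_square)
  have eq: "?f \<xi> = (\<Prod>b\<in>Basis. cis ((x \<bullet> b) * (\<xi> \<bullet> b)) * of_real (exp (- t * (\<xi> \<bullet> b)\<^sup>2)))" for \<xi>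
    by (simp add: euclidean_inner[of x \<xi>] cis_sum nsq sum_distrib_left exp_sum prod.distrib flip: sum_negf)
  have m: "?f \<in> borel_measurable lborel" by measurable
  note P = lborel_integral_prod_Basis[of "\<lambda>b z. cis ((x \<bullet> b) * z) * of_real (exp (- t * z\<^sup>2))", OF gauss_fourier_1D(1)[OF t]]
  show "integrable lebesgue ?f"
    unfolding integrable_completion[OF m] unfolding eq by (rule P(1))
  have "(LINT \<xi>|lebesgue. ?f \<xi>) = (\<Prod>b\<in>Basis. of_real (sqrt (pi / t) * exp (- (x \<bullet> b)\<^sup>2 / (4 * t))))"
    unfolding integral_completion[OF m] unfolding eq gauss_fourier_1D(2)[OF t, symmetric] by (rule P(2))
  also have "\<dots> = of_real (sqrt (pi / t) ^ DIM(real^'n) * exp (\<Sum>b\<in>Basis. - (x \<bullet> b)\<^sup>2 / (4 * t)))"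
    by (simp add: prod.distrib exp_sum)
  also have "(\<Sum>b\<in>Basis. - (x \<bullet> b)\<^sup>2 / (4 * t)) = - (norm x)\<^sup>2 / (4 * t)"
    by (simp add: nsq sum_divide_distrib sum_negf)
  finally show "(LINT \<xi>|lebesgue. ?f \<xi>) = of_real (sqrt (pi / t) ^ CARD('n) * exp (- (norm x)\<^sup>2 / (4 * t)))"
    by simp
qed

lemma gauss_integrable:
  fixes t :: real
  assumes t: "t > 0"
  shows "integrable lebesgue (\<lambda>\<xi>::real^'n. exp (- t * (norm \<xi>)\<^sup>2))"
    and "(LINT \<xi>|lebesgue. exp (- t * (norm (\<xi>::real^'n))\<^sup>2)) = sqrt (pi / t) ^ CARD('n)"
proof -
  have i: "integrable lebesgue (\<lambda>\<xi>::real^'n. complex_of_real (exp (- t * (norm \<xi>)\<^sup>2)))"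
    using gauss_fourier(1)[OF t, of 0] by simp
  then show "integrable lebesgue (\<lambda>\<xi>::real^'n. exp (- t * (norm \<xi>)\<^sup>2))"
    using complex_of_real_integrable_eq by blast
  have "complex_of_real (LINT \<xi>|lebesgue. exp (- t * (norm (\<xi>::real^'n))\<^sup>2)) = of_real (sqrt (pi / t) ^ CARD('n))"
    using gauss_fourier(2)[OF t, of "0::real^'n"] by (simp flip: integral_complex_of_real)
  then show "(LINT \<xi>|lebesgue. exp (- t * (norm (\<xi>::real^'n))\<^sup>2)) = sqrt (pi / t) ^ CARD('n)"
    using of_real_eq_iff by blast
qed

lemma lebesgue_integral_affine:
  fixes F :: "real^'n \<Rightarrow> 'b::{banach,second_countable_topology}"
  assumes F[measurable]: "F \<in> borel_measurable borel" and c: "c > 0"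
  shows "(LINT y|lebesgue. F y) = c ^ CARD('n) *\<^sub>R (LINT h|lebesgue. F (x + c *\<^sub>R h))"
proof -
  have "(LINT y|lebesgue. F y) = (LINT y|lborel. F y)" by (rule integral_completion) simp
  also have "\<dots> = (LINT y|density (distr lborel borel (\<lambda>h. x + c *\<^sub>R h)) (\<lambda>_. ennreal (\<bar>c\<bar> ^ DIM(real^'n))). F y)"
    using lborel_affine[of c x] c by (simp add: ennreal_power)
  also have "\<dots> = c ^ CARD('n) *\<^sub>R (LINT h|lborel. F (x + c *\<^sub>R h))"
    using c by (subst integral_density) (auto simp: integral_distr)
  also have "(LINT h|lborel. F (x + c *\<^sub>R h)) = (LINT h|lebesgue. F (x + c *\<^sub>R h))"
    by (rule integral_completion[symmetric]) simp
  finally show ?thesis .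
qed

section \<open>Plancherel's theorem\<close>

lemma fst_lebesgue: "fst \<in> borel_measurable ((lebesgue :: 'a::euclidean_space measure) \<Otimes>\<^sub>M (N :: 'b measure))"
  by (rule measurable_compose[OF measurable_fst measurable_lebesgue_borel])

lemma snd_lebesgue: "snd \<in> borel_measurable ((N :: 'b measure) \<Otimes>\<^sub>M (lebesgue :: 'a::euclidean_space measure))"
  by (rule measurable_compose[OF measurable_snd measurable_lebesgue_borel])

lemma fourier_kernel_measurable:
  "(\<lambda>p. cis (c * (fst p \<bullet> snd p))) \<in> borel_measurable ((lebesgue :: 'a::euclidean_space measure) \<Otimes>\<^sub>M lebesgue)"
proof -
  note [measurable] = fst_lebesgue snd_lebesgue
  show ?thesis by measurable
qed

lemma fourier_integral_measurable:
  assumes u[measurable]: "u \<in> borel_measurable lebesgue"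
  shows "fourier_integral u \<in> borel_measurable lebesgue"
proof -
  have "(\<lambda>\<xi>. LINT x|lebesgue. cis (-1 * (fst (\<xi>, x) \<bullet> snd (\<xi>, x))) * u (snd (\<xi>, x))) \<in> borel_measurable lebesgue"
  proof (rule leb.borel_measurable_lebesgue_integral)
    note [measurable] = fourier_kernel_measurable[of "-1"]
    show "(\<lambda>(\<xi>, x). cis (-1 * (fst (\<xi>, x) \<bullet> snd (\<xi>, x))) * u (snd (\<xi>, x))) \<in> borel_measurable (lebesgue \<Otimes>\<^sub>M lebesgue)"
      unfolding case_prod_beta prod.collapse by measurable
  qed
  then show ?thesis unfolding fourier_integral_def by (simp add: inner_commute)
qed

lemma norm_fourier_integral_le:
  "cmod (fourier_integral u \<xi>) \<le> (LINT x|lebesgue. cmod (u x))"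
  unfolding fourier_integral_def
  by (rule order_trans[OF integral_norm_bound]) (simp add: norm_mult)

lemma integrable_cis_mult:
  fixes u :: "real^'n \<Rightarrow> complex"
  assumes "integrable lebesgue u"
  shows "integrable lebesgue (\<lambda>x. cis (c * (x \<bullet> \<xi>)) * u x)"
proof (rule Bochner_Integration.integrable_bound[OF assms])
  have [measurable]: "u \<in> borel_measurable lebesgue" using assms by auto
  have [measurable]: "(\<lambda>x. cis (c * (x \<bullet> \<xi>))) \<in> borel_measurable lebesgue"
    by (rule measurable_completion) measurable
  show "(\<lambda>x. cis (c * (x \<bullet> \<xi>)) * u x) \<in> borel_measurable lebesgue" by measurable
qed (simp add: norm_mult)

lemma integrable_cis_mult':
  fixes u :: "real^'n \<Rightarrow> complex"
  assumes "integrable lebesgue u"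
  shows "integrable lebesgue (\<lambda>x. cis (- (x \<bullet> \<xi>)) * u x)"
  using integrable_cis_mult[OF assms, of "-1" \<xi>] by simp

lemma fourier_integral_lin:
  fixes u :: "real^'n \<Rightarrow> complex"
  assumes "integrable lebesgue u" "integrable lebesgue v"
  shows "fourier_integral (\<lambda>x. u x + c * v x) \<xi> = fourier_integral u \<xi> + c * fourier_integral v \<xi>"
proof -
  have "fourier_integral (\<lambda>x. u x + c * v x) \<xi>
    = (LINT x|lebesgue. cis (- (x \<bullet> \<xi>)) * u x + c * (cis (- (x \<bullet> \<xi>)) * v x))"
    unfolding fourier_integral_def by (simp add: algebra_simps)
  also have "\<dots> = fourier_integral u \<xi> + c * fourier_integral v \<xi>"
    unfolding fourier_integral_def using assms integrable_cis_mult'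
    by (subst Bochner_Integration.integral_add) auto
  finally show ?thesis .
qed

lemma fourier_integral_diff:
  fixes u :: "real^'n \<Rightarrow> complex"
  assumes "integrable lebesgue u" "integrable lebesgue v"
  shows "fourier_integral (\<lambda>x. u x - v x) \<xi> = fourier_integral u \<xi> - fourier_integral v \<xi>"
  using fourier_integral_lin[OF assms, of "-1" \<xi>] by simp

text \<open>
  Regularizing the frequency integral of \<open>\<F>u\<close> times the conjugate of \<open>\<F>v\<close> by a Gaussian makes it
  absolutely convergent, and Fubini's theorem turns it into a convolution with a heat kernel. This
  serves twice: for \<open>t \<rightarrow> 0\<close> it gives Plancherel's theorem, and integrated over \<open>t\<close> it gives the
  kernel of the fractional Laplacian.
\<close>

lemma fourier_gauss_identity:
  fixes u v :: "real^'n \<Rightarrow> complex"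
  assumes u: "integrable lebesgue u" and v: "integrable lebesgue v" and t: "t > 0"
  shows "(LINT \<xi>|lebesgue. of_real (exp (- t * (norm \<xi>)\<^sup>2)) * (fourier_integral u \<xi> * cnj (fourier_integral v \<xi>)))
    = (LINT x|lebesgue. u x * (LINT y|lebesgue. cnj (v y) *
        of_real (sqrt (pi / t) ^ CARD('n) * exp (- (norm (x - y))\<^sup>2 / (4 * t)))))"
proof -
  let ?G = "\<lambda>\<xi>::real^'n. complex_of_real (exp (- t * (norm \<xi>)\<^sup>2))"
  let ?V = "\<lambda>\<xi>. cnj (fourier_integral v \<xi>)"
  have [measurable]: "u \<in> borel_measurable lebesgue" "v \<in> borel_measurable lebesgue" using u v by auto
  have G: "integrable lebesgue ?G" using gauss_fourier(1)[OF t, of 0] by simp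
  note [measurable] = fourier_integral_measurable
  have GV: "integrable lebesgue (\<lambda>\<xi>. ?G \<xi> * ?V \<xi>)"
  proof (rule Bochner_Integration.integrable_bound)
    show "integrable lebesgue (\<lambda>\<xi>::real^'n. (LINT x|lebesgue. cmod (v x)) * exp (- t * (norm \<xi>)\<^sup>2))"
      using gauss_integrable(1)[OF t] by (rule integrable_mult_right)
    show "(\<lambda>\<xi>. ?G \<xi> * ?V \<xi>) \<in> borel_measurable lebesgue" using G by measurable
    show "AE \<xi> in lebesgue. norm (?G \<xi> * ?V \<xi>) \<le> norm ((LINT x|lebesgue. cmod (v x)) * exp (- t * (norm \<xi>)\<^sup>2))"
      using norm_fourier_integral_le[of v] by (auto simp: norm_mult mult.commute intro!: mult_right_mono)
  qed
  have vbar: "integrable lebesgue (\<lambda>y. cnj (v y))" using v by simp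
  have Veq: "?V \<xi> = (LINT y|lebesgue. cis (1 * (fst (\<xi>, y) \<bullet> snd (\<xi>, y))) * cnj (v y))" for \<xi>
    unfolding fourier_integral_def
    by (subst Bochner_Integration.integral_cnj[symmetric]) (simp add: cis_cnj inner_commute)
  have Ueq: "fourier_integral u \<xi> = (LINT x|lebesgue. cis (-1 * (fst (\<xi>, x) \<bullet> snd (\<xi>, x))) * u x)" for \<xi>
    unfolding fourier_integral_def by (simp add: inner_commute)
  have inner: "(LINT \<xi>|lebesgue. cis (-1 * (fst (\<xi>, x) \<bullet> snd (\<xi>, x))) * (?G \<xi> * ?V \<xi>))
     = (LINT y|lebesgue. cnj (v y) * of_real (sqrt (pi / t) ^ CARD('n) * exp (- (norm (x - y))\<^sup>2 / (4 * t))))" for x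
  proof -
    have i: "integrable lebesgue (\<lambda>\<xi>. cis (-1 * (\<xi> \<bullet> x)) * ?G \<xi>)" by (rule integrable_cis_mult[OF G])
    have "(LINT \<xi>|lebesgue. cis (-1 * (fst (\<xi>, x) \<bullet> snd (\<xi>, x))) * (?G \<xi> * ?V \<xi>))
      = (LINT \<xi>|lebesgue. (cis (-1 * (\<xi> \<bullet> x)) * ?G \<xi>) * (LINT y|lebesgue. cis (1 * (fst (\<xi>, y) \<bullet> snd (\<xi>, y))) * cnj (v y)))"
      unfolding Veq by (simp add: mult.assoc)
    also have "\<dots> = (LINT y|lebesgue. cnj (v y) * (LINT \<xi>|lebesgue. cis (1 * (fst (\<xi>, y) \<bullet> snd (\<xi>, y))) * (cis (-1 * (\<xi> \<bullet> x)) * ?G \<xi>)))"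
      by (rule lebp.integral_swap_kernel[OF i vbar fourier_kernel_measurable, of 1 1]) simp
    also have "\<dots> = (LINT y|lebesgue. cnj (v y) * (LINT \<xi>|lebesgue. cis ((y - x) \<bullet> \<xi>) * ?G \<xi>))"
    proof -
      have "cis (1 * (fst (\<xi>, y) \<bullet> snd (\<xi>, y))) * (cis (-1 * (\<xi> \<bullet> x)) * z) = cis ((y - x) \<bullet> \<xi>) * z" for \<xi> y z
        by (simp add: mult.assoc[symmetric] cis_mult inner_diff_left inner_commute[of \<xi>])
      note e = this
      show ?thesis by (simp only: e)
    qed
    finally show ?thesis unfolding gauss_fourier(2)[OF t] by (simp add: norm_minus_commute)
  qed
  have "(LINT \<xi>|lebesgue. ?G \<xi> * (fourier_integral u \<xi> * ?V \<xi>))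
    = (LINT \<xi>|lebesgue. (?G \<xi> * ?V \<xi>) * (LINT x|lebesgue. cis (-1 * (fst (\<xi>, x) \<bullet> snd (\<xi>, x))) * u x))"
    unfolding Ueq by (simp add: mult_ac)
  also have "\<dots> = (LINT x|lebesgue. u x * (LINT \<xi>|lebesgue. cis (-1 * (fst (\<xi>, x) \<bullet> snd (\<xi>, x))) * (?G \<xi> * ?V \<xi>)))"
    by (rule lebp.integral_swap_kernel[OF GV u fourier_kernel_measurable, of "-1" 1]) simp
  finally show ?thesis unfolding inner .
qed

text \<open>
  The substitution \<open>y = x + 2 \<surd>t h\<close> makes the Gaussian independent of \<open>t\<close>. The constant is
  \<open>(2\<pi>)\<^sup>n\<close> because the kernel carries the factor \<open>(\<pi>/t)\<^sup>n\<^sup>/\<^sup>2\<close> instead of the \<open>(4\<pi>t)\<^sup>-\<^sup>n\<^sup>/\<^sup>2\<close> of the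
  normalized heat kernel.
\<close>

lemma heat_kernel_approximate_identity:
  fixes v :: "real^'n \<Rightarrow> complex"
  assumes v: "continuous_on UNIV v" and M: "\<And>x. cmod (v x) \<le> M"
  defines "P t x \<equiv> (LINT y|lebesgue. v y *
        of_real (sqrt (pi / t) ^ CARD('n) * exp (- (norm (x - y))\<^sup>2 / (4 * t))))"
  shows "t > 0 \<Longrightarrow> cmod (P t x) \<le> (2 * pi) ^ CARD('n) * M"
    and "(\<lambda>k. P (1 / real (Suc k)) x) \<longlonglongrightarrow> (2 * pi) ^ CARD('n) * v x"
proof -
  have vm[measurable]: "v \<in> borel_measurable borel" using v by (rule borel_measurable_continuous_onI)
  have g1: "integrable lebesgue (\<lambda>h::real^'n. exp (- (norm h)\<^sup>2))"
       "(LINT h|lebesgue. exp (- (norm (h::real^'n))\<^sup>2)) = sqrt pi ^ CARD('n)"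
    using gauss_integrable[of 1, where 'n='n] by auto
  have const: "(2 * sqrt pi) ^ CARD('n) * sqrt pi ^ CARD('n) = (2 * pi) ^ CARD('n)"
    unfolding power_mult_distrib[symmetric] by (simp add: mult.assoc)
  have P: "P t x = (2 * sqrt pi) ^ CARD('n) *\<^sub>R (LINT h|lebesgue. v (x + (2 * sqrt t) *\<^sub>R h) * of_real (exp (- (norm h)\<^sup>2)))"
    if t: "t > 0" for t x
  proof -
    have e: "(norm (x - (x + (2 * sqrt t) *\<^sub>R h)))\<^sup>2 / (4 * t) = (norm h)\<^sup>2" for h
      using t by (simp add: power_mult_distrib)
    have "P t x = (2 * sqrt t) ^ CARD('n) *\<^sub>R (LINT h|lebesgue. v (x + (2 * sqrt t) *\<^sub>R h) *
        of_real (sqrt (pi / t) ^ CARD('n) * exp (- (norm (x - (x + (2 * sqrt t) *\<^sub>R h)))\<^sup>2 / (4 * t))))"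
      unfolding P_def by (rule lebesgue_integral_affine) (use t in \<open>auto\<close>)
    also have "(\<lambda>h. v (x + (2 * sqrt t) *\<^sub>R h) *
        of_real (sqrt (pi / t) ^ CARD('n) * exp (- (norm (x - (x + (2 * sqrt t) *\<^sub>R h)))\<^sup>2 / (4 * t))))
      = (\<lambda>h. complex_of_real (sqrt (pi / t) ^ CARD('n)) * (v (x + (2 * sqrt t) *\<^sub>R h) * of_real (exp (- (norm h)\<^sup>2))))"
      using e by (simp only: minus_divide_left[symmetric]) (simp add: mult_ac)
    also have "(LINT h|lebesgue. \<dots> h) = complex_of_real (sqrt (pi / t) ^ CARD('n)) * (LINT h|lebesgue. v (x + (2 * sqrt t) *\<^sub>R h) * of_real (exp (- (norm h)\<^sup>2)))"
      by (rule integral_mult_right_zero)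
    also have "(2 * sqrt t) ^ CARD('n) *\<^sub>R \<dots> = ((2 * sqrt t) ^ CARD('n) * sqrt (pi / t) ^ CARD('n)) *\<^sub>R (LINT h|lebesgue. v (x + (2 * sqrt t) *\<^sub>R h) * of_real (exp (- (norm h)\<^sup>2)))"
      by (simp add: scaleR_conv_of_real)
    also have "(2 * sqrt t) ^ CARD('n) * sqrt (pi / t) ^ CARD('n) = (2 * sqrt pi) ^ CARD('n)"
      unfolding power_mult_distrib[symmetric] using t by (simp add: real_sqrt_divide)
    finally show ?thesis .
  qed
  have nb: "cmod (v y * of_real (exp (- (norm h)\<^sup>2))) \<le> M * exp (- (norm h)\<^sup>2)" for y and h :: "real^'n"
    using M[of y] by (simp add: norm_mult)
  have meas: "(\<lambda>h::real^'n. v (x + c *\<^sub>R h) * of_real (exp (- (norm h)\<^sup>2))) \<in> borel_measurable lebesgue" for c x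
    by (rule measurable_completion) measurable
  have Mi: "integrable lebesgue (\<lambda>h::real^'n. M * exp (- (norm h)\<^sup>2))" using g1(1) by simp
  { assume t: "t > 0"
    have "cmod (LINT h|lebesgue. v (x + (2 * sqrt t) *\<^sub>R h) * of_real (exp (- (norm h)\<^sup>2)))
       \<le> (LINT h|lebesgue. M * exp (- (norm (h::real^'n))\<^sup>2))"
    proof (rule Bochner_Integration.integral_norm_bound_integral[OF _ Mi])
      show "integrable lebesgue (\<lambda>h. v (x + (2 * sqrt t) *\<^sub>R h) * of_real (exp (- (norm h)\<^sup>2)))"
        by (rule Bochner_Integration.integrable_bound[OF Mi meas]) (use nb in \<open>fastforce intro: order_trans\<close>)
    qed (use nb in auto)
    also have "\<dots> = sqrt pi ^ CARD('n) * M" using g1 by simp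
    finally have "cmod (P t x) \<le> (2 * sqrt pi) ^ CARD('n) * (sqrt pi ^ CARD('n) * M)"
      unfolding P[OF t] norm_scaleR by (intro mult_mono) auto
    then show "cmod (P t x) \<le> (2 * pi) ^ CARD('n) * M" by (simp only: const[symmetric] mult.assoc mult.commute[of M]) }
  have "(\<lambda>k. LINT h|lebesgue. v (x + (2 * sqrt (1 / real (Suc k))) *\<^sub>R h) * of_real (exp (- (norm h)\<^sup>2)))
     \<longlonglongrightarrow> (LINT h|lebesgue. v x * of_real (exp (- (norm (h::real^'n))\<^sup>2)))"
  proof (rule integral_dominated_convergence[OF _ meas Mi])
    show "(\<lambda>h::real^'n. v x * of_real (exp (- (norm h)\<^sup>2))) \<in> borel_measurable lebesgue"
      by (rule measurable_completion) measurable
    show "AE h in lebesgue. (\<lambda>k. v (x + (2 * sqrt (1 / real (Suc k))) *\<^sub>R h) * of_real (exp (- (norm h)\<^sup>2)))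
        \<longlonglongrightarrow> v x * of_real (exp (- (norm (h::real^'n))\<^sup>2))"
    proof (intro always_eventually allI tendsto_mult tendsto_const)
      fix h :: "real^'n"
      have "(\<lambda>k. 1 / real (Suc k)) \<longlonglongrightarrow> 0" by (rule one_over_Suc_tendsto_0)
      then have "(\<lambda>k. x + (2 * sqrt (1 / real (Suc k))) *\<^sub>R h) \<longlonglongrightarrow> x + (2 * sqrt 0) *\<^sub>R h"
        by (intro tendsto_intros)
      then show "(\<lambda>k. v (x + (2 * sqrt (1 / real (Suc k))) *\<^sub>R h)) \<longlonglongrightarrow> v x"
        by (intro continuous_on_tendsto_compose[OF v]) auto
    qed
  qed (use nb in auto)
  then have "(\<lambda>k. P (1 / real (Suc k)) x) \<longlonglongrightarrow> (2 * sqrt pi) ^ CARD('n) *\<^sub>R (LINT h|lebesgue. v x * of_real (exp (- (norm (h::real^'n))\<^sup>2)))"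
    by (subst P) (auto intro!: tendsto_intros)
  also have "(LINT h|lebesgue. v x * complex_of_real (exp (- (norm (h::real^'n))\<^sup>2))) = v x * of_real (sqrt pi ^ CARD('n))"
    using g1 by (simp flip: of_real_exp of_real_power)
  also have "(2 * sqrt pi) ^ CARD('n) *\<^sub>R (v x * of_real (sqrt pi ^ CARD('n))) = of_real ((2 * sqrt pi) ^ CARD('n) * sqrt pi ^ CARD('n)) * v x"
    by (simp add: scaleR_conv_of_real)
  finally show "(\<lambda>k. P (1 / real (Suc k)) x) \<longlonglongrightarrow> (2 * pi) ^ CARD('n) * v x"
    unfolding const .
qed

lemma indicator_L2:
  fixes S :: "(real^'n) set"
  assumes S: "S \<in> lmeasurable"
  shows "(indicator S :: _ \<Rightarrow> 'b::real_normed_field) \<in> L2"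
proof (rule L2I)
  have "(norm (indicator S x :: 'b))\<^sup>2 = indicator S x" for x by (simp add: indicator_def)
  then show "integrable lebesgue (\<lambda>x. (norm (indicator S x :: 'b))\<^sup>2)"
    using S[unfolded lmeasurable_iff_integrable] by simp
qed (use S fmeasurableD in auto)

lemma L2_bounded_support_integrable:
  fixes u :: "real^'n \<Rightarrow> 'b::{real_normed_field,banach,second_countable_topology}"
  assumes u: "u \<in> L2" and S: "S \<in> lmeasurable" and z: "\<And>x. x \<notin> S \<Longrightarrow> u x = 0"
  shows "integrable lebesgue u" and "(LINT x|lebesgue. norm (u x)) \<le> sqrt (measure lebesgue S) * l2norm u"
proof -
  have nS: "(norm (indicator S x :: 'b))\<^sup>2 = indicator S x" for x by (simp add: indicator_def)
  have SL: "(indicator S :: _ \<Rightarrow> 'b) \<in> L2" using S by (rule indicator_L2)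
  have e: "indicator S x * u x = u x" for x using z by (auto simp: indicator_def)
  show "integrable lebesgue u" using L2_mult_integrable[OF SL u] by (simp add: e)
  have "(LINT x|lebesgue. norm (indicator S x :: 'b) * norm (u x)) \<le> l2norm (indicator S :: _ \<Rightarrow> 'b) * l2norm u"
    by (rule l2norm_Cauchy_Schwarz[OF SL u])
  also have "l2norm (indicator S :: _ \<Rightarrow> 'b) = sqrt (measure lebesgue S)"
    using S unfolding l2norm_def nS by simp
  finally show "(LINT x|lebesgue. norm (u x)) \<le> sqrt (measure lebesgue S) * l2norm u"
    by (simp add: e flip: norm_mult)
qed

lemma continuous_compact_support_bounded:
  fixes g :: "real^'n \<Rightarrow> 'b::real_normed_vector"
  assumes g: "continuous_on UNIV g" and z: "\<And>x. x \<notin> cball 0 R \<Longrightarrow> g x = 0"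
  obtains M where "M > 0" "\<And>x. norm (g x) \<le> M"
proof -
  have "bounded (g ` cball 0 R)"
    by (intro compact_imp_bounded compact_continuous_image continuous_on_subset[OF g]) auto
  then obtain M where "M > 0" "\<And>x. x \<in> cball 0 R \<Longrightarrow> norm (g x) \<le> M"
    unfolding bounded_pos by auto
  with z show ?thesis by (intro that[of M]) (metis less_imp_le norm_zero)+
qed

lemma bounded_support_L2:
  fixes g :: "real^'n \<Rightarrow> 'b::real_normed_vector"
  assumes g: "g \<in> borel_measurable lebesgue" and S: "S \<in> lmeasurable"
    and z: "\<And>x. x \<notin> S \<Longrightarrow> g x = 0" and M: "\<And>x. norm (g x) \<le> M"
  shows "g \<in> L2"
proof -
  have "(indicator S :: _ \<Rightarrow> real) \<in> L2" using S by (rule indicator_L2)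
  then show ?thesis
    by (rule L2_bounded[OF _ g, of _ M]) (use z M in \<open>auto simp: indicator_def\<close>)
qed

lemma continuous_compact_support_L2:
  fixes g :: "real^'n \<Rightarrow> 'b::real_normed_vector"
  assumes g: "continuous_on UNIV g" and z: "\<And>x. x \<notin> cball 0 R \<Longrightarrow> g x = 0"
  shows "g \<in> L2"
proof -
  obtain M where "\<And>x. norm (g x) \<le> M" using continuous_compact_support_bounded[OF assms] by blast
  then show ?thesis
    by (intro bounded_support_L2[where S="cball 0 R"] measurable_completion)
       (use z in \<open>auto intro: borel_measurable_continuous_onI g\<close>)
qed

text \<open>
  Let \<open>t \<rightarrow> 0\<close> in the Gaussian identity with \<open>v = u\<close>: the frequency side increases to the square norm of
  the transform, and the other side converges by dominated convergence. Square integrability of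
  the transform is part of the conclusion of monotone convergence.
\<close>

lemma plancherel_continuous:
  fixes u :: "real^'n \<Rightarrow> complex"
  assumes u: "continuous_on UNIV u" and z: "\<And>x. x \<notin> cball 0 R \<Longrightarrow> u x = 0"
  shows "fourier_integral u \<in> L2" and "(l2norm (fourier_integral u))\<^sup>2 = (2 * pi) ^ CARD('n) * (l2norm u)\<^sup>2"
proof -
  obtain M where M: "M > 0" "\<And>x. norm (u x) \<le> M" using continuous_compact_support_bounded[OF assms] by blast
  have uL: "u \<in> L2" by (rule continuous_compact_support_L2[OF assms])
  have ui: "integrable lebesgue u" by (rule L2_bounded_support_integrable[OF uL lmeasurable_cball z])
  have [measurable]: "u \<in> borel_measurable lebesgue" using uL by (rule L2_measurable)
  have fm[measurable]: "fourier_integral u \<in> borel_measurable lebesgue" by (rule fourier_integral_measurable) simp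
  define t where "t k = 1 / real (Suc k)" for k
  have t: "t k > 0" for k by (simp add: t_def)
  define P where "P k x = (LINT y|lebesgue. cnj (u y) *
        of_real (sqrt (pi / t k) ^ CARD('n) * exp (- (norm (x - y))\<^sup>2 / (4 * t k))))" for k x
  let ?h = "\<lambda>k \<xi>. exp (- t k * (norm \<xi>)\<^sup>2) * (cmod (fourier_integral u \<xi>))\<^sup>2"
  have cu: "continuous_on UNIV (\<lambda>x. cnj (u x))" by (intro continuous_intros u)
  have P1: "cmod (P k x) \<le> (2 * pi) ^ CARD('n) * M" for k x
    unfolding P_def using heat_kernel_approximate_identity(1)[OF cu, of M "t k" x] t M by simp
  have P2: "(\<lambda>k. P k x) \<longlonglongrightarrow> (2 * pi) ^ CARD('n) * cnj (u x)" for x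
    unfolding P_def t_def using heat_kernel_approximate_identity(2)[OF cu, of M x] M by simp
  have hi: "integrable lebesgue (?h k)" for k
  proof (rule Bochner_Integration.integrable_bound)
    show "integrable lebesgue (\<lambda>\<xi>::real^'n. (LINT x|lebesgue. cmod (u x))\<^sup>2 * exp (- t k * (norm \<xi>)\<^sup>2))"
      using gauss_integrable(1)[OF t] by (rule integrable_mult_right)
    have [measurable]: "(\<lambda>\<xi>::real^'n. exp (- t k * (norm \<xi>)\<^sup>2)) \<in> borel_measurable lebesgue"
      using gauss_integrable(1)[OF t] by auto
    show "?h k \<in> borel_measurable lebesgue" by measurable
    show "AE \<xi> in lebesgue. norm (?h k \<xi>) \<le> norm ((LINT x|lebesgue. cmod (u x))\<^sup>2 * exp (- t k * (norm \<xi>)\<^sup>2))"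
      using norm_fourier_integral_le[of u] by (auto simp: mult.commute intro!: mult_right_mono power_mono)
  qed
  have id: "complex_of_real (LINT \<xi>|lebesgue. ?h k \<xi>) = (LINT x|lebesgue. u x * P k x)" for k
  proof -
    have "complex_of_real (LINT \<xi>|lebesgue. ?h k \<xi>) = (LINT \<xi>|lebesgue. complex_of_real (?h k \<xi>))"
      by (rule integral_complex_of_real[symmetric])
    also have "\<dots> = (LINT \<xi>|lebesgue. of_real (exp (- t k * (norm \<xi>)\<^sup>2)) * (fourier_integral u \<xi> * cnj (fourier_integral u \<xi>)))"
      by (simp add: complex_norm_square flip: of_real_power)
    also have "\<dots> = (LINT x|lebesgue. u x * P k x)"
      unfolding P_def by (rule fourier_gauss_identity[OF ui ui t])
    finally show ?thesis .
  qed
  have "(\<lambda>k. LINT x|lebesgue. u x * P k x) \<longlonglongrightarrow> (LINT x|lebesgue. u x * ((2 * pi) ^ CARD('n) * cnj (u x)))"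
  proof (rule integral_dominated_convergence)
    show "integrable lebesgue (\<lambda>x. cmod (u x) * ((2 * pi) ^ CARD('n) * M))" using ui by simp
    show "AE x in lebesgue. norm (u x * P k x) \<le> cmod (u x) * ((2 * pi) ^ CARD('n) * M)" for k
      using P1 by (auto simp: norm_mult intro!: mult_left_mono)
    show "AE x in lebesgue. (\<lambda>k. u x * P k x) \<longlonglongrightarrow> u x * ((2 * pi) ^ CARD('n) * cnj (u x))"
      using P2 by (auto intro!: tendsto_mult)
    have "(\<lambda>x. LINT y|lebesgue. cnj (u (snd (x, y))) * of_real (sqrt (pi / t k) ^ CARD('n) * exp (- (norm (fst (x, y) - snd (x, y)))\<^sup>2 / (4 * t k)))) \<in> borel_measurable lebesgue"
      for k
    proof (rule leb.borel_measurable_lebesgue_integral)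
      note [measurable] = fst_lebesgue snd_lebesgue
      show "(\<lambda>(x, y). cnj (u (snd (x, y))) * of_real (sqrt (pi / t k) ^ CARD('n) * exp (- (norm (fst (x, y) - snd (x, y)))\<^sup>2 / (4 * t k)))) \<in> borel_measurable (lebesgue \<Otimes>\<^sub>M lebesgue)"
        unfolding case_prod_beta prod.collapse by measurable
    qed
    then have [measurable]: "P k \<in> borel_measurable lebesgue" for k unfolding P_def by simp
    show "(\<lambda>x. u x * P k x) \<in> borel_measurable lebesgue" for k by measurable
    show "(\<lambda>x. u x * ((2 * pi) ^ CARD('n) * cnj (u x))) \<in> borel_measurable lebesgue" by measurable
  qed
  also have "(LINT x|lebesgue. u x * ((2 * pi) ^ CARD('n) * cnj (u x))) = of_real ((2 * pi) ^ CARD('n) * (l2norm u)\<^sup>2)"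
  proof -
    have "(\<lambda>x. u x * ((2 * pi) ^ CARD('n) * cnj (u x))) = (\<lambda>x. of_real ((2 * pi) ^ CARD('n) * (cmod (u x))\<^sup>2))"
      by (auto simp: complex_norm_square mult_ac simp del: of_real_power simp flip: of_real_power[of "cmod _"])
    then show ?thesis by (simp only: integral_complex_of_real l2norm_sq Bochner_Integration.integral_mult_right_zero)
  qed
  finally have lim: "(\<lambda>k. LINT \<xi>|lebesgue. ?h k \<xi>) \<longlonglongrightarrow> (2 * pi) ^ CARD('n) * (l2norm u)\<^sup>2"
    unfolding id[symmetric] by (simp only: tendsto_of_real_iff)
  have mono: "AE \<xi> in lebesgue. mono (\<lambda>k. ?h k \<xi>)"
  proof (intro always_eventually allI monoI mult_right_mono)
    fix \<xi> :: "real^'n" and i j :: nat assume "i \<le> j"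
    then have "t j \<le> t i" by (simp add: t_def frac_le)
    then show "exp (- t i * (norm \<xi>)\<^sup>2) \<le> exp (- t j * (norm \<xi>)\<^sup>2)" by (simp add: mult_right_mono)
  qed simp
  have tlim: "t \<longlonglongrightarrow> 0" unfolding t_def by (rule one_over_Suc_tendsto_0)
  have pw: "AE \<xi> in lebesgue. (\<lambda>k. ?h k \<xi>) \<longlonglongrightarrow> (cmod (fourier_integral u \<xi>))\<^sup>2"
  proof (intro always_eventually allI)
    fix \<xi> :: "real^'n"
    have "(\<lambda>k. ?h k \<xi>) \<longlonglongrightarrow> exp (- 0 * (norm \<xi>)\<^sup>2) * (cmod (fourier_integral u \<xi>))\<^sup>2"
      by (intro tendsto_intros tlim)
    then show "(\<lambda>k. ?h k \<xi>) \<longlonglongrightarrow> (cmod (fourier_integral u \<xi>))\<^sup>2" by simp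
  qed
  have fm2: "(\<lambda>\<xi>. (cmod (fourier_integral u \<xi>))\<^sup>2) \<in> borel_measurable lebesgue" by measurable
  show "fourier_integral u \<in> L2"
    using integrable_monotone_convergence[OF hi mono pw lim fm2] by (intro L2I fm) 
  show "(l2norm (fourier_integral u))\<^sup>2 = (2 * pi) ^ CARD('n) * (l2norm u)\<^sup>2"
    unfolding l2norm_sq[of "fourier_integral u"] by (rule integral_monotone_convergence[OF hi mono pw lim fm2])
qed

text \<open>
  Radial projection onto the ball of radius \<open>M\<close>, which keeps approximating functions bounded.
\<close>

definition clip :: "real \<Rightarrow> complex \<Rightarrow> complex" where
  "clip M z = (M / max M (cmod z)) *\<^sub>R z"

lemma cmod_clip_le: "M > 0 \<Longrightarrow> cmod (clip M z) \<le> M"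
  by (auto simp: clip_def divide_simps max_def)

lemma clip_eq: "M > 0 \<Longrightarrow> cmod z \<le> M \<Longrightarrow> clip M z = z"
  by (simp add: clip_def max_def)

lemma continuous_on_clip: "M > 0 \<Longrightarrow> continuous_on UNIV (clip M)"
  unfolding clip_def by (intro continuous_intros) (auto simp: max_def)

text \<open>
  A measurable function is an almost everywhere limit of continuous functions. Projecting their
  values to the ball of radius \<open>M\<close> and multiplying with a continuous cutoff at \<open>R + 1\<close> does not change
  the limit, but provides the integrable majorant for mean square convergence.
\<close>

lemma bounded_approx_continuous:
  fixes u :: "real^'n \<Rightarrow> complex"
  assumes u: "u \<in> L2" and z: "\<And>x. x \<notin> cball 0 R \<Longrightarrow> u x = 0" and M: "M > 0" "\<And>x. cmod (u x) \<le> M"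
  obtains g where "\<And>k::nat. continuous_on UNIV (g k)" "\<And>k x. x \<notin> cball 0 (R + 1) \<Longrightarrow> g k x = 0"
    "(\<lambda>k. l2norm (\<lambda>x. g k x - u x)) \<longlonglongrightarrow> 0"
proof -
  have [measurable]: "u \<in> borel_measurable lebesgue" using u by (rule L2_measurable)
  have "u measurable_on UNIV" by (intro lebesgue_measurable_imp_measurable_on) auto
  then obtain N g where N: "negligible N" and g: "\<And>k::nat. continuous_on UNIV (g k)"
      and lim: "\<And>x. x \<notin> N \<Longrightarrow> (\<lambda>k. g k x) \<longlonglongrightarrow> u x"
    unfolding measurable_on_def by auto
  define cut where "cut x = max 0 (min 1 (R + 1 - norm x))" for x :: "real^'n"
  define h where "h k x = cut x *\<^sub>R clip M (g k x)" for k x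
  have cut: "0 \<le> cut x" "cut x \<le> 1" for x by (auto simp: cut_def)
  have hc: "continuous_on UNIV (h k)" for k
    unfolding h_def cut_def by (intro continuous_intros continuous_on_compose2[OF continuous_on_clip[OF M(1)] g]) auto
  have hz: "h k x = 0" if "x \<notin> cball 0 (R + 1)" for k x using that by (simp add: h_def cut_def)
  have hM: "cmod (h k x) \<le> M" for k x
  proof -
    have "cut x * cmod (clip M (g k x)) \<le> 1 * M"
      using cut[of x] cmod_clip_le[OF M(1)] by (intro mult_mono) auto
    then show ?thesis using cut[of x] by (simp add: h_def)
  qed
  have [measurable]: "h k \<in> borel_measurable lebesgue" for k
    by (intro measurable_completion) (auto intro: borel_measurable_continuous_onI hc)
  have "(\<lambda>k. LINT x|lebesgue. (cmod (h k x - u x))\<^sup>2) \<longlonglongrightarrow> (LINT (x::real^'n)|lebesgue. 0)"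
  proof (rule integral_dominated_convergence)
    show "integrable lebesgue (\<lambda>x::real^'n. (2 * M)\<^sup>2 * indicator (cball 0 (R + 1)) x)"
      using lmeasurable_cball[of "0::real^'n" "R + 1", unfolded lmeasurable_iff_integrable] by (rule integrable_mult_right)
    show "AE x in lebesgue. (\<lambda>k. (cmod (h k x - u x))\<^sup>2) \<longlonglongrightarrow> 0"
    proof (rule AE_I')
      show "N \<in> null_sets lebesgue" using N by (simp add: negligible_iff_null_sets)
      show "{x \<in> space lebesgue. \<not> (\<lambda>k. (cmod (h k x - u x))\<^sup>2) \<longlonglongrightarrow> 0} \<subseteq> N"
      proof (rule subsetI, rule ccontr)
        fix x assume x: "x \<in> {x \<in> space lebesgue. \<not> (\<lambda>k. (cmod (h k x - u x))\<^sup>2) \<longlonglongrightarrow> 0}" "x \<notin> N"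
        have "(\<lambda>k. h k x) \<longlonglongrightarrow> cut x *\<^sub>R clip M (u x)"
          unfolding h_def by (intro tendsto_intros continuous_on_tendsto_compose[OF continuous_on_clip[OF M(1)] lim[OF x(2)]]) auto
        also have "cut x *\<^sub>R clip M (u x) = u x"
          using z[of x] M by (cases "x \<in> cball 0 R") (auto simp: clip_eq cut_def)
        finally have "(\<lambda>k. (cmod (h k x - u x))\<^sup>2) \<longlonglongrightarrow> (cmod (u x - u x))\<^sup>2" by (intro tendsto_intros)
        with x(1) show False by simp
      qed
    qed
    show "AE x in lebesgue. norm ((cmod (h k x - u x))\<^sup>2) \<le> (2 * M)\<^sup>2 * indicator (cball 0 (R + 1)) x" for k
    proof (intro always_eventually allI)
      fix x
      show "norm ((cmod (h k x - u x))\<^sup>2) \<le> (2 * M)\<^sup>2 * indicator (cball 0 (R + 1)) x"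
      proof (cases "x \<in> cball 0 (R + 1)")
        case True
        have "cmod (h k x - u x) \<le> 2 * M" using norm_triangle_ineq4[of "h k x" "u x"] hM[of k x] M(2)[of x] by linarith
        then have "(cmod (h k x - u x))\<^sup>2 \<le> (2 * M)\<^sup>2" by (intro power_mono) auto
        then show ?thesis using True by simp
      next
        case False then show ?thesis using hz[of x k] z[of x] by simp
      qed
    qed
  qed measurable
  then have "(\<lambda>k. (l2norm (\<lambda>x. h k x - u x))\<^sup>2) \<longlonglongrightarrow> 0" by (simp add: l2norm_sq)
  then have "(\<lambda>k. sqrt ((l2norm (\<lambda>x. h k x - u x))\<^sup>2)) \<longlonglongrightarrow> sqrt 0" by (intro tendsto_intros)
  then have "(\<lambda>k. l2norm (\<lambda>x. h k x - u x)) \<longlonglongrightarrow> 0" by simp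
  with hc hz show ?thesis by (rule that)
qed

lemma l2norm_tendsto_0I:
  assumes "(\<lambda>k. LINT x|lebesgue. (norm (f k x))\<^sup>2) \<longlonglongrightarrow> 0"
  shows "(\<lambda>k. l2norm (f k)) \<longlonglongrightarrow> 0"
  using tendsto_real_sqrt[OF assms] by (simp add: l2norm_def)

text \<open>
  The two truncations used below, to large balls and to large values, are both of the form
  \<open>1\<^bsub>A\<^sub>k\<^esub> u\<close> with sets \<open>A\<^sub>k\<close> that eventually contain every point.
\<close>

lemma l2norm_indicator_tendsto:
  fixes u :: "real^'n \<Rightarrow> 'b::{real_normed_field,banach,second_countable_topology}"
  assumes u: "u \<in> L2" and A: "\<And>k. A k \<in> sets lebesgue" and ev: "\<And>x. eventually (\<lambda>k. x \<in> A k) sequentially"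
  shows "(\<lambda>k. l2norm (\<lambda>x. indicator (A k) x * u x - u x)) \<longlonglongrightarrow> 0"
proof (rule l2norm_tendsto_0I)
  have [measurable]: "u \<in> borel_measurable lebesgue" "A k \<in> sets lebesgue" for k
    using u A by (auto dest: L2_measurable)
  have "(\<lambda>k. LINT x|lebesgue. (norm (indicator (A k) x * u x - u x))\<^sup>2) \<longlonglongrightarrow> (LINT (x::real^'n)|lebesgue. 0)"
  proof (rule integral_dominated_convergence)
    show "integrable lebesgue (\<lambda>x. (norm (u x))\<^sup>2)" by (rule L2_integrable_sq[OF u])
    show "AE x in lebesgue. (\<lambda>k. (norm (indicator (A k) x * u x - u x))\<^sup>2) \<longlonglongrightarrow> 0"
    proof (rule AE_I2, rule tendsto_eventually)
      fix x show "eventually (\<lambda>k. (norm (indicator (A k) x * u x - u x))\<^sup>2 = 0) sequentially"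
        using ev[of x] by eventually_elim simp
    qed
    show "AE x in lebesgue. norm ((norm (indicator (A k) x * u x - u x))\<^sup>2) \<le> (norm (u x))\<^sup>2" for k
      by (auto simp: indicator_def)
  qed measurable
  then show "(\<lambda>k. LINT x|lebesgue. (norm (indicator (A k) x * u x - u x))\<^sup>2) \<longlonglongrightarrow> 0" by simp
qed

text \<open>
  Plancherel's identity is stable under mean square limits of functions with support in a common
  ball: there mean square convergence implies convergence of the Fourier integrals at every point,
  and Fatou's lemma identifies the limits.
\<close>

lemma plancherel_closure:
  fixes u :: "real^'n \<Rightarrow> complex"
  assumes gL: "\<And>k. g k \<in> L2" and uL: "u \<in> L2"
    and gz: "\<And>k x. x \<notin> cball 0 R \<Longrightarrow> g k x = 0" and uz: "\<And>x. x \<notin> cball 0 R \<Longrightarrow> u x = 0"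
    and lim: "(\<lambda>k::nat. l2norm (\<lambda>x. g k x - u x)) \<longlonglongrightarrow> 0"
    and FL: "\<And>k. fourier_integral (g k) \<in> L2"
    and Fn: "\<And>k. l2norm (fourier_integral (g k)) = sqrt ((2 * pi) ^ CARD('n)) * l2norm (g k)"
    and Fd: "\<And>i j. l2norm (fourier_integral (\<lambda>x. g i x - g j x)) = sqrt ((2 * pi) ^ CARD('n)) * l2norm (\<lambda>x. g i x - g j x)"
  shows "fourier_integral u \<in> L2 \<and> l2norm (fourier_integral u) = sqrt ((2 * pi) ^ CARD('n)) * l2norm u"
proof -
  let ?c = "sqrt ((2 * pi) ^ CARD('n))"
  have c: "?c > 0" by simp
  have gi: "integrable lebesgue (g k)" for k by (rule L2_bounded_support_integrable[OF gL lmeasurable_cball gz])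
  have ui: "integrable lebesgue u" by (rule L2_bounded_support_integrable[OF uL lmeasurable_cball uz])
  have [measurable]: "fourier_integral u \<in> borel_measurable lebesgue"
     "fourier_integral (g k) \<in> borel_measurable lebesgue" for k
    using gi ui by (auto intro: fourier_integral_measurable)
  have pw: "(\<lambda>k. fourier_integral (g k) \<xi>) \<longlonglongrightarrow> fourier_integral u \<xi>" for \<xi>
  proof (rule LIM_zero_cancel, rule Lim_null_comparison)
    show "\<forall>\<^sub>F k in sequentially. norm (fourier_integral (g k) \<xi> - fourier_integral u \<xi>)
        \<le> sqrt (measure lebesgue (cball (0::real^'n) R)) * l2norm (\<lambda>x. g k x - u x)"
    proof (intro always_eventually allI)
      fix k
      have "norm (fourier_integral (g k) \<xi> - fourier_integral u \<xi>) \<le> (LINT x|lebesgue. cmod (g k x - u x))"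
        unfolding fourier_integral_diff[OF gi ui, symmetric] by (rule norm_fourier_integral_le)
      also have "\<dots> \<le> sqrt (measure lebesgue (cball (0::real^'n) R)) * l2norm (\<lambda>x. g k x - u x)"
        by (rule L2_bounded_support_integrable(2)[OF L2_diff[OF gL uL] lmeasurable_cball]) (simp add: gz uz)
      finally show "norm (fourier_integral (g k) \<xi> - fourier_integral u \<xi>) \<le> \<dots>" .
    qed
    show "(\<lambda>k. sqrt (measure lebesgue (cball (0::real^'n) R)) * l2norm (\<lambda>x. g k x - u x)) \<longlonglongrightarrow> 0"
      using tendsto_mult_left[OF lim, of "sqrt (measure lebesgue (cball (0::real^'n) R))"] by simp
  qed
  have dist: "l2norm (\<lambda>\<xi>. fourier_integral (g i) \<xi> - fourier_integral (g j) \<xi>) = ?c * l2norm (\<lambda>x. g i x - g j x)" for i j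
    unfolding Fd[symmetric] fourier_integral_diff[OF gi gi] ..
  have close: "(\<lambda>\<xi>. fourier_integral (g i) \<xi> - fourier_integral u \<xi>) \<in> L2 \<and>
      l2norm (\<lambda>\<xi>. fourier_integral (g i) \<xi> - fourier_integral u \<xi>) \<le> ?c * (l2norm (\<lambda>x. g i x - u x) + e)" if "e > 0" for i e
  proof -
    have "eventually (\<lambda>j. l2norm (\<lambda>x. g j x - u x) < e) sequentially"
      using lim that by (rule order_tendstoD)
    then have ev: "eventually (\<lambda>j. l2norm (\<lambda>\<xi>. fourier_integral (g i) \<xi> - fourier_integral (g j) \<xi>)
        \<le> ?c * (l2norm (\<lambda>x. g i x - u x) + e)) sequentially"
    proof eventually_elim
      fix j assume "l2norm (\<lambda>x. g j x - u x) < e"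
      then have "l2norm (\<lambda>x. g i x - g j x) \<le> l2norm (\<lambda>x. g i x - u x) + e"
        using l2norm_triangle_diff[OF gL[of i] uL gL[of j]] l2norm_minus_commute[of u "g j"] by linarith
      then show "l2norm (\<lambda>\<xi>. fourier_integral (g i) \<xi> - fourier_integral (g j) \<xi>) \<le> ?c * (l2norm (\<lambda>x. g i x - u x) + e)"
        unfolding dist by (intro mult_left_mono) auto
    qed
    have ae: "AE \<xi> in lebesgue. (\<lambda>j. fourier_integral (g i) \<xi> - fourier_integral (g j) \<xi>)
        \<longlonglongrightarrow> fourier_integral (g i) \<xi> - fourier_integral u \<xi>"
      by (rule AE_I2) (rule tendsto_diff[OF tendsto_const pw])
    have me: "(\<lambda>\<xi>. fourier_integral (g i) \<xi> - fourier_integral u \<xi>) \<in> borel_measurable lebesgue"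
      by measurable
    show ?thesis
      using L2_Fatou(1)[OF L2_diff[OF FL FL] me ae ev] L2_Fatou(2)[OF L2_diff[OF FL FL] me ae ev] by (rule conjI)
  qed
  have "(\<lambda>\<xi>. fourier_integral (g 0) \<xi> - (fourier_integral (g 0) \<xi> - fourier_integral u \<xi>)) \<in> L2"
    by (rule L2_diff[OF FL conjunct1[OF close[of 1 0]]]) simp
  then have FuL: "fourier_integral u \<in> L2" by simp
  have cl: "l2norm (\<lambda>\<xi>. fourier_integral (g i) \<xi> - fourier_integral u \<xi>) \<le> ?c * l2norm (\<lambda>x. g i x - u x)" for i
  proof (rule field_le_epsilon)
    fix e :: real assume "e > 0"
    then have "l2norm (\<lambda>\<xi>. fourier_integral (g i) \<xi> - fourier_integral u \<xi>) \<le> ?c * (l2norm (\<lambda>x. g i x - u x) + e / ?c)"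
      using close[of "e / ?c" i] c by simp
    also have "\<dots> = ?c * l2norm (\<lambda>x. g i x - u x) + e" using c by (simp add: field_simps)
    finally show "l2norm (\<lambda>\<xi>. fourier_integral (g i) \<xi> - fourier_integral u \<xi>) \<le> ?c * l2norm (\<lambda>x. g i x - u x) + e" .
  qed
  have "(\<lambda>i. l2norm (\<lambda>\<xi>. fourier_integral (g i) \<xi> - fourier_integral u \<xi>)) \<longlonglongrightarrow> 0"
  proof (rule Lim_null_comparison)
    show "\<forall>\<^sub>F i in sequentially. norm (l2norm (\<lambda>\<xi>. fourier_integral (g i) \<xi> - fourier_integral u \<xi>)) \<le> ?c * l2norm (\<lambda>x. g i x - u x)"
      using cl by simp
    show "(\<lambda>i. ?c * l2norm (\<lambda>x. g i x - u x)) \<longlonglongrightarrow> 0" using tendsto_mult_left[OF lim, of ?c] by simp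
  qed
  then have "(\<lambda>i. l2norm (fourier_integral (g i))) \<longlonglongrightarrow> l2norm (fourier_integral u)"
    by (rule l2norm_tendsto[OF FL FuL])
  moreover have "(\<lambda>i. l2norm (fourier_integral (g i))) \<longlonglongrightarrow> ?c * l2norm u"
    unfolding Fn by (intro tendsto_intros l2norm_tendsto[OF gL uL lim])
  ultimately show ?thesis using FuL LIMSEQ_unique by blast
qed

text \<open>
  Two closure steps: from continuous to bounded functions, and from bounded to square integrable
  ones by truncating large values.
\<close>

lemma plancherel_bounded_support:
  fixes u :: "real^'n \<Rightarrow> complex"
  assumes u: "u \<in> L2" and z: "\<And>x. x \<notin> cball 0 R \<Longrightarrow> u x = 0"
  shows "fourier_integral u \<in> L2" and "l2norm (fourier_integral u) = sqrt ((2 * pi) ^ CARD('n)) * l2norm u"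
proof -
  have cont: "fourier_integral v \<in> L2 \<and> l2norm (fourier_integral v) = sqrt ((2 * pi) ^ CARD('n)) * l2norm v"
    if "continuous_on UNIV v" "\<And>x. x \<notin> cball 0 r \<Longrightarrow> v x = 0" for v :: "real^'n \<Rightarrow> complex" and r
  proof -
    have "sqrt ((l2norm (fourier_integral v))\<^sup>2) = sqrt ((2 * pi) ^ CARD('n) * (l2norm v)\<^sup>2)"
      using plancherel_continuous(2)[OF that] by simp
    then show ?thesis using plancherel_continuous(1)[OF that] by (simp add: real_sqrt_mult)
  qed
  have bdd: "fourier_integral v \<in> L2 \<and> l2norm (fourier_integral v) = sqrt ((2 * pi) ^ CARD('n)) * l2norm v"
    if v: "v \<in> L2" "\<And>x. x \<notin> cball 0 R \<Longrightarrow> v x = 0" "M > 0" "\<And>x. cmod (v x) \<le> M" for v :: "real^'n \<Rightarrow> complex" and M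
  proof -
    obtain g where g: "\<And>k::nat. continuous_on UNIV (g k)" "\<And>k x. x \<notin> cball 0 (R + 1) \<Longrightarrow> g k x = 0"
      "(\<lambda>k. l2norm (\<lambda>x. g k x - v x)) \<longlonglongrightarrow> 0" using bounded_approx_continuous[OF v] by blast
    have gL: "g k \<in> L2" for k by (rule continuous_compact_support_L2[OF g(1,2)])
    have vz: "v x = 0" if "x \<notin> cball 0 (R + 1)" for x using that by (intro v(2)) auto
    show ?thesis
    proof (rule plancherel_closure[OF gL v(1) g(2) vz g(3)])
      show "fourier_integral (g k) \<in> L2" "l2norm (fourier_integral (g k)) = sqrt ((2 * pi) ^ CARD('n)) * l2norm (g k)" for k
        using cont[OF g(1,2)] by auto
      show "l2norm (fourier_integral (\<lambda>x. g i x - g j x)) = sqrt ((2 * pi) ^ CARD('n)) * l2norm (\<lambda>x. g i x - g j x)" for i j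
        using cont[of "\<lambda>x. g i x - g j x" "R + 1"] g(1,2) by (auto intro: continuous_intros)
    qed
  qed
  have [measurable]: "u \<in> borel_measurable lebesgue" using u by (rule L2_measurable)
  define A where "A k = {x. cmod (u x) \<le> real k}" for k
  have A[measurable]: "A k \<in> sets lebesgue" for k
  proof -
    have "{x \<in> space lebesgue. cmod (u x) \<le> real k} \<in> sets lebesgue" by measurable
    then show ?thesis by (simp add: A_def)
  qed
  let ?g = "\<lambda>k x. indicator (A k) x * u x"
  have gL: "?g k \<in> L2" for k by (rule L2_indicator[OF u A])
  have lim: "(\<lambda>k. l2norm (\<lambda>x. ?g k x - u x)) \<longlonglongrightarrow> 0"
  proof (rule l2norm_indicator_tendsto[OF u A])
    fix x obtain N where "cmod (u x) \<le> real N" using real_arch_simple by blast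
    then show "eventually (\<lambda>k. x \<in> A k) sequentially"
      by (intro eventually_sequentiallyI[of N]) (auto simp: A_def)
  qed
  have bd: "cmod (?g k x) \<le> real k + 1" for k x by (auto simp: A_def indicator_def)
  have gd: "cmod (?g i x - ?g j x) \<le> real i + real j + 2" for i j x
    using norm_triangle_ineq4[of "?g i x" "?g j x"] bd[of i x] bd[of j x] by linarith
  have "fourier_integral u \<in> L2 \<and> l2norm (fourier_integral u) = sqrt ((2 * pi) ^ CARD('n)) * l2norm u"
  proof (rule plancherel_closure[OF gL u _ z lim])
    show "fourier_integral (?g k) \<in> L2" "l2norm (fourier_integral (?g k)) = sqrt ((2 * pi) ^ CARD('n)) * l2norm (?g k)" for k
      using bdd[OF gL _ _ bd] z by auto
    show "l2norm (fourier_integral (\<lambda>x. ?g i x - ?g j x)) = sqrt ((2 * pi) ^ CARD('n)) * l2norm (\<lambda>x. ?g i x - ?g j x)" for i j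
      using bdd[OF L2_diff[OF gL gL] _ _ gd] z by auto
  qed (use z in auto)
  then show "fourier_integral u \<in> L2" "l2norm (fourier_integral u) = sqrt ((2 * pi) ^ CARD('n)) * l2norm u" by auto
qed

section \<open>The Fourier transform of square integrable functions\<close>

definition trunc :: "nat \<Rightarrow> (real^'n \<Rightarrow> complex) \<Rightarrow> real^'n \<Rightarrow> complex" where
  "trunc k u = (\<lambda>x. indicator (cball 0 (real k)) x * u x)"

lemma trunc_L2: "u \<in> L2 \<Longrightarrow> trunc k u \<in> L2"
  unfolding trunc_def by (intro L2_indicator) auto

lemma trunc_support: "x \<notin> cball 0 (real k) \<Longrightarrow> trunc k u x = 0"
  by (simp add: trunc_def)

lemma trunc_tendsto: "u \<in> L2 \<Longrightarrow> (\<lambda>k. l2norm (\<lambda>x. trunc k u x - u x)) \<longlonglongrightarrow> 0"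
  unfolding trunc_def
proof (rule l2norm_indicator_tendsto)
  fix x :: "real^'n"
  obtain N where "norm x \<le> real N" using real_arch_simple by blast
  then show "eventually (\<lambda>k. x \<in> cball 0 (real k)) sequentially"
    by (intro eventually_sequentiallyI[of N]) auto
qed auto

lemma trunc_integrable: "u \<in> L2 \<Longrightarrow> integrable lebesgue (trunc k u)"
  by (rule L2_bounded_support_integrable[OF trunc_L2 lmeasurable_cball trunc_support])

lemma fourier_trunc_L2: "u \<in> L2 \<Longrightarrow> fourier_integral (trunc k u) \<in> L2"
  by (rule plancherel_bounded_support[OF trunc_L2 trunc_support])

lemma trunc_lin: "trunc k (\<lambda>x. u x + c * v x) = (\<lambda>x. trunc k u x + c * trunc k v x)"
  by (auto simp: trunc_def algebra_simps)

lemma is_fourier_transform_iff: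
  assumes u: "u \<in> L2"
  shows "is_fourier_transform u v \<longleftrightarrow>
    v \<in> L2 \<and> (\<lambda>k. l2norm (\<lambda>\<xi>. fourier_integral (trunc k u) \<xi> - v \<xi>)) \<longlonglongrightarrow> 0"
proof -
  have "((\<lambda>k::nat. \<integral>\<^sup>+\<xi>. ennreal ((cmod (v \<xi> - fourier_integral (trunc k u) \<xi>))\<^sup>2) \<partial>lebesgue) \<longlonglongrightarrow> 0) \<longleftrightarrow>
      (\<lambda>k. l2norm (\<lambda>\<xi>. fourier_integral (trunc k u) \<xi> - v \<xi>)) \<longlonglongrightarrow> 0" if v: "v \<in> L2"
  proof -
    have "(\<integral>\<^sup>+\<xi>. ennreal ((cmod (v \<xi> - fourier_integral (trunc k u) \<xi>))\<^sup>2) \<partial>lebesgue)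
        = ennreal ((l2norm (\<lambda>\<xi>. fourier_integral (trunc k u) \<xi> - v \<xi>))\<^sup>2)" for k
      using L2_integrable_sq[OF L2_diff[OF v fourier_trunc_L2[OF u]]]
      by (simp add: nn_integral_eq_integral l2norm_sq norm_minus_commute)
    moreover have "((\<lambda>k. ennreal ((l2norm (\<lambda>\<xi>. fourier_integral (trunc k u) \<xi> - v \<xi>))\<^sup>2)) \<longlonglongrightarrow> 0) \<longleftrightarrow>
        (\<lambda>k. (l2norm (\<lambda>\<xi>. fourier_integral (trunc k u) \<xi> - v \<xi>))\<^sup>2) \<longlonglongrightarrow> 0"
      unfolding ennreal_0[symmetric] by (intro tendsto_ennreal_iff) auto
    moreover have "((\<lambda>k. (l2norm (\<lambda>\<xi>. fourier_integral (trunc k u) \<xi> - v \<xi>))\<^sup>2) \<longlonglongrightarrow> 0) \<longleftrightarrow>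
        (\<lambda>k. l2norm (\<lambda>\<xi>. fourier_integral (trunc k u) \<xi> - v \<xi>)) \<longlonglongrightarrow> 0"
      using tendsto_real_sqrt[of "\<lambda>k. (l2norm (\<lambda>\<xi>. fourier_integral (trunc k u) \<xi> - v \<xi>))\<^sup>2" 0 sequentially]
        tendsto_power[of "\<lambda>k. l2norm (\<lambda>\<xi>. fourier_integral (trunc k u) \<xi> - v \<xi>)" 0 sequentially 2]
      by auto
    ultimately show ?thesis by simp
  qed
  then show ?thesis unfolding is_fourier_transform_def trunc_def by blast
qed

text \<open>The complex version of \<open>fourier\<close>, which the duality and inversion arguments need.\<close>

definition fourierC :: "(real^'n \<Rightarrow> complex) \<Rightarrow> real^'n \<Rightarrow> complex" where
  "fourierC u = (SOME v. is_fourier_transform u v)"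

lemma fourier_eq_fourierC: "fourier u = fourierC (\<lambda>x. of_real (u x))"
  by (simp add: fourier_def fourierC_def)

lemma is_fourier_transform_fourierC:
  assumes u: "u \<in> L2"
  shows "is_fourier_transform u (fourierC u)"
proof -
  let ?c = "sqrt ((2 * pi) ^ CARD('a))"
  have c: "?c > 0" by simp
  have d: "l2norm (\<lambda>\<xi>. fourier_integral (trunc i u) \<xi> - fourier_integral (trunc j u) \<xi>) = ?c * l2norm (\<lambda>x. trunc i u x - trunc j u x)" for i j
  proof -
    have "l2norm (fourier_integral (\<lambda>x. trunc i u x - trunc j u x)) = ?c * l2norm (\<lambda>x. trunc i u x - trunc j u x)"
      by (rule plancherel_bounded_support(2)[OF L2_diff[OF trunc_L2[OF u] trunc_L2[OF u]], where R = "real (max i j)"])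
         (simp add: trunc_def)
    then show ?thesis unfolding fourier_integral_diff[OF trunc_integrable[OF u] trunc_integrable[OF u]] .
  qed
  have "\<exists>N. \<forall>i\<ge>N. \<forall>j\<ge>N. l2norm (\<lambda>\<xi>. fourier_integral (trunc i u) \<xi> - fourier_integral (trunc j u) \<xi>) < e" if "e > 0" for e
  proof -
    have "e / (2 * ?c) > 0" using that c by simp
    from order_tendstoD(2)[OF trunc_tendsto[OF u] this]
    obtain N where N: "\<And>k. k \<ge> N \<Longrightarrow> l2norm (\<lambda>x. trunc k u x - u x) < e / (2 * ?c)"
      unfolding eventually_sequentially by blast
    have "l2norm (\<lambda>\<xi>. fourier_integral (trunc i u) \<xi> - fourier_integral (trunc j u) \<xi>) < e" if "i \<ge> N" "j \<ge> N" for i j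
    proof -
      have "l2norm (\<lambda>x. trunc i u x - trunc j u x) < e / (2 * ?c) + e / (2 * ?c)"
        using l2norm_triangle_diff[OF trunc_L2[OF u, of i] u trunc_L2[OF u, of j]] N[OF that(1)] N[OF that(2)]
          l2norm_minus_commute[of u "trunc j u"] by linarith
      also have "\<dots> = e / ?c" by simp
      finally show ?thesis unfolding d using c by (simp only: pos_less_divide_eq mult.commute)
    qed
    then show ?thesis by blast
  qed
  from L2_complete[OF fourier_trunc_L2[OF u] this]
  obtain v where "v \<in> L2" "(\<lambda>k. l2norm (\<lambda>\<xi>. fourier_integral (trunc k u) \<xi> - v \<xi>)) \<longlonglongrightarrow> 0" by blast
  then have "is_fourier_transform u v" by (simp add: is_fourier_transform_iff[OF u])
  then show ?thesis unfolding fourierC_def by (rule someI[of "is_fourier_transform u"])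
qed

lemma fourierC_L2: "u \<in> L2 \<Longrightarrow> fourierC u \<in> L2"
  using is_fourier_transform_fourierC is_fourier_transform_iff by blast

lemma fourierC_tendsto: "u \<in> L2 \<Longrightarrow> (\<lambda>k. l2norm (\<lambda>\<xi>. fourier_integral (trunc k u) \<xi> - fourierC u \<xi>)) \<longlonglongrightarrow> 0"
  using is_fourier_transform_fourierC is_fourier_transform_iff by blast

lemma fourierC_eqI:
  assumes "u \<in> L2" "v \<in> L2" "(\<lambda>k. l2norm (\<lambda>\<xi>. fourier_integral (trunc k u) \<xi> - v \<xi>)) \<longlonglongrightarrow> 0"
  shows "AE \<xi> in lebesgue. fourierC u \<xi> = v \<xi>"
  by (rule L2_tendsto_unique[OF fourier_trunc_L2[OF assms(1)] fourierC_L2[OF assms(1)] assms(2) fourierC_tendsto[OF assms(1)] assms(3)])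

lemma fourierC_plancherel:
  fixes u :: "real^'n \<Rightarrow> complex"
  assumes u: "u \<in> L2" shows "l2norm (fourierC u) = sqrt ((2 * pi) ^ CARD('n)) * l2norm u"
proof (rule LIMSEQ_unique)
  show "(\<lambda>k. l2norm (fourier_integral (trunc k u))) \<longlonglongrightarrow> l2norm (fourierC u)"
    by (rule l2norm_tendsto[OF fourier_trunc_L2[OF u] fourierC_L2[OF u] fourierC_tendsto[OF u]])
  show "(\<lambda>k. l2norm (fourier_integral (trunc k u))) \<longlonglongrightarrow> sqrt ((2 * pi) ^ CARD('n)) * l2norm u"
    using plancherel_bounded_support(2)[OF trunc_L2[OF u] trunc_support]
    by (simp only:) (intro tendsto_intros l2norm_tendsto[OF trunc_L2[OF u] u trunc_tendsto[OF u]])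
qed

lemma fourierC_lin:
  assumes u: "u \<in> L2" and v: "v \<in> L2"
  shows "AE \<xi> in lebesgue. fourierC (\<lambda>x. u x + c * v x) \<xi> = fourierC u \<xi> + c * fourierC v \<xi>"
proof (rule fourierC_eqI)
  show "(\<lambda>x. u x + c * v x) \<in> L2" "(\<lambda>\<xi>. fourierC u \<xi> + c * fourierC v \<xi>) \<in> L2"
    by (intro L2_lin u v fourierC_L2)+
  show "(\<lambda>k. l2norm (\<lambda>\<xi>. fourier_integral (trunc k (\<lambda>x. u x + c * v x)) \<xi> - (fourierC u \<xi> + c * fourierC v \<xi>))) \<longlonglongrightarrow> 0"
  proof (rule Lim_null_comparison)
    let ?e = "\<lambda>k. l2norm (\<lambda>\<xi>. fourier_integral (trunc k u) \<xi> - fourierC u \<xi>) + cmod c * l2norm (\<lambda>\<xi>. fourier_integral (trunc k v) \<xi> - fourierC v \<xi>)"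
    show "\<forall>\<^sub>F k in sequentially. norm (l2norm (\<lambda>\<xi>. fourier_integral (trunc k (\<lambda>x. u x + c * v x)) \<xi> - (fourierC u \<xi> + c * fourierC v \<xi>))) \<le> ?e k"
    proof (intro always_eventually allI)
      fix k
      have "(\<lambda>\<xi>. fourier_integral (trunc k (\<lambda>x. u x + c * v x)) \<xi> - (fourierC u \<xi> + c * fourierC v \<xi>))
        = (\<lambda>\<xi>. (fourier_integral (trunc k u) \<xi> - fourierC u \<xi>) + c * (fourier_integral (trunc k v) \<xi> - fourierC v \<xi>))"
        unfolding trunc_lin fourier_integral_lin[OF trunc_integrable[OF u] trunc_integrable[OF v]] by (auto simp: algebra_simps)
      then show "norm (l2norm (\<lambda>\<xi>. fourier_integral (trunc k (\<lambda>x. u x + c * v x)) \<xi> - (fourierC u \<xi> + c * fourierC v \<xi>))) \<le> ?e k"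
        using l2norm_triangle[OF L2_diff[OF fourier_trunc_L2[OF u, of k] fourierC_L2[OF u]] L2_cmult[OF L2_diff[OF fourier_trunc_L2[OF v, of k] fourierC_L2[OF v]], of c]]
        by (simp add: l2norm_cmult)
    qed
    have "?e \<longlonglongrightarrow> 0 + cmod c * 0" by (intro tendsto_intros fourierC_tendsto u v)
    then show "?e \<longlonglongrightarrow> 0" by simp
  qed
qed

lemma fourierC_cong_AE:
  assumes u: "u \<in> L2" and v: "v \<in> L2" and "AE x in lebesgue. u x = v x"
  shows "AE \<xi> in lebesgue. fourierC u \<xi> = fourierC v \<xi>"
proof -
  have "fourier_integral (trunc k u) = fourier_integral (trunc k v)" for k
    unfolding fourier_integral_def
    by (intro ext integral_cong_AE borel_measurable_integrable integrable_cis_mult' trunc_integrable u v)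
       (use assms(3) in \<open>eventually_elim, simp add: trunc_def\<close>)
  then show ?thesis
    using fourierC_tendsto[OF v] by (intro fourierC_eqI[OF u fourierC_L2[OF v]]) simp
qed

lemma fourierC_eq_fourier_integral:
  assumes u: "u \<in> L2" and z: "\<And>x. x \<notin> cball 0 R \<Longrightarrow> u x = 0"
  shows "AE \<xi> in lebesgue. fourierC u \<xi> = fourier_integral u \<xi>"
proof (rule fourierC_eqI[OF u plancherel_bounded_support(1)[OF assms]])
  obtain N where N: "R \<le> real N" using real_arch_simple by blast
  have "trunc k u = u" if "k \<ge> N" for k
    using N that z by (auto simp: trunc_def indicator_def fun_eq_iff)
  then have "\<forall>\<^sub>F k in sequentially. l2norm (\<lambda>\<xi>. fourier_integral (trunc k u) \<xi> - fourier_integral u \<xi>) = 0"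
    by (intro eventually_sequentiallyI[of N]) (simp add: l2norm_def)
  then show "(\<lambda>k. l2norm (\<lambda>\<xi>. fourier_integral (trunc k u) \<xi> - fourier_integral u \<xi>)) \<longlonglongrightarrow> 0"
    by (rule tendsto_eventually)
qed

lemma l2norm_add_sq:
  assumes u: "u \<in> L2" and v: "v \<in> L2"
  shows "(l2norm (\<lambda>x. u x + c * v x))\<^sup>2 = (l2norm u)\<^sup>2 + (cmod c)\<^sup>2 * (l2norm v)\<^sup>2 + 2 * Re (cnj c * (LINT x|lebesgue. u x * cnj (v x)))"
proof -
  have i: "integrable lebesgue (\<lambda>x. u x * cnj (v x))" by (rule L2_mult_integrable[OF u L2_cnj[OF v]])
  have ia: "integrable lebesgue (\<lambda>x. (cmod (u x))\<^sup>2)" by (rule L2_integrable_sq[OF u])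
  have ib: "integrable lebesgue (\<lambda>x. (cmod c)\<^sup>2 * (cmod (v x))\<^sup>2)"
    by (rule integrable_mult_right[OF L2_integrable_sq[OF v]])
  have ir: "integrable lebesgue (\<lambda>x. 2 * Re (cnj c * (u x * cnj (v x))))"
    by (intro integrable_mult_right integrable_Re i)
  have e: "(cmod (a + c * b))\<^sup>2 = (cmod a)\<^sup>2 + (cmod c)\<^sup>2 * (cmod b)\<^sup>2 + 2 * Re (cnj c * (a * cnj b))" for a b
    unfolding cmod_power2 by (simp add: power2_eq_square algebra_simps)
  have "(l2norm (\<lambda>x. u x + c * v x))\<^sup>2 = (LINT x|lebesgue. (cmod (u x))\<^sup>2 + (cmod c)\<^sup>2 * (cmod (v x))\<^sup>2 + 2 * Re (cnj c * (u x * cnj (v x))))"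
    by (simp only: l2norm_sq e)
  also have "\<dots> = (l2norm u)\<^sup>2 + (cmod c)\<^sup>2 * (l2norm v)\<^sup>2 + 2 * (LINT x|lebesgue. Re (cnj c * (u x * cnj (v x))))"
    unfolding l2norm_sq Bochner_Integration.integral_add[OF Bochner_Integration.integrable_add[OF ia ib] ir]
      Bochner_Integration.integral_add[OF ia ib] by (simp only: Bochner_Integration.integral_mult_right_zero)
  also have "(LINT x|lebesgue. Re (cnj c * (u x * cnj (v x)))) = Re (cnj c * (LINT x|lebesgue. u x * cnj (v x)))"
    using i by (subst integral_Re) auto
  finally show ?thesis .
qed

text \<open>
  Polarization: Plancherel's identity for \<open>u + c v\<close> gives the real part of the inner product for
  \<open>c = 1\<close> and the imaginary part for \<open>c = \<i>\<close>.
\<close>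

lemma fourierC_parseval:
  fixes u v :: "real^'n \<Rightarrow> complex"
  assumes u: "u \<in> L2" and v: "v \<in> L2"
  shows "(LINT \<xi>|lebesgue. fourierC u \<xi> * cnj (fourierC v \<xi>)) = complex_of_real ((2 * pi) ^ CARD('n)) * (LINT x|lebesgue. u x * cnj (v x))"
proof -
  define K where "K = (2 * pi) ^ CARD('n)"
  let ?A = "LINT \<xi>|lebesgue. fourierC u \<xi> * cnj (fourierC v \<xi>)" and ?B = "LINT x|lebesgue. u x * cnj (v x)"
  have Re: "Re (cnj c * ?A) = K * Re (cnj c * ?B)" for c
  proof -
    have P: "(l2norm (fourierC w))\<^sup>2 = K * (l2norm w)\<^sup>2" if "w \<in> L2" for w :: "real^'n \<Rightarrow> complex"
      unfolding fourierC_plancherel[OF that] K_def by (simp add: power_mult_distrib)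
    have "(l2norm (\<lambda>\<xi>. fourierC u \<xi> + c * fourierC v \<xi>))\<^sup>2 = K * (l2norm (\<lambda>x. u x + c * v x))\<^sup>2"
      using l2norm_cong_AE[OF fourierC_L2[OF L2_lin[OF u v]] L2_lin[OF fourierC_L2[OF u] fourierC_L2[OF v]] fourierC_lin[OF u v, of c]]
        P[OF L2_lin[OF u v, of c]] by simp
    then show ?thesis
      unfolding l2norm_add_sq[OF u v] l2norm_add_sq[OF fourierC_L2[OF u] fourierC_L2[OF v]] P[OF u] P[OF v] distrib_left
      by (simp only: mult.left_commute[of K])
  qed
  have "?A = complex_of_real K * ?B"
  proof (rule complex_eqI)
    show "Re ?A = Re (complex_of_real K * ?B)" using Re[of 1] by simp
    show "Im ?A = Im (complex_of_real K * ?B)" using Re[of \<i>] by simp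
  qed
  then show ?thesis unfolding K_def .
qed

text \<open>
  For truncated functions this is Fubini's theorem; both sides are continuous in mean square.
\<close>

lemma fourierC_multiplication_formula:
  fixes u v :: "real^'n \<Rightarrow> complex"
  assumes u: "u \<in> L2" and v: "v \<in> L2"
  shows "(LINT \<xi>|lebesgue. fourierC u \<xi> * v \<xi>) = (LINT x|lebesgue. u x * fourierC v x)"
proof -
  have e: "(LINT \<xi>|lebesgue. fourier_integral (trunc k u) \<xi> * trunc k v \<xi>) = (LINT x|lebesgue. trunc k u x * fourier_integral (trunc k v) x)" for k
  proof -
    have "(LINT \<xi>|lebesgue. trunc k v \<xi> * (LINT x|lebesgue. cis (-1 * (fst (\<xi>, x) \<bullet> snd (\<xi>, x))) * trunc k u x))
      = (LINT x|lebesgue. trunc k u x * (LINT \<xi>|lebesgue. cis (-1 * (fst (\<xi>, x) \<bullet> snd (\<xi>, x))) * trunc k v \<xi>))"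
      by (rule lebp.integral_swap_kernel[OF trunc_integrable[OF v] trunc_integrable[OF u] fourier_kernel_measurable, of "-1" 1]) simp
    then show ?thesis unfolding fourier_integral_def by (simp add: inner_commute mult.commute)
  qed
  have "(\<lambda>k. LINT \<xi>|lebesgue. fourier_integral (trunc k u) \<xi> * trunc k v \<xi>) \<longlonglongrightarrow> (LINT \<xi>|lebesgue. fourierC u \<xi> * v \<xi>)"
    by (rule L2_mult_tendsto[OF fourier_trunc_L2[OF u] fourierC_L2[OF u] fourierC_tendsto[OF u] trunc_L2[OF v] v trunc_tendsto[OF v]])
  moreover have "(\<lambda>k. LINT x|lebesgue. trunc k u x * fourier_integral (trunc k v) x) \<longlonglongrightarrow> (LINT x|lebesgue. u x * fourierC v x)"
    by (rule L2_mult_tendsto[OF trunc_L2[OF u] u trunc_tendsto[OF u] fourier_trunc_L2[OF v] fourierC_L2[OF v] fourierC_tendsto[OF v]])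
  ultimately show ?thesis unfolding e by (rule LIMSEQ_unique)
qed

lemma L2_eqI_weak:
  assumes w: "w \<in> L2" and "\<And>v. v \<in> L2 \<Longrightarrow> (LINT x|lebesgue. w x * cnj (v x)) = 0"
  shows "AE x in lebesgue. w x = 0"
proof -
  have "complex_of_real ((l2norm w)\<^sup>2) = (LINT x|lebesgue. w x * cnj (w x))"
    unfolding l2norm_sq by (simp add: complex_norm_square flip: integral_complex_of_real of_real_power)
  then have "l2norm w = 0" using assms by (metis of_real_eq_0_iff zero_eq_power2)
  then show ?thesis by (rule l2norm_eq_0[OF w])
qed

text \<open>
  With \<open>F\<^sup>* g\<close> the conjugate of \<open>F\<close> applied to the conjugate of \<open>g\<close>, the multiplication formula says
  that \<open>F\<^sup>*\<close> is the adjoint of \<open>F\<close>, and Parseval's identity says \<open>F\<^sup>* F = (2\<pi>)\<^sup>n\<close>. Conjugating this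
  identity gives \<open>F F\<^sup>* = (2\<pi>)\<^sup>n\<close>, so \<open>F\<close> is onto.
\<close>

lemma fourierC_inversion:
  fixes u :: "real^'n \<Rightarrow> complex"
  assumes u: "u \<in> L2"
  shows "AE x in lebesgue. fourierC (\<lambda>\<xi>. cnj (fourierC u \<xi>)) x = complex_of_real ((2 * pi) ^ CARD('n)) * cnj (u x)"
proof -
  let ?K = "complex_of_real ((2 * pi) ^ CARD('n))"
  let ?w = "\<lambda>x. fourierC (\<lambda>\<xi>. cnj (fourierC u \<xi>)) x - ?K * cnj (u x)"
  have FuL: "(\<lambda>\<xi>. cnj (fourierC u \<xi>)) \<in> L2" by (intro L2_cnj fourierC_L2 u)
  have wL: "?w \<in> L2" by (intro L2_diff L2_cmult L2_cnj fourierC_L2 u)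
  have "AE x in lebesgue. ?w x = 0"
  proof (rule L2_eqI_weak[OF wL])
    fix v :: "real^'n \<Rightarrow> complex" assume v: "v \<in> L2"
    define v' where "v' = (\<lambda>x. cnj (v x))"
    have v': "v' \<in> L2" unfolding v'_def by (rule L2_cnj[OF v])
    have "(LINT x|lebesgue. fourierC (\<lambda>\<xi>. cnj (fourierC u \<xi>)) x * v' x) = (LINT x|lebesgue. cnj (fourierC u x) * fourierC v' x)"
      by (rule fourierC_multiplication_formula[OF FuL v'])
    also have "\<dots> = (LINT x|lebesgue. fourierC v' x * cnj (fourierC u x))" by (simp add: mult.commute)
    also have "\<dots> = ?K * (LINT x|lebesgue. v' x * cnj (u x))" by (rule fourierC_parseval[OF v' u])
    also have "\<dots> = (LINT x|lebesgue. ?K * (v' x * cnj (u x)))" by (rule integral_mult_right_zero[symmetric])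
    also have "\<dots> = (LINT x|lebesgue. ?K * cnj (u x) * v' x)" by (simp only: mult_ac)
    finally show "(LINT x|lebesgue. ?w x * cnj (v x)) = 0"
      unfolding v'_def[symmetric] left_diff_distrib
      by (subst Bochner_Integration.integral_diff) (auto simp: v'_def intro!: L2_mult_integrable fourierC_L2 L2_cmult L2_cnj u v)
  qed
  then show ?thesis by eventually_elim simp
qed

lemma fourierC_surj:
  fixes g :: "real^'n \<Rightarrow> complex"
  assumes g: "g \<in> L2"
  obtains u where "u \<in> L2" "AE \<xi> in lebesgue. fourierC u \<xi> = g \<xi>"
proof -
  let ?K = "complex_of_real ((2 * pi) ^ CARD('n))"
  let ?u = "\<lambda>x. cnj (fourierC (\<lambda>\<xi>. cnj (g \<xi>)) x)"
  have uL: "?u \<in> L2" by (intro L2_cnj fourierC_L2 g)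
  have "AE x in lebesgue. fourierC (\<lambda>x. 0 + (1 / ?K) * ?u x) x = fourierC (\<lambda>x. 0) x + (1 / ?K) * fourierC ?u x"
    by (rule fourierC_lin[OF L2_zero uL])
  moreover have "AE x in lebesgue. fourierC ?u x = ?K * cnj (cnj (g x))"
    using fourierC_inversion[OF L2_cnj[OF g]] by simp
  moreover have "AE x in lebesgue. fourierC (\<lambda>x::real^'n. 0) x = 0"
    using fourierC_lin[OF L2_zero L2_zero, of "-1", where 'a='n] fourierC_lin[OF L2_zero L2_zero, of "1", where 'a='n]
    by eventually_elim auto
  ultimately have "AE x in lebesgue. fourierC (\<lambda>x. (1 / ?K) * ?u x) x = g x"
    by eventually_elim simp
  then show ?thesis by (rule that[rotated]) (rule L2_cmult[OF uL])
qed

section \<open>Sobolev spaces and the energy form\<close>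

lemma fourier_L2: "u \<in> L2 \<Longrightarrow> fourier u \<in> L2"
  unfolding fourier_eq_fourierC by (intro fourierC_L2 L2_of_real)

lemma fourier_lin:
  assumes "u \<in> L2" "v \<in> L2"
  shows "AE \<xi> in lebesgue. fourier (\<lambda>x. u x + c * v x) \<xi> = fourier u \<xi> + of_real c * fourier v \<xi>"
  using fourierC_lin[OF L2_of_real[OF assms(1)] L2_of_real[OF assms(2)], of "of_real c"]
  unfolding fourier_eq_fourierC by simp

lemma fourier_cong_AE:
  assumes "u \<in> L2" "v \<in> L2" "AE x in lebesgue. u x = v x"
  shows "AE \<xi> in lebesgue. fourier u \<xi> = fourier v \<xi>"
  unfolding fourier_eq_fourierC
  by (rule fourierC_cong_AE[OF L2_of_real[OF assms(1)] L2_of_real[OF assms(2)]]) (use assms(3) in auto)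

lemma fourier_parseval:
  fixes u v :: "real^'n \<Rightarrow> real"
  assumes "u \<in> L2" "v \<in> L2"
  shows "(LINT \<xi>|lebesgue. fourier u \<xi> * cnj (fourier v \<xi>)) = of_real ((2 * pi) ^ CARD('n) * (LINT x|lebesgue. u x * v x))"
proof -
  have "(LINT x|lebesgue. complex_of_real (u x) * cnj (of_real (v x))) = of_real (LINT x|lebesgue. u x * v x)"
    by (simp flip: of_real_mult integral_complex_of_real)
  then show ?thesis
    using fourierC_parseval[OF L2_of_real[OF assms(1)] L2_of_real[OF assms(2)]]
    unfolding fourier_eq_fourierC by simp
qed

lemma fourier_plancherel:
  fixes u :: "real^'n \<Rightarrow> real"
  assumes "u \<in> L2" shows "l2norm (fourier u) = sqrt ((2 * pi) ^ CARD('n)) * l2norm u"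
proof -
  have "l2norm (\<lambda>x. complex_of_real (u x)) = l2norm u" by (simp add: l2norm_def)
  then show ?thesis unfolding fourier_eq_fourierC fourierC_plancherel[OF L2_of_real[OF assms]] by simp
qed

lemma fourier_eq_fourier_integral:
  fixes u :: "real^'n \<Rightarrow> real"
  assumes "u \<in> L2" "\<And>x. x \<notin> cball 0 R \<Longrightarrow> u x = 0"
  shows "AE \<xi> in lebesgue. fourier u \<xi> = fourier_integral (\<lambda>x. of_real (u x)) \<xi>"
  unfolding fourier_eq_fourierC
  by (rule fourierC_eq_fourier_integral[OF L2_of_real[OF assms(1)], of R]) (simp add: assms(2))

lemma AE_lebesgue_uminus:
  fixes P :: "real^'n \<Rightarrow> bool"
  assumes "AE x in lebesgue. P x" shows "AE x in lebesgue. P (- x)"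
proof -
  obtain N where N: "negligible N" "{x. \<not> P x} \<subseteq> N"
    using assms unfolding eventually_ae_filter_negligible by auto
  have "negligible (uminus ` N)"
    by (rule negligible_differentiable_image_negligible[OF _ N(1)])
       (auto intro!: differentiable_on_minus differentiable_on_ident)
  moreover have "{x. \<not> P (- x)} \<subseteq> uminus ` N" using N(2) by (force simp: image_iff)
  ultimately show ?thesis unfolding eventually_ae_filter_negligible by blast
qed

lemma fourier_integral_uminus:
  "fourier_integral (\<lambda>x. of_real (u x)) (- \<xi>) = cnj (fourier_integral (\<lambda>x. of_real (u x)) \<xi>)"
  unfolding fourier_integral_def
  by (subst Bochner_Integration.integral_cnj[symmetric]) (simp add: cis_cnj)

lemma fourier_uminus:
  assumes u: "u \<in> L2"
  shows "AE \<xi> in lebesgue. fourier u (- \<xi>) = cnj (fourier u \<xi>)"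
proof -
  let ?u = "\<lambda>x. complex_of_real (u x)"
  have uL: "?u \<in> L2" by (rule L2_of_real[OF u])
  obtain r :: "nat \<Rightarrow> nat" where r: "AE \<xi> in lebesgue. (\<lambda>k. fourier_integral (trunc (r k) ?u) \<xi>) \<longlonglongrightarrow> fourierC ?u \<xi>"
    using L2_tendsto_subseq_AE[OF fourier_trunc_L2[OF uL] fourierC_L2[OF uL] fourierC_tendsto[OF uL]] by blast
  have t: "trunc k ?u = (\<lambda>x. of_real (indicator (cball 0 (real k)) x * u x))" for k
    by (auto simp: trunc_def indicator_def)
  show ?thesis using r AE_lebesgue_uminus[OF r]
  proof eventually_elim
    fix \<xi>
    assume 1: "(\<lambda>k. fourier_integral (trunc (r k) ?u) \<xi>) \<longlonglongrightarrow> fourierC ?u \<xi>"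
      and 2: "(\<lambda>k. fourier_integral (trunc (r k) ?u) (- \<xi>)) \<longlonglongrightarrow> fourierC ?u (- \<xi>)"
    have "(\<lambda>k. cnj (fourier_integral (trunc (r k) ?u) \<xi>)) \<longlonglongrightarrow> cnj (fourierC ?u \<xi>)"
      using 1 by (intro tendsto_intros)
    with 2 show "fourier u (- \<xi>) = cnj (fourier u \<xi>)"
      unfolding t fourier_integral_uminus fourier_eq_fourierC by (rule LIMSEQ_unique)
  qed
qed

text \<open>
  The preimage \<open>a + i b\<close> of a Hermitian function has real \<open>a\<close> and \<open>b\<close>; the transform of \<open>a\<close> is
  Hermitian and that of \<open>i b\<close> anti-Hermitian, so the latter vanishes.
\<close>

lemma fourier_surj_hermitian:
  fixes g :: "real^'n \<Rightarrow> complex"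
  assumes g: "g \<in> L2" and h: "AE \<xi> in lebesgue. g (- \<xi>) = cnj (g \<xi>)"
  obtains v :: "real^'n \<Rightarrow> real" where "v \<in> L2" "AE \<xi> in lebesgue. fourier v \<xi> = g \<xi>"
proof -
  obtain w where w: "w \<in> L2" "AE \<xi> in lebesgue. fourierC w \<xi> = g \<xi>" using fourierC_surj[OF g] by blast
  define a b where "a = (\<lambda>x. Re (w x))" and "b = (\<lambda>x. Re (- \<i> * w x))"
  have aL: "a \<in> L2" and bL: "b \<in> L2" unfolding a_def b_def by (intro L2_Re L2_cmult w)+
  have "(\<lambda>x. complex_of_real (a x) + \<i> * complex_of_real (b x)) = w"
    by (auto simp: a_def b_def complex_eq_iff)
  then have F: "AE \<xi> in lebesgue. fourierC w \<xi> = fourier a \<xi> + \<i> * fourier b \<xi>"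
    using fourierC_lin[OF L2_of_real[OF aL] L2_of_real[OF bL], of \<i>] unfolding fourier_eq_fourierC by simp
  have G: "AE \<xi> in lebesgue. g \<xi> = fourier a \<xi> + \<i> * fourier b \<xi>"
    using F w(2) by eventually_elim simp
  have "AE \<xi> in lebesgue. fourier a \<xi> = g \<xi>"
    using G AE_lebesgue_uminus[OF G] h fourier_uminus[OF aL] fourier_uminus[OF bL]
  proof eventually_elim
    fix \<xi>
    assume *: "g \<xi> = fourier a \<xi> + \<i> * fourier b \<xi>" "g (- \<xi>) = fourier a (- \<xi>) + \<i> * fourier b (- \<xi>)"
      "g (- \<xi>) = cnj (g \<xi>)" "fourier a (- \<xi>) = cnj (fourier a \<xi>)" "fourier b (- \<xi>) = cnj (fourier b \<xi>)"
    then have "\<i> * cnj (fourier b \<xi>) = - (\<i> * cnj (fourier b \<xi>))" by simp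
    then have "fourier b \<xi> = 0" by (simp add: complex_eq_iff)
    then show "fourier a \<xi> = g \<xi>" using *(1) by simp
  qed
  then show ?thesis by (rule that[OF aL])
qed

text \<open>
  The Sobolev norm is the mean square norm of \<open>sob s u\<close>, and the energy form is the inner product
  of the functions \<open>flap s u\<close>, the transforms of \<open>(-\<Delta>)\<^sup>s\<^sup>/\<^sup>2 u\<close>.
\<close>

definition sob :: "real \<Rightarrow> (real^'n \<Rightarrow> real) \<Rightarrow> real^'n \<Rightarrow> complex" where
  "sob s u \<xi> = of_real ((1 + (norm \<xi>)\<^sup>2) powr (s / 2)) * fourier u \<xi>"

definition flap :: "real \<Rightarrow> (real^'n \<Rightarrow> real) \<Rightarrow> real^'n \<Rightarrow> complex" where
  "flap s u \<xi> = of_real (norm \<xi> powr s) * fourier u \<xi>"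

definition energy :: "real \<Rightarrow> (real^'n \<Rightarrow> real) \<Rightarrow> (real^'n \<Rightarrow> real) \<Rightarrow> real" where
  "energy s u v = Re (LINT \<xi>|lebesgue. flap s u \<xi> * cnj (flap s v \<xi>)) / (2 * pi) ^ CARD('n)"

lemma weight_measurable:
  "(\<lambda>\<xi>::real^'n. complex_of_real ((1 + (norm \<xi>)\<^sup>2) powr t)) \<in> borel_measurable lebesgue"
  "(\<lambda>\<xi>::real^'n. complex_of_real (norm \<xi> powr t)) \<in> borel_measurable lebesgue"
  by (rule measurable_completion, measurable)+

lemma sob_measurable: "u \<in> L2 \<Longrightarrow> sob s u \<in> borel_measurable lebesgue"
  unfolding sob_def[abs_def] by (intro borel_measurable_times weight_measurable L2_measurable fourier_L2)

lemma flap_measurable: "u \<in> L2 \<Longrightarrow> flap s u \<in> borel_measurable lebesgue"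
  unfolding flap_def[abs_def] by (intro borel_measurable_times weight_measurable L2_measurable fourier_L2)

lemma norm_sob_sq: "(cmod (sob s u \<xi>))\<^sup>2 = (1 + (norm \<xi>)\<^sup>2) powr s * (cmod (fourier u \<xi>))\<^sup>2"
proof -
  have "0 < 1 + (norm \<xi>)\<^sup>2" by (simp add: add_pos_nonneg)
  then have "((1 + (norm \<xi>)\<^sup>2) powr (s / 2))\<^sup>2 = (1 + (norm \<xi>)\<^sup>2) powr s"
    by (simp add: power2_eq_square flip: powr_add)
  then show ?thesis by (simp add: sob_def norm_mult power_mult_distrib)
qed

lemma norm_flap_sq: "(cmod (flap s u \<xi>))\<^sup>2 = norm \<xi> powr (2 * s) * (cmod (fourier u \<xi>))\<^sup>2"
proof -
  have "(norm \<xi> powr s)\<^sup>2 = norm \<xi> powr (2 * s)"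
    by (simp add: power2_eq_square flip: powr_add)
  then show ?thesis by (simp add: flap_def norm_mult power_mult_distrib)
qed

lemma Hs_iff: "u \<in> Hs s \<longleftrightarrow> u \<in> L2 \<and> sob s u \<in> L2"
  unfolding Hs_def using sob_measurable by (auto simp: norm_sob_sq[symmetric] L2_def)

lemma Hs_L2: "u \<in> Hs s \<Longrightarrow> u \<in> L2" and Hs_sob: "u \<in> Hs s \<Longrightarrow> sob s u \<in> L2"
  by (auto simp: Hs_iff)

lemma Hs_norm_eq: "Hs_norm s u = l2norm (sob s u)"
  by (simp add: Hs_norm_def l2norm_def norm_sob_sq)

lemma Hs_norm_nonneg [simp]: "0 \<le> Hs_norm s u"
  by (simp add: Hs_norm_eq)

lemma norm_flap_le: "s \<ge> 0 \<Longrightarrow> cmod (flap s u \<xi>) \<le> cmod (sob s u \<xi>)"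
proof -
  assume s: "s \<ge> 0"
  have "norm \<xi> powr s \<le> (1 + (norm \<xi>)\<^sup>2) powr (s / 2)"
  proof (cases "\<xi> = 0")
    case False
    have "norm \<xi> powr s = ((norm \<xi>)\<^sup>2) powr (s / 2)"
      using False by (simp add: powr_powr flip: powr_numeral)
    also have "\<dots> \<le> (1 + (norm \<xi>)\<^sup>2) powr (s / 2)" by (rule powr_mono2) (use s in auto)
    finally show ?thesis .
  qed simp
  then show ?thesis unfolding flap_def sob_def norm_mult by (intro mult_right_mono) auto
qed

lemma norm_fourier_le_sob: "s \<ge> 0 \<Longrightarrow> cmod (fourier u \<xi>) \<le> cmod (sob s u \<xi>)"
proof -
  assume s: "s \<ge> 0"
  have "1 \<le> (1 + (norm \<xi>)\<^sup>2) powr (s / 2)" using s by (intro ge_one_powr_ge_zero) auto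
  then have "1 * cmod (fourier u \<xi>) \<le> (1 + (norm \<xi>)\<^sup>2) powr (s / 2) * cmod (fourier u \<xi>)"
    by (intro mult_right_mono) auto
  then show ?thesis by (simp add: sob_def norm_mult)
qed

lemma flap_L2: "u \<in> Hs s \<Longrightarrow> s \<ge> 0 \<Longrightarrow> flap s u \<in> L2"
  by (rule L2_bounded[of "sob s u" _ 1]) (auto simp: Hs_iff flap_measurable norm_flap_le)

lemma l2norm_mono:
  fixes u v :: "real^'n \<Rightarrow> 'b::{real_normed_field,banach,second_countable_topology}"
  assumes "u \<in> L2" "v \<in> L2" "\<And>x. norm (u x) \<le> norm (v x)" shows "l2norm u \<le> l2norm v"
  unfolding l2norm_def
  by (intro real_sqrt_le_mono integral_mono L2_integrable_sq assms power_mono) auto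

lemma l2norm_flap_le: "u \<in> Hs s \<Longrightarrow> s \<ge> 0 \<Longrightarrow> l2norm (flap s u) \<le> Hs_norm s u"
  unfolding Hs_norm_eq by (intro l2norm_mono flap_L2 norm_flap_le Hs_sob)

lemma l2norm_le_Hs_norm:
  fixes u :: "real^'n \<Rightarrow> real"
  assumes "u \<in> Hs s" "s \<ge> 0" shows "l2norm u \<le> Hs_norm s u"
proof -
  have "1 \<le> (2 * pi) ^ CARD('n)" by (rule one_le_power) (use pi_ge_two in simp)
  then have "1 * l2norm u \<le> sqrt ((2 * pi) ^ CARD('n)) * l2norm u"
    by (intro mult_right_mono) (simp_all only: real_sqrt_ge_1_iff l2norm_nonneg)
  also have "\<dots> = l2norm (fourier u)" using fourier_plancherel[OF Hs_L2[OF assms(1)]] by simp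
  also have "\<dots> \<le> Hs_norm s u"
    unfolding Hs_norm_eq using assms by (intro l2norm_mono norm_fourier_le_sob Hs_sob fourier_L2 Hs_L2[of u s])
  finally show ?thesis by simp
qed

lemma sob_lin:
  assumes "u \<in> L2" "v \<in> L2"
  shows "AE \<xi> in lebesgue. sob s (\<lambda>x. u x + c * v x) \<xi> = sob s u \<xi> + of_real c * sob s v \<xi>"
  using fourier_lin[OF assms, of c] by eventually_elim (simp add: sob_def algebra_simps)

lemma flap_lin:
  assumes "u \<in> L2" "v \<in> L2"
  shows "AE \<xi> in lebesgue. flap s (\<lambda>x. u x + c * v x) \<xi> = flap s u \<xi> + of_real c * flap s v \<xi>"
  using fourier_lin[OF assms, of c] by eventually_elim (simp add: flap_def algebra_simps)

lemma Hs_lin: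
  assumes "u \<in> Hs s" "v \<in> Hs s" shows "(\<lambda>x. u x + c * v x) \<in> Hs s"
proof -
  have L: "(\<lambda>x. u x + c * v x) \<in> L2" using assms by (intro L2_lin Hs_L2)
  have "sob s (\<lambda>x. u x + c * v x) \<in> L2"
  proof (rule L2_AE_bounded)
    show "(\<lambda>\<xi>. sob s u \<xi> + of_real c * sob s v \<xi>) \<in> L2" using assms by (intro L2_lin Hs_sob)
    show "AE \<xi> in lebesgue. norm (sob s (\<lambda>x. u x + c * v x) \<xi>) \<le> 1 * norm (sob s u \<xi> + of_real c * sob s v \<xi>)"
      using sob_lin[OF Hs_L2[OF assms(1)] Hs_L2[OF assms(2)], of s c] by eventually_elim simp
  qed (rule sob_measurable[OF L])
  with L show ?thesis by (simp add: Hs_iff)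
qed

lemma Hs_diff: "u \<in> Hs s \<Longrightarrow> v \<in> Hs s \<Longrightarrow> (\<lambda>x. u x - v x) \<in> Hs s"
  using Hs_lin[of u s v "-1"] by simp

lemma Hs_norm_lin:
  assumes u: "u \<in> Hs s" and v: "v \<in> Hs s"
  shows "Hs_norm s (\<lambda>x. u x + c * v x) = l2norm (\<lambda>\<xi>. sob s u \<xi> + of_real c * sob s v \<xi>)"
  unfolding Hs_norm_eq
  by (rule l2norm_cong_AE[OF Hs_sob[OF Hs_lin[OF u v]] L2_lin[OF Hs_sob[OF u] Hs_sob[OF v]]
      sob_lin[OF Hs_L2[OF u] Hs_L2[OF v]]])

lemma Hs_norm_diff:
  assumes u: "u \<in> Hs s" and v: "v \<in> Hs s"
  shows "Hs_norm s (\<lambda>x. u x - v x) = l2norm (\<lambda>\<xi>. sob s u \<xi> - sob s v \<xi>)"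
  using Hs_norm_lin[OF assms, of "-1"] by simp

lemma Hs_norm_triangle:
  assumes u: "u \<in> Hs s" and v: "v \<in> Hs s"
  shows "Hs_norm s (\<lambda>x. u x + c * v x) \<le> Hs_norm s u + \<bar>c\<bar> * Hs_norm s v"
  unfolding Hs_norm_lin[OF assms] using l2norm_triangle[OF Hs_sob[OF u] L2_cmult[OF Hs_sob[OF v]], of "of_real c"]
  by (simp add: l2norm_cmult Hs_norm_eq)

lemma energy_lin:
  assumes u: "u \<in> Hs s" and v: "v \<in> Hs s" and w: "w \<in> Hs s" and s: "s \<ge> 0"
  shows "energy s (\<lambda>x. u x + c * v x) w = energy s u w + c * energy s v w"
proof -
  note L = flap_L2[OF u s] flap_L2[OF v s] L2_cnj[OF flap_L2[OF w s]]
  have "(LINT \<xi>|lebesgue. flap s (\<lambda>x. u x + c * v x) \<xi> * cnj (flap s w \<xi>))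
     = (LINT \<xi>|lebesgue. flap s u \<xi> * cnj (flap s w \<xi>) + of_real c * (flap s v \<xi> * cnj (flap s w \<xi>)))"
  proof (rule integral_cong_AE)
    show "AE \<xi> in lebesgue. flap s (\<lambda>x. u x + c * v x) \<xi> * cnj (flap s w \<xi>) = flap s u \<xi> * cnj (flap s w \<xi>) + of_real c * (flap s v \<xi> * cnj (flap s w \<xi>))"
      using flap_lin[OF Hs_L2[OF u] Hs_L2[OF v], of s c] by eventually_elim (simp add: algebra_simps)
  qed (intro borel_measurable_integrable Bochner_Integration.integrable_add integrable_mult_right L2_mult_integrable L flap_L2 Hs_lin u v s)+
  also have "\<dots> = (LINT \<xi>|lebesgue. flap s u \<xi> * cnj (flap s w \<xi>)) + of_real c * (LINT \<xi>|lebesgue. flap s v \<xi> * cnj (flap s w \<xi>))"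
    by (subst Bochner_Integration.integral_add[OF L2_mult_integrable[OF L(1,3)] integrable_mult_right[OF L2_mult_integrable[OF L(2,3)]]])
       simp
  finally show ?thesis by (simp add: energy_def add_divide_distrib)
qed

lemma energy_bound:
  assumes u: "u \<in> Hs s" and v: "v \<in> Hs s" and s: "s \<ge> 0"
  shows "\<bar>energy s u v\<bar> \<le> Hs_norm s u * Hs_norm s v"
proof -
  let ?I = "LINT \<xi>|lebesgue. flap s u \<xi> * cnj (flap s v \<xi>)"
  have "cmod ?I \<le> l2norm (flap s u) * l2norm (\<lambda>\<xi>. cnj (flap s v \<xi>))"
    by (rule l2norm_integral_mult[OF flap_L2[OF u s] L2_cnj[OF flap_L2[OF v s]]])
  also have "l2norm (\<lambda>\<xi>. cnj (flap s v \<xi>)) = l2norm (flap s v)" by (simp add: l2norm_def)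
  also have "l2norm (flap s u) * l2norm (flap s v) \<le> Hs_norm s u * Hs_norm s v"
    by (intro mult_mono l2norm_flap_le u v s) auto
  finally have I: "\<bar>Re ?I\<bar> \<le> Hs_norm s u * Hs_norm s v" using abs_Re_le_cmod order_trans by blast
  have "1 \<le> (2 * pi) ^ CARD('a)" using pi_ge_two by (intro one_le_power) simp
  then have "\<bar>Re ?I\<bar> / (2 * pi) ^ CARD('a) \<le> \<bar>Re ?I\<bar> / 1" by (intro divide_left_mono) auto
  then show ?thesis using I by (simp add: energy_def abs_divide)
qed

text \<open>
  The multiplier maps transforms of real functions to Hermitian functions, so a real valued
  function with the prescribed transform exists and the choice in \<open>frac_laplacian\<close> is meaningful.
\<close>

lemma frac_laplacian_spec:
  fixes u :: "real^'n \<Rightarrow> real"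
  assumes u: "u \<in> Hs s" and s: "s \<ge> 0"
  shows "frac_laplacian (s / 2) u \<in> L2" "AE \<xi> in lebesgue. fourier (frac_laplacian (s / 2) u) \<xi> = flap s u \<xi>"
proof -
  have "AE \<xi> in lebesgue. flap s u (- \<xi>) = cnj (flap s u \<xi>)"
    using fourier_uminus[OF Hs_L2[OF u]] by eventually_elim (simp add: flap_def)
  then obtain v :: "real^'n \<Rightarrow> real" where "v \<in> L2" "AE \<xi> in lebesgue. fourier v \<xi> = flap s u \<xi>"
    using fourier_surj_hermitian[OF flap_L2[OF u s]] by blast
  then have "v \<in> L2 \<and> (AE \<xi> in lebesgue. fourier v \<xi> = of_real (norm \<xi> powr (2 * (s / 2))) * fourier u \<xi>)"
    by (simp add: flap_def)
  then have "frac_laplacian (s / 2) u \<in> L2 \<and> (AE \<xi> in lebesgue. fourier (frac_laplacian (s / 2) u) \<xi> = of_real (norm \<xi> powr (2 * (s / 2))) * fourier u \<xi>)"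
    unfolding frac_laplacian_def by (rule someI[of "\<lambda>v. v \<in> L2 \<and> (AE \<xi> in lebesgue. fourier v \<xi> = of_real (norm \<xi> powr (2 * (s / 2))) * fourier u \<xi>)"])
  then show "frac_laplacian (s / 2) u \<in> L2" "AE \<xi> in lebesgue. fourier (frac_laplacian (s / 2) u) \<xi> = flap s u \<xi>"
    by (auto simp: flap_def)
qed

lemma integral_flap:
  fixes u v :: "real^'n \<Rightarrow> real"
  assumes u: "u \<in> Hs s" and v: "v \<in> Hs s" and s: "s \<ge> 0"
  shows "(LINT \<xi>|lebesgue. flap s u \<xi> * cnj (flap s v \<xi>)) =
     of_real ((2 * pi) ^ CARD('n) * (LINT x|lebesgue. frac_laplacian (s / 2) u x * frac_laplacian (s / 2) v x))"
proof -
  let ?u = "frac_laplacian (s / 2) u" and ?v = "frac_laplacian (s / 2) v"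
  note U = frac_laplacian_spec[OF u s] and V = frac_laplacian_spec[OF v s]
  have "(LINT \<xi>|lebesgue. flap s u \<xi> * cnj (flap s v \<xi>)) = (LINT \<xi>|lebesgue. fourier ?u \<xi> * cnj (fourier ?v \<xi>))"
  proof (rule integral_cong_AE)
    show "AE \<xi> in lebesgue. flap s u \<xi> * cnj (flap s v \<xi>) = fourier ?u \<xi> * cnj (fourier ?v \<xi>)"
      using U(2) V(2) by eventually_elim simp
  qed (intro borel_measurable_integrable L2_mult_integrable L2_cnj flap_L2 fourier_L2 U V u v s)+
  then show ?thesis using fourier_parseval[OF U(1) V(1)] by simp
qed

lemma bilinear_form_eq:
  assumes "v \<in> Hs s" "w \<in> Hs s" "s \<ge> 0"
  shows "bilinear_form s \<Omega> q v w = energy s v w + (LINT x:\<Omega>|lebesgue. q x * v x * w x)"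
  unfolding bilinear_form_def energy_def integral_flap[OF assms] by simp

lemma frac_laplacian_distr_eq:
  fixes u \<phi> :: "real^'n \<Rightarrow> real"
  assumes u: "u \<in> Hs s" and \<phi>: "\<phi> \<in> Hs s" and s: "s \<ge> 0" and z: "\<And>x. x \<notin> cball 0 R \<Longrightarrow> \<phi> x = 0"
  shows "frac_laplacian_distr s u \<phi> = of_real (energy s u \<phi>)"
proof -
  let ?K = "(2 * pi) ^ CARD('n)"
  have inv: "inverse_fourier_integral (\<lambda>x. of_real (\<phi> x)) \<xi> = cnj (fourier_integral (\<lambda>x. of_real (\<phi> x)) \<xi>) / of_real ?K" for \<xi>
    unfolding fourier_integral_uminus[symmetric] unfolding inverse_fourier_integral_def fourier_integral_def
    by (simp add: inner_commute)
  have sq: "norm \<xi> powr (2 * s) = norm \<xi> powr s * norm \<xi> powr s" for \<xi> :: "real^'n"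
    by (simp flip: powr_add)
  have f: "AE \<xi> in lebesgue. fourier \<phi> \<xi> = fourier_integral (\<lambda>x. of_real (\<phi> x)) \<xi>"
    by (rule fourier_eq_fourier_integral[OF Hs_L2[OF \<phi>] z])
  have "frac_laplacian_distr s u \<phi> = (LINT \<xi>|lebesgue. flap s u \<xi> * cnj (flap s \<phi> \<xi>) / of_real ?K)"
    unfolding frac_laplacian_distr_def inv
  proof (rule integral_cong_AE)
    show "AE \<xi> in lebesgue. of_real (norm \<xi> powr (2 * s)) * fourier u \<xi> * (cnj (fourier_integral (\<lambda>x. of_real (\<phi> x)) \<xi>) / of_real ?K) = flap s u \<xi> * cnj (flap s \<phi> \<xi>) / of_real ?K"
      using f
      by eventually_elim (simp add: flap_def sq)
    show "(\<lambda>\<xi>. flap s u \<xi> * cnj (flap s \<phi> \<xi>) / of_real ?K) \<in> borel_measurable lebesgue"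
      by (intro borel_measurable_integrable integrable_divide L2_mult_integrable L2_cnj flap_L2 u \<phi> s)
    have m: "fourier_integral (\<lambda>x. of_real (\<phi> x)) \<in> borel_measurable lebesgue"
      by (rule fourier_integral_measurable[OF L2_measurable[OF L2_of_real[OF Hs_L2[OF \<phi>]]]])
    show "(\<lambda>\<xi>. of_real (norm \<xi> powr (2 * s)) * fourier u \<xi> * (cnj (fourier_integral (\<lambda>x. of_real (\<phi> x)) \<xi>) / of_real ?K)) \<in> borel_measurable lebesgue"
      by (intro borel_measurable_times borel_measurable_divide borel_measurable_const weight_measurable
          L2_measurable fourier_L2 Hs_L2[OF u] measurable_compose[OF m measurable_cnj])
  qed
  also have "\<dots> = of_real (energy s u \<phi>)"
    unfolding energy_def integral_flap[OF u \<phi> s] Bochner_Integration.integral_divide_zero by simp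
  finally show ?thesis .
qed

section \<open>Test functions\<close>

lemma C_k_SucI:
  assumes "\<And>x. (f has_derivative D x) (at x)" "\<And>v. C_k k (\<lambda>x. D x v)"
  shows "C_k (Suc k) f"
proof -
  have "frechet_derivative f (at x) = D x" for x using frechet_derivative_at[OF assms(1)] by simp
  then show ?thesis using assms by (auto simp: differentiable_def)
qed

lemma C_k_SucD:
  assumes "C_k (Suc k) f"
  shows "\<exists>D. (\<forall>x. (f has_derivative D x) (at x)) \<and> (\<forall>v. C_k k (\<lambda>x. D x v))"
  using assms by (intro exI[of _ "\<lambda>x. frechet_derivative f (at x)"]) (auto simp: frechet_derivative_works[symmetric])

lemma C_k_Suc_imp: "C_k (Suc k) f \<Longrightarrow> C_k k f"
proof (induction k arbitrary: f)
  case 0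
  then have "\<forall>x. f differentiable (at x)" by simp
  then show ?case by (auto intro!: continuous_at_imp_continuous_on differentiable_imp_continuous_within)
next
  case (Suc k)
  obtain D where D: "\<And>x. (f has_derivative D x) (at x)" "\<And>v. C_k (Suc k) (\<lambda>x. D x v)"
    using C_k_SucD[OF Suc.prems] by blast
  show ?case by (rule C_k_SucI[OF D(1) Suc.IH[OF D(2)]])
qed

lemma C_k_const: "C_k k (\<lambda>x. c)"
proof (induction k arbitrary: c)
  case (Suc k) show ?case by (rule C_k_SucI[OF has_derivative_const Suc.IH])
qed simp

lemma C_k_add:
  fixes f g :: "'a::real_normed_vector \<Rightarrow> real"
  shows "C_k k f \<Longrightarrow> C_k k g \<Longrightarrow> C_k k (\<lambda>x. f x + g x)"
proof (induction k arbitrary: f g)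
  case 0 then show ?case by (auto intro: continuous_intros)
next
  case (Suc k)
  obtain D where D: "\<And>x. (f has_derivative D x) (at x)" "\<And>v. C_k k (\<lambda>x. D x v)"
    using C_k_SucD[OF Suc.prems(1)] by blast
  obtain E where E: "\<And>x. (g has_derivative E x) (at x)" "\<And>v. C_k k (\<lambda>x. E x v)"
    using C_k_SucD[OF Suc.prems(2)] by blast
  show ?case by (rule C_k_SucI[OF has_derivative_add[OF D(1) E(1)] Suc.IH[OF D(2) E(2)]])
qed

lemma C_k_mult:
  fixes f g :: "'a::real_normed_vector \<Rightarrow> real"
  shows "C_k k f \<Longrightarrow> C_k k g \<Longrightarrow> C_k k (\<lambda>x. f x * g x)"
proof (induction k arbitrary: f g)
  case 0 then show ?case by (auto intro: continuous_intros)
next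
  case (Suc k)
  obtain D where D: "\<And>x. (f has_derivative D x) (at x)" "\<And>v. C_k k (\<lambda>x. D x v)"
    using C_k_SucD[OF Suc.prems(1)] by blast
  obtain E where E: "\<And>x. (g has_derivative E x) (at x)" "\<And>v. C_k k (\<lambda>x. E x v)"
    using C_k_SucD[OF Suc.prems(2)] by blast
  show ?case
    by (rule C_k_SucI[OF has_derivative_mult[OF D(1) E(1)]])
       (intro C_k_add Suc.IH D(2) E(2) C_k_Suc_imp[OF Suc.prems(1)] C_k_Suc_imp[OF Suc.prems(2)])
qed

lemma C_k_prod:
  fixes f :: "'i \<Rightarrow> 'a::real_normed_vector \<Rightarrow> real"
  shows "finite I \<Longrightarrow> (\<And>i. i \<in> I \<Longrightarrow> C_k k (f i)) \<Longrightarrow> C_k k (\<lambda>x. \<Prod>i\<in>I. f i x)"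
  by (induction I rule: finite_induct) (auto intro: C_k_mult C_k_const)

text \<open>
  The flat functions \<open>t\<^sup>-\<^sup>m exp (-1/t)\<close>, extended by zero. The derivative of one is a linear
  combination of two others, so all of them are smooth.
\<close>

definition flat :: "nat \<Rightarrow> real \<Rightarrow> real" where
  "flat m t = (if t > 0 then (1 / t) ^ m * exp (- (1 / t)) else 0)"

lemma flat_tendsto_0: "(flat m \<longlongrightarrow> 0) (at 0)"
proof -
  have "((\<lambda>x::real. x ^ m / exp x) \<longlongrightarrow> 0) at_top" by (rule tendsto_power_div_exp_0)
  then have "((\<lambda>t::real. (inverse t) ^ m / exp (inverse t)) \<longlongrightarrow> 0) (at_right 0)"
    by (rule filterlim_compose) (rule filterlim_inverse_at_top_right)
  then have "(flat m \<longlongrightarrow> 0) (at_right 0)"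
  proof (rule Lim_transform_eventually)
    show "\<forall>\<^sub>F t in at_right 0. (inverse t) ^ m / exp (inverse t) = flat m t"
      unfolding eventually_at_right_field by (auto intro!: exI[of _ 1] simp: flat_def exp_minus divide_simps)
  qed
  moreover have "(flat m \<longlongrightarrow> 0) (at_left 0)"
    by (rule tendsto_eventually) (auto simp: eventually_at_left_field flat_def intro!: exI[of _ "-1"])
  ultimately show ?thesis by (simp add: filterlim_at_split)
qed

lemma flat_has_derivative: "(flat m has_real_derivative (- real m * flat (m + 1) t + flat (m + 2) t)) (at t)"
proof -
  consider "t > 0" | "t < 0" | "t = 0" by linarith
  then show ?thesis
  proof cases
    case 1
    have "((\<lambda>t. (1 / t) ^ m * exp (- (1 / t))) has_real_derivative (- real m * flat (m + 1) t + flat (m + 2) t)) (at t)"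
    proof -
      define c where "c = 1 / t"
      have p: "((\<lambda>t. (1 / t) ^ m) has_real_derivative - real m * (1 / t) ^ (m + 1)) (at t)" for m
      proof (induction m)
        case (Suc m)
        have "((\<lambda>t. 1 / t) has_real_derivative - ((1 / t) ^ 2)) (at t)"
          using 1 by (auto intro!: derivative_eq_intros simp: power2_eq_square)
        from DERIV_mult[OF this Suc.IH]
        have "((\<lambda>t. 1 / t * (1 / t) ^ m) has_real_derivative - real (Suc m) * (1 / t) ^ (Suc m + 1)) (at t)"
          by (rule DERIV_cong) (simp only: c_def[symmetric], simp add: algebra_simps power2_eq_square)
        then show ?case by simp
      qed auto
      have e: "((\<lambda>t. exp (- (1 / t))) has_real_derivative exp (- (1 / t)) * (1 / t) ^ 2) (at t)"
        using 1 by (auto intro!: derivative_eq_intros simp: power2_eq_square)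
      show ?thesis
        by (rule DERIV_cong[OF DERIV_mult[OF p e]]) (use 1 in \<open>simp add: flat_def power_add power2_eq_square algebra_simps\<close>)
    qed
    then show ?thesis
      by (rule DERIV_cong_ev[THEN iffD1, rotated 3, OF _ refl _ refl])
         (use eventually_nhds_in_open[of "{0<..}" t] 1 in \<open>auto simp: flat_def elim!: eventually_mono\<close>)
  next
    case 2
    have "((\<lambda>t. 0) has_real_derivative (- real m * flat (m + 1) t + flat (m + 2) t)) (at t)"
      using 2 by (auto simp: flat_def)
    then show ?thesis
      by (rule DERIV_cong_ev[THEN iffD1, rotated 3, OF _ refl _ refl])
         (use eventually_nhds_in_open[of "{..<0}" t] 2 in \<open>auto simp: flat_def elim!: eventually_mono\<close>)
  next
    case 3
    have "((\<lambda>h. (flat m (0 + h) - flat m 0) / h) \<longlongrightarrow> 0) (at 0)"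
    proof (rule Lim_transform_eventually[OF flat_tendsto_0[of "Suc m"]])
      show "\<forall>\<^sub>F h in at 0. flat (Suc m) h = (flat m (0 + h) - flat m 0) / h"
        by (auto simp: flat_def eventually_at intro!: exI[of _ 1])
    qed
    then show ?thesis unfolding 3 by (simp add: DERIV_def flat_def)
  qed
qed

lemma C_k_flat:
  fixes b :: "'a::real_inner"
  shows "C_k k (\<lambda>x. flat m (c * (x \<bullet> b) + d))"
proof (induction k arbitrary: m)
  case 0
  have "continuous_on UNIV (flat m)"
    by (intro continuous_at_imp_continuous_on ballI DERIV_isCont[OF flat_has_derivative])
  then have "continuous_on UNIV (\<lambda>x. flat m (c * (x \<bullet> b) + d))"
    by (rule continuous_on_compose2) (auto intro!: continuous_intros)
  then show ?case by simp
next
  case (Suc k)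
  show ?case
  proof (rule C_k_SucI)
    fix x :: 'a
    have "((\<lambda>x. c * (x \<bullet> b) + d) has_derivative (\<lambda>v. c * (v \<bullet> b))) (at x)"
      by (auto intro!: derivative_eq_intros)
    from DERIV_compose_FDERIV[OF flat_has_derivative this]
    show "((\<lambda>x. flat m (c * (x \<bullet> b) + d)) has_derivative
       (\<lambda>v. c * (v \<bullet> b) * (- real m * flat (m + 1) (c * (x \<bullet> b) + d) + flat (m + 2) (c * (x \<bullet> b) + d)))) (at x)" .
  qed (intro C_k_mult C_k_add C_k_const Suc.IH)
qed

definition bump :: "real \<Rightarrow> real^'n \<Rightarrow> real^'n \<Rightarrow> real^'n \<Rightarrow> real" where
  "bump k a b x = (\<Prod>i\<in>Basis. flat 0 (k * (x \<bullet> i) + - (k * (a \<bullet> i))) * flat 0 (- k * (x \<bullet> i) + k * (b \<bullet> i)))"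

lemma flat0_bounds: "0 \<le> flat 0 t" "flat 0 t \<le> 1"
  by (auto simp: flat_def)

lemma bump_bounds: "0 \<le> bump k a b x" "bump k a b x \<le> 1"
  unfolding bump_def
  by (intro prod_nonneg prod_le_1 conjI ballI mult_nonneg_nonneg mult_le_one flat0_bounds)+

lemma bump_nz: "k > 0 \<Longrightarrow> bump k a b x \<noteq> 0 \<Longrightarrow> x \<in> box a b"
proof -
  assume k: "k > 0" and nz: "bump k a b x \<noteq> 0"
  have "a \<bullet> i < x \<bullet> i \<and> x \<bullet> i < b \<bullet> i" if "i \<in> Basis" for i
  proof -
    have "flat 0 (k * (x \<bullet> i) + - (k * (a \<bullet> i))) \<noteq> 0" "flat 0 (- k * (x \<bullet> i) + k * (b \<bullet> i)) \<noteq> 0"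
      using nz that unfolding bump_def by auto
    then have "k * (a \<bullet> i) < k * (x \<bullet> i)" "k * (x \<bullet> i) < k * (b \<bullet> i)"
      by (auto simp: flat_def split: if_splits)
    then show ?thesis using k by simp
  qed
  then show "x \<in> box a b" by (simp add: mem_box)
qed

lemma Cc_inftyI:
  assumes "smooth \<phi>" "\<And>x. \<phi> x \<noteq> 0 \<Longrightarrow> x \<in> K" "compact K" "K \<subseteq> U"
  shows "\<phi> \<in> Cc_infty U"
proof -
  have sub: "closure {x. \<phi> x \<noteq> 0} \<subseteq> K"
    by (rule closure_minimal) (use assms compact_imp_closed in auto)
  then have "compact (closure {x. \<phi> x \<noteq> 0})"
    using compact_Int_closed[OF assms(3) closed_closure[of "{x. \<phi> x \<noteq> 0}"]] by (simp add: inf.absorb2)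
  then show ?thesis using sub assms(1,4) by (auto simp: Cc_infty_def)
qed

lemma bump_Cc_infty: "k > 0 \<Longrightarrow> cbox a b \<subseteq> U \<Longrightarrow> bump k a b \<in> Cc_infty U"
proof (rule Cc_inftyI[where K = "cbox a b"])
  show "smooth (bump k a b)"
    unfolding smooth_def bump_def[abs_def] by (intro allI C_k_prod C_k_mult C_k_flat) auto
  show "k > 0 \<Longrightarrow> bump k a b x \<noteq> 0 \<Longrightarrow> x \<in> cbox a b" for x
    using bump_nz box_subset_cbox by blast
qed auto

text \<open>
  For large \<open>k\<close> the arguments of the flat functions are large inside the box, where these functions
  tend to 1.
\<close>

lemma bump_tendsto:
  fixes a b x :: "real^'n"
  shows "(\<lambda>k. bump (real (Suc k)) a b x) \<longlonglongrightarrow> indicator (box a b) x"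
proof (cases "x \<in> box a b")
  case False
  then have "bump (real (Suc k)) a b x = 0" for k using bump_nz[of "real (Suc k)" a b x] by fastforce
  then show ?thesis using False by simp
next
  case True
  have one: "(\<lambda>k. flat 0 (real (Suc k) * c)) \<longlonglongrightarrow> 1" if "c > 0" for c
  proof -
    have "(\<lambda>k. 1 / real (Suc k)) \<longlonglongrightarrow> 0" by (rule one_over_Suc_tendsto_0)
    then have "(\<lambda>k. exp (- (1 / real (Suc k) * (1 / c)))) \<longlonglongrightarrow> exp (- (0 * (1 / c)))"
      by (intro tendsto_intros)
    then show ?thesis using that by (simp add: flat_def)
  qed
  have e: "bump k a b x = (\<Prod>i\<in>Basis. flat 0 (k * ((x - a) \<bullet> i)) * flat 0 (k * ((b - x) \<bullet> i)))" for k
    unfolding bump_def by (intro prod.cong) (simp_all add: inner_diff_left algebra_simps)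
  have "(\<lambda>k. bump (real (Suc k)) a b x) \<longlonglongrightarrow> (\<Prod>i\<in>(Basis :: (real^'n) set). 1 * 1)"
    unfolding e by (intro tendsto_prod tendsto_mult one) (use True in \<open>auto simp: mem_box inner_diff_left\<close>)
  then show ?thesis using True by simp
qed

lemma Cc_infty_C_k: "\<phi> \<in> Cc_infty U \<Longrightarrow> C_k k \<phi>"
  by (simp add: Cc_infty_def smooth_def)

lemma Cc_infty_continuous: "\<phi> \<in> Cc_infty U \<Longrightarrow> continuous_on UNIV \<phi>"
  using Cc_infty_C_k[of \<phi> U 0] by simp

lemma Cc_infty_support: "\<phi> \<in> Cc_infty U \<Longrightarrow> \<phi> x \<noteq> 0 \<Longrightarrow> x \<in> U"
  unfolding Cc_infty_def using closure_subset by fastforce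

lemma Cc_infty_bounded_support:
  fixes \<phi> :: "real^'n \<Rightarrow> real"
  assumes "\<phi> \<in> Cc_infty U" obtains R where "R > 0" "\<And>x. x \<notin> cball 0 R \<Longrightarrow> \<phi> x = 0"
proof -
  have "bounded (closure {x. \<phi> x \<noteq> 0})" using assms by (auto simp: Cc_infty_def compact_imp_bounded)
  then obtain R where R: "R > 0" "\<And>x. x \<in> closure {x. \<phi> x \<noteq> 0} \<Longrightarrow> norm x \<le> R" unfolding bounded_pos by auto
  show ?thesis
  proof (rule that[OF R(1)])
    fix x :: "real^'n" assume "x \<notin> cball 0 R"
    then show "\<phi> x = 0" using R(2)[of x] closure_subset[of "{x. \<phi> x \<noteq> 0}"] by auto
  qed
qed

lemma Cc_infty_lin:
  assumes "\<phi> \<in> Cc_infty U" "\<psi> \<in> Cc_infty U" shows "(\<lambda>x. \<phi> x + c * \<psi> x) \<in> Cc_infty U"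
proof (rule Cc_inftyI[where K = "closure {x. \<phi> x \<noteq> 0} \<union> closure {x. \<psi> x \<noteq> 0}"])
  show "smooth (\<lambda>x. \<phi> x + c * \<psi> x)"
    unfolding smooth_def
    by (intro allI C_k_add C_k_mult C_k_const Cc_infty_C_k[OF assms(1)] Cc_infty_C_k[OF assms(2)])
  fix x assume "\<phi> x + c * \<psi> x \<noteq> 0"
  then have "\<phi> x \<noteq> 0 \<or> \<psi> x \<noteq> 0" by auto
  then show "x \<in> closure {x. \<phi> x \<noteq> 0} \<union> closure {x. \<psi> x \<noteq> 0}"
    using closure_subset[of "{x. \<phi> x \<noteq> 0}"] closure_subset[of "{x. \<psi> x \<noteq> 0}"] by auto
qed (use assms in \<open>auto simp: Cc_infty_def compact_Un\<close>)

lemma Cc_infty_zero: "(\<lambda>x. 0) \<in> Cc_infty U"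
  by (rule Cc_inftyI[where K = "{}"]) (auto simp: smooth_def C_k_const)

lemma Cc_infty_L2: "\<phi> \<in> Cc_infty U \<Longrightarrow> \<phi> \<in> L2"
  using Cc_infty_bounded_support[of \<phi> U] continuous_compact_support_L2[OF Cc_infty_continuous[of \<phi> U]]
  by blast

lemma Cc_infty_Lipschitz:
  fixes \<phi> :: "real^'n \<Rightarrow> real"
  assumes "\<phi> \<in> Cc_infty U"
  obtains L where "L \<ge> 0" "\<And>x y. \<bar>\<phi> x - \<phi> y\<bar> \<le> L * norm (x - y)"
proof -
  obtain D where D: "\<And>x. (\<phi> has_derivative D x) (at x)" and "\<And>v. C_k 0 (\<lambda>x. D x v)"
    using C_k_SucD[OF Cc_infty_C_k[OF assms, of "Suc 0"]] by blast
  then have C: "\<And>v. continuous_on UNIV (\<lambda>x. D x v)" by simp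
  obtain R where R: "R > 0" "\<And>x. x \<notin> cball 0 R \<Longrightarrow> \<phi> x = 0" using Cc_infty_bounded_support[OF assms] by blast
  have Dz: "D x v = 0" if x: "x \<notin> cball 0 R" for x v
  proof -
    have "((\<lambda>x. 0) has_derivative D x) (at x)"
      by (rule has_derivative_transform_within_open[OF D open_Compl[OF closed_cball[of 0 R]]]) (use x R in auto)
    then have "D x = (\<lambda>_. 0)" using has_derivative_const has_derivative_unique by blast
    then show ?thesis by simp
  qed
  have "\<exists>M. M > 0 \<and> (\<forall>x. \<bar>D x i\<bar> \<le> M)" for i
    using continuous_compact_support_bounded[OF C[of i] Dz] by (metis real_norm_def)
  then obtain M where M: "\<And>i. M i > 0" "\<And>i x. \<bar>D x i\<bar> \<le> M i" by metis
  define L where "L = (\<Sum>i\<in>(Basis :: (real^'n) set). M i)"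
  have L: "L \<ge> 0" unfolding L_def using M(1) by (intro sum_nonneg) (auto intro: less_imp_le)
  have bl: "bounded_linear (D x)" for x using D by (rule has_derivative_bounded_linear)
  have on: "onorm (D x) \<le> L" for x
  proof (rule onorm_bound[OF L])
    fix v
    interpret bounded_linear "D x" by (rule bl)
    have "D x v = D x (\<Sum>i\<in>Basis. (v \<bullet> i) *\<^sub>R i)" by (simp add: euclidean_representation)
    also have "\<dots> = (\<Sum>i\<in>Basis. (v \<bullet> i) * D x i)" by (simp add: sum scaleR)
    also have "norm \<dots> \<le> (\<Sum>i\<in>Basis. norm v * M i)"
      by (rule sum_norm_le) (auto simp: abs_mult intro!: mult_mono M Basis_le_norm)
    finally show "norm (D x v) \<le> L * norm v" by (simp add: L_def sum_distrib_left mult.commute)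
  qed
  have "norm (\<phi> x - \<phi> y) \<le> L * norm (x - y)" for x y
    by (rule differentiable_bound[of UNIV \<phi> D]) (auto intro: D on has_derivative_at_withinI)
  then show ?thesis using L by (intro that[of L]) auto
qed

lemma fourier_integral_translate:
  fixes u :: "real^'n \<Rightarrow> complex"
  assumes u: "continuous_on UNIV u"
  shows "fourier_integral (\<lambda>x. u (h + x)) \<xi> = cis (h \<bullet> \<xi>) * fourier_integral u \<xi>"
proof -
  have [measurable]: "u \<in> borel_measurable borel" using u by (rule borel_measurable_continuous_onI)
  have "(LINT y|lebesgue. cis (- (y \<bullet> \<xi>)) * u y) = 1 ^ CARD('n) *\<^sub>R (LINT x|lebesgue. cis (- ((h + 1 *\<^sub>R x) \<bullet> \<xi>)) * u (h + 1 *\<^sub>R x))"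
    by (rule lebesgue_integral_affine) auto
  also have "\<dots> = (LINT x|lebesgue. cis (- (h \<bullet> \<xi>)) * (cis (- (x \<bullet> \<xi>)) * u (h + x)))"
    by (simp add: inner_add_left cis_mult mult.assoc[symmetric])
  finally have "fourier_integral u \<xi> = cis (- (h \<bullet> \<xi>)) * fourier_integral (\<lambda>x. u (h + x)) \<xi>"
    unfolding fourier_integral_def by simp
  then have "cis (h \<bullet> \<xi>) * fourier_integral u \<xi> = (cis (h \<bullet> \<xi>) * cis (- (h \<bullet> \<xi>))) * fourier_integral (\<lambda>x. u (h + x)) \<xi>"
    by (simp add: mult.assoc)
  then show ?thesis by (simp add: cis_mult)
qed

text \<open>
  A test function is Lipschitz, so its difference quotients are bounded in mean square. Their
  transforms converge pointwise to \<open>i \<xi>\<^sub>j\<close> times the transform of the function, which is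
  therefore square integrable by Fatou's lemma.
\<close>

lemma Cc_infty_fourier_moment:
  fixes \<phi> :: "real^'n \<Rightarrow> real"
  assumes \<phi>: "\<phi> \<in> Cc_infty U"
  shows "(\<lambda>\<xi>. of_real (\<xi> \<bullet> j) * fourier_integral (\<lambda>x. of_real (\<phi> x)) \<xi>) \<in> L2"
proof -
  obtain L where L: "L \<ge> 0" "\<And>x y. \<bar>\<phi> x - \<phi> y\<bar> \<le> L * norm (x - y)" using Cc_infty_Lipschitz[OF \<phi>] by blast
  obtain R where R: "R > 0" "\<And>x. x \<notin> cball 0 R \<Longrightarrow> \<phi> x = 0" using Cc_infty_bounded_support[OF \<phi>] by blast
  define u where "u x = complex_of_real (\<phi> x)" for x
  have uc: "continuous_on UNIV u" unfolding u_def by (intro continuous_intros Cc_infty_continuous[OF \<phi>])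
  have um: "fourier_integral u \<in> borel_measurable lebesgue"
    by (rule fourier_integral_measurable, rule measurable_completion) (simp add: borel_measurable_continuous_onI uc)
  define t where "t k = 1 / real (Suc k)" for k
  have t: "0 < t k" "t k \<le> 1" for k by (auto simp: t_def)
  define S where "S = cball (0::real^'n) (R + norm j)"
  define d where "d k x = of_real (1 / t k) * (u (t k *\<^sub>R j + x) - u x)" for k x
  have dc: "continuous_on UNIV (d k)" for k
    unfolding d_def by (intro continuous_intros continuous_on_compose2[OF uc]) auto
  have dz: "d k x = 0" if "x \<notin> cball 0 (R + norm j)" for k x
  proof -
    have "norm x > R" using that by (simp add: not_le) (meson add_increasing2 le_less_trans norm_ge_zero not_le order_less_imp_le order_refl)
    moreover have "norm (t k *\<^sub>R j + x) > R"
    proof -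
      have "norm x \<le> norm (t k *\<^sub>R j + x) + norm (t k *\<^sub>R j)" using norm_triangle_ineq4[of "t k *\<^sub>R j + x" "t k *\<^sub>R j"] by simp
      moreover have "norm (t k *\<^sub>R j) \<le> norm j" using t[of k] by (simp add: mult_left_le_one_le)
      ultimately show ?thesis using that by simp
    qed
    ultimately show ?thesis using R(2) by (simp add: d_def u_def)
  qed
  have dL: "d k \<in> L2" for k by (rule continuous_compact_support_L2[OF dc dz])
  have db: "cmod (d k x) \<le> L * norm j * norm (indicator S x :: complex)" for k x
  proof (cases "x \<in> S")
    case True
    have "cmod (u (t k *\<^sub>R j + x) - u x) \<le> L * norm (t k *\<^sub>R j)"
      using L(2)[of "t k *\<^sub>R j + x" x] by (simp add: u_def flip: of_real_diff)
    then have "cmod (d k x) \<le> 1 / t k * (L * norm (t k *\<^sub>R j))"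
      unfolding d_def norm_mult using t[of k] by (intro mult_mono) (auto simp: norm_divide)
    then show ?thesis using True t[of k] by (simp add: abs_of_pos)
  next
    case False then show ?thesis using dz by (simp add: S_def)
  qed
  have "l2norm (d k) \<le> l2norm (\<lambda>x. of_real (L * norm j) * indicator S x :: complex)" for k
    using db[of k] L by (intro l2norm_mono dL L2_cmult indicator_L2) (auto simp: S_def norm_mult abs_mult)
  note dn = this
  define F where "F k \<xi> = of_real (1 / t k) * (cis (t k * (\<xi> \<bullet> j)) - 1) * fourier_integral u \<xi>" for k \<xi>
  have ui: "integrable lebesgue u"
    by (rule L2_bounded_support_integrable[OF continuous_compact_support_L2[OF uc] lmeasurable_cball[of 0 R]]) (use R in \<open>auto simp: u_def\<close>)
  have F: "fourier_integral (d k) = F k" for k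
  proof
    fix \<xi>
    have c1: "continuous_on UNIV (\<lambda>x. u (t k *\<^sub>R j + x))" by (intro continuous_on_compose2[OF uc] continuous_intros) auto
    have z1: "u (t k *\<^sub>R j + x) = 0" if "x \<notin> cball 0 (R + norm j)" for x
    proof -
      have "norm x \<le> norm (t k *\<^sub>R j + x) + norm (t k *\<^sub>R j)" using norm_triangle_ineq4[of "t k *\<^sub>R j + x" "t k *\<^sub>R j"] by simp
      moreover have "norm (t k *\<^sub>R j) \<le> norm j" using t[of k] by (simp add: mult_left_le_one_le)
      ultimately show ?thesis using that R(2)[of "t k *\<^sub>R j + x"] by (simp add: u_def)
    qed
    have i1: "integrable lebesgue (\<lambda>x. u (t k *\<^sub>R j + x))"
      by (rule L2_bounded_support_integrable[OF continuous_compact_support_L2[OF c1 z1] lmeasurable_cball z1])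
    have "fourier_integral (d k) \<xi> = fourier_integral (\<lambda>x. 0 + of_real (1 / t k) * (u (t k *\<^sub>R j + x) - u x)) \<xi>"
      by (simp add: d_def[abs_def])
    also have "\<dots> = of_real (1 / t k) * (fourier_integral (\<lambda>x. u (t k *\<^sub>R j + x)) \<xi> - fourier_integral u \<xi>)"
      unfolding fourier_integral_diff[OF i1 ui, symmetric]
      by (subst fourier_integral_lin) (auto intro: i1 ui simp: fourier_integral_def[of "\<lambda>x. 0"])
    also have "\<dots> = F k \<xi>"
      unfolding fourier_integral_translate[OF uc] F_def by (simp add: algebra_simps inner_commute)
    finally show "fourier_integral (d k) \<xi> = F k \<xi>" .
  qed
  have FL: "F k \<in> L2" for k using plancherel_bounded_support(1)[OF dL dz] by (simp add: F)
  have Fn: "l2norm (F k) \<le> sqrt ((2 * pi) ^ CARD('n)) * l2norm (\<lambda>x. of_real (L * norm j) * indicator S x :: complex)" for k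
  proof -
    have "l2norm (fourier_integral (d k)) = sqrt ((2 * pi) ^ CARD('n)) * l2norm (d k)"
      by (rule plancherel_bounded_support(2)[OF dL dz])
    then show ?thesis unfolding F[symmetric] by (simp only:) (intro mult_left_mono dn, simp)
  qed
  have tlim: "t \<longlonglongrightarrow> 0" unfolding t_def by (rule one_over_Suc_tendsto_0)
  have lim: "(\<lambda>k. F k \<xi>) \<longlonglongrightarrow> \<i> * of_real (\<xi> \<bullet> j) * fourier_integral u \<xi>" for \<xi>
  proof -
    let ?c = "complex_of_real (\<xi> \<bullet> j)"
    have "((\<lambda>z. exp (\<i> * (z * ?c))) has_field_derivative \<i> * ?c) (at 0)"
      by (auto intro!: derivative_eq_intros)
    then have "((\<lambda>z. (exp (\<i> * (z * ?c)) - 1) / z) \<longlongrightarrow> \<i> * ?c) (at 0)"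
      by (simp add: DERIV_def)
    moreover have "filterlim (\<lambda>k. complex_of_real (t k)) (at 0) sequentially"
    proof (rule filterlim_atI)
      show "(\<lambda>k. complex_of_real (t k)) \<longlonglongrightarrow> 0" using tendsto_of_real[OF tlim, where 'a=complex] by simp
      show "\<forall>\<^sub>F k in sequentially. complex_of_real (t k) \<noteq> 0" using t(1) by (auto simp: less_imp_neq[symmetric])
    qed
    ultimately have "(\<lambda>k. (exp (\<i> * (complex_of_real (t k) * ?c)) - 1) / complex_of_real (t k)) \<longlonglongrightarrow> \<i> * ?c"
      by (rule filterlim_compose)
    then have "(\<lambda>k. (exp (\<i> * (complex_of_real (t k) * ?c)) - 1) / complex_of_real (t k) * fourier_integral u \<xi>) \<longlonglongrightarrow> \<i> * ?c * fourier_integral u \<xi>"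
      by (rule tendsto_mult[OF _ tendsto_const])
    then show ?thesis by (simp add: F_def cis_conv_exp mult.commute)
  qed
  have "(\<lambda>\<xi>. \<i> * of_real (\<xi> \<bullet> j) * fourier_integral u \<xi>) \<in> L2"
  proof (rule L2_Fatou(1)[where f = F, OF FL _ AE_I2[OF lim] always_eventually[OF allI[OF Fn]]])
    have [measurable]: "(\<lambda>\<xi>::real^'n. complex_of_real (\<xi> \<bullet> j)) \<in> borel_measurable lebesgue"
      by (rule measurable_completion) measurable
    show "(\<lambda>\<xi>. \<i> * of_real (\<xi> \<bullet> j) * fourier_integral u \<xi>) \<in> borel_measurable lebesgue"
      using um by measurable
  qed
  then have "(\<lambda>\<xi>. - \<i> * (\<i> * of_real (\<xi> \<bullet> j) * fourier_integral u \<xi>)) \<in> L2" by (rule L2_cmult)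
  then show ?thesis by (simp add: u_def[abs_def] mult.assoc[symmetric])
qed

text \<open>
  The weight satisfies \<open>(1 + \<bar>\<xi>\<bar>\<^sup>2)\<^sup>s \<le> 1 + \<bar>\<xi>\<bar>\<^sup>2\<close> for \<open>s \<le> 1\<close>, so first moments of the transform are enough.
\<close>

lemma Cc_infty_Hs:
  fixes \<phi> :: "real^'n \<Rightarrow> real"
  assumes \<phi>: "\<phi> \<in> Cc_infty U" and s: "s \<le> 1"
  shows "\<phi> \<in> Hs s"
proof -
  let ?F = "fourier_integral (\<lambda>x. of_real (\<phi> x))"
  obtain R where R: "R > 0" "\<And>x. x \<notin> cball 0 R \<Longrightarrow> \<phi> x = 0" using Cc_infty_bounded_support[OF \<phi>] by blast
  have \<phi>L: "\<phi> \<in> L2" by (rule Cc_infty_L2[OF \<phi>])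
  have f: "AE \<xi> in lebesgue. fourier \<phi> \<xi> = ?F \<xi>" by (rule fourier_eq_fourier_integral[OF \<phi>L R(2)])
  have FL: "?F \<in> L2" by (rule plancherel_bounded_support(1)[OF L2_of_real[OF \<phi>L], of R]) (simp add: R(2))
  let ?g = "\<lambda>\<xi>. (cmod (?F \<xi>))\<^sup>2 + (\<Sum>j\<in>Basis. (cmod (of_real (\<xi> \<bullet> j) * ?F \<xi>))\<^sup>2)"
  have gi: "integrable lebesgue ?g"
    by (intro Bochner_Integration.integrable_add Bochner_Integration.integrable_sum L2_integrable_sq FL Cc_infty_fourier_moment[OF \<phi>])
  have ge: "?g \<xi> = (1 + (norm \<xi>)\<^sup>2) * (cmod (?F \<xi>))\<^sup>2" for \<xi>
  proof -
    have "(norm \<xi>)\<^sup>2 = (\<Sum>j\<in>Basis. (\<xi> \<bullet> j)\<^sup>2)"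
      by (subst power2_norm_eq_inner, subst euclidean_inner) (simp add: power2_eq_square)
    then show ?thesis by (simp add: norm_mult power_mult_distrib sum_distrib_right algebra_simps)
  qed
  have "sob s \<phi> \<in> L2"
  proof (rule L2I)
    show m: "sob s \<phi> \<in> borel_measurable lebesgue" by (rule sob_measurable[OF \<phi>L])
    show "integrable lebesgue (\<lambda>\<xi>. (norm (sob s \<phi> \<xi>))\<^sup>2)"
    proof (rule Bochner_Integration.integrable_bound[OF gi])
      show "(\<lambda>\<xi>. (norm (sob s \<phi> \<xi>))\<^sup>2) \<in> borel_measurable lebesgue" using m by measurable
      show "AE \<xi> in lebesgue. norm ((norm (sob s \<phi> \<xi>))\<^sup>2) \<le> norm (?g \<xi>)"
        using f
      proof eventually_elim
        fix \<xi> assume e: "fourier \<phi> \<xi> = ?F \<xi>"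
        have "(1 + (norm \<xi>)\<^sup>2) powr s \<le> (1 + (norm \<xi>)\<^sup>2) powr 1"
          using s by (intro powr_mono) auto
        also have "\<dots> = 1 + (norm \<xi>)\<^sup>2" by (simp add: add_nonneg_nonneg)
        finally have "(1 + (norm \<xi>)\<^sup>2) powr s * (cmod (?F \<xi>))\<^sup>2 \<le> (1 + (norm \<xi>)\<^sup>2) * (cmod (?F \<xi>))\<^sup>2"
          by (intro mult_right_mono) auto
        then show "norm ((norm (sob s \<phi> \<xi>))\<^sup>2) \<le> norm (?g \<xi>)"
          unfolding ge norm_sob_sq e by (simp add: abs_of_nonneg)
      qed
    qed
  qed
  with \<phi>L show ?thesis by (simp add: Hs_iff)
qed

text \<open>
  The positive and the negative part of the function are densities of finite measures that agree on
  boxes, which generate the Borel sets and are stable under intersection.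
\<close>

lemma integral_box_zero_imp_AE_zero:
  fixes w :: "real^'n \<Rightarrow> real"
  assumes wi: "integrable lebesgue w" and z: "\<And>a b. (LINT x|lebesgue. indicator (box a b) x * w x) = 0"
  shows "AE x in lebesgue. w x = 0"
proof -
  obtain w' where w'[measurable]: "w' \<in> borel_measurable lborel" and ww: "AE x in lborel. w x = w' x"
    using completion_ex_borel_measurable_real[of w lborel] borel_measurable_integrable[OF wi] by blast
  have ww': "AE x in lebesgue. w x = w' x" using ww by (rule AE_completion)
  have w'm: "w' \<in> borel_measurable lebesgue" by (rule measurable_completion) simp
  have w'i: "integrable lborel w'"
    using wi integrable_cong_AE[OF borel_measurable_integrable[OF wi] w'm ww'] integrable_completion[OF w'] by blast
  let ?P = "density lborel (\<lambda>x. ennreal (w' x))" and ?N = "density lborel (\<lambda>x. ennreal (- w' x))"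
  have fin: "(\<integral>\<^sup>+x. ennreal (w' x) \<partial>lborel) < \<infinity>" "(\<integral>\<^sup>+x. ennreal (- w' x) \<partial>lborel) < \<infinity>"
    using w'i by (auto simp: real_integrable_def top.not_eq_extremum)
  have box: "emeasure ?P (box a b) = emeasure ?N (box a b)" for a b
  proof -
    have ib: "integrable lborel (\<lambda>x. indicator (box a b) x * w' x)"
      using integrable_mult_indicator[OF _ w'i, of "box a b"] by simp
    have "(LINT x|lborel. indicator (box a b) x * w' x) = (LINT x|lebesgue. indicator (box a b) x * w' x)"
      by (rule integral_completion[symmetric]) measurable
    also have "\<dots> = (LINT x|lebesgue. indicator (box a b) x * w x)"
      by (rule integral_cong_AE)
         (use ww' borel_measurable_integrable[OF wi] w'm in \<open>auto intro!: borel_measurable_times borel_measurable_indicator\<close>)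
    finally have i0: "(LINT x|lborel. indicator (box a b) x * w' x) = 0" using z by simp
    have "(\<integral>\<^sup>+x. ennreal (indicator (box a b) x * w' x) \<partial>lborel) = (\<integral>\<^sup>+x. ennreal (- (indicator (box a b) x * w' x)) \<partial>lborel)"
    proof -
      have f: "(\<integral>\<^sup>+x. ennreal (indicator (box a b) x * w' x) \<partial>lborel) < \<infinity>" "(\<integral>\<^sup>+x. ennreal (- (indicator (box a b) x * w' x)) \<partial>lborel) < \<infinity>"
        using ib by (auto simp: real_integrable_def top.not_eq_extremum)
      have "enn2real (\<integral>\<^sup>+x. ennreal (indicator (box a b) x * w' x) \<partial>lborel) = enn2real (\<integral>\<^sup>+x. ennreal (- (indicator (box a b) x * w' x)) \<partial>lborel)"
        using i0 real_lebesgue_integral_def[OF ib] by simp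
      then show ?thesis using f by (metis ennreal_enn2real infinity_ennreal_def)
    qed
    moreover have "emeasure ?P (box a b) = (\<integral>\<^sup>+x. ennreal (indicator (box a b) x * w' x) \<partial>lborel)"
      by (subst emeasure_density) (auto intro!: nn_integral_cong simp: indicator_def)
    moreover have "emeasure ?N (box a b) = (\<integral>\<^sup>+x. ennreal (- (indicator (box a b) x * w' x)) \<partial>lborel)"
      by (subst emeasure_density) (auto intro!: nn_integral_cong simp: indicator_def)
    ultimately show ?thesis by simp
  qed
  have "?P = ?N"
  proof (rule measure_eqI_generator_eq)
    let ?E = "range (\<lambda>(a, b). box a b :: (real^'n) set)"
    let ?A = "\<lambda>n::nat. box (- (real n *\<^sub>R One)) (real n *\<^sub>R One) :: (real^'n) set"
    show "Int_stable ?E" by (auto simp: Int_stable_def box_Int_box)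
    show "?E \<subseteq> Pow UNIV" "sets ?P = sigma_sets UNIV ?E" "sets ?N = sigma_sets UNIV ?E"
      by (simp_all add: borel_eq_box)
    show "range ?A \<subseteq> ?E" "(\<Union>i. ?A i) = UNIV" unfolding UN_box_eq_UNIV by auto
    show "emeasure ?P X = emeasure ?N X" if "X \<in> ?E" for X using that box by auto
    show "emeasure ?P (?A i) \<noteq> \<infinity>" for i
    proof -
      have "emeasure ?P (?A i) \<le> emeasure ?P (space ?P)" by (rule emeasure_mono) auto
      also have "\<dots> = (\<integral>\<^sup>+x. ennreal (w' x) \<partial>lborel)" by (subst emeasure_density) auto
      finally show ?thesis using fin(1) by (auto simp: top_unique)
    qed
  qed
  then have "AE x in lborel. ennreal (w' x) = ennreal (- w' x)"
    using fin by (subst (asm) finite_density_unique) auto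
  then have "AE x in lborel. w' x = 0"
  proof eventually_elim
    fix x assume "ennreal (w' x) = ennreal (- w' x)"
    then show "w' x = 0" by (cases "w' x \<ge> 0") (auto simp: ennreal_neg)
  qed
  then have "AE x in lebesgue. w' x = 0" by (rule AE_completion)
  with ww' show ?thesis by eventually_elim simp
qed

text \<open>
  The fundamental lemma of the calculus of variations. Bumps converge to indicator functions of
  boxes, so the function has integral zero over every box in \<open>U\<close>; countably many boxes cover \<open>U\<close>.
\<close>

lemma fundamental_lemma:
  fixes v :: "real^'n \<Rightarrow> real"
  assumes U: "open U" and vi: "\<And>a b. cbox a b \<subseteq> U \<Longrightarrow> integrable lebesgue (\<lambda>x. indicator (cbox a b) x * v x)"
    and z: "\<And>\<phi>. \<phi> \<in> Cc_infty U \<Longrightarrow> (LINT x|lebesgue. v x * \<phi> x) = 0"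
  shows "AE x in lebesgue. x \<in> U \<longrightarrow> v x = 0"
proof -
  have box0: "(LINT x|lebesgue. indicator (box a b) x * v x) = 0" if sub: "cbox a b \<subseteq> U" for a b
  proof -
    let ?w = "\<lambda>x. indicator (cbox a b) x * v x"
    have bc: "bump (real (Suc k)) a b \<in> Cc_infty U" for k by (rule bump_Cc_infty[OF _ sub]) simp
    have e: "?w x * bump (real (Suc k)) a b x = v x * bump (real (Suc k)) a b x" for k x
      using bump_nz[of "real (Suc k)" a b x] box_subset_cbox[of a b] by (auto simp: indicator_def)
    have wm: "?w \<in> borel_measurable lebesgue" using vi[OF sub] by auto
    have bm: "bump (real (Suc k)) a b \<in> borel_measurable lebesgue" for k
      by (rule L2_measurable[OF Cc_infty_L2[OF bc]])
    have "(\<lambda>k. LINT x|lebesgue. ?w x * bump (real (Suc k)) a b x) \<longlonglongrightarrow> (LINT x|lebesgue. ?w x * indicator (box a b) x)"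
    proof (rule integral_dominated_convergence)
      show "integrable lebesgue (\<lambda>x. \<bar>?w x\<bar>)" using vi[OF sub] by (rule integrable_abs)
      show "AE x in lebesgue. (\<lambda>k. ?w x * bump (real (Suc k)) a b x) \<longlonglongrightarrow> ?w x * indicator (box a b) x"
        by (rule AE_I2, rule tendsto_mult[OF tendsto_const bump_tendsto])
      show "AE x in lebesgue. norm (?w x * bump (real (Suc k)) a b x) \<le> \<bar>?w x\<bar>" for k
        using bump_bounds[of "real (Suc k)" a b] by (intro AE_I2) (simp add: abs_mult mult_left_le)
    qed (intro borel_measurable_times wm bm borel_measurable_indicator; simp)+
    also have "(\<lambda>x. ?w x * indicator (box a b) x) = (\<lambda>x. indicator (box a b) x * v x)"
      using box_subset_cbox[of a b] by (auto simp: indicator_def fun_eq_iff)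
    finally have "(\<lambda>k. 0::real) \<longlonglongrightarrow> (LINT x|lebesgue. indicator (box a b) x * v x)" unfolding e z[OF bc] .
    then show ?thesis using LIMSEQ_unique tendsto_const by blast
  qed
  obtain D where D: "countable D" "D \<subseteq> Pow U" "\<And>X. X \<in> D \<Longrightarrow> \<exists>a b. X = cbox a b" "\<Union>D = U"
    using open_countable_Union_open_cbox[OF U] by blast
  have "AE x in lebesgue. x \<in> X \<longrightarrow> v x = 0" if X: "X \<in> D" for X
  proof -
    obtain c d where cd: "X = cbox c d" using D(3)[OF X] by blast
    have sub: "cbox c d \<subseteq> U" using D(2) X cd by auto
    let ?w = "\<lambda>x. indicator (cbox c d) x * v x"
    have "AE x in lebesgue. ?w x = 0"
    proof (rule integral_box_zero_imp_AE_zero[OF vi[OF sub]])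
      fix a b :: "real^'n"
      obtain p q where pq: "box a b \<inter> box c d = box p q" "cbox a b \<inter> cbox c d = cbox p q"
        by (rule that[OF box_Int_box[of a b c d] Int_interval[of a b c d]])
      have neg: "AE x in lebesgue. x \<notin> cbox c d - box c d"
        using negligible_frontier_interval[of c d] by (intro AE_not_in) (simp add: negligible_iff_null_sets)
      have "(LINT x|lebesgue. indicator (box a b) x * ?w x) = (LINT x|lebesgue. indicator (box p q) x * v x)"
      proof (rule integral_cong_AE)
        show "AE x in lebesgue. indicator (box a b) x * ?w x = indicator (box p q) x * v x"
          using neg
        proof eventually_elim
          fix x assume "x \<notin> cbox c d - box c d"
          then show "indicator (box a b) x * ?w x = indicator (box p q) x * v x"
            using box_subset_cbox[of c d] unfolding pq(1)[symmetric] by (auto simp: indicator_def)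
        qed
        have wm: "?w \<in> borel_measurable lebesgue" using vi[OF sub] by auto
        show "(\<lambda>x. indicator (box a b) x * ?w x) \<in> borel_measurable lebesgue"
          by (intro borel_measurable_times wm borel_measurable_indicator) simp
        have "(\<lambda>x. indicator (box p q) x * v x) = (\<lambda>x. indicator (box p q) x * ?w x)"
          using box_subset_cbox[of c d] unfolding pq(1)[symmetric] by (auto simp: indicator_def fun_eq_iff)
        moreover have "(\<lambda>x. indicator (box p q) x * ?w x) \<in> borel_measurable lebesgue"
          by (intro borel_measurable_times wm borel_measurable_indicator) simp
        ultimately show "(\<lambda>x. indicator (box p q) x * v x) \<in> borel_measurable lebesgue" by simp
      qed
      also have "\<dots> = 0" by (rule box0) (use pq(2) sub in auto)
      finally show "(LINT x|lebesgue. indicator (box a b) x * ?w x) = 0" .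
    qed
    then show ?thesis by eventually_elim (auto simp: cd indicator_def split: if_splits)
  qed
  then have "AE x in lebesgue. \<forall>X\<in>D. x \<in> X \<longrightarrow> v x = 0"
    by (subst AE_ball_countable[OF D(1)]) blast
  then show ?thesis by eventually_elim (use D(4) in blast)
qed

section \<open>Unique continuation for Riesz potentials\<close>

lemma integrable_mult_continuous:
  fixes \<phi> :: "real^'n \<Rightarrow> real"
  assumes S: "compact S" and \<phi>: "integrable lebesgue \<phi>" and z: "\<And>y. y \<notin> S \<Longrightarrow> \<phi> y = 0"
    and g: "continuous_on S g"
  shows "integrable lebesgue (\<lambda>y. \<phi> y * g y)"
proof -
  obtain C where C: "\<And>y. y \<in> S \<Longrightarrow> \<bar>g y\<bar> \<le> C"
    using compact_imp_bounded[OF compact_continuous_image[OF g S]] unfolding bounded_iff by auto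
  have m: "(\<lambda>y. indicator S y *\<^sub>R g y) \<in> borel_measurable lebesgue"
  proof (rule measurable_completion)
    have "(\<lambda>y. indicator S y *\<^sub>R g y) \<in> borel_measurable borel"
      by (rule borel_measurable_continuous_on_indicator[OF borel_closed[OF compact_imp_closed[OF S]] g])
    then show "(\<lambda>y. indicator S y *\<^sub>R g y) \<in> borel_measurable lborel" by simp
  qed
  have e: "\<phi> y * g y = \<phi> y * (indicator S y *\<^sub>R g y)" for y using z[of y] by (auto simp: indicator_def)
  show ?thesis
  proof (rule Bochner_Integration.integrable_bound)
    show "integrable lebesgue (\<lambda>y. C * \<phi> y)" using \<phi> by simp
    show "(\<lambda>y. \<phi> y * g y) \<in> borel_measurable lebesgue"
      unfolding e using \<phi> m by (intro borel_measurable_times) auto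
    show "AE y in lebesgue. norm (\<phi> y * g y) \<le> norm (C * \<phi> y)"
    proof (rule AE_I2)
      fix y show "norm (\<phi> y * g y) \<le> norm (C * \<phi> y)"
      proof (cases "y \<in> S")
        case True
        have "\<bar>\<phi> y\<bar> * \<bar>g y\<bar> \<le> \<bar>\<phi> y\<bar> * \<bar>C\<bar>" using C[OF True] by (intro mult_left_mono) auto
        then show ?thesis by (simp add: abs_mult mult.commute)
      qed (simp add: z)
    qed
  qed
qed

lemma continuous_on_section:
  assumes "continuous_on (W \<times> S) (\<lambda>(x, y). \<kappa> x y)" "x \<in> W" shows "continuous_on S (\<lambda>y. \<kappa> x y)"
proof -
  have "continuous_on S (\<lambda>y. (x, y))" by (intro continuous_intros)
  then have "continuous_on S (\<lambda>y. (\<lambda>(x, y). \<kappa> x y) (x, y))"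
    by (rule continuous_on_compose2[OF assms(1)]) (use assms(2) in auto)
  then show ?thesis by simp
qed

text \<open>
  Potentials may be differentiated under the integral. The difference quotients of the kernel have
  integral zero, and by the mean value theorem they are bounded by the maximum of the derivative on
  a compact set, so dominated convergence applies.
\<close>

lemma potential_derivative_zero:
  fixes \<phi> :: "real^'n \<Rightarrow> real" and \<kappa> \<kappa>' :: "real^'n \<Rightarrow> real^'n \<Rightarrow> real"
  assumes S: "compact S" and W: "open W" and \<phi>: "integrable lebesgue \<phi>" and z: "\<And>y. y \<notin> S \<Longrightarrow> \<phi> y = 0"
    and c: "continuous_on (W \<times> S) (\<lambda>(x, y). \<kappa> x y)" and c': "continuous_on (W \<times> S) (\<lambda>(x, y). \<kappa>' x y)"
    and d: "\<And>x y. x \<in> W \<Longrightarrow> y \<in> S \<Longrightarrow> ((\<lambda>h. \<kappa> (x + h *\<^sub>R e) y) has_real_derivative \<kappa>' x y) (at 0)"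
    and zero: "\<And>x. x \<in> W \<Longrightarrow> (LINT y|lebesgue. \<phi> y * \<kappa> x y) = 0" and x: "x \<in> W"
  shows "(LINT y|lebesgue. \<phi> y * \<kappa>' x y) = 0"
proof -
  obtain r where r: "r > 0" "cball x r \<subseteq> W" using W x open_contains_cball by blast
  define \<rho> where "\<rho> = r / (1 + norm e)"
  have ne: "1 + norm e > 0" by (simp add: add_pos_nonneg)
  have \<rho>: "\<rho> > 0" using r ne by (simp add: \<rho>_def)
  have mem: "x + h *\<^sub>R e \<in> cball x r" if "\<bar>h\<bar> \<le> \<rho>" for h
  proof -
    have "\<bar>h\<bar> * norm e \<le> \<rho> * (1 + norm e)" using that by (intro mult_mono) auto
    then show ?thesis using ne by (simp add: \<rho>_def dist_norm)
  qed
  have "compact ((\<lambda>(x, y). \<kappa>' x y) ` (cball x r \<times> S))"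
    by (intro compact_continuous_image continuous_on_subset[OF c'] compact_Times compact_cball S) (use r in auto)
  then have "bounded ((\<lambda>(x, y). \<kappa>' x y) ` (cball x r \<times> S))" by (rule compact_imp_bounded)
  then obtain C where "\<And>p. p \<in> cball x r \<times> S \<Longrightarrow> norm (case p of (x, y) \<Rightarrow> \<kappa>' x y) \<le> C"
    unfolding bounded_iff by blast
  then have C: "\<bar>\<kappa>' x' y\<bar> \<le> C" if "x' \<in> cball x r" "y \<in> S" for x' y using that by force
  have sec: "continuous_on S (\<lambda>y. \<kappa> x' y)" "continuous_on S (\<lambda>y. \<kappa>' x' y)" if "x' \<in> W" for x'
    by (rule continuous_on_section[OF c that], rule continuous_on_section[OF c' that])
  define h where "h k = \<rho> / real (Suc k)" for k
  have h: "0 < h k" "h k \<le> \<rho>" for k using \<rho> by (auto simp: h_def field_simps)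
  have W': "x + t *\<^sub>R e \<in> W" if "\<bar>t\<bar> \<le> \<rho>" for t using mem[OF that] r by auto
  have hlim: "filterlim h (at 0) sequentially"
  proof (rule filterlim_atI)
    have "(\<lambda>k. \<rho> * (1 / real (Suc k))) \<longlonglongrightarrow> \<rho> * 0"
      using one_over_Suc_tendsto_0 by (intro tendsto_intros) simp
    then show "h \<longlonglongrightarrow> 0" by (simp add: h_def[abs_def])
    show "\<forall>\<^sub>F k in sequentially. h k \<noteq> 0" using h(1) by (auto simp: less_imp_neq[symmetric])
  qed
  let ?q = "\<lambda>k y. (\<kappa> (x + h k *\<^sub>R e) y - \<kappa> x y) / h k"
  have ik1: "integrable lebesgue (\<lambda>y. \<phi> y * \<kappa> x' y)" if "x' \<in> W" for x'
    by (rule integrable_mult_continuous[OF S \<phi> z sec(1)[OF that]])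
  have ik2: "integrable lebesgue (\<lambda>y. \<phi> y * \<kappa>' x' y)" if "x' \<in> W" for x'
    by (rule integrable_mult_continuous[OF S \<phi> z sec(2)[OF that]])
  have q0: "(LINT y|lebesgue. \<phi> y * ?q k y) = 0" for k
  proof -
    have w: "x + h k *\<^sub>R e \<in> W" using h[of k] by (intro W') simp
    have "(LINT y|lebesgue. \<phi> y * ?q k y) = (LINT y|lebesgue. (\<phi> y * \<kappa> (x + h k *\<^sub>R e) y - \<phi> y * \<kappa> x y) / h k)"
      by (simp add: algebra_simps diff_divide_distrib)
    also have "\<dots> = 0" using ik1[OF w] ik1[OF x] zero[OF w] zero[OF x] by simp
    finally show ?thesis .
  qed
  have qb: "\<bar>?q k y\<bar> \<le> C" if y: "y \<in> S" for k y
  proof -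
    have der: "((\<lambda>h. \<kappa> (x + h *\<^sub>R e) y) has_real_derivative \<kappa>' (x + t *\<^sub>R e) y) (at t)" if "\<bar>t\<bar> \<le> \<rho>" for t
    proof -
      have "((\<lambda>h. \<kappa> ((x + t *\<^sub>R e) + h *\<^sub>R e) y) has_real_derivative \<kappa>' (x + t *\<^sub>R e) y) (at 0)"
        by (rule d[OF W'[OF that] y])
      then have "((\<lambda>h. \<kappa> (x + (h + t) *\<^sub>R e) y) has_real_derivative \<kappa>' (x + t *\<^sub>R e) y) (at 0)"
        by (simp add: algebra_simps)
      then show ?thesis using DERIV_shift[of "\<lambda>h. \<kappa> (x + h *\<^sub>R e) y" "\<kappa>' (x + t *\<^sub>R e) y" 0 t] by simp
    qed
    obtain t where t: "0 < t" "t < h k" "\<kappa> (x + h k *\<^sub>R e) y - \<kappa> (x + 0 *\<^sub>R e) y = (h k - 0) * \<kappa>' (x + t *\<^sub>R e) y"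
      using MVT2[of 0 "h k" "\<lambda>h. \<kappa> (x + h *\<^sub>R e) y" "\<lambda>t. \<kappa>' (x + t *\<^sub>R e) y"] der h[of k] by fastforce
    then have "?q k y = \<kappa>' (x + t *\<^sub>R e) y" using h[of k] by simp
    then show ?thesis using C[OF mem y, of t] t h[of k] by simp
  qed
  have "(\<lambda>k. LINT y|lebesgue. \<phi> y * ?q k y) \<longlonglongrightarrow> (LINT y|lebesgue. \<phi> y * \<kappa>' x y)"
  proof (rule integral_dominated_convergence)
    show "integrable lebesgue (\<lambda>y. \<bar>\<phi> y\<bar> * C)" using \<phi> by simp
    show "(\<lambda>y. \<phi> y * \<kappa>' x y) \<in> borel_measurable lebesgue" using ik2[OF x] by auto
    show "(\<lambda>y. \<phi> y * ?q k y) \<in> borel_measurable lebesgue" for k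
    proof -
      have w: "x + h k *\<^sub>R e \<in> W" using h[of k] by (intro W') simp
      have "(\<lambda>y. (\<phi> y * \<kappa> (x + h k *\<^sub>R e) y - \<phi> y * \<kappa> x y) / h k) \<in> borel_measurable lebesgue"
        using ik1[OF w] ik1[OF x] by auto
      then show ?thesis by (simp add: algebra_simps diff_divide_distrib)
    qed
    show "AE y in lebesgue. (\<lambda>k. \<phi> y * ?q k y) \<longlonglongrightarrow> \<phi> y * \<kappa>' x y"
    proof (rule AE_I2)
      fix y show "(\<lambda>k. \<phi> y * ?q k y) \<longlonglongrightarrow> \<phi> y * \<kappa>' x y"
      proof (cases "y \<in> S")
        case True
        have "((\<lambda>h. (\<kappa> (x + h *\<^sub>R e) y - \<kappa> x y) / h) \<longlongrightarrow> \<kappa>' x y) (at 0)"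
          using d[OF x True] by (simp add: DERIV_def)
        then show ?thesis by (intro tendsto_mult tendsto_const filterlim_compose[OF _ hlim])
      qed (simp add: z)
    qed
    show "AE y in lebesgue. norm (\<phi> y * ?q k y) \<le> \<bar>\<phi> y\<bar> * C" for k
    proof (rule AE_I2)
      fix y show "norm (\<phi> y * ?q k y) \<le> \<bar>\<phi> y\<bar> * C"
      proof (cases "y \<in> S")
        case True
        have "\<bar>\<phi> y\<bar> * \<bar>?q k y\<bar> \<le> \<bar>\<phi> y\<bar> * C" using qb[OF True] by (rule mult_left_mono) simp
        then show ?thesis by (simp only: real_norm_def abs_mult)
      qed (simp add: z)
    qed
  qed
  then show ?thesis unfolding q0 using LIMSEQ_unique tendsto_const by blast
qed

text \<open>
  The kernel \<open>\<bar>x - y\<bar>\<^sup>-\<^sup>b\<close>, written as a power of the squared distance, which is a polynomial along lines.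
\<close>

definition riesz :: "real \<Rightarrow> real^'n \<Rightarrow> real^'n \<Rightarrow> real" where
  "riesz b x y = ((x - y) \<bullet> (x - y)) powr (- (b / 2))"

lemma riesz_continuous: "W \<inter> S = {} \<Longrightarrow> continuous_on (W \<times> S) (\<lambda>(x, y). riesz b x y)"
  unfolding riesz_def case_prod_beta by (intro continuous_intros) auto

lemma riesz_derivative:
  assumes "x \<noteq> y"
  shows "((\<lambda>h. riesz b (x + h *\<^sub>R e) y) has_real_derivative - b * (((x - y) \<bullet> e) * riesz (b + 2) x y)) (at 0)"
proof -
  let ?N = "\<lambda>h. (x + h *\<^sub>R e - y) \<bullet> (x + h *\<^sub>R e - y)"
  have N0: "?N 0 > 0" using assms by simp
  have e: "?N h = (x - y) \<bullet> (x - y) + 2 * h * ((x - y) \<bullet> e) + h\<^sup>2 * (e \<bullet> e)" for h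
    by (simp add: inner_diff_left inner_diff_right inner_add_left inner_add_right inner_commute power2_eq_square algebra_simps)
  have "(?N has_real_derivative 2 * ((x - y) \<bullet> e)) (at 0)"
    unfolding e by (auto intro!: derivative_eq_intros)
  from DERIV_chain2[OF has_real_derivative_powr[OF N0] this]
  have "((\<lambda>h. ?N h powr (- (b / 2))) has_real_derivative (- (b / 2) * ?N 0 powr (- (b / 2) - 1)) * (2 * ((x - y) \<bullet> e))) (at 0)" .
  moreover have "- (b / 2) - 1 = - ((b + 2) / 2)" by (simp add: field_simps)
  ultimately show ?thesis unfolding riesz_def by (simp add: mult_ac)
qed

text \<open>
  The Laplacian of \<open>\<bar>x\<bar>\<^sup>-\<^sup>b\<close> is \<open>b (b + 2 - n) \<bar>x\<bar>\<^sup>-\<^sup>b\<^sup>-\<^sup>2\<close>, so the exponent can be raised by two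
  as long as the factor does not vanish.
\<close>

lemma riesz_potential_zero_step:
  fixes \<phi> :: "real^'n \<Rightarrow> real" and b :: real
  assumes S: "compact S" and W: "open W" and WS: "W \<inter> S = {}" and \<phi>: "integrable lebesgue \<phi>" and z: "\<And>y. y \<notin> S \<Longrightarrow> \<phi> y = 0"
    and b: "b > 0" "b + 2 > CARD('n)"
    and zero: "\<And>x. x \<in> W \<Longrightarrow> (LINT y|lebesgue. \<phi> y * riesz b x y) = 0" and x: "x \<in> W"
  shows "(LINT y|lebesgue. \<phi> y * riesz (b + 2) x y) = 0"
proof -
  let ?k1 = "\<lambda>e x y. - b * (((x - y) \<bullet> e) * riesz (b + 2) x y)"
  let ?k2 = "\<lambda>e x y. - b * (riesz (b + 2) x y - (b + 2) * (((x - y) \<bullet> e)\<^sup>2 * riesz (b + 4) x y))"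
  note rc = riesz_continuous[OF WS, unfolded case_prod_beta]
  have c1: "continuous_on (W \<times> S) (\<lambda>(x, y). ?k1 e x y)" for e
    unfolding case_prod_beta by (intro continuous_intros rc)
  have c2: "continuous_on (W \<times> S) (\<lambda>(x, y). ?k2 e x y)" for e
    unfolding case_prod_beta by (intro continuous_intros rc)
  have z1: "(LINT y|lebesgue. \<phi> y * ?k1 e x y) = 0" if "x \<in> W" for e x
    using that WS by (intro potential_derivative_zero[OF S W \<phi> z riesz_continuous[OF WS] c1 riesz_derivative zero]) auto
  have d2: "((\<lambda>h. ?k1 e (x + h *\<^sub>R e) y) has_real_derivative ?k2 e x y) (at 0)"
    if "x \<in> W" "y \<in> S" "e \<in> Basis" for x y e
  proof -
    have ne: "x \<noteq> y" using that WS by auto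
    have l: "((\<lambda>h. (x + h *\<^sub>R e - y) \<bullet> e) has_real_derivative 1) (at 0)"
      using that(3) by (auto intro!: derivative_eq_intros simp: inner_diff_left inner_add_left)
    from DERIV_cmult[OF DERIV_mult[OF l riesz_derivative[OF ne, of "b + 2" e]], of "- b"]
    show ?thesis by (rule DERIV_cong) (simp add: algebra_simps power2_eq_square)
  qed
  have z2: "(LINT y|lebesgue. \<phi> y * ?k2 e x y) = 0" if "e \<in> Basis" for e
    by (rule potential_derivative_zero[OF S W \<phi> z c1 c2 d2 z1 x]) (use that in auto)
  have sec: "continuous_on S (\<lambda>y. ?k2 e x y)" for e
    by (rule continuous_on_section[OF c2 x])
  have k2i: "integrable lebesgue (\<lambda>y. \<phi> y * ?k2 e x y)" for e
    by (rule integrable_mult_continuous[OF S \<phi> z sec])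
  have "(LINT y|lebesgue. (\<Sum>e\<in>Basis. \<phi> y * ?k2 e x y)) = 0"
    using z2 by (subst Bochner_Integration.integral_sum[OF k2i]) (rule sum.neutral, blast)
  also have "(\<lambda>y. \<Sum>e\<in>Basis. \<phi> y * ?k2 e x y) = (\<lambda>y. (b * (b + 2 - CARD('n))) * (\<phi> y * riesz (b + 2) x y))"
  proof
    fix y
    show "(\<Sum>e\<in>Basis. \<phi> y * ?k2 e x y) = (b * (b + 2 - CARD('n))) * (\<phi> y * riesz (b + 2) x y)"
    proof (cases "y \<in> S")
      case True
      then have ne: "x \<noteq> y" using x WS by auto
      let ?N = "(x - y) \<bullet> (x - y)"
      have N: "?N > 0" using ne by simp
      have s: "(\<Sum>e\<in>Basis. ((x - y) \<bullet> e)\<^sup>2) = ?N"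
        by (subst euclidean_inner) (simp add: power2_eq_square)
      have "?N powr 1 * ?N powr (- ((b + 4) / 2)) = ?N powr (1 - (b + 4) / 2)"
        by (simp only: powr_add[symmetric]) simp
      also have "1 - (b + 4) / 2 = - ((b + 2) / 2)" by (simp add: field_simps)
      finally have r: "?N * riesz (b + 4) x y = riesz (b + 2) x y"
        using N unfolding riesz_def by simp
      have "\<phi> y * ?k2 e x y = - (b * \<phi> y * riesz (b + 2) x y) + (b * (b + 2) * \<phi> y * riesz (b + 4) x y) * ((x - y) \<bullet> e)\<^sup>2" for e
        by (simp add: algebra_simps)
      then have "(\<Sum>e\<in>Basis. \<phi> y * ?k2 e x y) = real CARD('n) * (- (b * \<phi> y * riesz (b + 2) x y))
          + (b * (b + 2) * \<phi> y * riesz (b + 4) x y) * (\<Sum>e\<in>Basis. ((x - y) \<bullet> e)\<^sup>2)"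
        by (simp only: sum.distrib sum_distrib_left[symmetric]) simp
      also have "\<dots> = real CARD('n) * (- (b * \<phi> y * riesz (b + 2) x y)) + b * (b + 2) * \<phi> y * (?N * riesz (b + 4) x y)"
        unfolding s by (simp only: mult_ac)
      also have "\<dots> = (b * (b + 2 - CARD('n))) * (\<phi> y * riesz (b + 2) x y)"
        unfolding r by (simp add: algebra_simps)
      finally show ?thesis .
    qed (simp add: z)
  qed
  finally show ?thesis using b by simp
qed

text \<open>
  Once all exponents \<open>a + 2 k\<close> are reached, Weierstrass approximation in the variable
  \<open>\<bar>x - y\<bar>\<^sup>-\<^sup>2\<close> replaces the Riesz kernel by the Gaussian.
\<close>

lemma riesz_potential_zero_imp_gauss:
  fixes \<phi> :: "real^'n \<Rightarrow> real" and a :: real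
  assumes S: "compact S" and W: "open W" and WS: "W \<inter> S = {}" and \<phi>: "integrable lebesgue \<phi>" and z: "\<And>y. y \<notin> S \<Longrightarrow> \<phi> y = 0"
    and a: "a > 0" "a + 2 > CARD('n)"
    and zero: "\<And>x. x \<in> W \<Longrightarrow> (LINT y|lebesgue. \<phi> y * riesz a x y) = 0" and x: "x \<in> W"
  shows "(LINT y|lebesgue. \<phi> y * exp (- ((x - y) \<bullet> (x - y)))) = 0"
proof -
  have all: "(LINT y|lebesgue. \<phi> y * riesz (a + 2 * real k) x y) = 0" if "x \<in> W" for k x
    using that
  proof (induction k arbitrary: x)
    case 0 then show ?case using zero by simp
  next
    case (Suc k)
    have "(LINT y|lebesgue. \<phi> y * riesz (a + 2 * real k + 2) x y) = 0"
      by (rule riesz_potential_zero_step[OF S W WS \<phi> z _ _ Suc.IH Suc.prems]) (use a in auto)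
    then show ?case by (simp add: algebra_simps)
  qed
  let ?N = "\<lambda>y. (x - y) \<bullet> (x - y)"
  have N: "?N y > 0" if "y \<in> S" for y using that x WS by (metis disjoint_iff inner_gt_zero_iff right_minus_eq)
  define J where "J = (\<lambda>y. 1 / ?N y) ` S"
  have J: "compact J" unfolding J_def
    by (intro compact_continuous_image S continuous_intros) (use N in force)
  have Jpos: "\<tau> > 0" if "\<tau> \<in> J" for \<tau> using that N by (auto simp: J_def)
  let ?H = "\<lambda>\<tau>::real. \<tau> powr (- (a / 2)) * exp (- (1 / \<tau>))"
  have H: "continuous_on J ?H" using Jpos by (intro continuous_intros) force+
  have sec: "continuous_on S (\<lambda>y. riesz b x y)" for b
    by (rule continuous_on_section[OF riesz_continuous[OF WS] x])
  have i: "integrable lebesgue (\<lambda>y. \<phi> y * riesz b x y)" for b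
    by (rule integrable_mult_continuous[OF S \<phi> z sec])
  have ig: "integrable lebesgue (\<lambda>y. \<phi> y * exp (- ?N y))"
    by (rule integrable_mult_continuous[OF S \<phi> z]) (auto intro!: continuous_intros)
  let ?A = "LINT y|lebesgue. \<bar>\<phi> y * riesz a x y\<bar>"
  have est: "\<bar>LINT y|lebesgue. \<phi> y * exp (- ?N y)\<bar> \<le> \<epsilon> * ?A" if eps: "\<epsilon> > 0" for \<epsilon>
  proof -
    obtain g where "real_polynomial_function g" and g: "\<And>\<tau>. \<tau> \<in> J \<Longrightarrow> \<bar>?H \<tau> - g \<tau>\<bar> < \<epsilon>"
      using Stone_Weierstrass_real_polynomial_function[OF J H eps] by blast
    then obtain c m where gm: "g = (\<lambda>\<tau>. \<Sum>i\<le>(m::nat). c i * \<tau> ^ i)"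
      using real_polynomial_function_iff_sum by metis
    have rk: "riesz a x y * (1 / ?N y) ^ k = riesz (a + 2 * real k) x y" if "y \<in> S" for y k
    proof -
      have "(1 / ?N y) ^ k = ?N y powr (- real k)"
        using N[OF that] by (simp add: powr_minus powr_realpow divide_inverse power_inverse)
      moreover have "- (a / 2) + - real k = - ((a + 2 * real k) / 2)" by (simp add: field_simps)
      ultimately show ?thesis unfolding riesz_def by (simp only: powr_add[symmetric])
    qed
    have eH: "riesz a x y * ?H (1 / ?N y) = exp (- ?N y)" if "y \<in> S" for y
    proof -
      have "(1 / ?N y) powr (- (a / 2)) = ?N y powr (a / 2)"
        using N[OF that] by (simp add: powr_def ln_div)
      then have "riesz a x y * ?H (1 / ?N y) = (?N y powr (- (a / 2)) * ?N y powr (a / 2)) * exp (- ?N y)"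
        unfolding riesz_def by (simp only: mult.assoc) simp
      also have "?N y powr (- (a / 2)) * ?N y powr (a / 2) = 1"
        using N[OF that] by (simp only: powr_add[symmetric]) simp
      finally show ?thesis by simp
    qed
    have poly: "\<phi> y * riesz a x y * g (1 / ?N y) = (\<Sum>i\<le>m. c i * (\<phi> y * riesz (a + 2 * real i) x y))" for y
    proof (cases "y \<in> S")
      case True
      have "\<phi> y * riesz a x y * g (1 / ?N y) = (\<Sum>i\<le>m. c i * (\<phi> y * (riesz a x y * (1 / ?N y) ^ i)))"
        unfolding gm sum_distrib_left by (simp only: mult_ac)
      then show ?thesis by (simp only: rk[OF True])
    qed (simp add: z)
    have p0: "(LINT y|lebesgue. (\<Sum>i\<le>m. c i * (\<phi> y * riesz (a + 2 * real i) x y))) = 0"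
      using all[OF x] by (subst Bochner_Integration.integral_sum) (auto intro!: integrable_mult_right i)
    have pi: "integrable lebesgue (\<lambda>y. \<Sum>i\<le>m. c i * (\<phi> y * riesz (a + 2 * real i) x y))"
      by (intro Bochner_Integration.integrable_sum integrable_mult_right i)
    have "(LINT y|lebesgue. \<phi> y * exp (- ?N y)) = (LINT y|lebesgue. \<phi> y * exp (- ?N y) - (\<Sum>i\<le>m. c i * (\<phi> y * riesz (a + 2 * real i) x y)))"
      using ig pi p0 by simp
    also have "\<bar>\<dots>\<bar> \<le> (LINT y|lebesgue. \<epsilon> * \<bar>\<phi> y * riesz a x y\<bar>)"
    proof (rule order_trans[OF integral_abs_bound], rule integral_mono)
      fix y
      show "\<bar>\<phi> y * exp (- ?N y) - (\<Sum>i\<le>m. c i * (\<phi> y * riesz (a + 2 * real i) x y))\<bar> \<le> \<epsilon> * \<bar>\<phi> y * riesz a x y\<bar>"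
      proof (cases "y \<in> S")
        case True
        have "\<phi> y * exp (- ?N y) - \<phi> y * riesz a x y * g (1 / ?N y) = \<phi> y * riesz a x y * (?H (1 / ?N y) - g (1 / ?N y))"
          unfolding eH[OF True, symmetric] by (simp add: algebra_simps)
        moreover have "\<bar>?H (1 / ?N y) - g (1 / ?N y)\<bar> \<le> \<epsilon>" using g[of "1 / ?N y"] True by (auto simp: J_def)
        ultimately show ?thesis unfolding poly[symmetric]
          by (simp only: abs_mult mult.commute[of \<epsilon>]) (intro mult_left_mono, auto)
      qed (simp add: z)
    qed (use ig pi i in auto)
    also have "\<dots> = \<epsilon> * ?A" by simp
    finally show ?thesis .
  qed
  have A0: "?A \<ge> 0" by (rule Bochner_Integration.integral_nonneg) simp
  have A1: "?A + 1 > 0" using A0 by linarith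
  have A2: "?A / (?A + 1) \<le> 1" by (subst divide_le_eq_1_pos[OF A1]) simp
  have "\<bar>LINT y|lebesgue. \<phi> y * exp (- ?N y)\<bar> \<le> 0"
  proof (rule field_le_epsilon)
    fix d :: real assume "d > 0"
    then have "d / (?A + 1) > 0" by (rule divide_pos_pos[OF _ A1])
    from est[OF this] have "\<bar>LINT y|lebesgue. \<phi> y * exp (- ?N y)\<bar> \<le> d * (?A / (?A + 1))" by simp
    also have "\<dots> \<le> d * 1" using \<open>d > 0\<close> by (intro mult_left_mono A2) simp
    finally show "\<bar>LINT y|lebesgue. \<phi> y * exp (- ?N y)\<bar> \<le> 0 + d" by simp
  qed
  then show ?thesis by simp
qed

text \<open>
  Expanding the square, \<open>exp (-\<bar>x - y\<bar>\<^sup>2)\<close> is up to a factor \<open>exp (2 x \<sqdot> y - \<bar>y\<bar>\<^sup>2)\<close>, and a derivative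
  in \<open>x\<close> now just multiplies the kernel by a coordinate of \<open>y\<close>. All moments of the density
  vanish, and by the Stone--Weierstrass theorem so does the density.
\<close>

theorem riesz_potential_unique_continuation:
  fixes \<phi> :: "real^'n \<Rightarrow> real" and a :: real
  assumes S: "compact S" and W: "open W" "W \<noteq> {}" and WS: "W \<inter> S = {}" and \<phi>: "integrable lebesgue \<phi>" and z: "\<And>y. y \<notin> S \<Longrightarrow> \<phi> y = 0"
    and a: "a > 0" "a + 2 > CARD('n)"
    and zero: "\<And>x. x \<in> W \<Longrightarrow> (LINT y|lebesgue. \<phi> y * riesz a x y) = 0"
  shows "AE y in lebesgue. \<phi> y = 0"
proof -
  define E where "E x y = exp (2 * (x \<bullet> y) - y \<bullet> y)" for x y :: "real^'n"
  have Ec: "continuous_on A (\<lambda>(x, y). E x y * p y)" if "continuous_on UNIV p" for A p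
    unfolding E_def case_prod_beta
    by (intro continuous_intros continuous_on_compose2[OF that]) auto
  have E1: "(LINT y|lebesgue. \<phi> y * (E x y * 1)) = 0" if x: "x \<in> W" for x
  proof -
    have "\<phi> y * (E x y * 1) = exp (x \<bullet> x) * (\<phi> y * exp (- ((x - y) \<bullet> (x - y))))" for y
      unfolding E_def by (simp add: mult.left_commute inner_diff_left inner_diff_right inner_commute algebra_simps flip: exp_add)
    note e = this
    have "(LINT y|lebesgue. \<phi> y * exp (- ((x - y) \<bullet> (x - y)))) = 0"
      by (rule riesz_potential_zero_imp_gauss[OF S W(1) WS \<phi> z a zero x])
    then show ?thesis unfolding e Bochner_Integration.integral_mult_right_zero by simp
  qed
  have poly: "\<forall>p. continuous_on UNIV p \<longrightarrow> (\<forall>x\<in>W. (LINT y|lebesgue. \<phi> y * (E x y * p y)) = 0) \<longrightarrow>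
      (\<forall>x\<in>W. (LINT y|lebesgue. \<phi> y * (E x y * (p y * q y))) = 0)"
    if "real_polynomial_function q" for q
    using that
  proof (induction q)
    case (linear q)
    interpret q: bounded_linear q by fact
    show ?case
    proof (intro allI impI ballI)
      fix p x assume pc: "continuous_on UNIV p" and p0: "\<forall>x\<in>W. (LINT y|lebesgue. \<phi> y * (E x y * p y)) = 0" and x: "x \<in> W"
      have c': "continuous_on UNIV (\<lambda>y. 2 * (y \<bullet> e) * p y)" for e by (intro continuous_intros pc)
      have "(LINT y|lebesgue. \<phi> y * (E x y * (2 * (y \<bullet> e) * p y))) = 0" for e
      proof (rule potential_derivative_zero[OF S W(1) \<phi> z Ec[OF pc] Ec[OF c'] _ _ x])
        fix x y
        show "((\<lambda>h. E (x + h *\<^sub>R e) y * p y) has_real_derivative E x y * (2 * (y \<bullet> e) * p y)) (at 0)"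
        proof -
          have "E (x + h *\<^sub>R e) y = exp (2 * (x \<bullet> y) + h * (2 * (y \<bullet> e)) - y \<bullet> y)" for h
            by (simp add: E_def inner_add_left inner_commute algebra_simps)
          then show ?thesis by (simp only: E_def[of x]) (auto intro!: derivative_eq_intros)
        qed
      qed (use p0 in auto)
      note e0 = this
      have ie: "integrable lebesgue (\<lambda>y. \<phi> y * (E x y * (2 * (y \<bullet> e) * p y)))" for e
        by (rule integrable_mult_continuous[OF S \<phi> z continuous_on_section[OF Ec[OF c']]]) auto
      have q: "q y = (\<Sum>e\<in>Basis. (y \<bullet> e) * q e)" for y
        using arg_cong[OF euclidean_representation[of y, symmetric], of q] by (simp add: q.sum q.scaleR)
      have "\<phi> y * (E x y * (p y * q y)) = (\<Sum>e\<in>Basis. (q e / 2) * (\<phi> y * (E x y * (2 * (y \<bullet> e) * p y))))" for y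
        by (subst q) (simp add: sum_distrib_left mult_ac)
      note eq = this
      show "(LINT y|lebesgue. \<phi> y * (E x y * (p y * q y))) = 0"
        unfolding eq Bochner_Integration.integral_sum[OF integrable_mult_right[OF ie]]
          Bochner_Integration.integral_mult_right_zero e0 by simp
    qed
  next
    case (const c)
    have eq: "\<phi> y * (E x y * (p y * c)) = c * (\<phi> y * (E x y * p y))" for p x y by (simp only: mult_ac)
    show ?case unfolding eq Bochner_Integration.integral_mult_right_zero by simp
  next
    case (add f g)
    have cf: "continuous_on UNIV f" "continuous_on UNIV g"
      using add(1,2) continuous_on_polymonial_function real_polynomial_function_eq by blast+
    have i: "integrable lebesgue (\<lambda>y. \<phi> y * (E x y * r y))" if "continuous_on UNIV r" for r x
      by (rule integrable_mult_continuous[OF S \<phi> z continuous_on_section[OF Ec[OF that]]]) auto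
    show ?case
    proof (intro allI impI ballI)
      fix p x assume pc: "continuous_on UNIV p" and p0: "\<forall>x\<in>W. (LINT y|lebesgue. \<phi> y * (E x y * p y)) = 0" and x: "x \<in> W"
      have "(LINT y|lebesgue. \<phi> y * (E x y * (p y * (f y + g y)))) = (LINT y|lebesgue. \<phi> y * (E x y * (p y * f y)) + \<phi> y * (E x y * (p y * g y)))"
        by (simp add: algebra_simps)
      also have "\<dots> = 0"
        using add.IH pc p0 x by (subst Bochner_Integration.integral_add) (auto intro!: i continuous_intros cf)
      finally show "(LINT y|lebesgue. \<phi> y * (E x y * (p y * (f y + g y)))) = 0" .
    qed
  next
    case (mult f g)
    have cf: "continuous_on UNIV f"
      using mult(1) continuous_on_polymonial_function real_polynomial_function_eq by blast
    show ?case
    proof (intro allI impI)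
      fix p assume pc: "continuous_on UNIV p" and p0: "\<forall>x\<in>W. (LINT y|lebesgue. \<phi> y * (E x y * p y)) = 0"
      have "continuous_on UNIV (\<lambda>y. p y * f y)" by (intro continuous_intros pc cf)
      moreover have "\<forall>x\<in>W. (LINT y|lebesgue. \<phi> y * (E x y * (p y * f y))) = 0"
        using mult.IH(1) pc p0 by blast
      ultimately have "\<forall>x\<in>W. (LINT y|lebesgue. \<phi> y * (E x y * (p y * f y * g y))) = 0"
        using mult.IH(2)[rule_format, of "\<lambda>y. p y * f y"] by blast
      then show "\<forall>x\<in>W. (LINT y|lebesgue. \<phi> y * (E x y * (p y * (f y * g y)))) = 0" by (simp add: mult.assoc)
    qed
  qed
  obtain x where x: "x \<in> W" using W(2) by blast
  have all: "(LINT y|lebesgue. \<phi> y * \<psi> y) = 0" if \<psi>: "continuous_on UNIV \<psi>" for \<psi>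
  proof -
    let ?h = "\<lambda>y. \<psi> y / E x y"
    have hc: "continuous_on S ?h" unfolding E_def
      by (intro continuous_intros continuous_on_subset[OF \<psi>]) auto
    have Exc: "continuous_on S (\<lambda>y. E x y)" unfolding E_def by (intro continuous_intros)
    have i: "integrable lebesgue (\<lambda>y. \<phi> y * E x y)" by (rule integrable_mult_continuous[OF S \<phi> z Exc])
    let ?A = "LINT y|lebesgue. \<bar>\<phi> y * E x y\<bar>"
    have i\<psi>: "integrable lebesgue (\<lambda>y. \<phi> y * \<psi> y)" by (rule integrable_mult_continuous[OF S \<phi> z continuous_on_subset[OF \<psi>]]) auto
    have est: "\<bar>LINT y|lebesgue. \<phi> y * \<psi> y\<bar> \<le> \<epsilon> * ?A" if eps: "\<epsilon> > 0" for \<epsilon>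
    proof -
      obtain g where g: "real_polynomial_function g" "\<And>y. y \<in> S \<Longrightarrow> \<bar>?h y - g y\<bar> < \<epsilon>"
        using Stone_Weierstrass_real_polynomial_function[OF S hc eps] by blast
      have gc: "continuous_on S g" using g(1) continuous_on_polymonial_function real_polynomial_function_eq by blast
      have g0: "(LINT y|lebesgue. \<phi> y * (E x y * g y)) = 0"
        using poly[OF g(1), rule_format, of "\<lambda>_. 1" x] E1 x by simp
      have ig: "integrable lebesgue (\<lambda>y. \<phi> y * (E x y * g y))"
        by (rule integrable_mult_continuous[OF S \<phi> z]) (auto intro!: continuous_intros Exc gc)
      have "(LINT y|lebesgue. \<phi> y * \<psi> y) = (LINT y|lebesgue. \<phi> y * \<psi> y - \<phi> y * (E x y * g y))"
        using i\<psi> ig g0 by simp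
      also have "\<bar>\<dots>\<bar> \<le> (LINT y|lebesgue. \<epsilon> * \<bar>\<phi> y * E x y\<bar>)"
      proof (rule order_trans[OF integral_abs_bound], rule integral_mono)
        fix y
        show "\<bar>\<phi> y * \<psi> y - \<phi> y * (E x y * g y)\<bar> \<le> \<epsilon> * \<bar>\<phi> y * E x y\<bar>"
        proof (cases "y \<in> S")
          case True
          have "\<phi> y * \<psi> y - \<phi> y * (E x y * g y) = \<phi> y * E x y * (?h y - g y)"
            unfolding E_def by (simp add: field_simps)
          moreover have "\<bar>?h y - g y\<bar> \<le> \<epsilon>" using g(2)[OF True] by simp
          ultimately show ?thesis
            by (simp only: abs_mult mult.commute[of \<epsilon>]) (intro mult_left_mono, auto)
        qed (simp add: z)
      qed (use i i\<psi> ig in auto)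
      also have "\<dots> = \<epsilon> * ?A" by simp
      finally show ?thesis .
    qed
    have A0: "?A \<ge> 0" by (rule Bochner_Integration.integral_nonneg) simp
    have A1: "?A + 1 > 0" using A0 by linarith
    have A2: "?A / (?A + 1) \<le> 1" by (subst divide_le_eq_1_pos[OF A1]) simp
    have "\<bar>LINT y|lebesgue. \<phi> y * \<psi> y\<bar> \<le> 0"
    proof (rule field_le_epsilon)
      fix d :: real assume "d > 0"
      then have "d / (?A + 1) > 0" by (rule divide_pos_pos[OF _ A1])
      from est[OF this] have "\<bar>LINT y|lebesgue. \<phi> y * \<psi> y\<bar> \<le> d * (?A / (?A + 1))" by simp
      also have "\<dots> \<le> d * 1" using \<open>d > 0\<close> by (intro mult_left_mono A2) simp
      finally show "\<bar>LINT y|lebesgue. \<phi> y * \<psi> y\<bar> \<le> 0 + d" by simp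
    qed
    then show ?thesis by simp
  qed
  have "AE y in lebesgue. y \<in> UNIV \<longrightarrow> \<phi> y = 0"
  proof (rule fundamental_lemma)
    show "integrable lebesgue (\<lambda>x. indicator (cbox a b) x * \<phi> x)" for a b
      using integrable_mult_indicator[OF _ \<phi>, of "cbox a b"] by simp
  qed (auto intro: all Cc_infty_continuous)
  then show ?thesis by simp
qed

section \<open>The fractional Laplacian away from the support\<close>

text \<open>
  Both sides of the kernel identity are superpositions of heat semigroup quantities with the weight
  \<open>t\<^sup>-\<^sup>1\<^sup>-\<^sup>s\<close>: by scaling, \<open>\<bar>\<xi>\<bar>\<^sup>2\<^sup>s\<close> is a multiple of \<open>\<integral> (1 - exp (-t\<bar>\<xi>\<bar>\<^sup>2)) t\<^sup>-\<^sup>1\<^sup>-\<^sup>s dt\<close> and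
  \<open>\<bar>z\<bar>\<^sup>-\<^sup>n\<^sup>-\<^sup>2\<^sup>s\<close> is a multiple of the same integral of the heat kernel.
\<close>

definition hweight :: "real \<Rightarrow> real \<Rightarrow> real" where
  "hweight s t = (if t > 0 then t powr (- 1 - s) else 0)"

lemma hweight_measurable [measurable]: "hweight s \<in> borel_measurable borel"
  unfolding hweight_def by measurable

lemma hweight_nonneg [simp]: "0 \<le> hweight s t"
  by (simp add: hweight_def)

lemma hweight_scale: "c > 0 \<Longrightarrow> hweight s (c * t) = c powr (- 1 - s) * hweight s t"
  by (simp add: hweight_def powr_mult zero_less_mult_iff)

text \<open>
  A common majorant for the two integrands with weight \<open>hweight\<close>: both are \<open>O(t\<^sup>-\<^sup>s)\<close> near 0, where
  \<open>s < 1\<close> is used, and \<open>O(t\<^sup>-\<^sup>1\<^sup>-\<^sup>s)\<close> at infinity.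
\<close>

definition hbound :: "real \<Rightarrow> real \<Rightarrow> real" where
  "hbound s t = indicator {0..1} t * t powr (- s) + indicator {1..} t * t powr (- 1 - s)"

lemma hbound_integrable:
  assumes s: "0 < s" "s < 1" shows "integrable lborel (hbound s)"
proof -
  have "(\<lambda>t::real. t powr (- s)) absolutely_integrable_on {0..1}"
    by (rule nonnegative_absolutely_integrable_1)
       (use s integrable_on_powr_from_0[of "- s" 1] in auto)
  then have "integrable lebesgue (\<lambda>t::real. indicator {0..1} t * t powr (- s))"
    by (simp add: set_integrable_def)
  moreover have "(\<lambda>t::real. t powr (- 1 - s)) absolutely_integrable_on {1..}"
    by (rule nonnegative_absolutely_integrable_1)
       (use s has_integral_powr_to_inf[of "- 1 - s" 1] in \<open>auto simp: integrable_on_def\<close>)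
  then have "integrable lebesgue (\<lambda>t::real. indicator {1..} t * t powr (- 1 - s))"
    by (simp add: set_integrable_def)
  ultimately have "integrable lebesgue (hbound s)" unfolding hbound_def by simp
  moreover have "hbound s \<in> borel_measurable lborel" unfolding hbound_def by measurable
  ultimately show ?thesis by (simp add: integrable_completion)
qed

lemma symbol_integrable:
  assumes s: "0 < s" "s < 1" shows "integrable lborel (\<lambda>t. hweight s t * (1 - exp (- t)))"
proof (rule Bochner_Integration.integrable_bound[OF hbound_integrable[OF s]])
  show "AE t in lborel. norm (hweight s t * (1 - exp (- t))) \<le> norm (hbound s t)"
  proof (rule AE_I2)
    fix t :: real
    show "norm (hweight s t * (1 - exp (- t))) \<le> norm (hbound s t)"
    proof (cases "t > 0")
      case True
      have e: "0 \<le> 1 - exp (- t)" "1 - exp (- t) \<le> t" "1 - exp (- t) \<le> 1"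
        using True exp_ge_add_one_self[of "- t"] by auto
      have p: "t powr (- 1 - s) * t = t powr (- s)"
        using powr_add[of t "- 1 - s" 1] True by simp
      have "t powr (- 1 - s) * (1 - exp (- t)) \<le> t powr (- s)"
        unfolding p[symmetric] using e by (intro mult_left_mono) auto
      moreover have "t powr (- 1 - s) * (1 - exp (- t)) \<le> t powr (- 1 - s)"
        using e mult_left_mono[of "1 - exp (- t)" 1 "t powr (- 1 - s)"] by simp
      ultimately show ?thesis using True e
        by (cases "t \<le> 1")
           (auto simp: hweight_def hbound_def indicator_def abs_mult, insert exp_ge_zero[of "- 1 :: real"], linarith)
    qed (simp add: hweight_def)
  qed
qed measurable

text \<open>
  The substitution \<open>t \<mapsto> r\<^sup>2 t\<close>.
\<close>

lemma symbol_scaling: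
  fixes r :: real
  assumes s: "0 < s" "s < 1" and r: "r > 0"
  shows "integrable lborel (\<lambda>t. hweight s t * (1 - exp (- t * r\<^sup>2)))"
    and "(LINT t|lborel. hweight s t * (1 - exp (- t * r\<^sup>2))) = r powr (2 * s) * (LINT t|lborel. hweight s t * (1 - exp (- t)))"
proof -
  let ?h = "\<lambda>t. hweight s t * (1 - exp (- t))"
  have r2: "r\<^sup>2 > 0" using r by simp
  have e: "hweight s t * (1 - exp (- t * r\<^sup>2)) = (r\<^sup>2) powr (1 + s) * ?h (0 + r\<^sup>2 * t)" for t
  proof -
    have "(r\<^sup>2) powr (1 + s) * (r\<^sup>2) powr (- 1 - s) = 1" using r by (simp flip: powr_add)
    then show ?thesis using hweight_scale[OF r2, of s t] by (simp add: mult_ac)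
  qed
  have i: "integrable lborel (\<lambda>t. ?h (0 + r\<^sup>2 * t))"
    by (rule lborel_integrable_real_affine[OF symbol_integrable[OF s]]) (use r in simp)
  then show "integrable lborel (\<lambda>t. hweight s t * (1 - exp (- t * r\<^sup>2)))"
    unfolding e by (rule integrable_mult_right)
  have "(LINT t|lborel. ?h t) = \<bar>r\<^sup>2\<bar> *\<^sub>R (LINT t|lborel. ?h (0 + r\<^sup>2 * t))"
    by (rule lborel_integral_real_affine) (use r in simp)
  then have "(LINT t|lborel. ?h (0 + r\<^sup>2 * t)) = (LINT t|lborel. ?h t) / r\<^sup>2" using r2 by (simp add: field_simps)
  then have "(LINT t|lborel. hweight s t * (1 - exp (- t * r\<^sup>2))) = (r\<^sup>2) powr (1 + s) / r\<^sup>2 * (LINT t|lborel. ?h t)"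
    unfolding e Bochner_Integration.integral_mult_right_zero by simp
  also have "(r\<^sup>2) powr (1 + s) / r\<^sup>2 = r powr (2 * s)"
  proof -
    have "(r\<^sup>2) powr (1 + s) = r\<^sup>2 * (r\<^sup>2) powr s" using r by (simp add: powr_add)
    moreover have "(r\<^sup>2) powr s = r powr (2 * s)" using r by (simp add: powr_powr flip: powr_numeral)
    ultimately show ?thesis using r by simp
  qed
  finally show "(LINT t|lborel. hweight s t * (1 - exp (- t * r\<^sup>2))) = r powr (2 * s) * (LINT t|lborel. ?h t)" .
qed

text \<open>
  The kernel of \<open>fourier_gauss_identity\<close> as a function of the squared distance \<open>R\<close>; it is \<open>(2\<pi>)\<^sup>n\<close> times
  the heat kernel.
\<close>

definition hkernel :: "nat \<Rightarrow> real \<Rightarrow> real \<Rightarrow> real" where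
  "hkernel n t R = sqrt (pi / t) ^ n * exp (- R / (4 * t))"

lemma hkernel_measurable [measurable]: "(\<lambda>p. hkernel n (fst p) (snd p)) \<in> borel_measurable (borel \<Otimes>\<^sub>M borel)"
  unfolding hkernel_def by measurable

lemma hkernel_nonneg: "t > 0 \<Longrightarrow> 0 \<le> hkernel n t R"
  by (simp add: hkernel_def)

text \<open>
  Near \<open>t = 0\<close> the exponential beats the negative powers of \<open>t\<close>; at infinity the kernel is bounded.
\<close>

lemma heat_integrable:
  assumes s: "0 < s" "s < 1"
  shows "integrable lborel (\<lambda>t. hweight s t * hkernel n t 1)"
proof -
  \<comment> \<open>With \<open>x = 1/t\<close>, the inequality \<open>(1 + y/N)\<^sup>N \<le> exp y\<close> for \<open>y = x/4\<close> and \<open>N = n + 1\<close> bounds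
    \<open>x\<^sup>N exp (-x/4)\<close> by \<open>(4 N)\<^sup>N\<close>. The summand 1 covers the case \<open>t > 1\<close>.\<close>
  define C where "C = sqrt pi ^ n * ((4 * real (n + 1)) ^ (n + 1) + 1)"
  have C: "C \<ge> 0" by (simp add: C_def)
  show ?thesis
  proof (rule Bochner_Integration.integrable_bound)
    show "integrable lborel (\<lambda>t. C * hbound s t)" using hbound_integrable[OF s] by simp
    have "(\<lambda>t. hkernel n (fst (t, 1::real)) (snd (t, 1::real))) \<in> borel_measurable borel"
      by (rule measurable_compose[OF _ hkernel_measurable]) measurable
    then show "(\<lambda>t. hweight s t * hkernel n t 1) \<in> borel_measurable lborel" by simp
    show "AE t in lborel. norm (hweight s t * hkernel n t 1) \<le> norm (C * hbound s t)"
    proof (rule AE_I2)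
      fix t :: real
      show "norm (hweight s t * hkernel n t 1) \<le> norm (C * hbound s t)"
      proof (cases "t > 0")
        case True
        show ?thesis
        proof (cases "t \<le> 1")
          case t1: True
          define x where "x = 1 / t"
          have x: "x \<ge> 1" using True t1 by (simp add: x_def)
          have "(x / 4 / real (n + 1)) ^ (n + 1) \<le> (1 + x / 4 / real (n + 1)) ^ (n + 1)"
            using x by (intro power_mono) auto
          also have "\<dots> \<le> exp (x / 4)"
            by (rule exp_ge_one_plus_x_over_n_power_n) (use x in auto)
          finally have q: "x ^ (n + 1) / (4 * real (n + 1)) ^ (n + 1) \<le> exp (x / 4)"
            by (simp only: power_divide divide_divide_eq_left)
          have "(4 * real (n + 1)) ^ (n + 1) > 0" by (rule zero_less_power) simp
          with q have "x ^ (n + 1) \<le> exp (x / 4) * (4 * real (n + 1)) ^ (n + 1)"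
            by (simp only: pos_divide_le_eq)
          then have "x ^ (n + 1) * exp (- (x / 4)) \<le> exp (x / 4) * (4 * real (n + 1)) ^ (n + 1) * exp (- (x / 4))"
            by (intro mult_right_mono) auto
          also have "\<dots> = (4 * real (n + 1)) ^ (n + 1)" by (simp add: exp_minus)
          finally have e: "x ^ (n + 1) * exp (- (x / 4)) \<le> (4 * real (n + 1)) ^ (n + 1)" .
          have "sqrt x \<le> x" by (rule real_le_lsqrt) (use x in \<open>auto simp: power2_eq_square\<close>)
          then have "sqrt x ^ n \<le> x ^ n" using x by (intro power_mono) auto
          then have "x * sqrt x ^ n * exp (- (x / 4)) \<le> x * x ^ n * exp (- (x / 4))"
            using x by (intro mult_right_mono mult_left_mono) auto
          also have "\<dots> \<le> (4 * real (n + 1)) ^ (n + 1)" using e by simp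
          finally have b: "x * sqrt x ^ n * exp (- (x / 4)) \<le> (4 * real (n + 1)) ^ (n + 1) + 1" by simp
          have "hkernel n t 1 = sqrt pi ^ n * (sqrt x ^ n * exp (- (x / 4)))"
            unfolding hkernel_def x_def by (simp add: real_sqrt_divide power_divide)
          moreover have "t powr (- 1 - s) = t powr (- s) * x"
            using True by (simp add: x_def powr_diff powr_minus field_simps)
          ultimately have "t powr (- 1 - s) * hkernel n t 1 = t powr (- s) * (sqrt pi ^ n * (x * sqrt x ^ n * exp (- (x / 4))))"
            by (simp add: mult_ac)
          also have "\<dots> \<le> t powr (- s) * C"
            unfolding C_def by (intro mult_left_mono b) auto
          finally have "hweight s t * hkernel n t 1 \<le> C * (t powr (- s))" using True by (simp add: hweight_def mult.commute)
          also have "\<dots> \<le> C * hbound s t" using C True t1 by (intro mult_left_mono) (auto simp: hbound_def indicator_def)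
          finally show ?thesis using hkernel_nonneg[OF True, of n 1] by simp
        next
          case False
          have "sqrt (pi / t) ^ n \<le> sqrt pi ^ n" using False by (intro power_mono real_sqrt_le_mono) (auto simp: field_simps)
          then have "hkernel n t 1 \<le> sqrt pi ^ n * 1"
            unfolding hkernel_def using True by (intro mult_mono) auto
          also have "\<dots> \<le> C" unfolding C_def by (intro mult_left_mono) auto
          finally have "hweight s t * hkernel n t 1 \<le> hweight s t * C" by (intro mult_left_mono) auto
          also have "\<dots> = C * hbound s t" using True False by (simp add: hweight_def hbound_def indicator_def)
          finally show ?thesis using hkernel_nonneg[OF True, of n 1] by simp
        qed
      qed (simp add: hweight_def)
    qed
  qed
qed

lemma heat_scaling:
  fixes r :: real
  assumes s: "0 < s" "s < 1" and r: "r > 0"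
  shows "integrable lborel (\<lambda>t. hweight s t * hkernel n t (r\<^sup>2))"
    and "(LINT t|lborel. hweight s t * hkernel n t (r\<^sup>2)) = (r\<^sup>2) powr (- ((real n + 2 * s) / 2)) * (LINT t|lborel. hweight s t * hkernel n t 1)"
proof -
  let ?h = "\<lambda>t. hweight s t * hkernel n t 1"
  define c where "c = 1 / r\<^sup>2"
  have c: "c > 0" using r by (simp add: c_def)
  define A where "A = c powr (1 + s) * sqrt c ^ n"
  have e: "hweight s t * hkernel n t (r\<^sup>2) = A * ?h (0 + c * t)" for t
  proof (cases "t > 0")
    case True
    have 1: "hweight s (c * t) = c powr (- 1 - s) * hweight s t" by (rule hweight_scale[OF c])
    have "sqrt (pi / t) = sqrt c * sqrt (pi / (c * t))"
      using c True by (simp add: real_sqrt_divide real_sqrt_mult)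
    then have "sqrt (pi / t) ^ n = sqrt c ^ n * sqrt (pi / (c * t)) ^ n" by (simp add: power_mult_distrib)
    moreover have "- r\<^sup>2 / (4 * t) = - 1 / (4 * (c * t))" using r True by (simp add: c_def field_simps)
    ultimately have 2: "hkernel n t (r\<^sup>2) = sqrt c ^ n * hkernel n (c * t) 1" by (simp add: hkernel_def)
    have "c powr (1 + s) * c powr (- 1 - s) = 1" using c by (simp flip: powr_add)
    then show ?thesis unfolding A_def using 1 2 by (simp add: mult_ac)
  next
    case False then show ?thesis using c by (simp add: hweight_def zero_less_mult_iff)
  qed
  have i: "integrable lborel (\<lambda>t. ?h (0 + c * t))"
    by (rule lborel_integrable_real_affine[OF heat_integrable[OF s]]) (use c in simp)
  then show "integrable lborel (\<lambda>t. hweight s t * hkernel n t (r\<^sup>2))"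
    unfolding e by (rule integrable_mult_right)
  have "(LINT t|lborel. ?h t) = \<bar>c\<bar> *\<^sub>R (LINT t|lborel. ?h (0 + c * t))"
    by (rule lborel_integral_real_affine) (use c in simp)
  then have "(LINT t|lborel. ?h (0 + c * t)) = (LINT t|lborel. ?h t) / c" using c by (simp add: field_simps)
  then have "(LINT t|lborel. hweight s t * hkernel n t (r\<^sup>2)) = A / c * (LINT t|lborel. ?h t)"
    unfolding e Bochner_Integration.integral_mult_right_zero by simp
  also have "A / c = (r\<^sup>2) powr (- ((real n + 2 * s) / 2))"
  proof -
    have "sqrt c ^ n = c powr (real n / 2)"
      using c by (simp add: powr_half_sqrt[symmetric] powr_powr flip: powr_realpow)
    then have "A / c = c powr (1 + s) * c powr (real n / 2) / c powr 1" using c by (simp add: A_def)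
    also have "\<dots> = c powr (1 + s + real n / 2 - 1)" by (simp only: powr_add powr_diff)
    also have "1 + s + real n / 2 - 1 = (real n + 2 * s) / 2" by (simp add: field_simps)
    also have "c powr ((real n + 2 * s) / 2) = (r\<^sup>2) powr (- ((real n + 2 * s) / 2))"
      using r by (simp add: c_def powr_def ln_div)
    finally show ?thesis .
  qed
  finally show "(LINT t|lborel. hweight s t * hkernel n t (r\<^sup>2)) = (r\<^sup>2) powr (- ((real n + 2 * s) / 2)) * (LINT t|lborel. ?h t)" .
qed

lemma heat_constant_pos:
  assumes s: "0 < s" "s < 1"
  shows "(LINT t|lborel. hweight s t * hkernel n t 1) \<noteq> 0"
proof
  have nn: "AE t in lborel. 0 \<le> hweight s t * hkernel n t 1"
  proof (rule AE_I2)
    fix t :: real show "0 \<le> hweight s t * hkernel n t 1"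
      using hkernel_nonneg[of t n 1] by (cases "t > 0") (auto simp: hweight_def)
  qed
  assume "(LINT t|lborel. hweight s t * hkernel n t 1) = 0"
  then have "AE t in lborel. hweight s t * hkernel n t 1 = 0"
    using integral_nonneg_eq_0_iff_AE[OF heat_integrable[OF s] nn] by simp
  then have "AE t in lborel. t \<notin> {0<..<(1::real)}"
    by eventually_elim (auto simp: hweight_def hkernel_def)
  then have "emeasure lborel {0<..<(1::real)} = 0"
    by (subst (asm) AE_iff_measurable[of "{0<..<1}"]) auto
  then show False by simp
qed

text \<open>
  For two functions with disjoint compact supports the energy is a nonzero multiple of the pairing
  with the Riesz kernel of exponent \<open>n + 2 s\<close>. The frequency integral is written as a superposition
  of \<open>1 - exp (-t\<bar>\<xi>\<bar>\<^sup>2)\<close>, and the Gaussian identity translates each Gaussian into a heat kernel; the 1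
  contributes \<open>\<integral> \<phi> f = 0\<close>.
\<close>

lemma energy_zero_imp_riesz_zero:
  fixes \<phi> f :: "real^'n \<Rightarrow> real"
  assumes s: "0 < s" "s < 1" and \<phi>: "\<phi> \<in> Hs s" and f: "f \<in> Hs s"
    and S: "compact S" and T: "compact T" and ST: "S \<inter> T = {}"
    and \<phi>z: "\<And>x. x \<notin> S \<Longrightarrow> \<phi> x = 0" and fz: "\<And>x. x \<notin> T \<Longrightarrow> f x = 0"
    and e0: "energy s \<phi> f = 0"
  shows "(LINT x|lebesgue. f x * (LINT y|lebesgue. \<phi> y * riesz (real CARD('n) + 2 * s) x y)) = 0"
proof -
  have s0: "0 \<le> s" using s by simp
  let ?n = "CARD('n)"
  obtain R where R: "\<And>x. x \<in> S \<union> T \<Longrightarrow> norm x \<le> R"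
    using compact_imp_bounded[OF compact_Un[OF S T]] unfolding bounded_iff by blast
  have supp: "\<phi> x = 0" "f x = 0" if "x \<notin> cball 0 R" for x
    using that R[of x] \<phi>z[of x] fz[of x] by auto
  note \<phi>L = Hs_L2[OF \<phi>] and fL = Hs_L2[OF f]
  have \<phi>i: "integrable lebesgue \<phi>" by (rule L2_bounded_support_integrable[OF \<phi>L lmeasurable_cball supp(1)])
  have fi: "integrable lebesgue f" by (rule L2_bounded_support_integrable[OF fL lmeasurable_cball supp(2)])
  let ?\<phi> = "\<lambda>x. complex_of_real (\<phi> x)" and ?f = "\<lambda>x. complex_of_real (f x)"
  define G where "G \<xi> = fourier \<phi> \<xi> * cnj (fourier f \<xi>)" for \<xi>
  have Gi: "integrable lebesgue G" unfolding G_def[abs_def]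
    by (intro L2_mult_integrable L2_cnj fourier_L2 \<phi>L fL)
  have Gm[measurable]: "G \<in> borel_measurable lebesgue" using Gi by auto
  have sq: "norm \<xi> powr (2 * s) = norm \<xi> powr s * norm \<xi> powr s" for \<xi> :: "real^'n"
    by (simp flip: powr_add)
  have fG: "flap s \<phi> \<xi> * cnj (flap s f \<xi>) = of_real (norm \<xi> powr (2 * s)) * G \<xi>" for \<xi>
    unfolding sq flap_def G_def by (simp add: mult_ac)
  have Gsi: "integrable lebesgue (\<lambda>\<xi>. of_real (norm \<xi> powr (2 * s)) * G \<xi>)"
    unfolding fG[symmetric] by (intro L2_mult_integrable L2_cnj flap_L2 \<phi> f s0)
  have E0: "(LINT \<xi>|lebesgue. of_real (norm \<xi> powr (2 * s)) * G \<xi>) = 0"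
    using e0 integral_flap[OF \<phi> f s0] unfolding fG energy_def by simp
  have G0: "(LINT \<xi>|lebesgue. G \<xi>) = 0"
  proof -
    have "(\<lambda>x. \<phi> x * f x) = (\<lambda>x. 0)" using \<phi>z fz ST by (auto simp: fun_eq_iff)
    then have "(LINT x|lebesgue. \<phi> x * f x) = 0" by simp
    then show ?thesis unfolding G_def fourier_parseval[OF \<phi>L fL] by (simp only: mult_zero_right of_real_0)
  qed
  define I1 where "I1 = (LINT t|lborel. hweight s t * (1 - exp (- t)))"
  define K1 where "K1 = (LINT t|lborel. hweight s t * hkernel ?n t 1)"
  have sym: "integrable lborel (\<lambda>t. hweight s t * (1 - exp (- t * (norm \<xi>)\<^sup>2)))"
    "(LINT t|lborel. hweight s t * (1 - exp (- t * (norm \<xi>)\<^sup>2))) = norm \<xi> powr (2 * s) * I1" for \<xi> :: "real^'n"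
    using symbol_scaling[OF s, of "norm \<xi>"] by (cases "\<xi> = 0"; simp add: I1_def)+
  interpret FT: pair_sigma_finite "lebesgue :: (real^'n) measure" "lborel :: real measure" ..
  note [measurable] = fst_lebesgue
  let ?H = "\<lambda>\<xi> t. of_real (hweight s t * (1 - exp (- t * (norm \<xi>)\<^sup>2))) * G \<xi>"
  have Hi: "integrable ((lebesgue :: (real^'n) measure) \<Otimes>\<^sub>M lborel) (\<lambda>(\<xi>, t). ?H \<xi> t)"
  proof (rule FT.Fubini_integrable)
    show "(\<lambda>(\<xi>, t). ?H \<xi> t) \<in> borel_measurable (lebesgue \<Otimes>\<^sub>M lborel)"
      unfolding case_prod_beta by measurable
    have "norm (?H \<xi> t) = hweight s t * (1 - exp (- t * (norm \<xi>)\<^sup>2)) * cmod (G \<xi>)" for \<xi> t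
    proof -
      have "0 \<le> hweight s t * (1 - exp (- t * (norm \<xi>)\<^sup>2))"
        by (cases "t > 0") (auto simp: hweight_def)
      then show ?thesis by (simp only: norm_mult norm_of_real abs_of_nonneg)
    qed
    then have "(\<lambda>\<xi>. LINT t|lborel. norm (case (\<xi>, t) of (\<xi>, t) \<Rightarrow> ?H \<xi> t)) = (\<lambda>\<xi>. norm \<xi> powr (2 * s) * I1 * cmod (G \<xi>))"
      using sym(2) by simp
    moreover have "integrable lebesgue (\<lambda>\<xi>. norm (of_real (norm \<xi> powr (2 * s)) * G \<xi>) * I1)" using Gsi by simp
    ultimately show "integrable lebesgue (\<lambda>\<xi>. LINT t|lborel. norm (case (\<xi>, t) of (\<xi>, t) \<Rightarrow> ?H \<xi> t))"
      by (simp add: norm_mult mult_ac)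
    show "AE \<xi> in lebesgue. integrable lborel (\<lambda>t. case (\<xi>, t) of (\<xi>, t) \<Rightarrow> ?H \<xi> t)"
    proof (rule AE_I2)
      fix \<xi> :: "real^'n"
      have "integrable lborel (\<lambda>t. complex_of_real (hweight s t * (1 - exp (- t * (norm \<xi>)\<^sup>2))))"
        using sym(1)[of \<xi>] by (rule integrable_of_real)
      then have "integrable lborel (\<lambda>t. ?H \<xi> t)" by (rule integrable_mult_left)
      then show "integrable lborel (\<lambda>t. case (\<xi>, t) of (\<xi>, t) \<Rightarrow> ?H \<xi> t)" by simp
    qed
  qed
  have "(LINT t|lborel. (LINT \<xi>|lebesgue. ?H \<xi> t)) = (LINT \<xi>|lebesgue. (LINT t|lborel. ?H \<xi> t))"
    by (rule FT.Fubini_integral[OF Hi])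
  also have "\<dots> = (LINT \<xi>|lebesgue. of_real I1 * (of_real (norm \<xi> powr (2 * s)) * G \<xi>))"
  proof -
    have "(LINT t|lborel. ?H \<xi> t) = of_real I1 * (of_real (norm \<xi> powr (2 * s)) * G \<xi>)" for \<xi>
    proof -
      have "(LINT t|lborel. ?H \<xi> t) = (LINT t|lborel. complex_of_real (hweight s t * (1 - exp (- t * (norm \<xi>)\<^sup>2)))) * G \<xi>"
        by (rule integral_mult_left_zero)
      also have "\<dots> = of_real (norm \<xi> powr (2 * s) * I1) * G \<xi>"
        unfolding integral_complex_of_real sym(2) ..
      finally show ?thesis by (simp only: of_real_mult mult_ac)
    qed
    then show ?thesis by (simp only:)
  qed
  also have "\<dots> = 0" unfolding Bochner_Integration.integral_mult_right_zero E0 by simp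
  finally have freq: "(LINT t|lborel. (LINT \<xi>|lebesgue. ?H \<xi> t)) = 0" .
  have \<phi>ci: "integrable lebesgue ?\<phi>" and fci: "integrable lebesgue ?f" using \<phi>i fi by auto
  let ?Q = "\<lambda>t. LINT x|lebesgue. f x * (LINT y|lebesgue. \<phi> y * hkernel ?n t ((norm (x - y))\<^sup>2))"
  \<comment> \<open>For fixed \<open>t\<close>, the passage from frequencies to space.\<close>
  have HQ: "(LINT \<xi>|lebesgue. ?H \<xi> t) = of_real (- hweight s t * ?Q t)" for t
  proof (cases "t > 0")
    case True
    let ?g = "\<lambda>\<xi>::real^'n. complex_of_real (exp (- t * (norm \<xi>)\<^sup>2))"
    have gG: "integrable lebesgue (\<lambda>\<xi>. ?g \<xi> * G \<xi>)"
    proof (rule Bochner_Integration.integrable_bound[OF Gi])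
      have "?g \<in> borel_measurable lebesgue" by (rule measurable_completion) measurable
      then show "(\<lambda>\<xi>. ?g \<xi> * G \<xi>) \<in> borel_measurable lebesgue" by measurable
      show "AE \<xi> in lebesgue. norm (?g \<xi> * G \<xi>) \<le> norm (G \<xi>)"
        using True by (intro AE_I2) (simp add: norm_mult mult_left_le_one_le)
    qed
    have "(LINT \<xi>|lebesgue. ?H \<xi> t) = (LINT \<xi>|lebesgue. of_real (hweight s t) * (G \<xi> - ?g \<xi> * G \<xi>))"
      by (simp add: algebra_simps)
    also have "\<dots> = of_real (hweight s t) * ((LINT \<xi>|lebesgue. G \<xi>) - (LINT \<xi>|lebesgue. ?g \<xi> * G \<xi>))"
      unfolding Bochner_Integration.integral_mult_right_zero Bochner_Integration.integral_diff[OF Gi gG] ..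
    also have "(LINT \<xi>|lebesgue. ?g \<xi> * G \<xi>) = cnj (LINT \<xi>|lebesgue. ?g \<xi> * (fourier_integral ?f \<xi> * cnj (fourier_integral ?\<phi> \<xi>)))"
    proof -
      have F1: "AE \<xi> in lebesgue. fourier \<phi> \<xi> = fourier_integral ?\<phi> \<xi>" by (rule fourier_eq_fourier_integral[OF \<phi>L supp(1)])
      have F2: "AE \<xi> in lebesgue. fourier f \<xi> = fourier_integral ?f \<xi>" by (rule fourier_eq_fourier_integral[OF fL supp(2)])
      have "(LINT \<xi>|lebesgue. ?g \<xi> * G \<xi>) = (LINT \<xi>|lebesgue. cnj (?g \<xi> * (fourier_integral ?f \<xi> * cnj (fourier_integral ?\<phi> \<xi>))))"
      proof (rule integral_cong_AE)
        show "(\<lambda>\<xi>. ?g \<xi> * G \<xi>) \<in> borel_measurable lebesgue" using gG by auto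
        have m: "fourier_integral ?\<phi> \<in> borel_measurable lebesgue" "fourier_integral ?f \<in> borel_measurable lebesgue"
          using \<phi>ci fci by (auto intro: fourier_integral_measurable)
        have "?g \<in> borel_measurable lebesgue" by (rule measurable_completion) measurable
        then show "(\<lambda>\<xi>. cnj (?g \<xi> * (fourier_integral ?f \<xi> * cnj (fourier_integral ?\<phi> \<xi>)))) \<in> borel_measurable lebesgue"
          using m by measurable
        show "AE \<xi> in lebesgue. ?g \<xi> * G \<xi> = cnj (?g \<xi> * (fourier_integral ?f \<xi> * cnj (fourier_integral ?\<phi> \<xi>)))"
          using F1 F2 by eventually_elim (simp add: G_def mult.commute)
      qed
      also have "\<dots> = cnj (LINT \<xi>|lebesgue. ?g \<xi> * (fourier_integral ?f \<xi> * cnj (fourier_integral ?\<phi> \<xi>)))"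
        by (rule Bochner_Integration.integral_cnj)
      finally show ?thesis .
    qed
    also have "(LINT \<xi>|lebesgue. ?g \<xi> * (fourier_integral ?f \<xi> * cnj (fourier_integral ?\<phi> \<xi>)))
        = (LINT x|lebesgue. ?f x * (LINT y|lebesgue. cnj (?\<phi> y) * of_real (hkernel ?n t ((norm (x - y))\<^sup>2))))"
      unfolding hkernel_def by (rule fourier_gauss_identity[OF fci \<phi>ci True])
    also have "\<dots> = of_real (?Q t)"
    proof -
      have "(LINT y|lebesgue. cnj (?\<phi> y) * of_real (hkernel ?n t ((norm (x - y))\<^sup>2))) = of_real (LINT y|lebesgue. \<phi> y * hkernel ?n t ((norm (x - y))\<^sup>2))" for x
        by (simp flip: of_real_mult integral_complex_of_real)
      then show ?thesis by (simp only: of_real_mult[symmetric] integral_complex_of_real)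
    qed
    finally show ?thesis by (simp add: G0)
  qed (simp add: hweight_def)
  have Q0: "(LINT t|lborel. hweight s t * ?Q t) = 0"
    using freq unfolding HQ integral_complex_of_real by simp
  define Kr where "Kr x y = riesz (real ?n + 2 * s) x y" for x y :: "real^'n"
  have Kr: "integrable lborel (\<lambda>t. hweight s t * hkernel ?n t ((norm (x - y))\<^sup>2))"
     "(LINT t|lborel. hweight s t * hkernel ?n t ((norm (x - y))\<^sup>2)) = Kr x y * K1" if "x \<noteq> y" for x y :: "real^'n"
    using heat_scaling[OF s, of "norm (x - y)" ?n] that
    by (simp_all add: Kr_def riesz_def K1_def power2_norm_eq_inner)
  \<comment> \<open>The Riesz kernel is bounded on the product of the disjoint supports, which gives the absolute
    integrability that is needed to integrate over \<open>t\<close> first.\<close>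
  obtain D where D: "\<And>x y. x \<in> T \<Longrightarrow> y \<in> S \<Longrightarrow> \<bar>Kr x y\<bar> \<le> D"
  proof -
    have "compact ((\<lambda>(x, y). Kr x y) ` (T \<times> S))" unfolding Kr_def
      by (intro compact_continuous_image riesz_continuous compact_Times S T) (use ST in auto)
    then have "bounded ((\<lambda>(x, y). Kr x y) ` (T \<times> S))" by (rule compact_imp_bounded)
    then obtain D where "\<And>p. p \<in> T \<times> S \<Longrightarrow> norm (case p of (x, y) \<Rightarrow> Kr x y) \<le> D"
      unfolding bounded_iff by blast
    then have "\<bar>Kr x y\<bar> \<le> D" if "x \<in> T" "y \<in> S" for x y using that by force
    then show ?thesis by (rule that)
  qed
  note [measurable] = snd_lebesgue
  have [measurable]: "\<phi> \<in> borel_measurable lebesgue" "f \<in> borel_measurable lebesgue" using \<phi>i fi by auto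
  let ?P = "(lebesgue :: (real^'n) measure) \<Otimes>\<^sub>M (lebesgue :: (real^'n) measure)"
  have ffi: "integrable ?P (\<lambda>(x, y). f x * \<phi> y)"
    using lebp.integrable_bounded_kernel[OF fi \<phi>i, of "\<lambda>_. 1" 1] by simp
  interpret PT: pair_sigma_finite ?P "lborel :: real measure" ..
  let ?J = "\<lambda>p t. f (fst p) * \<phi> (snd p) * (hweight s t * hkernel ?n t ((norm (fst p - snd p))\<^sup>2))"
  have Jint: "integrable lborel (\<lambda>t. ?J p t)" "(LINT t|lborel. ?J p t) = f (fst p) * \<phi> (snd p) * Kr (fst p) (snd p) * K1"
     "(LINT t|lborel. norm (?J p t)) = \<bar>f (fst p) * \<phi> (snd p)\<bar> * Kr (fst p) (snd p) * K1" for p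
  proof -
    have nn: "0 \<le> hweight s t * hkernel ?n t r" for t r
      using hkernel_nonneg[of t ?n r] by (cases "t > 0") (auto simp: hweight_def)
    have n: "norm (?J p t) = \<bar>f (fst p) * \<phi> (snd p)\<bar> * (hweight s t * hkernel ?n t ((norm (fst p - snd p))\<^sup>2))" for t
      using nn by (simp only: real_norm_def abs_mult[of "f (fst p) * \<phi> (snd p)"] abs_of_nonneg)
    have "f (fst p) * \<phi> (snd p) = 0 \<or> fst p \<noteq> snd p"
      using fz[of "fst p"] \<phi>z[of "snd p"] ST by (metis disjoint_iff mult_eq_0_iff)
    then show "integrable lborel (\<lambda>t. ?J p t)" "(LINT t|lborel. ?J p t) = f (fst p) * \<phi> (snd p) * Kr (fst p) (snd p) * K1"
     "(LINT t|lborel. norm (?J p t)) = \<bar>f (fst p) * \<phi> (snd p)\<bar> * Kr (fst p) (snd p) * K1"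
      unfolding n using Kr[of "fst p" "snd p"] by auto
  qed
  have Krm: "(\<lambda>p. Kr (fst p) (snd p)) \<in> borel_measurable ?P"
    unfolding Kr_def riesz_def by measurable
  have fK: "integrable ?P (\<lambda>p. f (fst p) * \<phi> (snd p) * Kr (fst p) (snd p))"
  proof (rule Bochner_Integration.integrable_bound)
    show "integrable ?P (\<lambda>p. D * (f (fst p) * \<phi> (snd p)))"
      using ffi unfolding case_prod_beta' by (rule integrable_mult_right)
    show "(\<lambda>p. f (fst p) * \<phi> (snd p) * Kr (fst p) (snd p)) \<in> borel_measurable ?P"
      using Krm by measurable
    show "AE p in ?P. norm (f (fst p) * \<phi> (snd p) * Kr (fst p) (snd p)) \<le> norm (D * (f (fst p) * \<phi> (snd p)))"
    proof (rule AE_I2)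
      fix p
      show "norm (f (fst p) * \<phi> (snd p) * Kr (fst p) (snd p)) \<le> norm (D * (f (fst p) * \<phi> (snd p)))"
      proof (cases "fst p \<in> T \<and> snd p \<in> S")
        case True
        then have "\<bar>Kr (fst p) (snd p)\<bar> \<le> \<bar>D\<bar>" using D[of "fst p" "snd p"] by auto
        then have "\<bar>f (fst p) * \<phi> (snd p)\<bar> * \<bar>Kr (fst p) (snd p)\<bar> \<le> \<bar>f (fst p) * \<phi> (snd p)\<bar> * \<bar>D\<bar>"
          by (rule mult_left_mono) simp
        then show ?thesis by (simp only: real_norm_def abs_mult mult.commute[of "\<bar>D\<bar>"])
      next
        case False then show ?thesis using fz[of "fst p"] \<phi>z[of "snd p"] by auto
      qed
    qed
  qed
  have Krn: "0 \<le> Kr x y" for x y by (simp add: Kr_def riesz_def)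
  have Ji: "integrable (?P \<Otimes>\<^sub>M lborel) (\<lambda>(p, t). ?J p t)"
  proof (rule PT.Fubini_integrable)
    have "(\<lambda>q. hkernel ?n (fst (snd q, (norm (fst (fst q) - snd (fst q)))\<^sup>2)) (snd (snd q, (norm (fst (fst q) - snd (fst q)))\<^sup>2))) \<in> borel_measurable (?P \<Otimes>\<^sub>M (lborel :: real measure))"
      by (rule measurable_compose[OF _ hkernel_measurable]) measurable
    then have [measurable]: "(\<lambda>q. hkernel ?n (snd q) ((norm (fst (fst q) - snd (fst q)))\<^sup>2)) \<in> borel_measurable (?P \<Otimes>\<^sub>M (lborel :: real measure))"
      by simp
    show "(\<lambda>(p, t). ?J p t) \<in> borel_measurable (?P \<Otimes>\<^sub>M lborel)"
      unfolding case_prod_beta by measurable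
    have "integrable ?P (\<lambda>p. \<bar>f (fst p) * \<phi> (snd p) * Kr (fst p) (snd p)\<bar> * K1)" using fK by simp
    then show "integrable ?P (\<lambda>p. LINT t|lborel. norm (case (p, t) of (p, t) \<Rightarrow> ?J p t))"
      unfolding prod.case Jint(3) using Krn by (simp add: abs_mult)
    show "AE p in ?P. integrable lborel (\<lambda>t. case (p, t) of (p, t) \<Rightarrow> ?J p t)"
      unfolding prod.case using Jint(1) by (intro AE_I2)
  qed
  have "(LINT t|lborel. (LINT p|?P. ?J p t)) = (LINT p|?P. (LINT t|lborel. ?J p t))"
    by (rule PT.Fubini_integral[OF Ji])
  also have "\<dots> = (LINT p|?P. f (fst p) * \<phi> (snd p) * Kr (fst p) (snd p)) * K1"
    unfolding Jint(2) by (rule integral_mult_left_zero)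
  also have "(LINT p|?P. f (fst p) * \<phi> (snd p) * Kr (fst p) (snd p)) = (LINT x|lebesgue. (LINT y|lebesgue. f x * \<phi> y * Kr x y))"
    using lebp.integral_fst'[OF fK] by simp
  also have "\<dots> = (LINT x|lebesgue. f x * (LINT y|lebesgue. \<phi> y * Kr x y))"
    by (simp only: mult.assoc Bochner_Integration.integral_mult_right_zero)
  finally have main: "(LINT t|lborel. (LINT p|?P. ?J p t)) = (LINT x|lebesgue. f x * (LINT y|lebesgue. \<phi> y * Kr x y)) * K1" .
  have "(LINT p|?P. ?J p t) = hweight s t * ?Q t" for t
  proof (cases "t > 0")
    case True
    have "(\<lambda>p. hkernel ?n (fst (t, (norm (fst p - snd p))\<^sup>2)) (snd (t, (norm (fst p - snd p))\<^sup>2))) \<in> borel_measurable ?P"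
      by (rule measurable_compose[OF _ hkernel_measurable]) measurable
    then have km: "(\<lambda>p. hkernel ?n t ((norm (fst p - snd p))\<^sup>2)) \<in> borel_measurable ?P" by simp
    have kb: "norm (hkernel ?n t ((norm (fst p - snd p))\<^sup>2)) \<le> sqrt (pi / t) ^ ?n" for p :: "(real^'n) \<times> (real^'n)"
    proof -
      have "hkernel ?n t ((norm (fst p - snd p))\<^sup>2) \<le> sqrt (pi / t) ^ ?n * 1"
        unfolding hkernel_def using True by (intro mult_left_mono) auto
      then show ?thesis using hkernel_nonneg[OF True] by simp
    qed
    have i: "integrable ?P (\<lambda>(x, y). f x * (hkernel ?n t ((norm (fst (x, y) - snd (x, y)))\<^sup>2) * \<phi> y))"
      by (rule lebp.integrable_bounded_kernel[OF fi \<phi>i km kb])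
    have "(LINT p|?P. ?J p t) = (LINT p|?P. hweight s t * (case p of (x, y) \<Rightarrow> f x * (hkernel ?n t ((norm (fst (x, y) - snd (x, y)))\<^sup>2) * \<phi> y)))"
      by (simp add: case_prod_beta mult_ac)
    also have "\<dots> = hweight s t * (LINT x|lebesgue. (LINT y|lebesgue. f x * (hkernel ?n t ((norm (x - y))\<^sup>2) * \<phi> y)))"
      unfolding Bochner_Integration.integral_mult_right_zero lebp.integral_fst'[OF i, symmetric] by simp
    also have "\<dots> = hweight s t * ?Q t"
      by (simp only: Bochner_Integration.integral_mult_right_zero mult.commute[of "hkernel _ _ _"])
    finally show ?thesis .
  qed (simp add: hweight_def)
  then have "(LINT x|lebesgue. f x * (LINT y|lebesgue. \<phi> y * Kr x y)) * K1 = 0"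
    using main Q0 by simp
  then show ?thesis using heat_constant_pos[OF s, of ?n] unfolding Kr_def K1_def by simp
qed

section \<open>Finite rank perturbations\<close>

definition lin_subspace :: "('x \<Rightarrow> real) set \<Rightarrow> bool" where
  "lin_subspace V \<longleftrightarrow> (\<forall>u\<in>V. \<forall>v\<in>V. \<forall>c. (\<lambda>x. u x + c * v x) \<in> V)"

definition lin_on :: "('x \<Rightarrow> real) set \<Rightarrow> (('x \<Rightarrow> real) \<Rightarrow> real) \<Rightarrow> bool" where
  "lin_on V F \<longleftrightarrow> (\<forall>u\<in>V. \<forall>v\<in>V. \<forall>c. F (\<lambda>x. u x + c * v x) = F u + c * F v)"

definition sym_bilinear_on :: "('x \<Rightarrow> real) set \<Rightarrow> (('x \<Rightarrow> real) \<Rightarrow> ('x \<Rightarrow> real) \<Rightarrow> real) \<Rightarrow> bool" where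
  "sym_bilinear_on V b \<longleftrightarrow> (\<forall>w\<in>V. lin_on V (\<lambda>u. b u w)) \<and> (\<forall>u\<in>V. \<forall>v\<in>V. b u v = b v u)"

text \<open>
  Fredholm solvability: the right-hand sides range over a class \<open>A\<close> of functionals, such as the bounded
  ones, and must vanish on the kernel of the form.
\<close>

definition solvable_on :: "('x \<Rightarrow> real) set \<Rightarrow> (('x \<Rightarrow> real) \<Rightarrow> ('x \<Rightarrow> real) \<Rightarrow> real) \<Rightarrow> ((('x \<Rightarrow> real) \<Rightarrow> real) \<Rightarrow> bool) \<Rightarrow> bool" where
  "solvable_on V b A \<longleftrightarrow> (\<forall>F. A F \<longrightarrow> (\<forall>k\<in>V. (\<forall>v\<in>V. b k v = 0) \<longrightarrow> F k = 0) \<longrightarrow> (\<exists>u\<in>V. \<forall>v\<in>V. b u v = F v))"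

text \<open>
  The Fredholm alternative survives the removal of a rank one term, by elementary linear algebra:
  either some \<open>k\<close> in the kernel of the perturbed form has \<open>\<ell> k \<noteq> 0\<close>, and then \<open>b k\<close> is a multiple of
  \<open>\<ell>\<close> that can be used for corrections, or the representative \<open>w\<close> of \<open>\<ell>\<close> serves for the same
  purpose unless \<open>\<ell> w = 1\<close>, in which case \<open>w\<close> is in the kernel of \<open>b\<close> and no correction is needed.
\<close>

lemma solvable_on_remove_rank_one:
  assumes V: "lin_subspace V" and b: "sym_bilinear_on V b" and l: "lin_on V l" and A: "\<And>F. A F \<Longrightarrow> lin_on V F"
    and Al: "A l" and AF: "\<And>F c. A F \<Longrightarrow> A (\<lambda>v. F v + c * l v)"
    and solv: "solvable_on V (\<lambda>u v. b u v + l u * l v) A"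
  shows "solvable_on V b A"
  unfolding solvable_on_def
proof (intro allI impI)
  fix F assume F: "A F" and orth: "\<forall>k\<in>V. (\<forall>v\<in>V. b k v = 0) \<longrightarrow> F k = 0"
  have Vl: "(\<lambda>x. u x + c * v x) \<in> V" if "u \<in> V" "v \<in> V" for u v c using V that by (auto simp: lin_subspace_def)
  have bl: "b (\<lambda>x. u x + c * v x) w = b u w + c * b v w" if "u \<in> V" "v \<in> V" "w \<in> V" for u v w c
    using b that by (auto simp: sym_bilinear_on_def lin_on_def)
  have bs: "b u v = b v u" if "u \<in> V" "v \<in> V" for u v using b that by (auto simp: sym_bilinear_on_def)
  have ll: "l (\<lambda>x. u x + c * v x) = l u + c * l v" if "u \<in> V" "v \<in> V" for u v c using l that by (auto simp: lin_on_def)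
  have Fl: "F (\<lambda>x. u x + c * v x) = F u + c * F v" if "u \<in> V" "v \<in> V" for u v c using A[OF F] that by (auto simp: lin_on_def)
  have solve: "\<exists>u\<in>V. \<forall>v\<in>V. b u v + l u * l v = G v"
    if "A G" "\<And>k. k \<in> V \<Longrightarrow> (\<And>v. v \<in> V \<Longrightarrow> b k v + l k * l v = 0) \<Longrightarrow> G k = 0" for G
    using solv that unfolding solvable_on_def by blast
  show "\<exists>u\<in>V. \<forall>v\<in>V. b u v = F v"
  proof (cases "\<exists>k\<in>V. (\<forall>v\<in>V. b k v + l k * l v = 0) \<and> l k \<noteq> 0")
    case True
    then obtain k where k: "k \<in> V" "\<And>v. v \<in> V \<Longrightarrow> b k v + l k * l v = 0" "l k \<noteq> 0" by blast
    have bk: "b k v = - (l k * l v)" if "v \<in> V" for v using k(2)[OF that] by simp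
    define \<alpha> where "\<alpha> = F k / l k"
    obtain u where u: "u \<in> V" "\<And>v. v \<in> V \<Longrightarrow> b u v + l u * l v = F v + (- \<alpha>) * l v"
    proof -
      have "\<exists>u\<in>V. \<forall>v\<in>V. b u v + l u * l v = F v + (- \<alpha>) * l v"
      proof (rule solve[OF AF[OF F]])
        fix k' assume k': "k' \<in> V" and z: "\<And>v. v \<in> V \<Longrightarrow> b k' v + l k' * l v = 0"
        let ?w = "\<lambda>x. k' x + (- (l k' / l k)) * k x"
        have w: "?w \<in> V" by (rule Vl[OF k' k(1)])
        have "b ?w v = 0" if v: "v \<in> V" for v
          using z[OF v] k(3) by (simp add: bl[OF k' k(1) v, of "- (l k' / l k)", simplified] bk[OF v])
        then have "F ?w = 0" using orth w by blast
        then have "F k' = l k' / l k * F k" using Fl[OF k' k(1), of "- (l k' / l k)"] by simp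
        then show "F k' + (- \<alpha>) * l k' = 0" by (simp add: \<alpha>_def)
      qed
      then show ?thesis using that by blast
    qed
    let ?c = "- ((\<alpha> + l u) / l k)"
    have "b (\<lambda>x. u x + ?c * k x) v = F v" if v: "v \<in> V" for v
    proof -
      have "b (\<lambda>x. u x + ?c * k x) v = b u v + ?c * b k v" by (rule bl[OF u(1) k(1) v])
      also have "\<dots> = b u v + (\<alpha> + l u) * l v" using k(3) by (simp add: bk[OF v])
      also have "\<dots> = F v" using u(2)[OF v] by (simp add: algebra_simps)
      finally show ?thesis .
    qed
    then show ?thesis using Vl[OF u(1) k(1), of ?c] by blast
  next
    case False
    then have l0: "l k = 0" if "k \<in> V" "\<And>v. v \<in> V \<Longrightarrow> b k v + l k * l v = 0" for k using that by blast
    obtain u where u: "u \<in> V" "\<And>v. v \<in> V \<Longrightarrow> b u v + l u * l v = F v"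
    proof -
      have "\<exists>u\<in>V. \<forall>v\<in>V. b u v + l u * l v = F v"
      proof (rule solve[OF F])
        fix k assume k: "k \<in> V" "\<And>v. v \<in> V \<Longrightarrow> b k v + l k * l v = 0"
        have "b k v = 0" if "v \<in> V" for v using k(2)[OF that] l0[OF k] by simp
        then show "F k = 0" using orth k(1) by blast
      qed
      then show ?thesis using that by blast
    qed
    obtain w where w: "w \<in> V" "\<And>v. v \<in> V \<Longrightarrow> b w v + l w * l v = l v"
      using solve[OF Al l0] by blast
    show ?thesis
    proof (cases "l w = 1")
      case True
      have "b w v = 0" if "v \<in> V" for v using w(2)[OF that] True by simp
      then have "F w = 0" using orth w(1) by blast
      then have "l u = 0" using u(2)[OF w(1)] w(2)[OF u(1)] bs[OF u(1) w(1)] True by simp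
      then show ?thesis using u by auto
    next
      case False
      let ?c = "l u / (1 - l w)"
      have "b (\<lambda>x. u x + ?c * w x) v = F v" if v: "v \<in> V" for v
      proof -
        have "b (\<lambda>x. u x + ?c * w x) v = b u v + ?c * b w v" by (rule bl[OF u(1) w(1) v])
        also have "b w v = (1 - l w) * l v" using w(2)[OF v] by (simp add: algebra_simps)
        also have "b u v + ?c * ((1 - l w) * l v) = F v" using u(2)[OF v] False by simp
        finally show ?thesis .
      qed
      then show ?thesis using Vl[OF u(1) w(1), of ?c] by blast
    qed
  qed
qed

lemma solvable_on_remove_finite_rank:
  assumes V: "lin_subspace V" and b: "sym_bilinear_on V b" and A: "\<And>F. A F \<Longrightarrow> lin_on V F"
    and AF: "\<And>F G c. A F \<Longrightarrow> A G \<Longrightarrow> A (\<lambda>v. F v + c * G v)"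
    and ls: "\<And>l. l \<in> set ls \<Longrightarrow> A l"
    and solv: "solvable_on V (\<lambda>u v. b u v + (\<Sum>l\<leftarrow>ls. l u * l v)) A"
  shows "solvable_on V b A"
  using b ls solv
proof (induction ls arbitrary: b)
  case Nil
  then show ?case by simp
next
  case (Cons l ls)
  have Al: "A l" by (rule Cons.prems(2)) simp
  have ll: "lin_on V l" by (rule A[OF Al])
  have b': "sym_bilinear_on V (\<lambda>u v. b u v + l u * l v)"
    using Cons.prems(1) ll unfolding sym_bilinear_on_def lin_on_def by (auto simp: algebra_simps)
  have solv': "solvable_on V (\<lambda>u v. b u v + l u * l v) A"
    by (rule Cons.IH[OF b']) (use Cons.prems(2,3) in \<open>auto simp: add.assoc\<close>)
  show ?case
  proof (rule solvable_on_remove_rank_one[where V = V and b = b and l = l and A = A])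
    show "lin_on V F" if "A F" for F by (rule A[OF that])
    show "A (\<lambda>v. F v + c * l v)" if "A F" for F c by (rule AF[OF that Al])
  qed (fact V Cons.prems(1) ll Al solv')+
qed

section \<open>The energy space of a domain\<close>

lemma Hs_norm_AE_zero:
  fixes u :: "real^'n \<Rightarrow> real"
  assumes u: "u \<in> L2" and z: "AE x in lebesgue. u x = 0"
  shows "u \<in> Hs s" "Hs_norm s u = 0"
proof -
  have "l2norm u = l2norm (\<lambda>x::real^'n. 0 :: real)" by (rule l2norm_cong_AE[OF u L2_zero z])
  then have "l2norm u = 0" by (simp add: l2norm_def)
  then have "l2norm (fourier u) = 0" by (simp add: fourier_plancherel[OF u])
  then have "AE \<xi> in lebesgue. fourier u \<xi> = 0" by (rule l2norm_eq_0[OF fourier_L2[OF u]])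
  then have e: "AE \<xi> in lebesgue. sob s u \<xi> = 0" by eventually_elim (simp add: sob_def)
  have sL: "sob s u \<in> L2"
    by (rule L2_AE_bounded[OF L2_zero sob_measurable[OF u], of _ 0]) (use e in auto)
  then show "u \<in> Hs s" using u by (simp add: Hs_iff)
  have "l2norm (sob s u) = l2norm (\<lambda>x::real^'n. 0 :: complex)" by (rule l2norm_cong_AE[OF sL L2_zero e])
  then show "Hs_norm s u = 0" by (simp add: Hs_norm_eq l2norm_def)
qed

lemma Hs_norm_minus_commute:
  assumes "u \<in> Hs s" "v \<in> Hs s" shows "Hs_norm s (\<lambda>x. u x - v x) = Hs_norm s (\<lambda>x. v x - u x)"
  unfolding Hs_norm_diff[OF assms] Hs_norm_diff[OF assms(2,1)] by (rule l2norm_minus_commute)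

lemma Hs_norm_self: "Hs_norm s (\<lambda>x. u x - u x) = 0"
  using Hs_norm_AE_zero(2)[of "\<lambda>x. 0" s] by simp

text \<open>
  Both the functions and their weighted transforms converge in \<open>L\<^sup>2\<close>, and a subsequence that converges
  almost everywhere identifies the second limit as the weighted transform of the first.
\<close>

lemma Hs_complete:
  fixes f :: "nat \<Rightarrow> real^'n \<Rightarrow> real"
  assumes f: "\<And>k. f k \<in> Hs s" and s: "s \<ge> 0"
    and Cauchy: "\<And>e. e > 0 \<Longrightarrow> \<exists>N. \<forall>i\<ge>N. \<forall>j\<ge>N. Hs_norm s (\<lambda>x. f i x - f j x) < e"
  obtains w where "w \<in> Hs s" "(\<lambda>k. Hs_norm s (\<lambda>x. f k x - w x)) \<longlonglongrightarrow> 0"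
proof -
  note fL = Hs_L2[OF f]
  have "\<exists>N. \<forall>i\<ge>N. \<forall>j\<ge>N. l2norm (\<lambda>\<xi>. sob s (f i) \<xi> - sob s (f j) \<xi>) < e" if "e > 0" for e
    using Cauchy[OF that] unfolding Hs_norm_diff[OF f f] .
  from L2_complete[OF Hs_sob[OF f] this] obtain G where G: "G \<in> L2" "(\<lambda>k. l2norm (\<lambda>\<xi>. sob s (f k) \<xi> - G \<xi>)) \<longlonglongrightarrow> 0" by blast
  have "\<exists>N. \<forall>i\<ge>N. \<forall>j\<ge>N. l2norm (\<lambda>x. f i x - f j x) < e" if "e > 0" for e
    using Cauchy[OF that] l2norm_le_Hs_norm[OF Hs_diff[OF f f] s] by (meson le_less_trans)
  from L2_complete[OF fL this] obtain w where w: "w \<in> L2" "(\<lambda>k. l2norm (\<lambda>x. f k x - w x)) \<longlonglongrightarrow> 0" by blast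
  have Fw: "(\<lambda>k. l2norm (\<lambda>\<xi>. fourier (f k) \<xi> - fourier w \<xi>)) \<longlonglongrightarrow> 0"
  proof -
    have "l2norm (\<lambda>\<xi>. fourier (f k) \<xi> - fourier w \<xi>) = sqrt ((2 * pi) ^ CARD('n)) * l2norm (\<lambda>x. f k x - w x)" for k
    proof -
      have "l2norm (\<lambda>\<xi>. fourier (f k) \<xi> - fourier w \<xi>) = l2norm (fourier (\<lambda>x. f k x + (-1) * w x))"
      proof (rule l2norm_cong_AE)
        show "AE \<xi> in lebesgue. fourier (f k) \<xi> - fourier w \<xi> = fourier (\<lambda>x. f k x + (-1) * w x) \<xi>"
          using fourier_lin[OF fL[of k] w(1), of "-1"] by eventually_elim simp
      qed (intro L2_diff fourier_L2 L2_lin fL w(1))+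
      then show ?thesis using fourier_plancherel[OF L2_diff[OF fL[of k] w(1)]] by simp
    qed
    then show ?thesis using tendsto_mult_left[OF w(2), of "sqrt ((2 * pi) ^ CARD('n))"] by simp
  qed
  obtain r :: "nat \<Rightarrow> nat" where r: "strict_mono r" "AE \<xi> in lebesgue. (\<lambda>k. fourier (f (r k)) \<xi>) \<longlonglongrightarrow> fourier w \<xi>"
    using L2_tendsto_subseq_AE[OF fourier_L2[OF fL] fourier_L2[OF w(1)] Fw] by blast
  have "(\<lambda>k. l2norm (\<lambda>\<xi>. sob s (f (r k)) \<xi> - G \<xi>)) \<longlonglongrightarrow> 0"
    using LIMSEQ_subseq_LIMSEQ[OF G(2) r(1)] by (simp add: o_def)
  then obtain t :: "nat \<Rightarrow> nat" where t: "strict_mono t" "AE \<xi> in lebesgue. (\<lambda>k. sob s (f (r (t k))) \<xi>) \<longlonglongrightarrow> G \<xi>"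
    using L2_tendsto_subseq_AE[OF Hs_sob[OF f] G(1)] by blast
  have eq: "AE \<xi> in lebesgue. sob s w \<xi> = G \<xi>"
    using r(2) t(2)
  proof eventually_elim
    fix \<xi> assume 1: "(\<lambda>k. fourier (f (r k)) \<xi>) \<longlonglongrightarrow> fourier w \<xi>" and 2: "(\<lambda>k. sob s (f (r (t k))) \<xi>) \<longlonglongrightarrow> G \<xi>"
    have "(\<lambda>k. fourier (f (r (t k))) \<xi>) \<longlonglongrightarrow> fourier w \<xi>"
      using LIMSEQ_subseq_LIMSEQ[OF 1 t(1)] by (simp add: o_def)
    then have "(\<lambda>k. sob s (f (r (t k))) \<xi>) \<longlonglongrightarrow> sob s w \<xi>"
      unfolding sob_def by (rule tendsto_mult_left)
    then show "sob s w \<xi> = G \<xi>" using 2 by (rule LIMSEQ_unique)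
  qed
  have sL: "sob s w \<in> L2"
    by (rule L2_AE_bounded[OF G(1) sob_measurable[OF w(1)], of _ 1]) (use eq in auto)
  have wH: "w \<in> Hs s" using w(1) sL by (simp add: Hs_iff)
  have "Hs_norm s (\<lambda>x. f k x - w x) = l2norm (\<lambda>\<xi>. sob s (f k) \<xi> - G \<xi>)" for k
    unfolding Hs_norm_diff[OF f wH]
  proof (rule l2norm_cong_AE[OF L2_diff[OF Hs_sob[OF f] sL] L2_diff[OF Hs_sob[OF f] G(1)]])
    show "AE \<xi> in lebesgue. sob s (f k) \<xi> - sob s w \<xi> = sob s (f k) \<xi> - G \<xi>"
      using eq by eventually_elim simp
  qed
  then show ?thesis using that[OF wH] G(2) by simp
qed

lemma Hs_tilde_Hs: "u \<in> Hs_tilde s \<Omega> \<Longrightarrow> u \<in> Hs s"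
  by (simp add: Hs_tilde_def)

lemma Hs_tilde_approx:
  assumes "u \<in> Hs_tilde s \<Omega>" "\<epsilon> > 0" obtains \<phi> where "\<phi> \<in> Cc_infty \<Omega>" "Hs_norm s (\<lambda>x. u x - \<phi> x) < \<epsilon>"
  using assms by (auto simp: Hs_tilde_def)

lemma Cc_infty_Hs_tilde: "\<phi> \<in> Cc_infty \<Omega> \<Longrightarrow> s \<le> 1 \<Longrightarrow> \<phi> \<in> Hs_tilde s \<Omega>"
  unfolding Hs_tilde_def mem_Collect_eq using Hs_norm_self[of s \<phi>]
  by (intro conjI Cc_infty_Hs allI impI bexI[of _ \<phi>]) simp_all

lemma Hs_tilde_lin:
  assumes u: "u \<in> Hs_tilde s \<Omega>" and v: "v \<in> Hs_tilde s \<Omega>" and s: "s \<le> 1"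
  shows "(\<lambda>x. u x + c * v x) \<in> Hs_tilde s \<Omega>"
  unfolding Hs_tilde_def mem_Collect_eq
proof (intro conjI allI impI)
  note uH = Hs_tilde_Hs[OF u] and vH = Hs_tilde_Hs[OF v]
  show "(\<lambda>x. u x + c * v x) \<in> Hs s" by (rule Hs_lin[OF uH vH])
  fix \<epsilon> :: real assume e: "\<epsilon> > 0"
  have e2: "\<epsilon> / (2 * (\<bar>c\<bar> + 1)) > 0" using e by simp
  obtain \<phi> where \<phi>: "\<phi> \<in> Cc_infty \<Omega>" "Hs_norm s (\<lambda>x. u x - \<phi> x) < \<epsilon> / 2" using Hs_tilde_approx[OF u, of "\<epsilon> / 2"] e by auto
  obtain \<psi> where \<psi>: "\<psi> \<in> Cc_infty \<Omega>" "Hs_norm s (\<lambda>x. v x - \<psi> x) < \<epsilon> / (2 * (\<bar>c\<bar> + 1))" using Hs_tilde_approx[OF v e2] by blast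
  note \<phi>H = Cc_infty_Hs[OF \<phi>(1) s] and \<psi>H = Cc_infty_Hs[OF \<psi>(1) s]
  have "(\<lambda>x. u x + c * v x - (\<phi> x + c * \<psi> x)) = (\<lambda>x. (u x - \<phi> x) + c * (v x - \<psi> x))" by (auto simp: algebra_simps)
  then have "Hs_norm s (\<lambda>x. u x + c * v x - (\<phi> x + c * \<psi> x)) \<le> Hs_norm s (\<lambda>x. u x - \<phi> x) + \<bar>c\<bar> * Hs_norm s (\<lambda>x. v x - \<psi> x)"
    using Hs_norm_triangle[OF Hs_diff[OF uH \<phi>H] Hs_diff[OF vH \<psi>H], of c] by simp
  also have "\<dots> < \<epsilon> / 2 + \<epsilon> / 2"
  proof (rule add_less_le_mono[OF \<phi>(2)])
    have "\<bar>c\<bar> * Hs_norm s (\<lambda>x. v x - \<psi> x) \<le> (\<bar>c\<bar> + 1) * (\<epsilon> / (2 * (\<bar>c\<bar> + 1)))"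
      using \<psi>(2) by (intro mult_mono) auto
    also have "\<dots> = \<epsilon> / 2" by (simp add: field_simps)
    finally show "\<bar>c\<bar> * Hs_norm s (\<lambda>x. v x - \<psi> x) \<le> \<epsilon> / 2" .
  qed
  finally show "\<exists>\<phi>\<in>Cc_infty \<Omega>. Hs_norm s (\<lambda>x. u x + c * v x - \<phi> x) < \<epsilon>"
    using Cc_infty_lin[OF \<phi>(1) \<psi>(1), of c] by (intro bexI[of _ "\<lambda>x. \<phi> x + c * \<psi> x"]) auto
qed

lemma Hs_tilde_lin_subspace: "s \<le> 1 \<Longrightarrow> lin_subspace (Hs_tilde s \<Omega>)"
  unfolding lin_subspace_def using Hs_tilde_lin by blast

lemma Hs_tilde_limit:
  assumes f: "\<And>k. f k \<in> Cc_infty \<Omega>" and w: "w \<in> Hs s" and s: "s \<le> 1"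
    and lim: "(\<lambda>k::nat. Hs_norm s (\<lambda>x. f k x - w x)) \<longlonglongrightarrow> 0"
  shows "w \<in> Hs_tilde s \<Omega>"
  unfolding Hs_tilde_def mem_Collect_eq
proof (intro conjI allI impI w)
  fix \<epsilon> :: real assume "\<epsilon> > 0"
  then obtain k where "Hs_norm s (\<lambda>x. f k x - w x) < \<epsilon>"
    using order_tendstoD(2)[OF lim] eventually_happens'[OF sequentially_bot] by blast
  then show "\<exists>\<phi>\<in>Cc_infty \<Omega>. Hs_norm s (\<lambda>x. w x - \<phi> x) < \<epsilon>"
    using f[of k] Hs_norm_minus_commute[OF w Cc_infty_Hs[OF f[of k] s]] by (intro bexI[of _ "f k"]) simp_all
qed

lemma Hs_tilde_extend_zero:
  assumes G: "lin_on (Hs_tilde s \<Omega>) G" and K: "\<And>v. v \<in> Hs_tilde s \<Omega> \<Longrightarrow> \<bar>G v\<bar> \<le> K * Hs_norm s v"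
    and z: "\<And>\<phi>. \<phi> \<in> Cc_infty \<Omega> \<Longrightarrow> G \<phi> = 0" and s: "s \<le> 1" and v: "v \<in> Hs_tilde s \<Omega>"
  shows "G v = 0"
proof -
  have "\<bar>G v\<bar> \<le> 0 + e" if e: "e > 0" for e
  proof -
    have "e / (\<bar>K\<bar> + 1) > 0" using e by simp
    then obtain \<phi> where \<phi>: "\<phi> \<in> Cc_infty \<Omega>" "Hs_norm s (\<lambda>x. v x - \<phi> x) < e / (\<bar>K\<bar> + 1)"
      using Hs_tilde_approx[OF v] by blast
    note \<phi>t = Cc_infty_Hs_tilde[OF \<phi>(1) s]
    have "G (\<lambda>x. v x + (-1) * \<phi> x) = G v + (-1) * G \<phi>" using G v \<phi>t unfolding lin_on_def by blast
    then have "\<bar>G v\<bar> \<le> K * Hs_norm s (\<lambda>x. v x - \<phi> x)"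
      using z[OF \<phi>(1)] K[OF Hs_tilde_lin[OF v \<phi>t s, of "-1"]] by simp
    also have "\<dots> \<le> (\<bar>K\<bar> + 1) * (e / (\<bar>K\<bar> + 1))" using \<phi>(2) by (intro mult_mono) auto
    also have "\<dots> = e" by (simp add: field_simps)
    finally show ?thesis by simp
  qed
  then have "\<bar>G v\<bar> \<le> 0" by (rule field_le_epsilon)
  then show ?thesis by simp
qed

text \<open>
  Mean square limits of test functions converge almost everywhere along a subsequence.
\<close>

lemma Hs_tilde_AE_zero:
  assumes u: "u \<in> Hs_tilde s \<Omega>" and s: "0 \<le> s" "s \<le> 1"
  shows "AE x in lebesgue. x \<notin> \<Omega> \<longrightarrow> u x = 0"
proof -
  have "\<exists>\<phi>. \<phi> \<in> Cc_infty \<Omega> \<and> Hs_norm s (\<lambda>x. u x - \<phi> x) < 1 / real (Suc k)" for k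
    using Hs_tilde_approx[OF u, of "1 / real (Suc k)"] by auto
  then obtain f where f: "\<And>k. f k \<in> Cc_infty \<Omega>" "\<And>k. Hs_norm s (\<lambda>x. u x - f k x) < 1 / real (Suc k)" by metis
  note uH = Hs_tilde_Hs[OF u] and fH = Cc_infty_Hs[OF f(1) s(2)]
  have "(\<lambda>k. l2norm (\<lambda>x. f k x - u x)) \<longlonglongrightarrow> 0"
  proof (rule Lim_null_comparison)
    show "\<forall>\<^sub>F k in sequentially. norm (l2norm (\<lambda>x. f k x - u x)) \<le> 1 / real (Suc k)"
    proof (intro always_eventually allI)
      fix k show "norm (l2norm (\<lambda>x. f k x - u x)) \<le> 1 / real (Suc k)"
        using l2norm_le_Hs_norm[OF Hs_diff[OF uH fH[of k]] s(1)] f(2)[of k] l2norm_minus_commute[of u "f k"] by simp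
    qed
    show "(\<lambda>k. 1 / real (Suc k)) \<longlonglongrightarrow> 0" by (rule one_over_Suc_tendsto_0)
  qed
  then obtain r :: "nat \<Rightarrow> nat" where r: "AE x in lebesgue. (\<lambda>k. f (r k) x) \<longlonglongrightarrow> u x"
    using L2_tendsto_subseq_AE[where f = f, OF Hs_L2[OF fH] Hs_L2[OF uH]] by blast
  then show ?thesis
  proof eventually_elim
    fix x assume l: "(\<lambda>k. f (r k) x) \<longlonglongrightarrow> u x"
    show "x \<notin> \<Omega> \<longrightarrow> u x = 0"
    proof
      assume "x \<notin> \<Omega>"
      then have "f (r k) x = 0" for k using Cc_infty_support[OF f(1)] by blast
      then have "(\<lambda>k::nat. 0) \<longlonglongrightarrow> u x" using l by simp
      then show "u x = 0" by (simp add: LIMSEQ_const_iff)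
    qed
  qed
qed

definition bdd_lin :: "real \<Rightarrow> (real^'n) set \<Rightarrow> ((real^'n \<Rightarrow> real) \<Rightarrow> real) \<Rightarrow> bool" where
  "bdd_lin s \<Omega> F \<longleftrightarrow> lin_on (Hs_tilde s \<Omega>) F \<and> (\<exists>K. \<forall>v\<in>Hs_tilde s \<Omega>. \<bar>F v\<bar> \<le> K * Hs_norm s v)"

lemma bdd_lin_lin_on: "bdd_lin s \<Omega> F \<Longrightarrow> lin_on (Hs_tilde s \<Omega>) F"
  by (simp add: bdd_lin_def)

lemma bdd_linE:
  assumes "bdd_lin s \<Omega> F" obtains K where "K > 0" "\<And>v. v \<in> Hs_tilde s \<Omega> \<Longrightarrow> \<bar>F v\<bar> \<le> K * Hs_norm s v"
proof -
  obtain K where K: "\<And>v. v \<in> Hs_tilde s \<Omega> \<Longrightarrow> \<bar>F v\<bar> \<le> K * Hs_norm s v" using assms by (auto simp: bdd_lin_def)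
  show ?thesis
  proof (rule that[of "\<bar>K\<bar> + 1"])
    fix v assume v: "v \<in> Hs_tilde s \<Omega>"
    have "K * Hs_norm s v \<le> (\<bar>K\<bar> + 1) * Hs_norm s v" by (intro mult_right_mono) auto
    then show "\<bar>F v\<bar> \<le> (\<bar>K\<bar> + 1) * Hs_norm s v" using K[OF v] by linarith
  qed simp
qed

lemma bdd_lin_add:
  assumes F: "bdd_lin s \<Omega> F" and G: "bdd_lin s \<Omega> G"
  shows "bdd_lin s \<Omega> (\<lambda>v. F v + c * G v)"
proof -
  obtain K where K: "K > 0" "\<And>v. v \<in> Hs_tilde s \<Omega> \<Longrightarrow> \<bar>F v\<bar> \<le> K * Hs_norm s v" using bdd_linE[OF F] by blast
  obtain L where L: "L > 0" "\<And>v. v \<in> Hs_tilde s \<Omega> \<Longrightarrow> \<bar>G v\<bar> \<le> L * Hs_norm s v" using bdd_linE[OF G] by blast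
  have "\<bar>F v + c * G v\<bar> \<le> (K + \<bar>c\<bar> * L) * Hs_norm s v" if "v \<in> Hs_tilde s \<Omega>" for v
  proof -
    have "\<bar>F v + c * G v\<bar> \<le> \<bar>F v\<bar> + \<bar>c\<bar> * \<bar>G v\<bar>" by (simp add: abs_mult[symmetric])
    also have "\<dots> \<le> K * Hs_norm s v + \<bar>c\<bar> * (L * Hs_norm s v)" by (intro add_mono mult_left_mono K L that) auto
    finally show ?thesis by (simp add: algebra_simps)
  qed
  moreover have "lin_on (Hs_tilde s \<Omega>) (\<lambda>v. F v + c * G v)"
    using F G unfolding bdd_lin_def lin_on_def by (auto simp: algebra_simps)
  ultimately show ?thesis unfolding bdd_lin_def by blast
qed

text \<open>
  Riesz representation for a coercive form by the direct method. The quadratic functional is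
  minimized over test functions, for which the parallelogram identity makes a minimizing sequence a
  Cauchy sequence; its limit is in the energy space by definition, and solves the equation.
\<close>

lemma coercive_solvable:
  fixes \<Omega> :: "(real^'n) set"
  assumes s: "0 \<le> s" "s \<le> 1"
    and b: "sym_bilinear_on (Hs_tilde s \<Omega>) b"
    and M: "\<And>u v. u \<in> Hs_tilde s \<Omega> \<Longrightarrow> v \<in> Hs_tilde s \<Omega> \<Longrightarrow> \<bar>b u v\<bar> \<le> M * Hs_norm s u * Hs_norm s v"
    and c: "c > 0" "\<And>u. u \<in> Hs_tilde s \<Omega> \<Longrightarrow> c * (Hs_norm s u)\<^sup>2 \<le> b u u"
    and F: "bdd_lin s \<Omega> F"
  shows "\<exists>u\<in>Hs_tilde s \<Omega>. \<forall>v\<in>Hs_tilde s \<Omega>. b u v = F v"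
proof -
  let ?V = "Hs_tilde s \<Omega>"
  note Vl = Hs_tilde_lin[OF _ _ s(2), of _ \<Omega>]
  note VH = Hs_tilde_Hs
  note CV = Cc_infty_Hs_tilde[OF _ s(2), of _ \<Omega>]
  have bl: "b (\<lambda>x. u x + c * v x) w = b u w + c * b v w" if "u \<in> ?V" "v \<in> ?V" "w \<in> ?V" for u v w c
    using b that by (auto simp: sym_bilinear_on_def lin_on_def)
  have bs: "b u v = b v u" if "u \<in> ?V" "v \<in> ?V" for u v using b that by (auto simp: sym_bilinear_on_def)
  have bq: "b (\<lambda>x. u x + t * v x) (\<lambda>x. u x + t * v x) = b u u + 2 * t * b u v + t\<^sup>2 * b v v" if "u \<in> ?V" "v \<in> ?V" for u v t
  proof -
    have w: "(\<lambda>x. u x + t * v x) \<in> ?V" by (rule Vl[OF that])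
    have 1: "b u (\<lambda>x. u x + t * v x) = b u u + t * b u v"
      using bs[OF that(1) w] bl[OF that that(1), of t] bs[OF that] by simp
    have 2: "b v (\<lambda>x. u x + t * v x) = b u v + t * b v v"
      using bs[OF that(2) w] bl[OF that that(2), of t] by simp
    show ?thesis using bl[OF that w, of t] 1 2 by (simp add: algebra_simps power2_eq_square)
  qed
  obtain K where K: "K > 0" "\<And>v. v \<in> ?V \<Longrightarrow> \<bar>F v\<bar> \<le> K * Hs_norm s v" using bdd_linE[OF F] by blast
  have Fl: "F (\<lambda>x. u x + c * v x) = F u + c * F v" if "u \<in> ?V" "v \<in> ?V" for u v c
    using F that by (auto simp: bdd_lin_def lin_on_def)
  define J where "J v = b v v - 2 * F v" for v
  have Jlow: "- (K\<^sup>2 / c) \<le> J v" if v: "v \<in> ?V" for v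
  proof -
    let ?h = "Hs_norm s v"
    have "0 \<le> (c * ?h - K)\<^sup>2 / c" using c(1) by simp
    also have "\<dots> = c * ?h\<^sup>2 - 2 * (K * ?h) + K\<^sup>2 / c" using c(1) by (simp add: field_simps power2_eq_square)
    finally show ?thesis unfolding J_def using c(2)[OF v] K(2)[OF v] by linarith
  qed
  let ?D = "Cc_infty \<Omega>"
  define m where "m = Inf (J ` ?D)"
  have bdd: "bdd_below (J ` ?D)" by (rule bdd_belowI2[of _ "- (K\<^sup>2 / c)"]) (rule Jlow[OF CV])
  have mle: "m \<le> J \<phi>" if "\<phi> \<in> ?D" for \<phi> unfolding m_def by (rule cINF_lower[OF bdd that])
  have "\<exists>\<phi>\<in>?D. J \<phi> < m + 1 / real (Suc k)" for k
    using cInf_lessD[of "J ` ?D" "m + 1 / real (Suc k)"] Cc_infty_zero unfolding m_def by fastforce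
  then obtain f where f: "\<And>k. f k \<in> ?D" "\<And>k. J (f k) < m + 1 / real (Suc k)" by metis
  have para: "c * (Hs_norm s (\<lambda>x. f i x - f j x))\<^sup>2 \<le> 2 / real (Suc i) + 2 / real (Suc j)" for i j
  proof -
    let ?d = "\<lambda>x. f j x + (-1) * f i x"
    let ?m = "\<lambda>x. f i x + (1/2) * ?d x"
    have fi: "f i \<in> ?V" "f j \<in> ?V" by (rule CV[OF f(1)])+
    have d: "?d \<in> ?V" by (rule Vl[OF fi(2) fi(1)])
    have dD: "?d \<in> ?D" by (rule Cc_infty_lin[OF f(1) f(1)])
    have mD: "?m \<in> ?D" by (rule Cc_infty_lin[OF f(1) dD])
    have 1: "J ?m = J (f i) + b (f i) ?d + (1/4) * b ?d ?d - F ?d"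
      unfolding J_def bq[OF fi(1) d] Fl[OF fi(1) d] by (simp add: power2_eq_square)
    have fj: "(\<lambda>x. f i x + 1 * ?d x) = f j" by auto
    have 2: "J (f j) = J (f i) + 2 * b (f i) ?d + b ?d ?d - 2 * F ?d"
      using bq[OF fi(1) d, of 1] Fl[OF fi(1) d, of 1] unfolding fj J_def by simp
    have "b ?d ?d = 2 * J (f i) + 2 * J (f j) - 4 * J ?m" using 1 2 by simp
    also have "\<dots> \<le> 2 * (1 / real (Suc i)) + 2 * (1 / real (Suc j))"
      using mle[OF mD] f(2)[of i] f(2)[of j] by linarith
    finally have "c * (Hs_norm s ?d)\<^sup>2 \<le> 2 / real (Suc i) + 2 / real (Suc j)" using c(2)[OF d] by simp
    then show ?thesis using Hs_norm_minus_commute[OF VH[OF fi(1)] VH[OF fi(2)]] by simp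
  qed
  have Cauchy: "\<exists>N. \<forall>i\<ge>N. \<forall>j\<ge>N. Hs_norm s (\<lambda>x. f i x - f j x) < e" if e: "e > 0" for e
  proof -
    have "c * e\<^sup>2 / 4 > 0" using c(1) e by simp
    then obtain N where N: "1 / real (Suc N) < c * e\<^sup>2 / 4" using nat_approx_posE by blast
    have "Hs_norm s (\<lambda>x. f i x - f j x) < e" if "i \<ge> N" "j \<ge> N" for i j
    proof -
      have "1 / real (Suc i) \<le> 1 / real (Suc N)" "1 / real (Suc j) \<le> 1 / real (Suc N)"
        using that by (auto intro!: divide_left_mono)
      then have "c * (Hs_norm s (\<lambda>x. f i x - f j x))\<^sup>2 < c * e\<^sup>2"
        using para[of i j] N by simp
      then have "(Hs_norm s (\<lambda>x. f i x - f j x))\<^sup>2 < e\<^sup>2" using c(1) by simp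
      then show ?thesis using e by (simp add: power2_less_imp_less)
    qed
    then show ?thesis by blast
  qed
  obtain w where w: "w \<in> Hs s" "(\<lambda>k. Hs_norm s (\<lambda>x. f k x - w x)) \<longlonglongrightarrow> 0"
    using Hs_complete[OF Cc_infty_Hs[OF f(1) s(2)] s(1) Cauchy] by blast
  have wV: "w \<in> ?V" by (rule Hs_tilde_limit[OF f(1) w(1) s(2) w(2)])
  have test: "b w v = F v" if vD: "v \<in> ?D" for v
  proof -
    have v: "v \<in> ?V" by (rule CV[OF vD])
    have lim: "(\<lambda>k. b (f k) v) \<longlonglongrightarrow> b w v"
    proof (rule LIM_zero_cancel, rule Lim_null_comparison)
      show "\<forall>\<^sub>F k in sequentially. norm (b (f k) v - b w v) \<le> \<bar>M\<bar> * Hs_norm s v * Hs_norm s (\<lambda>x. f k x - w x)"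
      proof (intro always_eventually allI)
        fix k
        have fk: "f k \<in> ?V" by (rule CV[OF f(1)])
        have "b (\<lambda>x. f k x + (-1) * w x) v = b (f k) v + (-1) * b w v" by (rule bl[OF fk wV v])
        then have "\<bar>b (f k) v - b w v\<bar> \<le> M * Hs_norm s (\<lambda>x. f k x - w x) * Hs_norm s v"
          using M[OF Vl[OF fk wV, of "-1"] v] by simp
        also have "\<dots> \<le> \<bar>M\<bar> * Hs_norm s (\<lambda>x. f k x - w x) * Hs_norm s v" by (intro mult_right_mono) auto
        finally show "norm (b (f k) v - b w v) \<le> \<bar>M\<bar> * Hs_norm s v * Hs_norm s (\<lambda>x. f k x - w x)" by (simp add: mult_ac)
      qed
      show "(\<lambda>k. \<bar>M\<bar> * Hs_norm s v * Hs_norm s (\<lambda>x. f k x - w x)) \<longlonglongrightarrow> 0"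
        using tendsto_mult_left[OF w(2), of "\<bar>M\<bar> * Hs_norm s v"] by simp
    qed
    have "0 \<le> 0 + 2 * t * (b w v - F v) + t\<^sup>2 * b v v" for t
    proof (rule LIMSEQ_le_const)
      have "(\<lambda>k. 1 / real (Suc k) + 2 * t * (b (f k) v - F v) + t\<^sup>2 * b v v) \<longlonglongrightarrow> 0 + 2 * t * (b w v - F v) + t\<^sup>2 * b v v"
        using one_over_Suc_tendsto_0
        by (intro tendsto_intros lim) simp
      then show "(\<lambda>k. 1 / real (Suc k) + 2 * t * (b (f k) v - F v) + t\<^sup>2 * b v v) \<longlonglongrightarrow> 0 + 2 * t * (b w v - F v) + t\<^sup>2 * b v v" .
      show "\<exists>N. \<forall>k\<ge>N. 0 \<le> 1 / real (Suc k) + 2 * t * (b (f k) v - F v) + t\<^sup>2 * b v v"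
      proof (intro exI allI impI)
        fix k :: nat
        have fk: "f k \<in> ?V" by (rule CV[OF f(1)])
        have "m \<le> J (\<lambda>x. f k x + t * v x)" by (rule mle[OF Cc_infty_lin[OF f(1) vD]])
        also have "\<dots> = J (f k) + 2 * t * (b (f k) v - F v) + t\<^sup>2 * b v v"
          unfolding J_def bq[OF fk v] Fl[OF fk v] by (simp add: algebra_simps)
        finally show "0 \<le> 1 / real (Suc k) + 2 * t * (b (f k) v - F v) + t\<^sup>2 * b v v" using f(2)[of k] by linarith
      qed
    qed
    from quadratic_nonneg_discriminant[OF this] show ?thesis by simp
  qed
  have "b w v = F v" if v: "v \<in> ?V" for v
  proof -
    have "b w v - F v = 0"
    proof (rule Hs_tilde_extend_zero[where G = "\<lambda>v. b w v - F v" and s = s and K = "\<bar>M\<bar> * Hs_norm s w + K", OF _ _ _ s(2) v])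
      show "lin_on ?V (\<lambda>v. b w v - F v)"
        unfolding lin_on_def
      proof (intro ballI allI)
        fix u v c assume uv: "u \<in> ?V" "v \<in> ?V"
        show "b w (\<lambda>x. u x + c * v x) - F (\<lambda>x. u x + c * v x) = b w u - F u + c * (b w v - F v)"
          using bs[OF wV Vl[OF uv, of c]] bl[OF uv wV, of c] bs[OF wV uv(1)] bs[OF wV uv(2)] Fl[OF uv, of c]
          by (simp add: algebra_simps)
      qed
      fix u assume u: "u \<in> ?V"
      have "\<bar>b w u - F u\<bar> \<le> \<bar>b w u\<bar> + \<bar>F u\<bar>" by simp
      also have "\<dots> \<le> M * Hs_norm s w * Hs_norm s u + K * Hs_norm s u" by (intro add_mono M[OF wV u] K(2)[OF u])
      also have "\<dots> \<le> \<bar>M\<bar> * Hs_norm s w * Hs_norm s u + K * Hs_norm s u" by (intro add_right_mono mult_right_mono) auto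
      finally show "\<bar>b w u - F u\<bar> \<le> (\<bar>M\<bar> * Hs_norm s w + K) * Hs_norm s u" by (simp add: algebra_simps)
    qed (simp add: test)
    then show ?thesis by simp
  qed
  then show ?thesis using wV by blast
qed

section \<open>Solvability of the Dirichlet problem\<close>

definition potential_form :: "(real^'n) set \<Rightarrow> (real^'n \<Rightarrow> real) \<Rightarrow> (real^'n \<Rightarrow> real) \<Rightarrow> (real^'n \<Rightarrow> real) \<Rightarrow> real" where
  "potential_form \<Omega> q u v = (LINT x:\<Omega>|lebesgue. q x * u x * v x)"

lemma L_inftyE:
  assumes "q \<in> L_infty \<Omega>"
  obtains M where "M > 0" "(\<lambda>x. indicator \<Omega> x * q x) \<in> borel_measurable lebesgue"
    "AE x in lebesgue. \<bar>indicator \<Omega> x * q x\<bar> \<le> M"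
proof -
  obtain C where C: "AE x in lebesgue. x \<in> \<Omega> \<longrightarrow> \<bar>q x\<bar> \<le> C" using assms by (auto simp: L_infty_def)
  have "(\<lambda>x. indicator \<Omega> x * q x) \<in> borel_measurable lebesgue"
    using assms by (simp add: L_infty_def set_borel_measurable_def)
  moreover have "AE x in lebesgue. \<bar>indicator \<Omega> x * q x\<bar> \<le> \<bar>C\<bar> + 1"
    using C by eventually_elim (auto simp: indicator_def)
  ultimately show ?thesis by (intro that[of "\<bar>C\<bar> + 1"]) auto
qed

lemma potential_form_eq: "potential_form \<Omega> q u v = (LINT x|lebesgue. (indicator \<Omega> x * q x * u x) * v x)"
  by (simp add: potential_form_def set_lebesgue_integral_def mult.assoc)

lemma potential_L2:
  fixes q u :: "real^'n \<Rightarrow> real"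
  assumes q: "q \<in> L_infty \<Omega>" and u: "u \<in> L2"
  shows "(\<lambda>x. indicator \<Omega> x * q x * u x) \<in> L2"
proof -
  obtain M where M: "M > 0" "(\<lambda>x. indicator \<Omega> x * q x) \<in> borel_measurable lebesgue"
    "AE x in lebesgue. \<bar>indicator \<Omega> x * q x\<bar> \<le> M" using L_inftyE[OF q] .
  show ?thesis
  proof (rule L2_AE_bounded[OF u])
    show "(\<lambda>x. indicator \<Omega> x * q x * u x) \<in> borel_measurable lebesgue"
      by (intro borel_measurable_times M L2_measurable u)
    show "AE x in lebesgue. norm (indicator \<Omega> x * q x * u x) \<le> M * norm (u x)"
      using M(3)
    proof eventually_elim
      fix x assume "\<bar>indicator \<Omega> x * q x\<bar> \<le> M"
      then have "\<bar>indicator \<Omega> x * q x\<bar> * \<bar>u x\<bar> \<le> M * \<bar>u x\<bar>" by (rule mult_right_mono) simp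
      then show "norm (indicator \<Omega> x * q x * u x) \<le> M * norm (u x)" by (simp only: abs_mult real_norm_def)
    qed
  qed
qed

lemma potential_form_lin:
  fixes q u :: "real^'n \<Rightarrow> real"
  assumes q: "q \<in> L_infty \<Omega>" and u: "u \<in> L2" "v \<in> L2" "w \<in> L2"
  shows "potential_form \<Omega> q (\<lambda>x. u x + c * v x) w = potential_form \<Omega> q u w + c * potential_form \<Omega> q v w"
proof -
  note i = L2_mult_integrable[OF potential_L2[OF q u(1)] u(3)] L2_mult_integrable[OF potential_L2[OF q u(2)] u(3)]
  have "potential_form \<Omega> q (\<lambda>x. u x + c * v x) w =
      (LINT x|lebesgue. (indicator \<Omega> x * q x * u x) * w x + c * ((indicator \<Omega> x * q x * v x) * w x))"
    unfolding potential_form_eq by (simp add: algebra_simps)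
  also have "\<dots> = potential_form \<Omega> q u w + c * potential_form \<Omega> q v w"
    unfolding potential_form_eq Bochner_Integration.integral_add[OF i(1) integrable_mult_right[OF i(2)]]
      Bochner_Integration.integral_mult_right_zero ..
  finally show ?thesis .
qed

lemma potential_form_sym: "potential_form \<Omega> q u v = potential_form \<Omega> q v u"
  unfolding potential_form_def by (simp only: mult.assoc mult.commute[of "u _"])

lemma potential_form_bound:
  fixes q :: "real^'n \<Rightarrow> real"
  assumes q: "q \<in> L_infty \<Omega>"
  obtains M where "M > 0" "\<And>u v. u \<in> L2 \<Longrightarrow> v \<in> L2 \<Longrightarrow> \<bar>potential_form \<Omega> q u v\<bar> \<le> M * l2norm u * l2norm v"
proof -
  obtain M where M: "M > 0" "(\<lambda>x. indicator \<Omega> x * q x) \<in> borel_measurable lebesgue"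
    "AE x in lebesgue. \<bar>indicator \<Omega> x * q x\<bar> \<le> M" using L_inftyE[OF q] .
  have "\<bar>potential_form \<Omega> q u v\<bar> \<le> M * l2norm u * l2norm v" if u: "u \<in> L2" and v: "v \<in> L2" for u v
  proof -
    have "\<bar>potential_form \<Omega> q u v\<bar> \<le> (LINT x|lebesgue. \<bar>(indicator \<Omega> x * q x * u x) * v x\<bar>)"
      unfolding potential_form_eq by (rule integral_abs_bound)
    also have "\<dots> \<le> (LINT x|lebesgue. M * (norm (u x) * norm (v x)))"
    proof (rule integral_mono_AE)
      show "integrable lebesgue (\<lambda>x. \<bar>(indicator \<Omega> x * q x * u x) * v x\<bar>)"
        using L2_mult_integrable[OF potential_L2[OF q u] v] by (rule integrable_abs)
      show "integrable lebesgue (\<lambda>x. M * (norm (u x) * norm (v x)))"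
        using L2_mult_integrable[OF L2_norm[OF u] L2_norm[OF v]] by (rule integrable_mult_right)
      show "AE x in lebesgue. \<bar>(indicator \<Omega> x * q x * u x) * v x\<bar> \<le> M * (norm (u x) * norm (v x))"
        using M(3)
      proof eventually_elim
        fix x assume "\<bar>indicator \<Omega> x * q x\<bar> \<le> M"
        then have "\<bar>indicator \<Omega> x * q x\<bar> * (\<bar>u x\<bar> * \<bar>v x\<bar>) \<le> M * (\<bar>u x\<bar> * \<bar>v x\<bar>)" by (rule mult_right_mono) simp
        then show "\<bar>(indicator \<Omega> x * q x * u x) * v x\<bar> \<le> M * (norm (u x) * norm (v x))"
          by (simp only: abs_mult real_norm_def mult.assoc)
      qed
    qed
    also have "\<dots> = M * (LINT x|lebesgue. norm (u x) * norm (v x))" by (rule Bochner_Integration.integral_mult_right_zero)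
    also have "\<dots> \<le> M * (l2norm u * l2norm v)" using M(1) by (intro mult_left_mono l2norm_Cauchy_Schwarz u v) auto
    finally show ?thesis by (simp add: mult.assoc)
  qed
  with M(1) show ?thesis by (rule that)
qed

lemma bilinear_form_lin:
  assumes q: "q \<in> L_infty \<Omega>" and s: "s \<ge> 0" and u: "u \<in> Hs s" "v \<in> Hs s" "w \<in> Hs s"
  shows "bilinear_form s \<Omega> q (\<lambda>x. u x + c * v x) w = bilinear_form s \<Omega> q u w + c * bilinear_form s \<Omega> q v w"
  using energy_lin[OF u s, of c] potential_form_lin[OF q Hs_L2[OF u(1)] Hs_L2[OF u(2)] Hs_L2[OF u(3)], of c]
  unfolding bilinear_form_eq[OF Hs_lin[OF u(1,2)] u(3) s] bilinear_form_eq[OF u(1,3) s] bilinear_form_eq[OF u(2,3) s]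
    potential_form_def[symmetric]
  by (simp add: distrib_left)

lemma bilinear_form_sym: "bilinear_form s \<Omega> q u v = bilinear_form s \<Omega> q v u"
  unfolding bilinear_form_def potential_form_def[symmetric]
  by (subst potential_form_sym) (simp add: mult.commute)

lemma bilinear_form_bound:
  fixes q :: "real^'n \<Rightarrow> real"
  assumes q: "q \<in> L_infty \<Omega>" and s: "s \<ge> 0"
  obtains M where "M > 0" "\<And>u v. u \<in> Hs s \<Longrightarrow> v \<in> Hs s \<Longrightarrow> \<bar>bilinear_form s \<Omega> q u v\<bar> \<le> M * Hs_norm s u * Hs_norm s v"
proof -
  obtain M where M: "M > 0" "\<And>u v. u \<in> L2 \<Longrightarrow> v \<in> L2 \<Longrightarrow> \<bar>potential_form \<Omega> q u v\<bar> \<le> M * l2norm u * l2norm v"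
    using potential_form_bound[OF q] by blast
  show ?thesis
  proof (rule that[of "1 + M"])
    fix u v :: "real^'n \<Rightarrow> real" assume u: "u \<in> Hs s" and v: "v \<in> Hs s"
    have "\<bar>bilinear_form s \<Omega> q u v\<bar> \<le> \<bar>energy s u v\<bar> + \<bar>potential_form \<Omega> q u v\<bar>"
      unfolding bilinear_form_eq[OF u v s] potential_form_def by (rule abs_triangle_ineq)
    also have "\<dots> \<le> Hs_norm s u * Hs_norm s v + M * l2norm u * l2norm v"
      by (intro add_mono energy_bound u v s M Hs_L2[of _ s])
    also have "M * l2norm u * l2norm v \<le> M * Hs_norm s u * Hs_norm s v"
      using M(1) by (intro mult_mono l2norm_le_Hs_norm u v s) auto
    finally show "\<bar>bilinear_form s \<Omega> q u v\<bar> \<le> (1 + M) * Hs_norm s u * Hs_norm s v" by (simp add: algebra_simps)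
  qed (use M in simp)
qed

lemma schroedinger_eq_iff:
  fixes \<Omega> :: "(real^'n) set"
  assumes s: "0 \<le> s" "s \<le> 1" and u: "u \<in> Hs s"
  shows "schroedinger_eq s \<Omega> q u \<longleftrightarrow> (\<forall>\<phi>\<in>Cc_infty \<Omega>. bilinear_form s \<Omega> q u \<phi> = 0)"
proof -
  have "frac_laplacian_distr s u \<phi> + of_real (LINT x:\<Omega>|lebesgue. q x * u x * \<phi> x) = of_real (bilinear_form s \<Omega> q u \<phi>)"
    if \<phi>: "\<phi> \<in> Cc_infty \<Omega>" for \<phi>
  proof -
    obtain R where R: "\<And>x. x \<notin> cball 0 R \<Longrightarrow> \<phi> x = 0" using Cc_infty_bounded_support[OF \<phi>] by blast
    note \<phi>H = Cc_infty_Hs[OF \<phi> s(2)]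
    have "frac_laplacian_distr s u \<phi> = of_real (energy s u \<phi>)" by (rule frac_laplacian_distr_eq[OF u \<phi>H s(1) R])
    then show ?thesis by (simp add: bilinear_form_eq[OF u \<phi>H s(1)])
  qed
  then show ?thesis unfolding schroedinger_eq_def by (metis of_real_eq_0_iff)
qed

text \<open>The weak equation extends from test functions to the energy space by density.\<close>

lemma schroedinger_eq_Hs_tilde:
  fixes \<Omega> :: "(real^'n) set"
  assumes s: "0 \<le> s" "s \<le> 1" and q: "q \<in> L_infty \<Omega>" and u: "u \<in> Hs s" and eq: "schroedinger_eq s \<Omega> q u"
    and v: "v \<in> Hs_tilde s \<Omega>"
  shows "bilinear_form s \<Omega> q u v = 0"
proof -
  obtain M where M: "M > 0" "\<And>u v. u \<in> Hs s \<Longrightarrow> v \<in> Hs s \<Longrightarrow> \<bar>bilinear_form s \<Omega> q u v\<bar> \<le> M * Hs_norm s u * Hs_norm s v"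
    using bilinear_form_bound[OF q s(1)] by blast
  show ?thesis
  proof (rule Hs_tilde_extend_zero[where G = "\<lambda>v. bilinear_form s \<Omega> q u v" and s = s and K = "M * Hs_norm s u", OF _ _ _ s(2) v])
    show "lin_on (Hs_tilde s \<Omega>) (bilinear_form s \<Omega> q u)"
      unfolding lin_on_def bilinear_form_sym[of s \<Omega> q u]
      using bilinear_form_lin[OF q s(1) Hs_tilde_Hs Hs_tilde_Hs u] by blast
    show "\<bar>bilinear_form s \<Omega> q u w\<bar> \<le> M * Hs_norm s u * Hs_norm s w" if "w \<in> Hs_tilde s \<Omega>" for w
      by (rule M(2)[OF u Hs_tilde_Hs[OF that]])
    show "bilinear_form s \<Omega> q u \<phi> = 0" if "\<phi> \<in> Cc_infty \<Omega>" for \<phi>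
      using eq that schroedinger_eq_iff[OF s u] by blast
  qed
qed

text \<open>
  Elements of the energy space vanish outside \<open>\<Omega>\<close> only almost everywhere. After the cutoff they do so
  at every point, and their transforms are given by Fourier integrals.
\<close>

definition cutoff :: "(real^'n) set \<Rightarrow> (real^'n \<Rightarrow> real) \<Rightarrow> real^'n \<Rightarrow> complex" where
  "cutoff \<Omega> u x = of_real (indicator \<Omega> x * u x)"

lemma cmod_cis_diff: "cmod (cis a - cis b) \<le> \<bar>a - b\<bar>"
proof -
  have "cis b * iexp (a - b) = cis a"
    unfolding cis_conv_exp by (simp add: algebra_simps flip: exp_add)
  then have "cis a - cis b = cis b * (iexp (a - b) - 1)" by (simp add: right_diff_distrib)
  then have "cmod (cis a - cis b) = cmod (iexp (a - b) - 1)" by (simp add: norm_mult)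
  also have "\<dots> \<le> \<bar>a - b\<bar>" using iexp_approx1[of "a - b" 0] by simp
  finally show ?thesis .
qed

text \<open>
  Only finitely many frequencies matter up to a small error: the transform of a function with
  support in a bounded set is Lipschitz with a constant controlled by the mean square norm, so on a
  ball it is determined up to a small error by its values at a finite net. This takes the place of
  Rellich's compactness theorem.
\<close>

lemma low_frequency_finite_rank:
  fixes \<Omega> :: "(real^'n) set"
  assumes \<Omega>: "open \<Omega>" "bounded \<Omega>" and s: "0 \<le> s" "s \<le> 1" and N: "N > 0" and \<epsilon>: "\<epsilon> > 0"
  obtains ls where "\<And>l. l \<in> set ls \<Longrightarrow> bdd_lin s \<Omega> l"
    "\<And>u. u \<in> Hs_tilde s \<Omega> \<Longrightarrow>
       N * (LINT \<xi>|lebesgue. indicator (cball 0 R) \<xi> * (cmod (fourier u \<xi>))\<^sup>2) \<le> (\<Sum>l\<leftarrow>ls. l u * l u) + \<epsilon> * (Hs_norm s u)\<^sup>2"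
proof -
  obtain \<rho> where \<rho>: "\<rho> > 0" "\<And>x. x \<in> \<Omega> \<Longrightarrow> norm x \<le> \<rho>" using \<Omega>(2) unfolding bounded_pos by auto
  have \<Omega>m: "\<Omega> \<in> lmeasurable" using \<Omega> by (rule lmeasurable_open[rotated])
  have \<Omega>s: "\<Omega> \<in> sets lebesgue" using \<Omega>m by (rule fmeasurableD)
  define V where "V = sqrt (measure lebesgue \<Omega>)"
  have V: "V \<ge> 0" by (simp add: V_def)
  have cL: "cutoff \<Omega> u \<in> L2" if "u \<in> L2" for u
  proof -
    have "(\<lambda>x. complex_of_real (indicator \<Omega> x * u x)) \<in> L2" by (rule L2_of_real[OF L2_indicator[OF that \<Omega>s]])
    then show ?thesis by (simp add: cutoff_def[abs_def])
  qed
  have cz: "cutoff \<Omega> u x = 0" if "x \<notin> \<Omega>" for u x using that by (simp add: cutoff_def)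
  have ci: "integrable lebesgue (cutoff \<Omega> u)" if "u \<in> L2" for u by (rule L2_bounded_support_integrable(1)[OF cL[OF that] \<Omega>m cz])
  have cn: "(LINT x|lebesgue. cmod (cutoff \<Omega> u x)) \<le> V * Hs_norm s u" if u: "u \<in> Hs s" for u
  proof -
    note uL = Hs_L2[OF u]
    have "(LINT x|lebesgue. cmod (cutoff \<Omega> u x)) \<le> V * l2norm (cutoff \<Omega> u)"
      unfolding V_def by (rule L2_bounded_support_integrable(2)[OF cL[OF uL] \<Omega>m cz])
    also have "l2norm (cutoff \<Omega> u) \<le> l2norm (\<lambda>x. complex_of_real (u x))"
      by (rule l2norm_mono[OF cL[OF uL] L2_of_real[OF uL]]) (simp add: cutoff_def indicator_def)
    also have "l2norm (\<lambda>x. complex_of_real (u x)) = l2norm u" by (simp add: l2norm_def)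
    also have "\<dots> \<le> Hs_norm s u" by (rule l2norm_le_Hs_norm[OF u s(1)])
    finally show ?thesis using V by (simp add: mult_left_mono)
  qed
  have bF: "cmod (fourier_integral (cutoff \<Omega> u) \<xi>) \<le> V * Hs_norm s u" if "u \<in> Hs s" for u \<xi>
    using norm_fourier_integral_le[of "cutoff \<Omega> u" \<xi>] cn[OF that] by simp
  have lF: "fourier_integral (cutoff \<Omega> (\<lambda>x. u x + c * v x)) \<xi> = fourier_integral (cutoff \<Omega> u) \<xi> + of_real c * fourier_integral (cutoff \<Omega> v) \<xi>"
    if "u \<in> L2" "v \<in> L2" for u v c \<xi>
  proof -
    have "cutoff \<Omega> (\<lambda>x. u x + c * v x) = (\<lambda>x. cutoff \<Omega> u x + of_real c * cutoff \<Omega> v x)"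
      by (auto simp: cutoff_def algebra_simps)
    then show ?thesis by (simp add: fourier_integral_lin[OF ci[OF that(1)] ci[OF that(2)]])
  qed
  have bl: "bdd_lin s \<Omega> (\<lambda>u. a * Re (fourier_integral (cutoff \<Omega> u) \<xi>))" "bdd_lin s \<Omega> (\<lambda>u. a * Im (fourier_integral (cutoff \<Omega> u) \<xi>))" for a \<xi>
  proof -
    have b: "\<bar>a * Re z\<bar> \<le> (\<bar>a\<bar> * V) * h" "\<bar>a * Im z\<bar> \<le> (\<bar>a\<bar> * V) * h" if "cmod z \<le> V * h" for z h
      using order_trans[OF abs_Re_le_cmod that] order_trans[OF abs_Im_le_cmod that]
      by (simp_all add: abs_mult mult.assoc mult_left_mono)
    show "bdd_lin s \<Omega> (\<lambda>u. a * Re (fourier_integral (cutoff \<Omega> u) \<xi>))"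
      unfolding bdd_lin_def lin_on_def
      by (intro conjI ballI allI exI[of _ "\<bar>a\<bar> * V"] b bF Hs_tilde_Hs)
         (simp_all add: lF Hs_L2[OF Hs_tilde_Hs] algebra_simps)
    show "bdd_lin s \<Omega> (\<lambda>u. a * Im (fourier_integral (cutoff \<Omega> u) \<xi>))"
      unfolding bdd_lin_def lin_on_def
      by (intro conjI ballI allI exI[of _ "\<bar>a\<bar> * V"] b bF Hs_tilde_Hs)
         (simp_all add: lF Hs_L2[OF Hs_tilde_Hs] algebra_simps)
  qed
  have lip: "cmod (fourier_integral (cutoff \<Omega> u) \<xi> - fourier_integral (cutoff \<Omega> u) \<eta>) \<le> \<rho> * norm (\<xi> - \<eta>) * (V * Hs_norm s u)"
    if u: "u \<in> Hs s" for u \<xi> \<eta>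
  proof -
    note i = integrable_cis_mult'[OF ci[OF Hs_L2[OF u]]]
    have "fourier_integral (cutoff \<Omega> u) \<xi> - fourier_integral (cutoff \<Omega> u) \<eta> = (LINT x|lebesgue. cis (- (x \<bullet> \<xi>)) * cutoff \<Omega> u x - cis (- (x \<bullet> \<eta>)) * cutoff \<Omega> u x)"
      unfolding fourier_integral_def by (rule Bochner_Integration.integral_diff[OF i i, symmetric])
    also have "cmod \<dots> \<le> (LINT x|lebesgue. \<rho> * norm (\<xi> - \<eta>) * cmod (cutoff \<Omega> u x))"
    proof (rule Bochner_Integration.integral_norm_bound_integral)
      show "integrable lebesgue (\<lambda>x. cis (- (x \<bullet> \<xi>)) * cutoff \<Omega> u x - cis (- (x \<bullet> \<eta>)) * cutoff \<Omega> u x)"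
        by (rule Bochner_Integration.integrable_diff[OF i i])
      show "integrable lebesgue (\<lambda>x. \<rho> * norm (\<xi> - \<eta>) * cmod (cutoff \<Omega> u x))"
        using ci[OF Hs_L2[OF u]] by (intro integrable_mult_right integrable_norm)
      fix x
      show "cmod (cis (- (x \<bullet> \<xi>)) * cutoff \<Omega> u x - cis (- (x \<bullet> \<eta>)) * cutoff \<Omega> u x) \<le> \<rho> * norm (\<xi> - \<eta>) * cmod (cutoff \<Omega> u x)"
      proof (cases "x \<in> \<Omega>")
        case True
        have "cmod (cis (- (x \<bullet> \<xi>)) - cis (- (x \<bullet> \<eta>))) \<le> \<bar>- (x \<bullet> \<xi>) - - (x \<bullet> \<eta>)\<bar>" by (rule cmod_cis_diff)
        also have "\<dots> = \<bar>x \<bullet> (\<xi> - \<eta>)\<bar>" by (simp add: inner_diff_right)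
        also have "\<dots> \<le> norm x * norm (\<xi> - \<eta>)" by (rule Cauchy_Schwarz_ineq2)
        also have "\<dots> \<le> \<rho> * norm (\<xi> - \<eta>)" by (rule mult_right_mono[OF \<rho>(2)[OF True]]) simp
        finally have "cmod (cis (- (x \<bullet> \<xi>)) - cis (- (x \<bullet> \<eta>))) * cmod (cutoff \<Omega> u x) \<le> \<rho> * norm (\<xi> - \<eta>) * cmod (cutoff \<Omega> u x)"
          by (rule mult_right_mono) simp
        then show ?thesis by (simp only: left_diff_distrib[symmetric] norm_mult)
      qed (simp add: cz)
    qed
    also have "\<dots> = \<rho> * norm (\<xi> - \<eta>) * (LINT x|lebesgue. cmod (cutoff \<Omega> u x))"
      by (rule Bochner_Integration.integral_mult_right_zero)
    also have "\<dots> \<le> \<rho> * norm (\<xi> - \<eta>) * (V * Hs_norm s u)" using \<rho>(1) by (intro mult_left_mono cn u) auto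
    finally show ?thesis .
  qed
  define B where "B = cball (0::real^'n) R"
  define vB where "vB = measure lebesgue B"
  have vB: "vB \<ge> 0" by (simp add: vB_def)
  have iB: "integrable lebesgue (indicator B :: _ \<Rightarrow> real)"
    using lmeasurable_cball[of "0::real^'n" R, unfolded lmeasurable_iff_integrable] by (simp add: B_def)
  have LB: "(LINT \<xi>|lebesgue. indicator B \<xi>) = vB"
    using lmeasurable_cball[of "0::real^'n" R] by (simp add: vB_def B_def)
  define L where "L = \<rho> * V"
  have L: "L \<ge> 0" using \<rho> V by (simp add: L_def)
  \<comment> \<open>On a net with mesh \<open>\<delta>\<close> the transform varies by at most \<open>L \<delta>\<close> times the Sobolev norm. The first
    factor 2 comes from \<open>(a + b)\<^sup>2 \<le> 2 a\<^sup>2 + 2 b\<^sup>2\<close>, and \<open>vB\<close> from integration over the ball.\<close>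
  obtain \<delta> where \<delta>: "\<delta> > 0" "N * (vB * (2 * (L * \<delta>)\<^sup>2)) \<le> \<epsilon>"
  proof -
    define K where "K = 2 * N * vB * L\<^sup>2"
    have K: "K \<ge> 0" using N vB by (simp add: K_def)
    show ?thesis
    proof (rule that[of "min 1 (\<epsilon> / (K + 1))"])
      let ?d = "min 1 (\<epsilon> / (K + 1))"
      show "?d > 0" using \<epsilon> K by simp
      then have "?d * ?d \<le> 1 * ?d" by (intro mult_right_mono) auto
      then have "?d\<^sup>2 \<le> \<epsilon> / (K + 1)" unfolding power2_eq_square by linarith
      then have "K * ?d\<^sup>2 \<le> K * (\<epsilon> / (K + 1))" using K by (intro mult_left_mono) auto
      also have "\<dots> \<le> \<epsilon>" using K \<epsilon> by (simp add: field_simps)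
      finally show "N * (vB * (2 * (L * ?d)\<^sup>2)) \<le> \<epsilon>" unfolding K_def by (simp add: power_mult_distrib mult_ac)
    qed
  qed
  have "compact B" by (simp add: B_def)
  then obtain X where X: "finite X" "B \<subseteq> (\<Union>x\<in>X. ball x \<delta>)"
    using \<delta>(1) unfolding compact_eq_totally_bounded by blast
  obtain xs where xs: "set xs = X" "distinct xs" using finite_distinct_list[OF X(1)] by blast
  define a where "a = sqrt (2 * N * vB)"
  have a2: "a * a = 2 * N * vB" using N vB by (simp add: a_def)
  define ls where "ls = map (\<lambda>\<eta> u. a * Re (fourier_integral (cutoff \<Omega> u) \<eta>)) xs @ map (\<lambda>\<eta> u. a * Im (fourier_integral (cutoff \<Omega> u) \<eta>)) xs"
  show ?thesis
  proof (rule that[of ls])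
    show "bdd_lin s \<Omega> l" if "l \<in> set ls" for l using that bl by (auto simp: ls_def)
    fix u assume u: "u \<in> Hs_tilde s \<Omega>"
    note uH = Hs_tilde_Hs[OF u] note uL = Hs_L2[OF uH]
    let ?F = "fourier_integral (cutoff \<Omega> u)"
    define h where "h = Hs_norm s u"
    define Sg where "Sg = (\<Sum>\<eta>\<in>X. (cmod (?F \<eta>))\<^sup>2)"
    have ls_sum: "(\<Sum>l\<leftarrow>ls. l u * l u) = 2 * N * vB * Sg"
    proof -
      have "(\<Sum>l\<leftarrow>ls. l u * l u) = (\<Sum>\<eta>\<in>X. (a * Re (?F \<eta>)) * (a * Re (?F \<eta>))) + (\<Sum>\<eta>\<in>X. (a * Im (?F \<eta>)) * (a * Im (?F \<eta>)))"
        unfolding ls_def using xs by (simp add: o_def sum_list_distinct_conv_sum_set)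
      also have "\<dots> = (\<Sum>\<eta>\<in>X. (a * a) * (cmod (?F \<eta>))\<^sup>2)"
        unfolding sum.distrib[symmetric] cmod_power2 by (simp add: power2_eq_square algebra_simps)
      also have "\<dots> = 2 * N * vB * Sg" unfolding a2 Sg_def by (rule sum_distrib_left[symmetric])
      finally show ?thesis .
    qed
    have uae: "AE x in lebesgue. u x = indicator \<Omega> x * u x"
      using Hs_tilde_AE_zero[OF u s] by eventually_elim (auto simp: indicator_def)
    have "AE \<xi> in lebesgue. fourier u \<xi> = fourier (\<lambda>x. indicator \<Omega> x * u x) \<xi>"
      by (rule fourier_cong_AE[OF uL L2_indicator[OF uL \<Omega>s] uae])
    moreover have "AE \<xi> in lebesgue. fourier (\<lambda>x. indicator \<Omega> x * u x) \<xi> = fourier_integral (\<lambda>x. of_real (indicator \<Omega> x * u x)) \<xi>"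
      by (rule fourier_eq_fourier_integral[OF L2_indicator[OF uL \<Omega>s], of \<rho>]) (use \<rho> in \<open>auto simp: indicator_def\<close>)
    ultimately have F: "AE \<xi> in lebesgue. fourier u \<xi> = ?F \<xi>"
      by eventually_elim (simp add: cutoff_def[abs_def])
    have Fm: "?F \<in> borel_measurable lebesgue" by (rule fourier_integral_measurable[OF L2_measurable[OF cL[OF uL]]])
    have pt: "(cmod (?F \<xi>))\<^sup>2 \<le> 2 * Sg + 2 * (L * \<delta> * h)\<^sup>2" if \<xi>: "\<xi> \<in> B" for \<xi>
    proof -
      obtain \<eta> where \<eta>: "\<eta> \<in> X" "dist \<eta> \<xi> < \<delta>" using X(2) \<xi> by auto
      have "cmod (?F \<xi> - ?F \<eta>) \<le> \<rho> * norm (\<xi> - \<eta>) * (V * h)" unfolding h_def by (rule lip[OF uH])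
      also have "\<dots> \<le> \<rho> * \<delta> * (V * h)"
        using \<eta>(2) \<rho>(1) V by (intro mult_right_mono mult_left_mono) (auto simp: dist_norm norm_minus_commute h_def)
      finally have d: "(cmod (?F \<xi> - ?F \<eta>))\<^sup>2 \<le> (L * \<delta> * h)\<^sup>2" unfolding L_def by (intro power_mono) (auto simp: mult_ac)
      have "(cmod (?F \<xi>))\<^sup>2 \<le> 2 * (cmod (?F \<eta>))\<^sup>2 + 2 * (cmod (?F \<xi> - ?F \<eta>))\<^sup>2"
        using norm_add_sq_le[of "?F \<eta>" "?F \<xi> - ?F \<eta>"] by simp
      moreover have "(cmod (?F \<eta>))\<^sup>2 \<le> Sg" unfolding Sg_def by (rule member_le_sum) (use \<eta> X in auto)
      ultimately show ?thesis using d by linarith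
    qed
    have "(LINT \<xi>|lebesgue. indicator B \<xi> * (cmod (fourier u \<xi>))\<^sup>2) \<le> (LINT \<xi>|lebesgue. indicator B \<xi> * (2 * Sg + 2 * (L * \<delta> * h)\<^sup>2))"
    proof (rule integral_mono_AE)
      show "integrable lebesgue (\<lambda>\<xi>. indicator B \<xi> * (cmod (fourier u \<xi>))\<^sup>2)"
        using integrable_mult_indicator[OF _ L2_integrable_sq[OF fourier_L2[OF uL]], of B] by (simp add: B_def)
      show "integrable lebesgue (\<lambda>\<xi>. indicator B \<xi> * (2 * Sg + 2 * (L * \<delta> * h)\<^sup>2))" using iB by (rule integrable_mult_left)
      show "AE \<xi> in lebesgue. indicator B \<xi> * (cmod (fourier u \<xi>))\<^sup>2 \<le> indicator B \<xi> * (2 * Sg + 2 * (L * \<delta> * h)\<^sup>2)"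
        using F by eventually_elim (use pt in \<open>auto simp: indicator_def\<close>)
    qed
    also have "\<dots> = vB * (2 * Sg + 2 * (L * \<delta> * h)\<^sup>2)"
      unfolding Bochner_Integration.integral_mult_left_zero LB ..
    finally have "N * (LINT \<xi>|lebesgue. indicator B \<xi> * (cmod (fourier u \<xi>))\<^sup>2) \<le> N * (vB * (2 * Sg + 2 * (L * \<delta> * h)\<^sup>2))"
      using N by (intro mult_left_mono) auto
    also have "\<dots> = 2 * N * vB * Sg + N * (vB * (2 * (L * \<delta>)\<^sup>2)) * h\<^sup>2"
      by (simp add: power_mult_distrib algebra_simps)
    also have "\<dots> \<le> 2 * N * vB * Sg + \<epsilon> * h\<^sup>2" using \<delta>(2) by (intro add_left_mono mult_right_mono) auto
    finally show "N * (LINT \<xi>|lebesgue. indicator (cball 0 R) \<xi> * (cmod (fourier u \<xi>))\<^sup>2) \<le> (\<Sum>l\<leftarrow>ls. l u * l u) + \<epsilon> * (Hs_norm s u)\<^sup>2"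
      unfolding ls_sum h_def B_def .
  qed
qed

lemma norm_sob_le_flap:
  assumes s: "0 \<le> s" "s \<le> 1"
  shows "(cmod (sob s u \<xi>))\<^sup>2 \<le> 2 * (cmod (flap s u \<xi>))\<^sup>2 + 2 * (cmod (fourier u \<xi>))\<^sup>2"
proof -
  have "(1 + (norm \<xi>)\<^sup>2) powr s \<le> 2 * norm \<xi> powr (2 * s) + 2"
  proof (cases "norm \<xi> \<le> 1")
    case True
    then have "(norm \<xi>)\<^sup>2 \<le> 1" by (simp add: power_le_one)
    then have "(1 + (norm \<xi>)\<^sup>2) powr s \<le> 2 powr s" using s by (intro powr_mono2) auto
    also have "\<dots> \<le> 2 powr 1" using s by (intro powr_mono) auto
    finally show ?thesis by (simp add: add_increasing)
  next
    case False
    then have "1 \<le> (norm \<xi>)\<^sup>2" by (simp add: one_le_power)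
    then have "(1 + (norm \<xi>)\<^sup>2) powr s \<le> (2 * (norm \<xi>)\<^sup>2) powr s" using s by (intro powr_mono2) auto
    also have "\<dots> = 2 powr s * ((norm \<xi>)\<^sup>2) powr s" by (simp add: powr_mult)
    also have "\<dots> \<le> 2 powr 1 * ((norm \<xi>)\<^sup>2) powr s" using s by (intro mult_right_mono powr_mono) auto
    also have "((norm \<xi>)\<^sup>2) powr s = norm \<xi> powr (2 * s)"
      using False by (simp add: powr_powr flip: powr_numeral)
    finally show ?thesis by simp
  qed
  then have "(1 + (norm \<xi>)\<^sup>2) powr s * (cmod (fourier u \<xi>))\<^sup>2 \<le> (2 * norm \<xi> powr (2 * s) + 2) * (cmod (fourier u \<xi>))\<^sup>2"
    by (rule mult_right_mono) simp
  then show ?thesis unfolding norm_sob_sq norm_flap_sq by (simp add: algebra_simps)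
qed

text \<open>
  Garding's inequality. The form differs from a coercive one by at most a multiple of the \<open>L\<^sup>2\<close> norm.
  The part of this norm at frequencies above \<open>R\<close> is a small multiple of the Sobolev norm, and the
  part below \<open>R\<close> is dominated by finitely many squares of functionals.
\<close>

lemma bilinear_form_coercive:
  fixes \<Omega> :: "(real^'n) set"
  assumes \<Omega>: "open \<Omega>" "bounded \<Omega>" and s: "0 < s" "s \<le> 1" and q: "q \<in> L_infty \<Omega>"
  obtains c ls where "c > 0" "\<forall>l\<in>set ls. bdd_lin s \<Omega> l"
    "\<forall>u\<in>Hs_tilde s \<Omega>. c * (Hs_norm s u)\<^sup>2 \<le> bilinear_form s \<Omega> q u u + (\<Sum>l\<leftarrow>ls. l u * l u)"
proof -
  have s0: "0 \<le> s" using s by simp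
  define K where "K = (2 * pi) ^ CARD('n)"
  have K: "K > 0" by (simp add: K_def)
  obtain M where M: "M > 0" "\<And>u v. u \<in> L2 \<Longrightarrow> v \<in> L2 \<Longrightarrow> \<bar>potential_form \<Omega> q u v\<bar> \<le> M * l2norm u * l2norm v"
    using potential_form_bound[OF q] by blast
  define N where "N = (1 + M) / K"
  have N: "N > 0" using M K by (simp add: N_def)
  \<comment> \<open>At frequencies above \<open>R\<close> the weight of the Sobolev norm is large enough to absorb \<open>1 + M\<close> times
    the square of the transform into an eighth of the Sobolev norm.\<close>
  obtain R where R: "R > 0" "8 * (1 + M) \<le> (1 + R\<^sup>2) powr s"
  proof -
    define R where "R = (8 * (1 + M)) powr (1 / s)"
    have 1: "1 \<le> R" unfolding R_def using M(1) s by (intro ge_one_powr_ge_zero) auto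
    have "8 * (1 + M) = R powr s" unfolding R_def using s M(1) by (simp add: powr_powr)
    also have "\<dots> \<le> (1 + R\<^sup>2) powr s"
    proof (rule powr_mono2)
      have "R * 1 \<le> R * R" using 1 by (intro mult_left_mono) auto
      then show "R \<le> 1 + R\<^sup>2" by (simp add: power2_eq_square)
    qed (use 1 s in auto)
    finally show ?thesis using 1 by (intro that[of R]) auto
  qed
  have "1 / (8 * K) > 0" using K by simp
  from low_frequency_finite_rank[OF \<Omega> s0 s(2) N this, of R]
  obtain ls where ls: "\<And>l. l \<in> set ls \<Longrightarrow> bdd_lin s \<Omega> l"
    "\<And>u. u \<in> Hs_tilde s \<Omega> \<Longrightarrow>
       N * (LINT \<xi>|lebesgue. indicator (cball 0 R) \<xi> * (cmod (fourier u \<xi>))\<^sup>2) \<le> (\<Sum>l\<leftarrow>ls. l u * l u) + 1 / (8 * K) * (Hs_norm s u)\<^sup>2"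
    by blast
  show ?thesis
  proof (rule that[of "1 / (4 * K)" ls])
    show "1 / (4 * K) > 0" using K by simp
    show "\<forall>l\<in>set ls. bdd_lin s \<Omega> l" using ls(1) by blast
    show "\<forall>u\<in>Hs_tilde s \<Omega>. 1 / (4 * K) * (Hs_norm s u)\<^sup>2 \<le> bilinear_form s \<Omega> q u u + (\<Sum>l\<leftarrow>ls. l u * l u)"
    proof
      fix u assume u: "u \<in> Hs_tilde s \<Omega>"
      note uH = Hs_tilde_Hs[OF u] note uL = Hs_L2[OF uH]
      define h where "h = (Hs_norm s u)\<^sup>2"
      define A where "A = (l2norm (flap s u))\<^sup>2"
      define f where "f = (l2norm (fourier u))\<^sup>2"
      have fi: "integrable lebesgue (\<lambda>\<xi>. (cmod (fourier u \<xi>))\<^sup>2)" by (rule L2_integrable_sq[OF fourier_L2[OF uL]])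
      have Ai: "integrable lebesgue (\<lambda>\<xi>. (cmod (flap s u \<xi>))\<^sup>2)" by (rule L2_integrable_sq[OF flap_L2[OF uH s0]])
      have hi: "integrable lebesgue (\<lambda>\<xi>. (cmod (sob s u \<xi>))\<^sup>2)" by (rule L2_integrable_sq[OF Hs_sob[OF uH]])
      have E: "energy s u u = A / K"
      proof -
        have "(LINT \<xi>|lebesgue. flap s u \<xi> * cnj (flap s u \<xi>)) = of_real A"
          unfolding A_def l2norm_sq integral_complex_of_real[symmetric]
          by (simp only: complex_norm_square[symmetric] of_real_power)
        then show ?thesis by (simp add: energy_def K_def)
      qed
      have h1: "h \<le> 2 * A + 2 * f"
      proof -
        have "h = (LINT \<xi>|lebesgue. (cmod (sob s u \<xi>))\<^sup>2)" by (simp only: h_def Hs_norm_eq l2norm_sq)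
        also have "\<dots> \<le> (LINT \<xi>|lebesgue. 2 * (cmod (flap s u \<xi>))\<^sup>2 + 2 * (cmod (fourier u \<xi>))\<^sup>2)"
          using fi Ai hi by (intro integral_mono norm_sob_le_flap s0 s) auto
        also have "\<dots> = 2 * A + 2 * f" using fi Ai by (simp add: A_def f_def l2norm_sq)
        finally show ?thesis .
      qed
      have P: "- (M * f / K) \<le> potential_form \<Omega> q u u"
      proof -
        have "f = K * (l2norm u)\<^sup>2" unfolding f_def fourier_plancherel[OF uL] K_def by (simp add: power_mult_distrib)
        then have "M * f / K = M * l2norm u * l2norm u" using K by (simp add: power2_eq_square)
        then show ?thesis using M(2)[OF uL uL] by linarith
      qed
      let ?I = "LINT \<xi>|lebesgue. indicator (cball 0 R) \<xi> * (cmod (fourier u \<xi>))\<^sup>2"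
      have tail: "(1 + M) * f \<le> (1 + M) * ?I + h / 8"
      proof -
        have Ii: "integrable lebesgue (\<lambda>\<xi>. indicator (cball 0 R) \<xi> * (cmod (fourier u \<xi>))\<^sup>2)"
          using integrable_mult_indicator[OF _ fi, of "cball 0 R"] by simp
        have "(1 + M) * f = (LINT \<xi>|lebesgue. (1 + M) * (cmod (fourier u \<xi>))\<^sup>2)" by (simp add: f_def l2norm_sq)
        also have "\<dots> \<le> (LINT \<xi>|lebesgue. (1 + M) * (indicator (cball 0 R) \<xi> * (cmod (fourier u \<xi>))\<^sup>2) + (1/8) * (cmod (sob s u \<xi>))\<^sup>2)"
        proof (rule integral_mono)
          show "integrable lebesgue (\<lambda>\<xi>. (1 + M) * (cmod (fourier u \<xi>))\<^sup>2)" using fi by simp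
          show "integrable lebesgue (\<lambda>\<xi>. (1 + M) * (indicator (cball 0 R) \<xi> * (cmod (fourier u \<xi>))\<^sup>2) + (1/8) * (cmod (sob s u \<xi>))\<^sup>2)"
            by (intro Bochner_Integration.integrable_add integrable_mult_right Ii hi)
          fix \<xi> :: "real^'n"
          show "(1 + M) * (cmod (fourier u \<xi>))\<^sup>2 \<le> (1 + M) * (indicator (cball 0 R) \<xi> * (cmod (fourier u \<xi>))\<^sup>2) + (1/8) * (cmod (sob s u \<xi>))\<^sup>2"
          proof (cases "\<xi> \<in> cball 0 R")
            case False
            then have "R\<^sup>2 \<le> (norm \<xi>)\<^sup>2" using R(1) by (intro power_mono) auto
            then have "(1 + R\<^sup>2) powr s \<le> (1 + (norm \<xi>)\<^sup>2) powr s" using s by (intro powr_mono2) auto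
            then have "8 * (1 + M) * (cmod (fourier u \<xi>))\<^sup>2 \<le> (1 + (norm \<xi>)\<^sup>2) powr s * (cmod (fourier u \<xi>))\<^sup>2"
              using R(2) by (intro mult_right_mono) auto
            moreover have i0: "indicator (cball 0 R) \<xi> = (0::real)" using False by simp
            ultimately show ?thesis unfolding norm_sob_sq i0 by linarith
          qed simp
        qed
        also have "\<dots> = (1 + M) * ?I + (1/8) * (LINT \<xi>|lebesgue. (cmod (sob s u \<xi>))\<^sup>2)"
          unfolding Bochner_Integration.integral_add[OF integrable_mult_right[OF Ii] integrable_mult_right[OF hi]]
            Bochner_Integration.integral_mult_right_zero ..
        finally show ?thesis by (simp add: h_def Hs_norm_eq l2norm_sq)
      qed
      have "(1 + M) * f / K \<le> ((1 + M) * ?I + h / 8) / K" using tail K by (intro divide_right_mono) auto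
      also have "\<dots> = N * ?I + h / (8 * K)" using K by (simp add: N_def field_simps)
      also have "\<dots> \<le> (\<Sum>l\<leftarrow>ls. l u * l u) + h / (4 * K)"
        using ls(2)[OF u] by (simp add: h_def)
      finally have t: "(1 + M) * f / K \<le> (\<Sum>l\<leftarrow>ls. l u * l u) + h / (4 * K)" .
      have "h / (2 * K) \<le> (A + f) / K" using h1 K by (simp add: field_simps)
      then have e1: "h / (2 * K) \<le> energy s u u + f / K" by (simp add: E add_divide_distrib)
      have e2: "f / K + M * f / K = (1 + M) * f / K" by (simp add: add_divide_distrib distrib_right)
      have e3: "h / (2 * K) = h / (4 * K) + h / (4 * K)" by (simp add: field_simps)
      have e4: "bilinear_form s \<Omega> q u u = energy s u u + potential_form \<Omega> q u u"
        by (simp add: bilinear_form_eq[OF uH uH s0] potential_form_def)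
      have "h / (4 * K) \<le> bilinear_form s \<Omega> q u u + (\<Sum>l\<leftarrow>ls. l u * l u)"
        using e1 e2 t P unfolding e3 e4 by linarith
      then show "1 / (4 * K) * (Hs_norm s u)\<^sup>2 \<le> bilinear_form s \<Omega> q u u + (\<Sum>l\<leftarrow>ls. l u * l u)" by (simp add: h_def)
    qed
  qed
qed

lemma finite_rank_form:
  assumes "\<And>l. l \<in> set ls \<Longrightarrow> bdd_lin s \<Omega> l"
  shows "sym_bilinear_on (Hs_tilde s \<Omega>) (\<lambda>u v. \<Sum>l\<leftarrow>ls. l u * l v) \<and>
    (\<exists>C. \<forall>u\<in>Hs_tilde s \<Omega>. \<forall>v\<in>Hs_tilde s \<Omega>. \<bar>\<Sum>l\<leftarrow>ls. l u * l v\<bar> \<le> C * Hs_norm s u * Hs_norm s v)"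
  using assms
proof (induction ls)
  case Nil
  show ?case by (auto simp: sym_bilinear_on_def lin_on_def intro!: exI[of _ 0])
next
  case (Cons l ls)
  let ?V = "Hs_tilde s \<Omega>"
  have l: "bdd_lin s \<Omega> l" using Cons.prems by simp
  obtain K where K: "K > 0" "\<And>v. v \<in> ?V \<Longrightarrow> \<bar>l v\<bar> \<le> K * Hs_norm s v" using bdd_linE[OF l] by blast
  have IH: "sym_bilinear_on ?V (\<lambda>u v. \<Sum>l\<leftarrow>ls. l u * l v)" using Cons by simp
  obtain C where C: "\<And>u v. u \<in> ?V \<Longrightarrow> v \<in> ?V \<Longrightarrow> \<bar>\<Sum>l\<leftarrow>ls. l u * l v\<bar> \<le> C * Hs_norm s u * Hs_norm s v" using Cons by fastforce
  have "sym_bilinear_on ?V (\<lambda>u v. \<Sum>l\<leftarrow>(l # ls). l u * l v)"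
    using IH l unfolding sym_bilinear_on_def bdd_lin_def lin_on_def by (auto simp: algebra_simps)
  moreover have "\<bar>\<Sum>l\<leftarrow>(l # ls). l u * l v\<bar> \<le> (K * K + C) * Hs_norm s u * Hs_norm s v" if u: "u \<in> ?V" and v: "v \<in> ?V" for u v
  proof -
    have "\<bar>l u * l v\<bar> \<le> (K * Hs_norm s u) * (K * Hs_norm s v)"
      unfolding abs_mult using K by (intro mult_mono K u v) auto
    then show ?thesis using C[OF u v] abs_triangle_ineq[of "l u * l v" "\<Sum>l\<leftarrow>ls. l u * l v"] by (simp add: algebra_simps)
  qed
  ultimately show ?case by blast
qed

text \<open>
  The uniqueness condition makes every element of the kernel zero almost everywhere, so every bounded
  functional vanishes on the kernel and is an admissible right-hand side.
\<close>

theorem dirichlet_problem_solvable: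
  fixes \<Omega> :: "(real^'n) set"
  assumes \<Omega>: "open \<Omega>" "bounded \<Omega>" and s: "0 < s" "s < 1" and q: "q \<in> L_infty \<Omega>"
    and uniq: "uniqueness_condition s \<Omega> q" and F: "bdd_lin s \<Omega> F"
  shows "\<exists>u\<in>Hs_tilde s \<Omega>. \<forall>v\<in>Hs_tilde s \<Omega>. bilinear_form s \<Omega> q u v = F v"
proof -
  have s': "0 \<le> s" "s \<le> 1" using s by auto
  let ?V = "Hs_tilde s \<Omega>"
  have V: "lin_subspace ?V" by (rule Hs_tilde_lin_subspace[OF s'(2)])
  have b: "sym_bilinear_on ?V (bilinear_form s \<Omega> q)"
    unfolding sym_bilinear_on_def lin_on_def
    using bilinear_form_lin[OF q s'(1) Hs_tilde_Hs Hs_tilde_Hs Hs_tilde_Hs] bilinear_form_sym by blast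
  obtain M where M: "M > 0" "\<And>u v. u \<in> Hs s \<Longrightarrow> v \<in> Hs s \<Longrightarrow> \<bar>bilinear_form s \<Omega> q u v\<bar> \<le> M * Hs_norm s u * Hs_norm s v"
    using bilinear_form_bound[OF q s'(1)] by blast
  obtain c ls where c: "c > 0" and ls0: "\<forall>l\<in>set ls. bdd_lin s \<Omega> l"
    and coer0: "\<forall>u\<in>?V. c * (Hs_norm s u)\<^sup>2 \<le> bilinear_form s \<Omega> q u u + (\<Sum>l\<leftarrow>ls. l u * l u)"
    using bilinear_form_coercive[OF \<Omega> s(1) s'(2) q] .
  note ls = ls0[rule_format] and coer = coer0[rule_format]
  have FR: "sym_bilinear_on ?V (\<lambda>u v. \<Sum>l\<leftarrow>ls. l u * l v) \<and>
      (\<exists>C. \<forall>u\<in>?V. \<forall>v\<in>?V. \<bar>\<Sum>l\<leftarrow>ls. l u * l v\<bar> \<le> C * Hs_norm s u * Hs_norm s v)"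
    by (rule finite_rank_form) (rule ls)
  note R = FR[THEN conjunct1]
  obtain C where "\<forall>u\<in>?V. \<forall>v\<in>?V. \<bar>\<Sum>l\<leftarrow>ls. l u * l v\<bar> \<le> C * Hs_norm s u * Hs_norm s v"
    using FR[THEN conjunct2] ..
  then have C: "\<bar>\<Sum>l\<leftarrow>ls. l u * l v\<bar> \<le> C * Hs_norm s u * Hs_norm s v" if "u \<in> ?V" "v \<in> ?V" for u v
    using that by (elim ballE) auto
  let ?b = "\<lambda>u v. bilinear_form s \<Omega> q u v + (\<Sum>l\<leftarrow>ls. l u * l v)"
  have b': "sym_bilinear_on ?V ?b"
    using b R unfolding sym_bilinear_on_def lin_on_def by (simp add: algebra_simps)
  have M': "\<bar>?b u v\<bar> \<le> (M + C) * Hs_norm s u * Hs_norm s v" if "u \<in> ?V" "v \<in> ?V" for u v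
    using M(2)[OF Hs_tilde_Hs[OF that(1)] Hs_tilde_Hs[OF that(2)]] C[OF that]
      abs_triangle_ineq[of "bilinear_form s \<Omega> q u v" "\<Sum>l\<leftarrow>ls. l u * l v"] by (simp add: algebra_simps)
  have "solvable_on ?V ?b (bdd_lin s \<Omega>)"
    unfolding solvable_on_def using coercive_solvable[OF s' b' M' c coer] by blast
  then have solv: "solvable_on ?V (bilinear_form s \<Omega> q) (bdd_lin s \<Omega>)"
    by (intro solvable_on_remove_finite_rank[where A = "bdd_lin s \<Omega>" and ls = ls, OF V b])
       (auto intro: bdd_lin_lin_on bdd_lin_add ls)
  have "F k = 0" if k: "k \<in> ?V" and z: "\<And>v. v \<in> ?V \<Longrightarrow> bilinear_form s \<Omega> q k v = 0" for k
  proof -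
    note kH = Hs_tilde_Hs[OF k]
    have "schroedinger_eq s \<Omega> q k"
      unfolding schroedinger_eq_iff[OF s' kH] using z Cc_infty_Hs_tilde[OF _ s'(2)] by blast
    moreover have "AE x in lebesgue. x \<in> exterior \<Omega> \<longrightarrow> k x = 0"
      using Hs_tilde_AE_zero[OF k s'] by eventually_elim (use closure_subset in \<open>auto simp: exterior_def\<close>)
    ultimately have "AE x in lebesgue. k x = 0" using uniq kH unfolding uniqueness_condition_def by blast
    then have n: "Hs_norm s k = 0" by (rule Hs_norm_AE_zero(2)[OF Hs_L2[OF kH]])
    obtain K where "\<And>v. v \<in> ?V \<Longrightarrow> \<bar>F v\<bar> \<le> K * Hs_norm s v" using bdd_linE[OF F] by blast
    from this[OF k] show ?thesis by (simp add: n)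
  qed
  then show ?thesis using solv F unfolding solvable_on_def by blast
qed

section \<open>Solutions and the Dirichlet-to-Neumann map\<close>

lemma bilinear_form_AE_zero:
  assumes q: "q \<in> L_infty \<Omega>" and s: "s \<ge> 0" and u: "u \<in> Hs s" and z: "AE x in lebesgue. u x = 0" and v: "v \<in> Hs s"
  shows "bilinear_form s \<Omega> q u v = 0"
proof -
  obtain M where M: "M > 0" "\<And>u v. u \<in> Hs s \<Longrightarrow> v \<in> Hs s \<Longrightarrow> \<bar>bilinear_form s \<Omega> q u v\<bar> \<le> M * Hs_norm s u * Hs_norm s v"
    using bilinear_form_bound[OF q s] by blast
  show ?thesis using M(2)[OF u v] Hs_norm_AE_zero(2)[OF Hs_L2[OF u] z, of s] by simp
qed

lemma bilinear_form_diff: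
  assumes q: "q \<in> L_infty \<Omega>" and s: "s \<ge> 0" and u: "u \<in> Hs s" "v \<in> Hs s" "w \<in> Hs s"
  shows "bilinear_form s \<Omega> q (\<lambda>x. u x - v x) w = bilinear_form s \<Omega> q u w - bilinear_form s \<Omega> q v w"
    and "bilinear_form s \<Omega> q w (\<lambda>x. u x - v x) = bilinear_form s \<Omega> q w u - bilinear_form s \<Omega> q w v"
  using bilinear_form_lin[OF q s u, of "-1"] by (simp_all add: bilinear_form_sym[of s \<Omega> q w])

lemma Hs_tilde_diff:
  assumes "u \<in> Hs_tilde s \<Omega>" "v \<in> Hs_tilde s \<Omega>" "s \<le> 1" shows "(\<lambda>x. u x - v x) \<in> Hs_tilde s \<Omega>"
  using Hs_tilde_lin[OF assms, of "-1"] by simp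

lemma dirichlet_solution_exists:
  fixes \<Omega> :: "(real^'n) set"
  assumes \<Omega>: "open \<Omega>" "bounded \<Omega>" and s: "0 < s" "s < 1" and q: "q \<in> L_infty \<Omega>"
    and uniq: "uniqueness_condition s \<Omega> q" and f: "f \<in> Hs s"
  shows "\<exists>u. dirichlet_solution s \<Omega> q f u"
proof -
  have s': "0 \<le> s" "s \<le> 1" using s by auto
  obtain M where M: "M > 0" "\<And>u v. u \<in> Hs s \<Longrightarrow> v \<in> Hs s \<Longrightarrow> \<bar>bilinear_form s \<Omega> q u v\<bar> \<le> M * Hs_norm s u * Hs_norm s v"
    using bilinear_form_bound[OF q s'(1)] by blast
  have "bdd_lin s \<Omega> (\<lambda>v. - bilinear_form s \<Omega> q v f)"
    unfolding bdd_lin_def lin_on_def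
  proof (intro conjI ballI allI exI[of _ "M * Hs_norm s f"])
    fix v assume v: "v \<in> Hs_tilde s \<Omega>"
    show "\<bar>- bilinear_form s \<Omega> q v f\<bar> \<le> M * Hs_norm s f * Hs_norm s v"
      using M(2)[OF Hs_tilde_Hs[OF v] f] by (simp add: mult_ac)
  qed (simp add: bilinear_form_lin[OF q s'(1) Hs_tilde_Hs Hs_tilde_Hs f])
  from dirichlet_problem_solvable[OF \<Omega> s q uniq this]
  obtain w where w: "w \<in> Hs_tilde s \<Omega>" "\<And>v. v \<in> Hs_tilde s \<Omega> \<Longrightarrow> bilinear_form s \<Omega> q w v = - bilinear_form s \<Omega> q v f" by blast
  note wH = Hs_tilde_Hs[OF w(1)]
  let ?u = "\<lambda>x. w x + 1 * f x"
  have uH: "?u \<in> Hs s" by (rule Hs_lin[OF wH f])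
  have "bilinear_form s \<Omega> q ?u \<phi> = 0" if \<phi>: "\<phi> \<in> Cc_infty \<Omega>" for \<phi>
    using bilinear_form_lin[OF q s'(1) wH f Cc_infty_Hs[OF \<phi> s'(2)], of 1] w(2)[OF Cc_infty_Hs_tilde[OF \<phi> s'(2)]]
      bilinear_form_sym[of s \<Omega> q f \<phi>] by simp
  then have "schroedinger_eq s \<Omega> q ?u" using schroedinger_eq_iff[OF s' uH] by blast
  then have "dirichlet_solution s \<Omega> q f ?u" using uH w(1) by (simp add: dirichlet_solution_def)
  then show ?thesis by blast
qed

text \<open>
  Against a weak solution only the class of the second argument counts, so the data of a solution
  may replace the solution itself.
\<close>

lemma bilinear_form_cong_trace:
  fixes \<Omega> :: "(real^'n) set"
  assumes s: "0 \<le> s" "s \<le> 1" and q: "q \<in> L_infty \<Omega>" and u: "u \<in> Hs s" and eq: "schroedinger_eq s \<Omega> q u"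
    and g: "g \<in> Hs s" "h \<in> Hs s" and d: "(\<lambda>x. g x - h x) \<in> Hs_tilde s \<Omega>"
  shows "bilinear_form s \<Omega> q u g = bilinear_form s \<Omega> q u h"
  using schroedinger_eq_Hs_tilde[OF s q u eq d] bilinear_form_diff(2)[OF q s(1) g u] by simp

lemma trace_class_iff: "g \<in> trace_class s \<Omega> f \<longleftrightarrow> f \<in> Hs s \<and> g \<in> Hs s \<and> (\<lambda>x. f x - g x) \<in> Hs_tilde s \<Omega>"
  by (simp add: trace_class_def trace_rel_def)

text \<open>
  Two solutions whose data are in the same class differ by a solution in the energy space, which the
  uniqueness condition makes zero almost everywhere. So the description in \<open>DN_map\<close> has only one value.
\<close>

lemma DN_map_eq:
  fixes \<Omega> :: "(real^'n) set"
  assumes s: "0 < s" "s < 1" and q: "q \<in> L_infty \<Omega>"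
    and uniq: "uniqueness_condition s \<Omega> q" and f: "f \<in> Hs s" and g: "g \<in> Hs s"
    and u: "dirichlet_solution s \<Omega> q f u"
  shows "DN_map s \<Omega> q (trace_class s \<Omega> f) (trace_class s \<Omega> g) = bilinear_form s \<Omega> q u g"
proof -
  have s': "0 \<le> s" "s \<le> 1" using s by auto
  have tc: "trace_class s \<Omega> h \<in> trace_space s \<Omega>" if "h \<in> Hs s" for h
    using that unfolding trace_class_def trace_space_def by (rule quotientI)
  have self: "h \<in> trace_class s \<Omega> h" if "h \<in> Hs s" for h
    using that Cc_infty_Hs_tilde[OF Cc_infty_zero s'(2)] by (simp add: trace_class_iff)
  have uH: "u \<in> Hs s" and ueq: "schroedinger_eq s \<Omega> q u" and uf: "(\<lambda>x. u x - f x) \<in> Hs_tilde s \<Omega>"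
    using u by (auto simp: dirichlet_solution_def)
  have "(THE b. \<exists>f'\<in>trace_class s \<Omega> f. \<exists>g'\<in>trace_class s \<Omega> g. \<exists>u. dirichlet_solution s \<Omega> q f' u \<and> b = bilinear_form s \<Omega> q u g')
     = bilinear_form s \<Omega> q u g"
  proof (rule the_equality)
    show "\<exists>f'\<in>trace_class s \<Omega> f. \<exists>g'\<in>trace_class s \<Omega> g. \<exists>u'. dirichlet_solution s \<Omega> q f' u' \<and> bilinear_form s \<Omega> q u g = bilinear_form s \<Omega> q u' g'"
      using self f g u by blast
    fix b assume "\<exists>f'\<in>trace_class s \<Omega> f. \<exists>g'\<in>trace_class s \<Omega> g. \<exists>u. dirichlet_solution s \<Omega> q f' u \<and> b = bilinear_form s \<Omega> q u g'"
    then obtain f' g' u' where *: "f' \<in> trace_class s \<Omega> f" "g' \<in> trace_class s \<Omega> g" "dirichlet_solution s \<Omega> q f' u'" "b = bilinear_form s \<Omega> q u' g'"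
      by blast
    have u'H: "u' \<in> Hs s" and u'eq: "schroedinger_eq s \<Omega> q u'" and u'f: "(\<lambda>x. u' x - f' x) \<in> Hs_tilde s \<Omega>"
      using *(3) by (auto simp: dirichlet_solution_def)
    have g': "g' \<in> Hs s" "(\<lambda>x. g x - g' x) \<in> Hs_tilde s \<Omega>" and ff': "(\<lambda>x. f x - f' x) \<in> Hs_tilde s \<Omega>"
      using *(1,2) by (auto simp: trace_class_iff)
    let ?d = "\<lambda>x. u' x - u x"
    have "(\<lambda>x. (u' x - f' x) - (f x - f' x) - (u x - f x)) \<in> Hs_tilde s \<Omega>"
      by (intro Hs_tilde_diff u'f ff' uf s')
    then have dt: "?d \<in> Hs_tilde s \<Omega>" by (simp add: algebra_simps)
    have dH: "?d \<in> Hs s" by (rule Hs_tilde_Hs[OF dt])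
    have "schroedinger_eq s \<Omega> q ?d"
      using ueq u'eq unfolding schroedinger_eq_iff[OF s' dH] schroedinger_eq_iff[OF s' uH] schroedinger_eq_iff[OF s' u'H]
      using bilinear_form_diff(1)[OF q s'(1) u'H uH Cc_infty_Hs[OF _ s'(2)]] by auto
    moreover have "AE x in lebesgue. x \<in> exterior \<Omega> \<longrightarrow> ?d x = 0"
      using Hs_tilde_AE_zero[OF dt s'] by eventually_elim (use closure_subset in \<open>auto simp: exterior_def\<close>)
    ultimately have "AE x in lebesgue. ?d x = 0" using uniq dH unfolding uniqueness_condition_def by blast
    then have "bilinear_form s \<Omega> q ?d g' = 0" by (rule bilinear_form_AE_zero[OF q s'(1) dH _ g'(1)])
    then have "b = bilinear_form s \<Omega> q u g'" using bilinear_form_diff(1)[OF q s'(1) u'H uH g'(1)] *(4) by simp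
    also have "\<dots> = bilinear_form s \<Omega> q u g"
      using bilinear_form_cong_trace[OF s' q uH ueq g g'(1) g'(2)] by simp
    finally show "b = bilinear_form s \<Omega> q u g" .
  qed
  then show ?thesis by (simp add: DN_map_def tc f g)
qed

text \<open>
  The integral identity. The unknown potentials enter only through the solutions, and by the
  symmetry of the forms data and solutions can be exchanged until both forms are evaluated at the
  same pair.
\<close>

lemma DN_integral_identity:
  fixes \<Omega> :: "(real^'n) set"
  assumes \<Omega>: "open \<Omega>" "bounded \<Omega>" and s: "0 < s" "s < 1" and q1: "q1 \<in> L_infty \<Omega>" and q2: "q2 \<in> L_infty \<Omega>"
    and uniq1: "uniqueness_condition s \<Omega> q1" and uniq2: "uniqueness_condition s \<Omega> q2"
    and f1: "f1 \<in> Hs s" and f2: "f2 \<in> Hs s"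
    and u1: "dirichlet_solution s \<Omega> q1 f1 u1" and u2: "dirichlet_solution s \<Omega> q2 f2 u2"
    and DN: "DN_map s \<Omega> q1 (trace_class s \<Omega> f1) (trace_class s \<Omega> f2) = DN_map s \<Omega> q2 (trace_class s \<Omega> f1) (trace_class s \<Omega> f2)"
  shows "potential_form \<Omega> q1 u1 u2 = potential_form \<Omega> q2 u1 u2"
proof -
  have s': "0 \<le> s" "s \<le> 1" using s by auto
  obtain w where w: "dirichlet_solution s \<Omega> q2 f1 w" using dirichlet_solution_exists[OF \<Omega> s q2 uniq2 f1] by blast
  have 1: "u1 \<in> Hs s" "schroedinger_eq s \<Omega> q1 u1" "(\<lambda>x. u1 x - f1 x) \<in> Hs_tilde s \<Omega>" using u1 by (auto simp: dirichlet_solution_def)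
  have 2: "u2 \<in> Hs s" "schroedinger_eq s \<Omega> q2 u2" "(\<lambda>x. u2 x - f2 x) \<in> Hs_tilde s \<Omega>" using u2 by (auto simp: dirichlet_solution_def)
  have 3: "w \<in> Hs s" "schroedinger_eq s \<Omega> q2 w" "(\<lambda>x. w x - f1 x) \<in> Hs_tilde s \<Omega>" using w by (auto simp: dirichlet_solution_def)
  have "bilinear_form s \<Omega> q1 u1 u2 = bilinear_form s \<Omega> q1 u1 f2"
    by (rule bilinear_form_cong_trace[OF s' q1 1(1,2) 2(1) f2 2(3)])
  also have "\<dots> = bilinear_form s \<Omega> q2 w f2"
    using DN DN_map_eq[OF s q1 uniq1 f1 f2 u1] DN_map_eq[OF s q2 uniq2 f1 f2 w] by simp
  also have "\<dots> = bilinear_form s \<Omega> q2 w u2"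
    by (rule bilinear_form_cong_trace[OF s' q2 3(1,2) 2(1) f2 2(3), symmetric])
  also have "\<dots> = bilinear_form s \<Omega> q2 u2 w" by (rule bilinear_form_sym)
  also have "\<dots> = bilinear_form s \<Omega> q2 u2 f1" by (rule bilinear_form_cong_trace[OF s' q2 2(1,2) 3(1) f1 3(3)])
  also have "\<dots> = bilinear_form s \<Omega> q2 u2 u1" by (rule bilinear_form_cong_trace[OF s' q2 2(1,2) 1(1) f1 1(3), symmetric])
  also have "\<dots> = bilinear_form s \<Omega> q2 u1 u2" by (rule bilinear_form_sym)
  finally show ?thesis
    unfolding bilinear_form_eq[OF 1(1) 2(1) s'(1)] potential_form_def by simp
qed

section \<open>Runge approximation\<close>

lemma energy_cong_AE:
  assumes u: "u \<in> Hs s" "v \<in> Hs s" and w: "w \<in> Hs s" and s: "s \<ge> 0" and ae: "AE x in lebesgue. u x = v x"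
  shows "energy s u w = energy s v w"
proof -
  have "AE \<xi> in lebesgue. fourier u \<xi> = fourier v \<xi>" by (rule fourier_cong_AE[OF Hs_L2[OF u(1)] Hs_L2[OF u(2)] ae])
  then have "AE \<xi> in lebesgue. flap s u \<xi> * cnj (flap s w \<xi>) = flap s v \<xi> * cnj (flap s w \<xi>)"
    by eventually_elim (simp add: flap_def)
  then have "(LINT \<xi>|lebesgue. flap s u \<xi> * cnj (flap s w \<xi>)) = (LINT \<xi>|lebesgue. flap s v \<xi> * cnj (flap s w \<xi>))"
    by (intro integral_cong_AE borel_measurable_integrable L2_mult_integrable L2_cnj flap_L2 u w s)
  then show ?thesis by (simp add: energy_def)
qed

lemma riesz_potential_continuous:
  fixes \<phi> :: "real^'n \<Rightarrow> real"
  assumes S: "compact S" and W: "open W" and WS: "W \<inter> S = {}" and \<phi>: "integrable lebesgue \<phi>" and z: "\<And>y. y \<notin> S \<Longrightarrow> \<phi> y = 0"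
  shows "continuous_on W (\<lambda>x. LINT y|lebesgue. \<phi> y * riesz a x y)"
  unfolding continuous_on_sequentially
proof (intro allI ballI impI)
  fix X x assume x: "x \<in> W" and X: "(\<forall>n. X n \<in> W) \<and> X \<longlonglongrightarrow> x"
  note rc = riesz_continuous[OF WS, of a]
  obtain r where r: "r > 0" "cball x r \<subseteq> W" using W x open_contains_cball by blast
  have "bounded ((\<lambda>(x, y). riesz a x y) ` (cball x r \<times> S))"
    by (intro compact_imp_bounded compact_continuous_image continuous_on_subset[OF rc] compact_Times compact_cball S) (use r in auto)
  then obtain C where "\<And>p. p \<in> cball x r \<times> S \<Longrightarrow> norm (case p of (x, y) \<Rightarrow> riesz a x y) \<le> C"
    unfolding bounded_iff by blast
  then have C: "\<bar>riesz a x' y\<bar> \<le> C" if "x' \<in> cball x r" "y \<in> S" for x' y using that by force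
  have i: "integrable lebesgue (\<lambda>y. \<phi> y * riesz a x' y)" if "x' \<in> W" for x'
    by (rule integrable_mult_continuous[OF S \<phi> z continuous_on_section[OF rc that]])
  have "\<forall>\<^sub>F n in sequentially. X n \<in> ball x r"
    using X r(1) by (intro topological_tendstoD) auto
  then obtain N where N: "\<And>n. n \<ge> N \<Longrightarrow> X n \<in> ball x r" unfolding eventually_sequentially by blast
  have "(\<lambda>n. LINT y|lebesgue. \<phi> y * riesz a (X (n + N)) y) \<longlonglongrightarrow> (LINT y|lebesgue. \<phi> y * riesz a x y)"
  proof (rule integral_dominated_convergence)
    show "integrable lebesgue (\<lambda>y. \<bar>\<phi> y\<bar> * C)" using \<phi> by simp
    show "(\<lambda>y. \<phi> y * riesz a x y) \<in> borel_measurable lebesgue" using i[OF x] by auto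
    show "(\<lambda>y. \<phi> y * riesz a (X (n + N)) y) \<in> borel_measurable lebesgue" for n using i X by auto
    show "AE y in lebesgue. (\<lambda>n. \<phi> y * riesz a (X (n + N)) y) \<longlonglongrightarrow> \<phi> y * riesz a x y"
    proof (rule AE_I2)
      fix y show "(\<lambda>n. \<phi> y * riesz a (X (n + N)) y) \<longlonglongrightarrow> \<phi> y * riesz a x y"
      proof (cases "y \<in> S")
        case True
        have l: "(\<lambda>n. (X (n + N), y)) \<longlonglongrightarrow> (x, y)" using X LIMSEQ_ignore_initial_segment[of X x N] by (intro tendsto_intros) auto
        have "(\<lambda>n. (\<lambda>(x, y). riesz a x y) (X (n + N), y)) \<longlonglongrightarrow> (\<lambda>(x, y). riesz a x y) (x, y)"
          by (rule continuous_on_tendsto_compose[OF rc l]) (use True x X in auto)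
        then show ?thesis by (intro tendsto_mult tendsto_const) simp
      qed (simp add: z)
    qed
    show "AE y in lebesgue. norm (\<phi> y * riesz a (X (n + N)) y) \<le> \<bar>\<phi> y\<bar> * C" for n
    proof (rule AE_I2)
      fix y show "norm (\<phi> y * riesz a (X (n + N)) y) \<le> \<bar>\<phi> y\<bar> * C"
      proof (cases "y \<in> S")
        case True
        have "X (n + N) \<in> cball x r" using N[of "n + N"] by auto
        then have "\<bar>\<phi> y\<bar> * \<bar>riesz a (X (n + N)) y\<bar> \<le> \<bar>\<phi> y\<bar> * C" using True by (intro mult_left_mono C) auto
        then show ?thesis by (simp only: real_norm_def abs_mult)
      qed (simp add: z)
    qed
  qed
  then have "(\<lambda>n. LINT y|lebesgue. \<phi> y * riesz a (X n) y) \<longlonglongrightarrow> (LINT y|lebesgue. \<phi> y * riesz a x y)"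
    by (rule LIMSEQ_offset)
  then show "((\<lambda>x. LINT y|lebesgue. \<phi> y * riesz a x y) \<circ> X) \<longlonglongrightarrow> (LINT y|lebesgue. \<phi> y * riesz a x y)"
    by (simp add: o_def)
qed

text \<open>
  Since the energies against test functions vanish, the Riesz potential of \<open>\<phi>\<close> is zero almost
  everywhere on \<open>W\<close>. It is continuous there, so it vanishes at every point, as the result on Riesz potentials requires.
\<close>

theorem frac_laplacian_unique_continuation:
  fixes \<Omega> W :: "(real^'n) set"
  assumes \<Omega>: "open \<Omega>" "bounded \<Omega>" and s: "0 < s" "s < 1"
    and W: "open W" "W \<noteq> {}" "W \<subseteq> exterior \<Omega>" and \<phi>: "\<phi> \<in> Hs_tilde s \<Omega>"
    and zero: "\<And>f. f \<in> Cc_infty W \<Longrightarrow> energy s \<phi> f = 0"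
  shows "AE x in lebesgue. \<phi> x = 0"
proof -
  have s': "0 \<le> s" "s \<le> 1" using s by auto
  note \<phi>H = Hs_tilde_Hs[OF \<phi>]
  let ?S = "closure \<Omega>"
  have S: "compact ?S" using \<Omega>(2) by (simp add: compact_closure)
  have WS: "W \<inter> ?S = {}" using W(3) by (auto simp: exterior_def)
  have \<Omega>m: "\<Omega> \<in> lmeasurable" using \<Omega> by (rule lmeasurable_open[rotated])
  define p where "p x = indicator \<Omega> x * \<phi> x" for x
  have pL: "p \<in> L2" unfolding p_def[abs_def] by (rule L2_indicator[OF Hs_L2[OF \<phi>H] fmeasurableD[OF \<Omega>m]])
  have ae: "AE x in lebesgue. p x = \<phi> x"
    using Hs_tilde_AE_zero[OF \<phi> s'] by eventually_elim (auto simp: p_def indicator_def)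
  have pH: "p \<in> Hs s"
  proof -
    have "AE x in lebesgue. p x - \<phi> x = 0" using ae by eventually_elim simp
    then have "(\<lambda>x. p x - \<phi> x) \<in> Hs s" by (rule Hs_norm_AE_zero(1)[OF L2_diff[OF pL Hs_L2[OF \<phi>H]]])
    from Hs_lin[OF this \<phi>H, of 1] show ?thesis by simp
  qed
  have pz: "p y = 0" if "y \<notin> \<Omega>" for y using that by (simp add: p_def)
  have pzS: "p y = 0" if "y \<notin> ?S" for y using that pz closure_subset by blast
  have pint: "integrable lebesgue p" by (rule L2_bounded_support_integrable(1)[OF pL \<Omega>m pz])
  define a where "a = real CARD('n) + 2 * s"
  define g where "g x = (LINT y|lebesgue. p y * riesz a x y)" for x
  have gc: "continuous_on W g" unfolding g_def[abs_def] by (rule riesz_potential_continuous[OF S W(1) WS pint pzS])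
  have "AE x in lebesgue. x \<in> W \<longrightarrow> g x = 0"
  proof (rule fundamental_lemma[OF W(1)])
    fix c d :: "real^'n" assume "cbox c d \<subseteq> W"
    then have "integrable lborel (\<lambda>x. indicator (cbox c d) x *\<^sub>R g x)"
      by (intro borel_integrable_compact compact_cbox continuous_on_subset[OF gc])
    then show "integrable lebesgue (\<lambda>x. indicator (cbox c d) x * g x)"
      using integrable_completion[OF borel_measurable_integrable, of lborel "\<lambda>x. indicator (cbox c d) x *\<^sub>R g x"] by simp
  next
    fix f assume f: "f \<in> Cc_infty W"
    note fH = Cc_infty_Hs[OF f s'(2)]
    let ?T = "closure {x. f x \<noteq> 0}"
    have T: "compact ?T" "?T \<subseteq> W" using f by (auto simp: Cc_infty_def)
    have e0: "energy s p f = 0" using zero[OF f] energy_cong_AE[OF pH \<phi>H fH s'(1) ae] by simp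
    have "(LINT x|lebesgue. f x * (LINT y|lebesgue. p y * riesz (real CARD('n) + 2 * s) x y)) = 0"
    proof (rule energy_zero_imp_riesz_zero[OF s pH fH S T(1) _ pzS _ e0])
      show "?S \<inter> ?T = {}" using T(2) WS by blast
      show "f x = 0" if "x \<notin> ?T" for x using that closure_subset[of "{x. f x \<noteq> 0}"] by auto
    qed
    then show "(LINT x|lebesgue. g x * f x) = 0" by (simp add: g_def a_def mult.commute)
  qed
  then have "AE x in lebesgue. x \<notin> W \<inter> g -` (- {0})" by eventually_elim auto
  then obtain N where N: "negligible N" "{x. \<not> x \<notin> W \<inter> g -` (- {0})} \<subseteq> N"
    unfolding eventually_ae_filter_negligible by blast
  have "W \<inter> g -` (- {0}) \<subseteq> N" using N(2) by blast
  then have "negligible (W \<inter> g -` (- {0}))" by (rule negligible_subset[OF N(1)])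
  moreover have "open (W \<inter> g -` (- {0}))"
    by (rule continuous_open_preimage[OF gc W(1)]) (simp add: open_Compl)
  ultimately have "W \<inter> g -` (- {0}) = {}" using open_not_negligible by blast
  then have g0: "(LINT y|lebesgue. p y * riesz a x y) = 0" if "x \<in> W" for x using that unfolding g_def by auto
  have "AE y in lebesgue. p y = 0"
    by (rule riesz_potential_unique_continuation[OF S W(1,2) WS pint pzS _ _ g0]) (use s in \<open>auto simp: a_def\<close>)
  with ae show ?thesis by eventually_elim simp
qed

text \<open>
  Runge approximation, in its dual form: a function that is orthogonal on the domain to all
  solutions with data in \<open>C\<^sub>c\<^sup>\<infinity>(W)\<close> vanishes there. The solution \<open>\<phi>\<close> of the adjoint problem with
  right-hand side \<open>v\<close> satisfies \<open>B(\<phi>, f) = - \<integral> v u\<^sub>f = 0\<close> for all such data \<open>f\<close>, so unique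
  continuation gives \<open>\<phi> = 0\<close> and then \<open>v = 0\<close>.
\<close>

theorem runge_dual:
  fixes \<Omega> W :: "(real^'n) set"
  assumes \<Omega>: "open \<Omega>" "bounded \<Omega>" and s: "0 < s" "s < 1" and q: "q \<in> L_infty \<Omega>"
    and uniq: "uniqueness_condition s \<Omega> q"
    and W: "open W" "W \<noteq> {}" "W \<subseteq> exterior \<Omega>" and v: "v \<in> L2"
    and orth: "\<And>f u. f \<in> Cc_infty W \<Longrightarrow> dirichlet_solution s \<Omega> q f u \<Longrightarrow> (LINT x|lebesgue. (indicator \<Omega> x * v x) * u x) = 0"
  shows "AE x in lebesgue. x \<in> \<Omega> \<longrightarrow> v x = 0"
proof -
  have s': "0 \<le> s" "s \<le> 1" using s by auto
  have \<Omega>m: "\<Omega> \<in> lmeasurable" using \<Omega> by (rule lmeasurable_open[rotated])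
  define V where "V x = indicator \<Omega> x * v x" for x
  have VL: "V \<in> L2" unfolding V_def[abs_def] by (rule L2_indicator[OF v fmeasurableD[OF \<Omega>m]])
  define F where "F w = (LINT x|lebesgue. V x * w x)" for w
  have Fl: "F (\<lambda>x. u x + c * w x) = F u + c * F w" if "u \<in> L2" "w \<in> L2" for u w c
  proof -
    note i = L2_mult_integrable[OF VL that(1)] L2_mult_integrable[OF VL that(2)]
    have "F (\<lambda>x. u x + c * w x) = (LINT x|lebesgue. V x * u x + c * (V x * w x))" unfolding F_def by (simp add: algebra_simps)
    also have "\<dots> = F u + c * F w"
      unfolding F_def Bochner_Integration.integral_add[OF i(1) integrable_mult_right[OF i(2)]] Bochner_Integration.integral_mult_right_zero ..
    finally show ?thesis .
  qed
  have "bdd_lin s \<Omega> F"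
    unfolding bdd_lin_def lin_on_def
  proof (intro conjI ballI allI exI[of _ "l2norm V"])
    fix w assume w: "w \<in> Hs_tilde s \<Omega>"
    note wH = Hs_tilde_Hs[OF w]
    have "\<bar>F w\<bar> \<le> l2norm V * l2norm w" using l2norm_integral_mult[OF VL Hs_L2[OF wH]] by (simp add: F_def)
    also have "\<dots> \<le> l2norm V * Hs_norm s w" by (intro mult_left_mono l2norm_le_Hs_norm wH s') simp
    finally show "\<bar>F w\<bar> \<le> l2norm V * Hs_norm s w" .
  qed (simp add: Fl Hs_L2[OF Hs_tilde_Hs])
  from dirichlet_problem_solvable[OF \<Omega> s q uniq this]
  obtain \<phi> where \<phi>: "\<phi> \<in> Hs_tilde s \<Omega>" "\<And>w. w \<in> Hs_tilde s \<Omega> \<Longrightarrow> bilinear_form s \<Omega> q \<phi> w = F w" by blast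
  note \<phi>H = Hs_tilde_Hs[OF \<phi>(1)]
  have "energy s \<phi> f = 0" if f: "f \<in> Cc_infty W" for f
  proof -
    note fH = Cc_infty_Hs[OF f s'(2)]
    have fz: "f x = 0" if "x \<in> \<Omega>" for x
      using Cc_infty_support[OF f, of x] W(3) that closure_subset[of \<Omega>] by (auto simp: exterior_def)
    obtain u where u: "dirichlet_solution s \<Omega> q f u" using dirichlet_solution_exists[OF \<Omega> s q uniq fH] by blast
    have uH: "u \<in> Hs s" and ueq: "schroedinger_eq s \<Omega> q u" and uf: "(\<lambda>x. u x - f x) \<in> Hs_tilde s \<Omega>"
      using u by (auto simp: dirichlet_solution_def)
    have "F f = 0"
    proof -
      have "(\<lambda>x. V x * f x) = (\<lambda>x. 0)" using fz by (auto simp: V_def indicator_def)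
      then show ?thesis by (simp add: F_def)
    qed
    moreover have "F u = 0" using orth[OF f u] by (simp add: F_def V_def)
    ultimately have "F (\<lambda>x. u x - f x) = 0" using Fl[OF Hs_L2[OF uH] Hs_L2[OF fH], of "-1"] by simp
    then have "bilinear_form s \<Omega> q \<phi> (\<lambda>x. u x - f x) = 0" using \<phi>(2)[OF uf] by simp
    moreover have "bilinear_form s \<Omega> q \<phi> u = 0"
      using schroedinger_eq_Hs_tilde[OF s' q uH ueq \<phi>(1)] bilinear_form_sym[of s \<Omega> q u \<phi>] by simp
    ultimately have "bilinear_form s \<Omega> q \<phi> f = 0" using bilinear_form_diff(2)[OF q s'(1) uH fH \<phi>H] by simp
    moreover have "potential_form \<Omega> q \<phi> f = 0"
    proof -
      have "(\<lambda>x. (indicator \<Omega> x * q x * \<phi> x) * f x) = (\<lambda>x. 0)" using fz by (auto simp: indicator_def)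
      then show ?thesis by (simp add: potential_form_eq)
    qed
    ultimately show ?thesis by (simp add: bilinear_form_eq[OF \<phi>H fH s'(1)] potential_form_def)
  qed
  then have \<phi>0: "AE x in lebesgue. \<phi> x = 0" by (rule frac_laplacian_unique_continuation[OF \<Omega> s W \<phi>(1)])
  show ?thesis
  proof (rule fundamental_lemma[OF \<Omega>(1)])
    fix a b :: "real^'n"
    have vL: "(\<lambda>x. indicator (cbox a b) x * v x) \<in> L2" by (rule L2_indicator[OF v]) simp
    show "integrable lebesgue (\<lambda>x. indicator (cbox a b) x * v x)"
      by (rule L2_bounded_support_integrable(1)[OF vL lmeasurable_cbox[of a b]]) simp
  next
    fix \<psi> assume \<psi>: "\<psi> \<in> Cc_infty \<Omega>"
    have e: "V x * \<psi> x = v x * \<psi> x" for x using Cc_infty_support[OF \<psi>, of x] by (auto simp: V_def indicator_def)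
    have "(LINT x|lebesgue. v x * \<psi> x) = F \<psi>" unfolding F_def e ..
    also have "\<dots> = bilinear_form s \<Omega> q \<phi> \<psi>" using \<phi>(2)[OF Cc_infty_Hs_tilde[OF \<psi> s'(2)]] by simp
    also have "\<dots> = 0" by (rule bilinear_form_AE_zero[OF q s'(1) \<phi>H \<phi>0 Cc_infty_Hs[OF \<psi> s'(2)]])
    finally show "(LINT x|lebesgue. v x * \<psi> x) = 0" .
  qed
qed

section \<open>Uniqueness in the fractional Calderon problem\<close>

theorem theorem1p1:
  fixes \<Omega> W1 W2 :: "(real^'n) set" and s :: real and q1 q2 :: "real^'n \<Rightarrow> real"
  assumes "CARD('n) \<ge> 2"
    and "open \<Omega>" and "bounded \<Omega>"
    and "0 < s" and "s < 1"
    and "q1 \<in> L_infty \<Omega>" and "q2 \<in> L_infty \<Omega>"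
    and "uniqueness_condition s \<Omega> q1" and "uniqueness_condition s \<Omega> q2"
    and "open W1" and "W1 \<noteq> {}" and "W1 \<subseteq> exterior \<Omega>"
    and "open W2" and "W2 \<noteq> {}" and "W2 \<subseteq> exterior \<Omega>"
    and "\<forall>f\<in>Cc_infty W1.
           restrict_distr s \<Omega> (DN_map s \<Omega> q1 (trace_class s \<Omega> f)) W2 =
           restrict_distr s \<Omega> (DN_map s \<Omega> q2 (trace_class s \<Omega> f)) W2"
  shows "AE x in lebesgue. x \<in> \<Omega> \<longrightarrow> q1 x = q2 x"
proof -
  note \<Omega> = \<open>open \<Omega>\<close> \<open>bounded \<Omega>\<close> and s = \<open>0 < s\<close> \<open>s < 1\<close>
  note q1 = \<open>q1 \<in> L_infty \<Omega>\<close> and q2 = \<open>q2 \<in> L_infty \<Omega>\<close>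
  note uniq1 = \<open>uniqueness_condition s \<Omega> q1\<close> and uniq2 = \<open>uniqueness_condition s \<Omega> q2\<close>
  have s': "0 \<le> s" "s \<le> 1" using s by auto
  have \<Omega>m: "\<Omega> \<in> lmeasurable" using \<Omega> by (rule lmeasurable_open[rotated])
  let ?p = "\<lambda>x. indicator \<Omega> x * q1 x - indicator \<Omega> x * q2 x"
  have pL: "(\<lambda>x. ?p x * u x) \<in> L2" if "u \<in> L2" for u
    using L2_diff[OF potential_L2[OF q1 that] potential_L2[OF q2 that]] by (simp add: left_diff_distrib)
  have ip: "indicator \<Omega> x * (?p x * c) = ?p x * c" for x c by (simp add: indicator_def)
  have identity: "(LINT x|lebesgue. ?p x * u2 x * u1 x) = 0"
    if f1: "f1 \<in> Cc_infty W1" and u1: "dirichlet_solution s \<Omega> q1 f1 u1"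
      and f2: "f2 \<in> Cc_infty W2" and u2: "dirichlet_solution s \<Omega> q2 f2 u2" for f1 u1 f2 u2
  proof -
    have "DN_map s \<Omega> q1 (trace_class s \<Omega> f1) (trace_class s \<Omega> f2) = DN_map s \<Omega> q2 (trace_class s \<Omega> f1) (trace_class s \<Omega> f2)"
    proof -
      have "restrict_distr s \<Omega> (DN_map s \<Omega> q1 (trace_class s \<Omega> f1)) W2 f2 = restrict_distr s \<Omega> (DN_map s \<Omega> q2 (trace_class s \<Omega> f1)) W2 f2"
        using assms(16) f1 by simp
      then show ?thesis using f2 by (simp add: restrict_distr_def)
    qed
    from DN_integral_identity[OF \<Omega> s q1 q2 uniq1 uniq2 Cc_infty_Hs[OF f1 s'(2)] Cc_infty_Hs[OF f2 s'(2)] u1 u2 this]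
    have eq: "potential_form \<Omega> q1 u1 u2 = potential_form \<Omega> q2 u1 u2" .
    have uL: "u1 \<in> L2" "u2 \<in> L2" using u1 u2 by (auto simp: dirichlet_solution_def Hs_iff)
    have "(LINT x|lebesgue. ?p x * u2 x * u1 x) = (LINT x|lebesgue. (indicator \<Omega> x * q1 x * u1 x) * u2 x - (indicator \<Omega> x * q2 x * u1 x) * u2 x)"
      by (simp add: algebra_simps)
    also have "\<dots> = potential_form \<Omega> q1 u1 u2 - potential_form \<Omega> q2 u1 u2"
      unfolding potential_form_eq
      by (rule Bochner_Integration.integral_diff[OF L2_mult_integrable[OF potential_L2[OF q1 uL(1)] uL(2)] L2_mult_integrable[OF potential_L2[OF q2 uL(1)] uL(2)]])
    finally show ?thesis by (simp add: eq)
  qed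
  \<comment> \<open>The first solution is removed: \<open>(q\<^sub>1 - q\<^sub>2) u\<^sub>2\<close> is orthogonal to all \<open>u\<^sub>1\<close>.\<close>
  have step1: "AE x in lebesgue. x \<in> \<Omega> \<longrightarrow> ?p x * u2 x = 0"
    if f2: "f2 \<in> Cc_infty W2" and u2: "dirichlet_solution s \<Omega> q2 f2 u2" for f2 u2
  proof (rule runge_dual[OF \<Omega> s q1 uniq1 \<open>open W1\<close> \<open>W1 \<noteq> {}\<close> \<open>W1 \<subseteq> exterior \<Omega>\<close>])
    show "(\<lambda>x. ?p x * u2 x) \<in> L2" using u2 by (intro pL) (simp add: dirichlet_solution_def Hs_iff)
    fix f1 u1 assume "f1 \<in> Cc_infty W1" "dirichlet_solution s \<Omega> q1 f1 u1"
    then show "(LINT x|lebesgue. (indicator \<Omega> x * (?p x * u2 x)) * u1 x) = 0"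
      unfolding ip by (rule identity[OF _ _ f2 u2])
  qed
  \<comment> \<open>Integrated over \<open>\<Omega>\<close>, this says that \<open>q\<^sub>1 - q\<^sub>2\<close> is orthogonal to all \<open>u\<^sub>2\<close>.\<close>
  have iL: "(indicator \<Omega> :: _ \<Rightarrow> real) \<in> L2" by (rule indicator_L2[OF \<Omega>m])
  have "AE x in lebesgue. x \<in> \<Omega> \<longrightarrow> ?p x * indicator \<Omega> x = 0"
  proof (rule runge_dual[OF \<Omega> s q2 uniq2 \<open>open W2\<close> \<open>W2 \<noteq> {}\<close> \<open>W2 \<subseteq> exterior \<Omega>\<close>])
    show pi: "(\<lambda>x. ?p x * indicator \<Omega> x) \<in> L2" by (rule pL[OF iL])
    fix f2 u2 assume f2: "f2 \<in> Cc_infty W2" and u2: "dirichlet_solution s \<Omega> q2 f2 u2"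
    have "(LINT x|lebesgue. (indicator \<Omega> x * (?p x * indicator \<Omega> x)) * u2 x) = (LINT x|lebesgue. 0 * u2 x)"
    proof (rule integral_cong_AE)
      have uL: "u2 \<in> L2" using u2 by (simp add: dirichlet_solution_def Hs_iff)
      show "(\<lambda>x. (indicator \<Omega> x * (?p x * indicator \<Omega> x)) * u2 x) \<in> borel_measurable lebesgue"
        unfolding ip by (rule borel_measurable_integrable[OF L2_mult_integrable[OF pi uL]])
      show "AE x in lebesgue. (indicator \<Omega> x * (?p x * indicator \<Omega> x)) * u2 x = 0 * u2 x"
        using step1[OF f2 u2] by eventually_elim (auto simp: indicator_def)
    qed simp
    then show "(LINT x|lebesgue. (indicator \<Omega> x * (?p x * indicator \<Omega> x)) * u2 x) = 0" by simp
  qed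
  then show ?thesis by eventually_elim auto
qed

end
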